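(* Let $(\mathcal A,\nabla,\sigma)$ be a differential structure whose quantum Markov semigroup $(\mathscr P_t)_t$ is ergodic, and assume that $\mathrm{Ric}(\mathcal A,\nabla,\sigma)\ge\kappa$ for some $\kappa\in\mathbb R$. Then the inequality $\mathrm{H}\mathcal W\mathrm{I}(\kappa)$ holds: for all $\rho\in\mathfrak P$, $$\mathrm{Ent}_\sigma(\rho)\le\mathcal W(\rho,\sigma)\sqrt{\mathcal I_\sigma(\rho)}-\frac\kappa2\mathcal W(\rho,\sigma)^2 .$$
   Context: Differential structure $(\mathcal A,\nabla,\sigma)$: $\mathcal A$ is a finite-dimensional von Neumann algebra with faithful tracial positive linear functional $\tau$, together with (1) a finite index set $\mathcal J$ and, for each $j\in\mathcal J$, a finite-dimensional von Neumann algebra $\mathcal B_j$ with faithful tracial positive linear functional $\tau_j$; (2) for each $j$, unital $*$-homomorphisms $\ell_j,r_j:\mathcal A\to\mathcal B_j$ with $\tau_j(\ell_j(A))=\tau_j(r_j(A))=\tau(A)$ for all $A\in\mathcal A$, and a non-zero $V_j\in\mathcal B_j$; (3) for each $j$ there is a unique $j^*\in\mathcal J$ with $V_{j^*}=V_j^*$, and $\mathcal B_{j^*}=\mathcal B_j$, $\tau_{j^*}=\tau_j$; moreover $\tau_j[V_j^*\ell_j(A_1)V_jr_j(A_2)]=\tau_j[V_j^*r_{j^*}(A_1)V_j\ell_{j^*}(A_2)]$ for all $A_1,A_2\in\mathcal A$; (4) an invertible density matrix $\sigma\in\mathcal A$ and numbers $\omega_j\in\mathbb R$ with $\ell_j(\sigma)V_jr_j(\sigma)^{-1}=e^{-\omega_j}V_j$.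 Set $\partial_jA:=V_jr_j(A)-\ell_j(A)V_j\in\mathcal B_j$, $\nabla A:=(\partial_jA)_{j\in\mathcal J}$. The associated generator $\mathscr L$ is defined by $\sum_{j}\tau_j[(\partial_jA_1)^*\ell_j(\sigma^{1/2})(\partial_jA_2)r_j(\sigma^{1/2})]=-\tau[A_1^*\sigma^{1/2}(\mathscr LA_2)\sigma^{1/2}]$ for all $A_1,A_2\in\mathcal A$; $\mathscr P_t=e^{t\mathscr L}$; $\dagger$ denotes adjoints with respect to $\tau[A^*B]$ on $\mathcal A$ and $\tau_j[A^*B]$ on $\mathcal B_j$. Ergodic means $\ker\mathscr L=\mathrm{lin}\{\mathbf 1\}$. $\mathfrak P$ (resp. $\mathfrak P_+$): positive semidefinite (resp. positive definite) $\rho\in\mathcal A$ with $\tau[\rho]=1$. $\mathcal A_0:=\{A\in\mathcal A: A=A^*,\ \tau[A]=0\}$. Put $\theta_j(r,s):=\Lambda(e^{\omega_j/2}r,e^{-\omega_j/2}s)$ with $\Lambda(r,s)=\frac{r-s}{\log r-\log s}$, $\Lambda(r,r)=r$, extended continuously to $[0,\infty)^2$. For $\rho=\sum_k\lambda_kE_k$ (spectral decomposition), $\widehat\rho_j:=\sum_{k,m}\theta_j(\lambda_k,\lambda_m)\ell_j(E_k)\otimes r_j(E_m)$, $(A\otimes B)\#C:=ACB$, and $\mathscr K_\rho A:=\sum_j\partial_j^\dagger(\widehat\rho_j\#\partial_jA)$. For $\rho\in\mathfrak P_+$, $\mathscr K_\rho$ is a bijection of $\mathcal A_0$ and defines the Riemannian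 metric $g_\rho(x,y)=\tau[(\mathscr K_\rho^{-1}x)y]$ on $\mathfrak P_+$. $\mathcal W$ is its Riemannian distance, $\mathcal W(\rho_0,\rho_1)^2=\inf\int_0^1\tau[A_t\mathscr K_{\rho_t}A_t]\,dt$ over smooth curves $(\rho_t)$ in $\mathfrak P_+$ from $\rho_0$ to $\rho_1$ and $(A_t)$ in $\mathcal A_0$ with $\partial_t\rho_t=\mathscr K_{\rho_t}A_t$; $\mathcal W$ extends continuously to a metric on $\mathfrak P$. $\mathrm{Ent}_\sigma(\rho)=\tau[\rho(\log\rho-\log\sigma)]$; $\mathcal I_\sigma(\rho)=-\tau[(\log\rho-\log\sigma)\mathscr L^\dagger\rho]$ for $\rho\in\mathfrak P_+$, with the convention $\mathcal I_\sigma(\rho)=+\infty$ for $\rho\in\mathfrak P\setminus\mathfrak P_+$. $\mathrm{Ric}(\mathcal A,\nabla,\sigma)\ge\kappa$ means that the following equivalent conditions hold: (i) any two points of $\mathfrak P$ are joined by a constant speed $\mathcal W$-geodesic $(\gamma_t)_{t\in[0,1]}$ with $\mathrm{Ent}_\sigma(\gamma_t)\le(1-t)\mathrm{Ent}_\sigma(\gamma_0)+t\,\mathrm{Ent}_\sigma(\gamma_1)-\frac\kappa2t(1-t)\mathcal W(\gamma_0,\gamma_1)^2$; (ii) the same inequality holds along every constant speed geodesic; (iii) for all $\rho,\nu\in\mathfrak P$ and $t\ge0$, $\frac12\frac{d^+}{dt}\mathcal W^2(\mathscr P_t^\dagger\rho,\nu)+\frac\kappa2\mathcal W^2(\mathscr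 P_t^\dagger\rho,\nu)\le\mathrm{Ent}_\sigma(\nu)-\mathrm{Ent}_\sigma(\mathscr P_t^\dagger\rho)$, where $\frac{d^+}{dt}f(t)=\limsup_{h\downarrow0}\frac{f(t+h)-f(t)}h$; (iv) $\frac{d^2}{ds^2}|_{s=0}\mathrm{Ent}_\sigma(\rho_s)\ge\kappa\,\tau[A\mathscr K_\rho A]$ for all $\rho\in\mathfrak P_+$, $A\in\mathcal A_0$, where $(\rho_s)$ is the Riemannian geodesic with $\rho_0=\rho$, $\dot\rho_0=\mathscr K_\rho A$. *)

theory Defs
  imports "HOL-Analysis.Analysis"
begin

section \<open>Finite-dimensional von Neumann algebras as algebras of complex matrices\<close>

text \<open>A finite-dimensional von Neumann algebra is given concretely, as a set of complex
  \<open>n \<times> n\<close> matrices that contains the identity matrix and is closed under the *-algebra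
  operations; closedness in the weak topology is automatic in finite dimension. On the type
  \<open>complex^'n^'n\<close> the operation \<open>*\<close> is entrywise, so products are written \<open>**\<close>.\<close>

definition adj :: "complex^'n^'n \<Rightarrow> complex^'n^'n" where
  "adj M = (\<chi> i j. cnj (M $ j $ i))"

definition cscale :: "complex \<Rightarrow> complex^'n^'n \<Rightarrow> complex^'n^'n" (infixr "*\<^sub>C" 75) where
  "c *\<^sub>C M = (\<chi> i j. c * M $ i $ j)"

definition vn_algebra :: "(complex^'n^'n) set \<Rightarrow> bool" where
  "vn_algebra \<A> \<longleftrightarrow>
     mat 1 \<in> \<A> \<and>
     (\<forall>a\<in>\<A>. \<forall>b\<in>\<A>. a + b \<in> \<A> \<and> a ** b \<in> \<A>) \<and>
     (\<forall>c. \<forall>a\<in>\<A>. c *\<^sub>C a \<in> \<A>) \<and>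
     (\<forall>a\<in>\<A>. adj a \<in> \<A>)"

text \<open>Functionals and homomorphisms are total functions on the matrix type; only their values on
  the algebra matter.\<close>

definition faithful_trace :: "(complex^'n^'n) set \<Rightarrow> (complex^'n^'n \<Rightarrow> complex) \<Rightarrow> bool" where
  "faithful_trace \<A> \<tau> \<longleftrightarrow>
     (\<forall>a\<in>\<A>. \<forall>b\<in>\<A>. \<tau> (a + b) = \<tau> a + \<tau> b) \<and>
     (\<forall>c. \<forall>a\<in>\<A>. \<tau> (c *\<^sub>C a) = c * \<tau> a) \<and>
     (\<forall>a\<in>\<A>. \<forall>b\<in>\<A>. \<tau> (a ** b) = \<tau> (b ** a)) \<and>
     (\<forall>a\<in>\<A>. \<tau> (adj a ** a) \<in> \<real>\<^sub>\<ge>\<^sub>0) \<and>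
     (\<forall>a\<in>\<A>. \<tau> (adj a ** a) = 0 \<longrightarrow> a = 0)"

definition unital_star_hom ::
  "(complex^'n^'n) set \<Rightarrow> (complex^'m^'m) set \<Rightarrow> (complex^'n^'n \<Rightarrow> complex^'m^'m) \<Rightarrow> bool" where
  "unital_star_hom \<A> \<B> h \<longleftrightarrow>
     h ` \<A> \<subseteq> \<B> \<and> h (mat 1) = mat 1 \<and>
     (\<forall>a\<in>\<A>. \<forall>b\<in>\<A>. h (a + b) = h a + h b \<and> h (a ** b) = h a ** h b) \<and>
     (\<forall>c. \<forall>a\<in>\<A>. h (c *\<^sub>C a) = c *\<^sub>C h a) \<and>
     (\<forall>a\<in>\<A>. h (adj a) = adj (h a))"

text \<open>The adjoint of a linear map \<open>T\<close> from \<open>\<A>\<close> (with inner product \<open>\<tau> (adj a ** b)\<close>) to another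
  algebra with trace \<open>\<tau>'\<close>.\<close>

definition trace_adjoint ::
  "(complex^'n^'n) set \<Rightarrow> (complex^'n^'n \<Rightarrow> complex) \<Rightarrow> (complex^'m^'m \<Rightarrow> complex) \<Rightarrow>
   (complex^'n^'n \<Rightarrow> complex^'m^'m) \<Rightarrow> complex^'m^'m \<Rightarrow> complex^'n^'n" where
  "trace_adjoint \<A> \<tau> \<tau>' T y =
     (THE x. x \<in> \<A> \<and> (\<forall>a\<in>\<A>. \<tau> (adj a ** x) = \<tau>' (adj (T a) ** y)))"


section \<open>Positivity and functional calculus\<close>

definition quad_form :: "complex^'n^'n \<Rightarrow> complex^'n \<Rightarrow> complex" where
  "quad_form M v = (\<Sum>i\<in>UNIV. cnj (v $ i) * (M *v v) $ i)"

definition pos_semidef :: "complex^'n^'n \<Rightarrow> bool" where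
  "pos_semidef M \<longleftrightarrow> adj M = M \<and> (\<forall>v. 0 \<le> Re (quad_form M v))"

definition pos_def :: "complex^'n^'n \<Rightarrow> bool" where
  "pos_def M \<longleftrightarrow> adj M = M \<and> (\<forall>v. v \<noteq> 0 \<longrightarrow> 0 < Re (quad_form M v))"

text \<open>Real eigenvalues and spectral projections; for self-adjoint \<open>M\<close> these give the spectral
  decomposition \<open>M = (\<Sum>x\<in>eigvals M. x *\<^sub>C eigproj M x)\<close>.\<close>

definition eigvals :: "complex^'n^'n \<Rightarrow> real set" where
  "eigvals M = {x. \<exists>v. v \<noteq> 0 \<and> M *v v = complex_of_real x *s v}"

definition eigproj :: "complex^'n^'n \<Rightarrow> real \<Rightarrow> complex^'n^'n" where
  "eigproj M x =
     (THE E. adj E = E \<and> E ** E = E \<and> range ((*v) E) = {v. M *v v = complex_of_real x *s v})"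

definition herm_fun :: "(real \<Rightarrow> real) \<Rightarrow> complex^'n^'n \<Rightarrow> complex^'n^'n" where
  "herm_fun f M = (\<Sum>x\<in>eigvals M. complex_of_real (f x) *\<^sub>C eigproj M x)"

definition log_mean :: "real \<Rightarrow> real \<Rightarrow> real" where
  "log_mean r s =
     (if r = s then r else if r = 0 \<or> s = 0 then 0 else (r - s) / (ln r - ln s))"


section \<open>Differential structures\<close>

text \<open>The algebras \<open>\<B>\<^sub>j\<close> all consist of matrices of one size: a finite family of matrix algebras of
  various sizes embeds unitally, via \<open>b \<mapsto> b \<otimes> 1\<close>, into the matrices of a common size.\<close>

record ('n, 'm, 'j) diff_struct =
  alg :: "(complex^'n^'n) set"
  tr :: "complex^'n^'n \<Rightarrow> complex"
  idx :: "'j set"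
  balg :: "'j \<Rightarrow> (complex^'m^'m) set"
  btr :: "'j \<Rightarrow> complex^'m^'m \<Rightarrow> complex"
  lhom :: "'j \<Rightarrow> complex^'n^'n \<Rightarrow> complex^'m^'m"
  rhom :: "'j \<Rightarrow> complex^'n^'n \<Rightarrow> complex^'m^'m"
  dvec :: "'j \<Rightarrow> complex^'m^'m"
  ref :: "complex^'n^'n"
  freq :: "'j \<Rightarrow> real"

definition dens :: "('n::finite, 'm::finite, 'j) diff_struct \<Rightarrow> (complex^'n^'n) set" where
  "dens D = {\<rho> \<in> alg D. pos_semidef \<rho> \<and> tr D \<rho> = 1}"

definition dens_pos :: "('n::finite, 'm::finite, 'j) diff_struct \<Rightarrow> (complex^'n^'n) set" where
  "dens_pos D = {\<rho> \<in> alg D. pos_def \<rho> \<and> tr D \<rho> = 1}"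

definition tangent :: "('n::finite, 'm::finite, 'j) diff_struct \<Rightarrow> (complex^'n^'n) set" where
  "tangent D = {a \<in> alg D. adj a = a \<and> tr D a = 0}"

text \<open>In the condition on \<open>k = j\<^sup>*\<close>, the equation \<open>V\<^sub>k = V\<^sub>j\<^sup>*\<close> is an equation between elements of one
  algebra. As all \<open>\<B>\<^sub>j\<close> live in the same matrix type, this is said explicitly by \<open>balg D k = balg D j\<close>.\<close>

definition differential_structure :: "('n::finite, 'm::finite, 'j) diff_struct \<Rightarrow> bool" where
  "differential_structure D \<longleftrightarrow>
     vn_algebra (alg D) \<and> faithful_trace (alg D) (tr D) \<and> finite (idx D) \<and>
     (\<forall>j\<in>idx D.
        vn_algebra (balg D j) \<and> faithful_trace (balg D j) (btr D j) \<and>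
        unital_star_hom (alg D) (balg D j) (lhom D j) \<and>
        unital_star_hom (alg D) (balg D j) (rhom D j) \<and>
        (\<forall>a\<in>alg D. btr D j (lhom D j a) = tr D a \<and> btr D j (rhom D j a) = tr D a) \<and>
        dvec D j \<in> balg D j \<and> dvec D j \<noteq> 0 \<and>
        (\<exists>k\<in>idx D. balg D k = balg D j \<and> dvec D k = adj (dvec D j) \<and>
           (\<forall>k'\<in>idx D. balg D k' = balg D j \<and> dvec D k' = adj (dvec D j) \<longrightarrow> k' = k) \<and>
           (\<forall>b\<in>balg D j. btr D k b = btr D j b) \<and>
           (\<forall>a1\<in>alg D. \<forall>a2\<in>alg D.
              btr D j (adj (dvec D j) ** lhom D j a1 ** dvec D j ** rhom D j a2) =
              btr D j (adj (dvec D j) ** rhom D k a1 ** dvec D j ** lhom D k a2)))) \<and>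
     ref D \<in> dens D \<and> invertible (ref D) \<and>
     (\<forall>j\<in>idx D. lhom D j (ref D) ** dvec D j ** matrix_inv (rhom D j (ref D)) =
        complex_of_real (exp (- freq D j)) *\<^sub>C dvec D j)"

definition pderiv_j ::
  "('n::finite, 'm::finite, 'j) diff_struct \<Rightarrow> 'j \<Rightarrow> complex^'n^'n \<Rightarrow> complex^'m^'m" where
  "pderiv_j D j a = dvec D j ** rhom D j a - lhom D j a ** dvec D j"

definition generator ::
  "('n::finite, 'm::finite, 'j) diff_struct \<Rightarrow> complex^'n^'n \<Rightarrow> complex^'n^'n" where
  "generator D a2 =
     (let s = herm_fun sqrt (ref D) in
      THE x. x \<in> alg D \<and>
        (\<forall>a1\<in>alg D.
           (\<Sum>j\<in>idx D. btr D j (adj (pderiv_j D j a1) ** lhom D j s ** pderiv_j D j a2 ** rhom D j s))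
           = - tr D (adj a1 ** s ** x ** s)))"

definition ergodic :: "('n::finite, 'm::finite, 'j) diff_struct \<Rightarrow> bool" where
  "ergodic D \<longleftrightarrow> {a \<in> alg D. generator D a = 0} = range (\<lambda>c. c *\<^sub>C mat 1)"

abbreviation generator_adj ::
  "('n::finite, 'm::finite, 'j) diff_struct \<Rightarrow> complex^'n^'n \<Rightarrow> complex^'n^'n" where
  "generator_adj D \<equiv> trace_adjoint (alg D) (tr D) (tr D) (generator D)"


section \<open>The transport metric\<close>

definition theta :: "('n::finite, 'm::finite, 'j) diff_struct \<Rightarrow> 'j \<Rightarrow> real \<Rightarrow> real \<Rightarrow> real" where
  "theta D j r s = log_mean (exp (freq D j / 2) * r) (exp (- freq D j / 2) * s)"

text \<open>The contraction \<open>\<rho>\<^sub>j # b\<close>, where \<open>\<rho>\<^sub>j\<close> is the tensor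
  \<open>\<Sum>x y. \<theta>\<^sub>j x y \<cdot> \<ell>\<^sub>j E\<^sub>x \<otimes> r\<^sub>j E\<^sub>y\<close> and \<open>(a \<otimes> c) # b = a b c\<close>.\<close>

definition rho_contract ::
  "('n::finite, 'm::finite, 'j) diff_struct \<Rightarrow> 'j \<Rightarrow> complex^'n^'n \<Rightarrow> complex^'m^'m \<Rightarrow> complex^'m^'m" where
  "rho_contract D j \<rho> b =
     (\<Sum>x\<in>eigvals \<rho>. \<Sum>y\<in>eigvals \<rho>.
        complex_of_real (theta D j x y) *\<^sub>C (lhom D j (eigproj \<rho> x) ** b ** rhom D j (eigproj \<rho> y)))"

definition Kop ::
  "('n::finite, 'm::finite, 'j) diff_struct \<Rightarrow> complex^'n^'n \<Rightarrow> complex^'n^'n \<Rightarrow> complex^'n^'n" where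
  "Kop D \<rho> a =
     (\<Sum>j\<in>idx D. trace_adjoint (alg D) (tr D) (btr D j) (pderiv_j D j)
                   (rho_contract D j \<rho> (pderiv_j D j a)))"

definition smooth_curve :: "(real \<Rightarrow> 'a::real_normed_vector) \<Rightarrow> bool" where
  "smooth_curve f \<longleftrightarrow>
     (\<exists>d. d 0 = f \<and> (\<forall>n::nat. \<forall>t\<in>{0..1}.
        (d n has_vector_derivative d (Suc n) t) (at t within {0..1})))"

definition admissible_curve ::
  "('n::finite, 'm::finite, 'j) diff_struct \<Rightarrow> complex^'n^'n \<Rightarrow> complex^'n^'n \<Rightarrow>
   (real \<Rightarrow> complex^'n^'n) \<Rightarrow> (real \<Rightarrow> complex^'n^'n) \<Rightarrow> bool" where
  "admissible_curve D \<rho>0 \<rho>1 \<rho> a \<longleftrightarrow>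
     smooth_curve \<rho> \<and> smooth_curve a \<and> \<rho> 0 = \<rho>0 \<and> \<rho> 1 = \<rho>1 \<and>
     (\<forall>t\<in>{0..1}. \<rho> t \<in> dens_pos D \<and> a t \<in> tangent D \<and>
        (\<rho> has_vector_derivative Kop D (\<rho> t) (a t)) (at t within {0..1}))"

definition riem_dist ::
  "('n::finite, 'm::finite, 'j) diff_struct \<Rightarrow> complex^'n^'n \<Rightarrow> complex^'n^'n \<Rightarrow> real" where
  "riem_dist D \<rho>0 \<rho>1 =
     sqrt (INF (\<rho>, a) \<in> {(\<rho>, a). admissible_curve D \<rho>0 \<rho>1 \<rho> a}.
             integral {0..1} (\<lambda>t. Re (tr D (a t ** Kop D (\<rho> t) (a t)))))"

text \<open>The continuous extension of the Riemannian distance to all of \<open>dens D\<close>. The case distinction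
  also covers the one-dimensional algebra, where \<open>dens_pos D\<close> is a single point.\<close>

definition wdist ::
  "('n::finite, 'm::finite, 'j) diff_struct \<Rightarrow> complex^'n^'n \<Rightarrow> complex^'n^'n \<Rightarrow> real" where
  "wdist D \<rho>0 \<rho>1 =
     (if \<rho>0 \<in> dens_pos D \<and> \<rho>1 \<in> dens_pos D then riem_dist D \<rho>0 \<rho>1
      else Lim (at (\<rho>0, \<rho>1) within dens_pos D \<times> dens_pos D) (\<lambda>(x, y). riem_dist D x y))"

definition const_speed_geodesic ::
  "('n::finite, 'm::finite, 'j) diff_struct \<Rightarrow> (real \<Rightarrow> complex^'n^'n) \<Rightarrow> bool" where
  "const_speed_geodesic D \<gamma> \<longleftrightarrow>
     (\<forall>t\<in>{0..1}. \<gamma> t \<in> dens D) \<and>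
     (\<forall>s\<in>{0..1}. \<forall>t\<in>{0..1}. wdist D (\<gamma> s) (\<gamma> t) = \<bar>s - t\<bar> * wdist D (\<gamma> 0) (\<gamma> 1))"


section \<open>Entropy, Fisher information and Ricci curvature\<close>

text \<open>For singular \<open>\<rho>\<close> the convention \<open>0 log 0 = 0\<close> is built in: \<open>ln 0 = 0\<close>.\<close>

definition Ent :: "('n::finite, 'm::finite, 'j) diff_struct \<Rightarrow> complex^'n^'n \<Rightarrow> real" where
  "Ent D \<rho> = Re (tr D (\<rho> ** (herm_fun ln \<rho> - herm_fun ln (ref D))))"

definition Fisher :: "('n::finite, 'm::finite, 'j) diff_struct \<Rightarrow> complex^'n^'n \<Rightarrow> ereal" where
  "Fisher D \<rho> =
     (if \<rho> \<in> dens_pos D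
      then ereal (- Re (tr D ((herm_fun ln \<rho> - herm_fun ln (ref D)) ** generator_adj D \<rho>)))
      else \<infinity>)"

text \<open>Square root of an extended nonnegative real.\<close>

definition sqrt_ereal :: "ereal \<Rightarrow> ereal" where
  "sqrt_ereal x = (if x = \<infinity> then \<infinity> else ereal (sqrt (real_of_ereal x)))"

text \<open>Geodesic \<open>\<kappa>\<close>-convexity of the entropy, the first of the equivalent definitions of the lower
  Ricci curvature bound.\<close>

definition Ric_ge :: "('n::finite, 'm::finite, 'j) diff_struct \<Rightarrow> real \<Rightarrow> bool" where
  "Ric_ge D \<kappa> \<longleftrightarrow>
     (\<forall>\<rho>0\<in>dens D. \<forall>\<rho>1\<in>dens D. \<exists>\<gamma>.
        const_speed_geodesic D \<gamma> \<and> \<gamma> 0 = \<rho>0 \<and> \<gamma> 1 = \<rho>1 \<and>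
        (\<forall>t\<in>{0..1}. Ent D (\<gamma> t) \<le>
           (1 - t) * Ent D (\<gamma> 0) + t * Ent D (\<gamma> 1)
           - \<kappa> / 2 * t * (1 - t) * (wdist D (\<gamma> 0) (\<gamma> 1))\<^sup>2))"

end

theory Submission
  imports Defs "HOL-Complex_Analysis.Complex_Analysis"
    "HOL-Computational_Algebra.Fundamental_Theorem_Algebra"
begin

text \<open>Let \<open>g = log \<rho> - log \<sigma>\<close> for positive definite \<open>\<rho>\<close>. Since the logarithmic mean turns the
  logarithms in \<open>\<partial>\<^sub>j g\<close> into differences linear in \<open>\<rho>\<close>, \<open>K\<^sub>\<rho> g = - L\<^sup>\<dagger> \<rho>\<close>, and the Fisher information is
  \<open>\<tau> (g K\<^sub>\<rho> g)\<close>. Klein's inequality bounds \<open>Ent \<rho> - Ent \<nu>\<close> by \<open>\<tau> (g (\<rho> - \<nu>))\<close>, with \<open>g\<close> fixed, and the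
  Cauchy--Schwarz inequality along a nearly shortest curve from \<open>\<rho>\<close> to a nearby \<open>\<nu>\<close> then gives
  \<open>Ent \<rho> - Ent \<nu> \<le> (sqrt (I \<rho>) + o(1)) W(\<rho>, \<nu>)\<close>. Applied to the points near \<open>\<rho>\<close> of a geodesic from \<open>\<rho>\<close>
  to \<open>\<sigma>\<close> along which the entropy is \<open>\<kappa>\<close>-convex, this is the claim. For singular \<open>\<rho>\<close> the right-hand side
  is infinite as soon as \<open>W(\<rho>, \<sigma>) > 0\<close>; here one needs that \<open>W\<close> really extends continuously to
  singular densities (otherwise \<open>Lim\<close> is a junk value). This follows from the triangle inequality and
  from explicit short curves between neighbouring densities, and \<open>W(\<rho>, \<nu>) \<ge> c \<bar>\<rho> - \<nu>\<bar>\<close> because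
  \<open>K\<^sub>\<rho>\<close> is bounded uniformly in \<open>\<rho>\<close>.\<close>

text \<open>Three obstacles shape the argument. The distance is an infimum over pairs of smooth
  curves, so a curve of densities counts only once its potential, the solution of an equation for K,
  is known to be smooth in time; but K is built from spectral projections, which need not vary
  continuously. A power series for the contraction, valid also for matrices that are not
  self-adjoint, makes everything analytic in the curve parameter. Next, differentiating the entropy
  along a curve would require the derivative of the operator logarithm; freezing the gradient at the
  starting point leaves a linear functional, and only the continuity of the form of K at that point
  is used. Last, K degenerates with the smallest eigenvalue of the density, so straight segments
  near the boundary may be too expensive and are bent into the interior. Ergodicity enters through
  one fact: the form of K is positive on trace-free elements, which makes K invertible and provides
  admissible curves at all.\<close>

no_notation fps_nth (infixl "$" 75)

section \<open>Algebra of complex matrices: scaling, product, adjoint\<close>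

lemma cscale_nth [simp]: "(c *\<^sub>C M) $ i $ j = c * M $ i $ j"
  by (simp add: cscale_def)

lemma adj_nth [simp]: "adj M $ i $ j = cnj (M $ j $ i)"
  by (simp add: adj_def)

lemma mat_eq_iff: "A = B \<longleftrightarrow> (\<forall>i j. A $ i $ j = B $ i $ j)"
  by (simp add: vec_eq_iff)

lemma cscale_cscale [simp]: "c *\<^sub>C d *\<^sub>C M = (c * d) *\<^sub>C M"
  by (simp add: mat_eq_iff mult.assoc)

lemma cscale_one [simp]: "1 *\<^sub>C M = M"
  and cscale_zero [simp]: "0 *\<^sub>C M = 0"
  and cscale_zero_right [simp]: "c *\<^sub>C 0 = 0"
  and cscale_add_right: "c *\<^sub>C (A + B) = c *\<^sub>C A + c *\<^sub>C B"
  and cscale_diff_right: "c *\<^sub>C (A - B) = c *\<^sub>C A - c *\<^sub>C B"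
  and cscale_add_left: "(c + d) *\<^sub>C A = c *\<^sub>C A + d *\<^sub>C A"
  and cscale_diff_left: "(c - d) *\<^sub>C A = c *\<^sub>C A - d *\<^sub>C A"
  and cscale_minus: "(- c) *\<^sub>C A = - (c *\<^sub>C A)"
  by (simp_all add: mat_eq_iff algebra_simps)

lemma scaleR_cscale: "r *\<^sub>R (M :: complex^'n^'n) = complex_of_real r *\<^sub>C M"
  by (simp add: mat_eq_iff scaleR_conv_of_real[where 'a=complex])

lemma cscale_sum: "c *\<^sub>C sum f S = (\<Sum>x\<in>S. c *\<^sub>C f x)"
  by (induction S rule: infinite_finite_induct) (simp_all add: cscale_add_right)

lemma cscale_sum_left: "(\<Sum>x\<in>S. f x) *\<^sub>C A = (\<Sum>x\<in>S. f x *\<^sub>C A)"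
  by (induction S rule: infinite_finite_induct) (simp_all add: cscale_add_left)

lemma cscale_eq_0_iff [simp]: "c *\<^sub>C A = 0 \<longleftrightarrow> c = 0 \<or> A = 0"
  by (auto simp: mat_eq_iff)

lemma mult_cscale_left [simp]: "(c *\<^sub>C A) ** B = c *\<^sub>C (A ** B)"
  and mult_cscale_right [simp]: "A ** (c *\<^sub>C B) = c *\<^sub>C (A ** B)"
  by (simp_all add: mat_eq_iff matrix_matrix_mult_def sum_distrib_left algebra_simps)

lemma norm_cscale [simp]: "norm (c *\<^sub>C (A :: complex^'n^'n)) = cmod c * norm A"
  unfolding norm_vec_def by (simp add: cscale_def norm_mult L2_set_right_distrib)

lemma matrix_add_rdistrib: "((A :: complex^'n^'m) + B) ** C = A ** C + B ** C"
  by (simp add: vec_eq_iff matrix_matrix_mult_def algebra_simps sum.distrib)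

lemma bounded_bilinear_matrix_mult:
  "bounded_bilinear (\<lambda>(A :: complex^'k^'n) (B :: complex^'m^'k). A ** B)"
  unfolding bilinear_conv_bounded_bilinear[symmetric] bilinear_def
  by (auto intro!: linearI simp: vec_eq_iff matrix_matrix_mult_def sum.distrib algebra_simps
      scaleR_sum_right)

lemma bounded_bilinear_matrix_vector_mult:
  "bounded_bilinear (\<lambda>(A :: complex^'n^'m) v. A *v v)"
  unfolding bilinear_conv_bounded_bilinear[symmetric] bilinear_def
  by (auto intro!: linearI simp: vec_eq_iff matrix_vector_mult_def sum.distrib algebra_simps
      scaleR_sum_right)

interpretation mm: bounded_bilinear "\<lambda>(A :: complex^'k^'n) (B :: complex^'m^'k). A ** B"
  by (rule bounded_bilinear_matrix_mult)

interpretation mv: bounded_bilinear "\<lambda>(A :: complex^'n^'m) v. A *v v"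
  by (rule bounded_bilinear_matrix_vector_mult)

lemma adj_adj [simp]: "adj (adj A) = A"
  and adj_zero [simp]: "adj 0 = 0"
  and adj_add: "adj (A + B) = adj A + adj B"
  and adj_diff: "adj (A - B) = adj A - adj B"
  and adj_cscale: "adj (c *\<^sub>C A) = cnj c *\<^sub>C adj A"
  and adj_scaleR: "adj (r *\<^sub>R A) = r *\<^sub>R adj A"
  and adj_mat_1 [simp]: "adj (mat 1) = mat 1"
  by (simp_all add: mat_eq_iff mat_def)

lemma adj_mult: "adj (A ** B) = adj B ** adj A"
  by (simp add: mat_eq_iff matrix_matrix_mult_def mult.commute)

lemma adj_sum: "adj (sum f S) = (\<Sum>x\<in>S. adj (f x))"
  by (induction S rule: infinite_finite_induct) (simp_all add: adj_add)

lemma matrix_vector_cscale: "(c *\<^sub>C A) *v v = c *s (A *v v)"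
  by (simp add: vec_eq_iff matrix_vector_mult_def sum_distrib_left mult.assoc)

lemma matrix_eqI: "(\<And>v. A *v v = B *v v) \<Longrightarrow> (A :: complex^'n^'m) = B"
  by (simp add: matrix_eq)

section \<open>The Hermitian inner product on column vectors\<close>

definition cinner :: "complex^'n \<Rightarrow> complex^'n \<Rightarrow> complex" where
  "cinner u v = (\<Sum>i\<in>UNIV. cnj (u $ i) * v $ i)"

lemma cinner_adj: "cinner u (M *v v) = cinner (adj M *v u) v"
proof -
  have "cinner u (M *v v) = (\<Sum>i\<in>UNIV. \<Sum>j\<in>UNIV. cnj (u $ i) * (M $ i $ j * v $ j))"
    by (simp add: cinner_def matrix_vector_mult_def sum_distrib_left)
  also have "\<dots> = (\<Sum>j\<in>UNIV. \<Sum>i\<in>UNIV. cnj (u $ i) * (M $ i $ j * v $ j))"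
    by (rule sum.swap)
  also have "\<dots> = cinner (adj M *v u) v"
    by (simp add: cinner_def matrix_vector_mult_def sum_distrib_left sum_distrib_right mult_ac)
  finally show ?thesis .
qed

lemma cinner_self: "cinner v v = complex_of_real ((norm v)\<^sup>2)"
proof -
  have "cinner v v = (\<Sum>i\<in>UNIV. complex_of_real ((cmod (v $ i))\<^sup>2))"
    unfolding cinner_def by (intro sum.cong refl) (metis complex_norm_square mult.commute)
  also have "\<dots> = complex_of_real ((norm v)\<^sup>2)"
    by (simp add: norm_vec_def L2_set_def real_sqrt_pow2 sum_nonneg)
  finally show ?thesis .
qed

lemma quad_form_cinner: "quad_form M v = cinner v (M *v v)"
  by (simp add: quad_form_def cinner_def)

lemma cinner_scale_right [simp]: "cinner u (c *s v) = c * cinner u v"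
  by (simp add: cinner_def sum_distrib_left mult_ac)

lemma cinner_scale_left [simp]: "cinner (c *s u) v = cnj c * cinner u v"
  by (simp add: cinner_def sum_distrib_left mult_ac)

lemma cinner_sum_right: "cinner u (sum f S) = (\<Sum>x\<in>S. cinner u (f x))"
  by (simp add: cinner_def sum_distrib_left) (rule sum.swap)

lemma Re_quad_form_eigen:
  assumes "M *v v = complex_of_real x *s v"
  shows "Re (quad_form M v) = x * (norm v)\<^sup>2"
  unfolding quad_form_cinner assms cinner_scale_right cinner_self of_real_mult[symmetric]
  by (rule Re_complex_of_real)

lemma cinner_zero_right [simp]: "cinner v 0 = 0"
  by (simp add: cinner_def)

lemma cinner_self_eq_0: "cinner v v = 0 \<longleftrightarrow> v = 0"
  by (simp add: cinner_self)

subsection \<open>Polynomials in a matrix\<close>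

text \<open>Horner's scheme: folding over the coefficients gives the recursion over
  \<open>pCons\<close> on which the ring laws below rest.\<close>

definition pmat :: "complex poly \<Rightarrow> complex^'n^'n \<Rightarrow> complex^'n^'n" where
  "pmat p M = fold_coeffs (\<lambda>a X. a *\<^sub>C mat 1 + M ** X) p 0"

lemma pmat_0 [simp]: "pmat 0 M = 0"
  by (simp add: pmat_def)

lemma pmat_pCons [simp]: "pmat (pCons a p) M = a *\<^sub>C mat 1 + M ** pmat p M"
  by (cases "p = 0 \<and> a = 0") (auto simp: pmat_def)

lemma pmat_1 [simp]: "pmat 1 M = mat 1"
  by (simp add: one_pCons)

lemma pmat_add [simp]: "pmat (p + q) M = pmat p M + pmat q M"
  by (induction p q rule: poly_induct2) (simp_all add: matrix_add_ldistrib cscale_add_left)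

lemma pmat_smult [simp]: "pmat (smult c p) M = c *\<^sub>C pmat p M"
  by (induction p) (simp_all add: cscale_add_right)

lemma pmat_diff [simp]: "pmat (p - q) M = pmat p M - pmat q M"
  using pmat_add[of "p - q" q M] by simp

lemma pmat_mult: "pmat (p * q) M = pmat p M ** pmat q M"
  by (induction p) (simp_all add: matrix_add_rdistrib matrix_mul_assoc)

lemma pmat_commute: "pmat p M ** pmat q M = pmat q M ** pmat p M"
  by (metis pmat_mult mult.commute)

lemma pmat_sum: "pmat (sum f S) M = (\<Sum>x\<in>S. pmat (f x) M)"
  by (induction S rule: infinite_finite_induct) simp_all

text \<open>More powers of \<open>M\<close> than the real dimension of the matrix space cannot be
  linearly independent.\<close>

lemma pmat_annihilator: "\<exists>p. p \<noteq> 0 \<and> pmat p (M :: complex^'n^'n) = 0"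
proof -
  define w where "w k = pmat (monom 1 k) M" for k
  define N where "N = DIM(complex^'n^'n)"
  show ?thesis
  \<comment> \<open>The dimension count is about the set of powers, so two coinciding powers need
    their own annihilator, a difference of monomials.\<close>
  proof (cases "inj_on w {..N}")
    case False
    then obtain i j where ij: "i \<noteq> j" "w i = w j" by (auto simp: inj_on_def)
    then have "coeff (monom 1 i - monom (1::complex) j) i \<noteq> 0" by simp
    then have "monom 1 i - monom (1::complex) j \<noteq> 0" by (metis coeff_0)
    with ij show ?thesis by (intro exI[of _ "monom 1 i - monom 1 j"]) (simp add: w_def)
  next
    case True
    then have "dependent (w ` {..N})"
      by (intro dependent_biggerset) (simp_all add: card_image N_def)
    then obtain u where u: "(\<Sum>v\<in>w ` {..N}. u v *\<^sub>R v) = 0" "\<exists>v\<in>w ` {..N}. u v \<noteq> 0"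
      by (auto simp: dependent_finite)
    define p where "p = (\<Sum>k\<le>N. monom (complex_of_real (u (w k))) k)"
    have "pmat p M = (\<Sum>k\<le>N. u (w k) *\<^sub>R w k)"
      unfolding p_def pmat_sum w_def
      by (intro sum.cong refl) (simp add: scaleR_cscale flip: pmat_smult smult_monom, simp add: smult_monom)
    also have "\<dots> = (\<Sum>v\<in>w ` {..N}. u v *\<^sub>R v)"
      by (simp add: sum.reindex[OF True])
    finally have "pmat p M = 0" using u(1) by simp
    moreover from u(2) obtain k where k: "k \<le> N" "u (w k) \<noteq> 0" by auto
    have "coeff p k = complex_of_real (u (w k))"
      using k(1) by (simp add: p_def coeff_sum)
    then have "p \<noteq> 0" using k by auto
    ultimately show ?thesis by blast
  qed
qed

text \<open>Evaluating the inner product of \<open>v\<close> and \<open>M *v v\<close> on either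
  side gives z = cnj z unless \<open>v\<close> vanishes.\<close>

lemma hermitian_shift_inj:
  assumes "adj M = M" "Im z \<noteq> 0" "M *v v = z *s v"
  shows "v = 0"
proof -
  have "z * cinner v v = cinner v (M *v v)" by (simp add: assms)
  also have "\<dots> = cinner (M *v v) v" using cinner_adj[of v M v] assms(1) by simp
  also have "\<dots> = cnj z * cinner v v" by (simp add: assms)
  finally have "(z - cnj z) * cinner v v = 0" unfolding left_diff_distrib by (rule eq_iff_diff_eq_0[THEN iffD1])
  moreover have "z - cnj z \<noteq> 0" using assms(2) by (simp add: complex_eq_iff)
  ultimately have "cinner v v = 0" by (metis mult_eq_0_iff)
  then show ?thesis by (simp add: cinner_self_eq_0)
qed

lemma adj_mult_self_eq_0:
  assumes "adj A ** A = 0" shows "A = (0 :: complex^'n^'n)"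
proof (rule matrix_eqI)
  fix v
  have "cinner (A *v v) (A *v v) = cinner v ((adj A ** A) *v v)"
    by (simp add: cinner_adj flip: matrix_vector_mul_assoc)
  then show "A *v v = 0 *v v" using assms by (simp add: cinner_self_eq_0)
qed

abbreviation lin_factor :: "complex \<Rightarrow> complex poly" where
  "lin_factor z \<equiv> [:- z, 1:]"

lemma pmat_lin_factor: "pmat (lin_factor z) M = M - z *\<^sub>C mat 1"
  by (simp add: cscale_minus)

lemma hermitian_split:
  fixes M X :: "complex^'n^'n"
  assumes herm: "adj M = M" and "p \<noteq> 0" "pmat p M ** X = 0"
  shows "\<exists>S. finite S \<and> pmat (\<Prod>s\<in>S. lin_factor (complex_of_real s)) M ** X = 0"
  using assms(2,3)
proof (induction "degree p" arbitrary: p X)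
  case 0
  then obtain c where c: "p = [:c:]" by (metis degree_eq_zeroE)
  then have "X = 0" using 0 by simp
  then show ?case by (intro exI[of _ "{}"]) simp
next
  case (Suc n)
  then obtain z where "poly p z = 0"
    using Fundamental_Theorem_Algebra.fundamental_theorem_of_algebra[of p] by (metis constant_degree nat.distinct(1))
  then obtain q where q: "p = lin_factor z * q" by (auto simp: poly_eq_0_iff_dvd)
  have "q \<noteq> 0" using Suc.prems q by auto
  have "degree q = n" using Suc(2) \<open>q \<noteq> 0\<close> unfolding q by (subst (asm) degree_mult_eq) auto
  define Y where "Y = pmat (lin_factor z) M ** X"
  have "pmat q M ** Y = pmat p M ** X"
    unfolding q Y_def pmat_mult by (metis matrix_mul_assoc pmat_commute)
  then obtain S where S: "finite S" "pmat (\<Prod>s\<in>S. lin_factor (complex_of_real s)) M ** Y = 0"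
    using Suc(1)[of q Y] \<open>degree q = n\<close> \<open>q \<noteq> 0\<close> Suc.prems by auto
  let ?P = "\<lambda>S. pmat (\<Prod>s\<in>S. lin_factor (complex_of_real s)) M"
  have *: "pmat (lin_factor z) M ** (?P S ** X) = 0"
    using S(2) unfolding Y_def by (metis matrix_mul_assoc pmat_commute)
  show ?case
  proof (cases "Im z = 0")
    case False
    have "?P S ** X = 0"
    proof (rule matrix_eqI)
      fix v
      have "(pmat (lin_factor z) M ** (?P S ** X)) *v v = 0" by (simp only: *) simp
      then have "M *v ((?P S ** X) *v v) = z *s ((?P S ** X) *v v)"
        by (simp only: pmat_lin_factor flip: matrix_vector_mul_assoc)
          (simp add: mv.diff_left matrix_vector_cscale)
      from hermitian_shift_inj[OF herm False this] show "(?P S ** X) *v v = 0 *v v" by simp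
    qed
    with S show ?thesis by blast
  next
    case True
    then obtain r where z: "z = complex_of_real r" by (metis complex_is_Real_iff Reals_cases)
    show ?thesis
    proof (cases "r \<in> S")
      case False
      then have "?P (insert r S) ** X = 0"
        using S * by (simp only: prod.insert[OF S(1) False] pmat_mult z flip: matrix_mul_assoc)
      with S show ?thesis by blast
    next
      case True
      let ?Z = "?P (S - {r}) ** X" and ?F = "pmat (lin_factor z) M"
      have Fh: "adj ?F = ?F"
        unfolding pmat_lin_factor by (simp add: adj_diff adj_cscale herm z)
      have P: "?P S ** X = ?F ** ?Z"
        by (simp only: prod.remove[OF S(1) True] pmat_mult z flip: matrix_mul_assoc)
      have "adj (?F ** ?Z) ** (?F ** ?Z) = adj ?Z ** (?F ** (?F ** ?Z))"
        by (simp only: adj_mult Fh flip: matrix_mul_assoc)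
      also have "\<dots> = 0" using * by (simp only: P mm.zero_right)
      finally have "?F ** ?Z = 0" by (rule adj_mult_self_eq_0)
      with P S show ?thesis by (intro exI[of _ S]) simp
    qed
  qed
qed

definition lagrange :: "real set \<Rightarrow> real \<Rightarrow> complex poly" where
  "lagrange S x = (\<Prod>y\<in>S - {x}. smult (inverse (complex_of_real (x - y))) (lin_factor (complex_of_real y)))"

lemma poly_lagrange:
  assumes "finite S" "x \<in> S" "y \<in> S"
  shows "poly (lagrange S x) (complex_of_real y) = (if x = y then 1 else 0)"
proof -
  have "poly (lagrange S x) (complex_of_real y) = (\<Prod>z\<in>S - {x}. complex_of_real ((y - z) / (x - z)))"
    unfolding lagrange_def poly_prod by (intro prod.cong refl) (simp add: divide_inverse algebra_simps)
  also have "\<dots> = (if x = y then 1 else 0)"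
    using assms by (auto intro!: prod.neutral prod_zero)
  finally show ?thesis .
qed

lemma degree_lagrange:
  assumes "finite S" "x \<in> S" shows "degree (lagrange S x) < card S"
proof -
  have "degree (lagrange S x) \<le> (\<Sum>y\<in>S - {x}. 1)"
    unfolding lagrange_def
    by (rule order.trans[OF degree_prod_sum_le]) (use assms in \<open>auto intro!: sum_mono simp: degree_smult_le\<close>)
  also have "\<dots> < card S" using assms by (simp add: card_gt_0_iff) (metis card_gt_0_iff diff_less empty_iff zero_less_Suc)
  finally show ?thesis .
qed

lemma sum_lagrange:
  assumes "finite S" "S \<noteq> {}" shows "(\<Sum>x\<in>S. lagrange S x) = 1"
proof (rule poly_eqI_degree[of "complex_of_real ` S"])
  have c: "card (complex_of_real ` S) = card S" by (simp add: card_image inj_on_def)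
  show "poly (\<Sum>x\<in>S. lagrange S x) z = poly 1 z" if "z \<in> complex_of_real ` S" for z
    using that assms by (auto simp: poly_sum poly_lagrange sum.delta cong: sum.cong)
  show "degree (\<Sum>x\<in>S. lagrange S x) < card (complex_of_real ` S)"
    unfolding c by (rule degree_sum_less) (use assms degree_lagrange in \<open>auto simp: card_gt_0_iff\<close>)
  show "degree (1 :: complex poly) < card (complex_of_real ` S)"
    using assms by (simp add: c card_gt_0_iff)
qed

subsection \<open>The spectral theorem\<close>

locale vn_alg =
  fixes A :: "(complex^'n^'n) set"
  assumes vn: "vn_algebra A"
begin

lemma one_in [simp, intro]: "mat 1 \<in> A"
  and add_in [simp, intro]: "a \<in> A \<Longrightarrow> b \<in> A \<Longrightarrow> a + b \<in> A"
  and mult_in [simp, intro]: "a \<in> A \<Longrightarrow> b \<in> A \<Longrightarrow> a ** b \<in> A"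
  and cscale_in [simp, intro]: "a \<in> A \<Longrightarrow> c *\<^sub>C a \<in> A"
  and adj_in [simp, intro]: "a \<in> A \<Longrightarrow> adj a \<in> A"
  using vn by (auto simp: vn_algebra_def)

lemma zero_in [simp, intro]: "0 \<in> A"
  using cscale_in[OF one_in, of 0] by simp

lemma scaleR_in [simp, intro]: "a \<in> A \<Longrightarrow> r *\<^sub>R a \<in> A"
  by (simp add: scaleR_cscale)

lemma minus_in [simp, intro]: "a \<in> A \<Longrightarrow> - a \<in> A"
  using cscale_in[of a "-1"] by (simp add: cscale_minus)

lemma diff_in [simp, intro]: "a \<in> A \<Longrightarrow> b \<in> A \<Longrightarrow> a - b \<in> A"
  using add_in[of a "- b"] by simp

lemma sum_in [intro]: "(\<And>x. x \<in> S \<Longrightarrow> f x \<in> A) \<Longrightarrow> sum f S \<in> A"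
  by (induction S rule: infinite_finite_induct) auto

lemma subspace_alg: "subspace A"
  by (auto simp: subspace_def)

lemma pmat_in: "M \<in> A \<Longrightarrow> pmat p M \<in> A"
  by (induction p) auto

end

text \<open>The Lagrange interpolation polynomials of an annihilating polynomial with simple real roots
  turn into the spectral projections.\<close>

lemma eigproj_lagrange:
  fixes M :: "complex^'n^'n"
  assumes herm: "adj M = M" and S: "finite S"
    and ann: "pmat (\<Prod>s\<in>S. lin_factor (complex_of_real s)) M = 0"
  defines "E \<equiv> \<lambda>x. pmat (lagrange S x) M"
  shows "(\<Sum>x\<in>S. E x) = mat 1" "\<And>x. x \<in> S \<Longrightarrow> M ** E x = complex_of_real x *\<^sub>C E x"
    "\<And>x. x \<in> S \<Longrightarrow> adj (E x) = E x"
    "\<And>x y. x \<in> S \<Longrightarrow> y \<in> S \<Longrightarrow> E x ** E y = (if x = y then E x else 0)"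
    "eigvals M = {x\<in>S. E x \<noteq> 0}" "\<And>x. x \<in> S \<Longrightarrow> eigproj M x = E x"
proof -
  have "S \<noteq> {}"
  proof
    assume "S = {}"
    then have "mat 1 = (0 :: complex^'n^'n)" using ann by simp
    then show False by (auto simp: mat_eq_iff mat_def split: if_splits)
  qed
  show sumE: "(\<Sum>x\<in>S. E x) = mat 1"
    using sum_lagrange[OF S \<open>S \<noteq> {}\<close>] by (simp add: E_def flip: pmat_sum)
  show ME: "M ** E x = complex_of_real x *\<^sub>C E x" if "x \<in> S" for x
  proof -
    have "lin_factor (complex_of_real x) * lagrange S x
        = smult (\<Prod>y\<in>S - {x}. inverse (complex_of_real (x - y))) (\<Prod>s\<in>S. lin_factor (complex_of_real s))"
      unfolding lagrange_def prod_smult prod.remove[OF S that] by (simp del: mult_pCons_left)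
    then have "pmat (lin_factor (complex_of_real x) * lagrange S x) M = 0"
      using ann by simp
    then show ?thesis
      unfolding pmat_mult pmat_lin_factor by (simp add: E_def mm.diff_left)
  qed
  have adjM: "adj (E x) ** M = complex_of_real x *\<^sub>C adj (E x)" if "x \<in> S" for x
    using arg_cong[OF ME[OF that], of adj] by (simp add: adj_mult herm adj_cscale)
  \<comment> \<open>Self-adjointness of the \<open>E x\<close> is not yet available, so
    orthogonality is first shown with one adjoint; inserting the identity as the sum of all
    \<open>E y\<close> then yields it.\<close>
  have orth: "adj (E x) ** E y = 0" if "x \<in> S" "y \<in> S" "x \<noteq> y" for x y
  proof -
    have "complex_of_real x *\<^sub>C (adj (E x) ** E y) = adj (E x) ** M ** E y"
      by (simp add: adjM that)
    also have "\<dots> = complex_of_real y *\<^sub>C (adj (E x) ** E y)"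
      by (simp add: ME that flip: matrix_mul_assoc)
    finally have "complex_of_real (x - y) *\<^sub>C (adj (E x) ** E y) = 0"
      by (simp add: cscale_diff_left)
    then show ?thesis using that by simp
  qed
  have adjE: "adj (E x) = adj (E x) ** E x" if "x \<in> S" for x
  proof -
    have "adj (E x) = (\<Sum>y\<in>S. adj (E x) ** E y)"
      using sumE by (simp flip: mm.sum_right)
    also have "\<dots> = (\<Sum>y\<in>S. if x = y then adj (E x) ** E x else 0)"
      using orth that by (intro sum.cong) auto
    finally show ?thesis using S that by simp
  qed
  show herE: "adj (E x) = E x" if "x \<in> S" for x
  proof -
    have "E x = adj (E x) ** E x"
      using arg_cong[OF adjE[OF that], of adj] unfolding adj_mult adj_adj .
    then show ?thesis using adjE[OF that] by (rule trans[OF _ sym, rotated])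
  qed
  show EE: "E x ** E y = (if x = y then E x else 0)" if "x \<in> S" "y \<in> S" for x y
    using orth adjE herE that by (metis (full_types))
  have vE: "v = E x *v v" if v: "M *v v = complex_of_real x *s v" and "x \<in> S" for x v
  proof -
    have 0: "E y *v v = 0" if "y \<in> S" "y \<noteq> x" for y
    proof -
      have "complex_of_real x *s (E y *v v) = (E y ** M) *v v"
        using v by (simp add: mv.scaleR_right vec.scale flip: matrix_vector_mul_assoc)
      also have "\<dots> = complex_of_real y *s (E y *v v)"
        using adjM[OF that(1)] herE[OF that(1)] by (simp add: matrix_vector_cscale)
      finally have "(complex_of_real x - complex_of_real y) *s (E y *v v) = 0"
        by (simp add: vec.scale_left_diff_distrib)
      then show ?thesis using that by (simp add: vec_eq_iff)
    qed
    have "v = (\<Sum>y\<in>S. E y) *v v" by (simp add: sumE)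
    also have "\<dots> = (\<Sum>y\<in>S. if y = x then E x *v v else 0)"
      unfolding mv.sum_left using 0 by (intro sum.cong) auto
    finally show ?thesis using S \<open>x \<in> S\<close> by simp
  qed
  have rng: "range ((*v) (E x)) = {v. M *v v = complex_of_real x *s v}" if "x \<in> S" for x
  proof -
    have "M *v (E x *v v) = complex_of_real x *s (E x *v v)" for v
      using ME[OF that] by (simp add: matrix_vector_mul_assoc matrix_vector_cscale)
    then show ?thesis using vE[OF _ that] by auto
  qed
  show "eigvals M = {x\<in>S. E x \<noteq> 0}"
  proof (intro set_eqI iffI)
    fix x assume "x \<in> eigvals M"
    then obtain v where v: "v \<noteq> 0" "M *v v = complex_of_real x *s v" by (auto simp: eigvals_def)
    have "x \<in> S"
    proof (rule ccontr)
      assume "x \<notin> S"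
      have 0: "E y *v v = 0" if "y \<in> S" for y
      proof -
        have "complex_of_real x *s (E y *v v) = (E y ** M) *v v"
          using v by (simp add: mv.scaleR_right vec.scale flip: matrix_vector_mul_assoc)
        also have "\<dots> = complex_of_real y *s (E y *v v)"
          using adjM[OF that] herE[OF that] by (simp add: matrix_vector_cscale)
        finally have "(complex_of_real x - complex_of_real y) *s (E y *v v) = 0"
          by (simp add: vec.scale_left_diff_distrib)
        then show ?thesis using that \<open>x \<notin> S\<close> by (auto simp: vec_eq_iff)
      qed
      have "v = (\<Sum>y\<in>S. E y) *v v" by (simp add: sumE)
      also have "\<dots> = 0" unfolding mv.sum_left using 0 by simp
      finally show False using v by simp
    qed
    moreover have "E x \<noteq> 0" using vE[OF v(2) \<open>x \<in> S\<close>] v(1) by auto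
    ultimately show "x \<in> {x\<in>S. E x \<noteq> 0}" by simp
  next
    fix x assume "x \<in> {x\<in>S. E x \<noteq> 0}"
    then have x: "x \<in> S" "E x \<noteq> 0" by auto
    then obtain v where "E x *v v \<noteq> 0" by (metis matrix_eqI mv.zero_left)
    then show "x \<in> eigvals M" using rng[OF x(1)] by (auto simp: eigvals_def)
  qed
  show "eigproj M x = E x" if "x \<in> S" for x
    unfolding eigproj_def
  proof (rule the_equality)
    show "adj (E x) = E x \<and> E x ** E x = E x \<and> range ((*v) (E x)) = {v. M *v v = complex_of_real x *s v}"
      using herE EE rng that by auto
  next
    \<comment> \<open>Two orthogonal projections with the same range absorb each other on the left;
      comparing adjoints gives equality.\<close>
    fix F assume F: "adj F = F \<and> F ** F = F \<and> range ((*v) F) = {v. M *v v = complex_of_real x *s v}"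
    then have eq: "range ((*v) F) = range ((*v) (E x))" using rng that by auto
    have "E x ** F = F"
    proof (rule matrix_eqI)
      fix v
      have "F *v v \<in> range ((*v) (E x))" using eq by auto
      then obtain w where w: "F *v v = E x *v w" by auto
      have "E x *v (F *v v) = F *v v" unfolding w using EE that by (simp add: matrix_vector_mul_assoc)
      then show "(E x ** F) *v v = F *v v" by (simp flip: matrix_vector_mul_assoc)
    qed
    moreover have "F ** E x = E x"
    proof (rule matrix_eqI)
      fix v
      have "E x *v v \<in> range ((*v) F)" using eq by auto
      then obtain w where w: "E x *v v = F *v w" by auto
      have "F *v (E x *v v) = E x *v v" unfolding w using F by (simp add: matrix_vector_mul_assoc)
      then show "(F ** E x) *v v = E x *v v" by (simp flip: matrix_vector_mul_assoc)
    qed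
    ultimately show "F = E x" by (metis F adj_mult herE that)
  qed
qed

lemma hermitian_annihilated:
  assumes "adj M = (M :: complex^'n^'n)"
  obtains S where "finite S" "pmat (\<Prod>s\<in>S. lin_factor (complex_of_real s)) M = 0"
proof -
  obtain p where "p \<noteq> 0" "pmat p M = 0" using pmat_annihilator by blast
  then show ?thesis using hermitian_split[OF assms, of p "mat 1"] that by auto
qed

section \<open>Spectral calculus of a self-adjoint matrix\<close>

context
  fixes M :: "complex^'n^'n"
  assumes herm: "adj M = M"
begin

lemma finite_eigvals [simp, intro]: "finite (eigvals M)"
proof -
  obtain S where S: "finite S" "pmat (\<Prod>s\<in>S. lin_factor (complex_of_real s)) M = 0"
    using hermitian_annihilated[OF herm] .
  show ?thesis using eigproj_lagrange(5)[OF herm S] S by simp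
qed

lemma eigproj_sum: "(\<Sum>x\<in>eigvals M. eigproj M x) = mat 1"
proof -
  obtain S where S: "finite S" "pmat (\<Prod>s\<in>S. lin_factor (complex_of_real s)) M = 0"
    using hermitian_annihilated[OF herm] .
  note E = eigproj_lagrange[OF herm S]
  have "(\<Sum>x\<in>eigvals M. eigproj M x) = (\<Sum>x\<in>S. pmat (lagrange S x) M)"
    using S E(5,6) by (intro sum.mono_neutral_cong_left) auto
  then show ?thesis using E(1) by simp
qed

lemma eigproj_props:
  assumes "x \<in> eigvals M"
  shows eigproj_eigen: "M ** eigproj M x = complex_of_real x *\<^sub>C eigproj M x"
    and eigproj_adj: "adj (eigproj M x) = eigproj M x"
    and eigproj_idem: "eigproj M x ** eigproj M x = eigproj M x"
    and eigproj_nz: "eigproj M x \<noteq> 0"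
proof -
  obtain S where S: "finite S" "pmat (\<Prod>s\<in>S. lin_factor (complex_of_real s)) M = 0"
    using hermitian_annihilated[OF herm] .
  note E = eigproj_lagrange[OF herm S]
  show "M ** eigproj M x = complex_of_real x *\<^sub>C eigproj M x" "adj (eigproj M x) = eigproj M x"
    "eigproj M x ** eigproj M x = eigproj M x" "eigproj M x \<noteq> 0"
    using assms E by auto
qed

lemma eigproj_orth:
  assumes "x \<in> eigvals M" "y \<in> eigvals M"
  shows "eigproj M x ** eigproj M y = (if x = y then eigproj M x else 0)"
proof -
  obtain S where S: "finite S" "pmat (\<Prod>s\<in>S. lin_factor (complex_of_real s)) M = 0"
    using hermitian_annihilated[OF herm] .
  note E = eigproj_lagrange[OF herm S]
  show ?thesis using assms E(4,5,6) by auto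
qed

lemma spectral_decomp: "M = (\<Sum>x\<in>eigvals M. complex_of_real x *\<^sub>C eigproj M x)"
proof -
  have "M = M ** (\<Sum>x\<in>eigvals M. eigproj M x)" by (simp add: eigproj_sum)
  then show ?thesis by (simp add: mm.sum_right eigproj_eigen cong: sum.cong)
qed

lemma eigproj_eigen': "x \<in> eigvals M \<Longrightarrow> eigproj M x ** M = complex_of_real x *\<^sub>C eigproj M x"
  using arg_cong[OF eigproj_eigen, of x adj] by (simp add: adj_mult herm adj_cscale eigproj_adj)

lemma herm_fun_mult: "herm_fun f M ** herm_fun g M = herm_fun (\<lambda>x. f x * g x) M"
proof -
  have "herm_fun f M ** herm_fun g M = (\<Sum>x\<in>eigvals M. \<Sum>y\<in>eigvals M.
      (complex_of_real (f x) * complex_of_real (g y)) *\<^sub>C (eigproj M x ** eigproj M y))"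
    unfolding herm_fun_def mm.sum_left by (simp add: mm.sum_right mult.commute)
  also have "\<dots> = (\<Sum>x\<in>eigvals M. \<Sum>y\<in>eigvals M. if x = y then (f x * g x) *\<^sub>C eigproj M x else 0)"
    by (intro sum.cong) (auto simp: eigproj_orth)
  finally show ?thesis by (simp add: herm_fun_def)
qed

lemma herm_fun_const: "herm_fun (\<lambda>_. c) M = complex_of_real c *\<^sub>C mat 1"
  by (simp add: herm_fun_def eigproj_sum flip: cscale_sum)

lemma herm_fun_id: "herm_fun (\<lambda>x. x) M = M"
  using spectral_decomp by (simp add: herm_fun_def)

lemma herm_fun_adj: "adj (herm_fun f M) = herm_fun f M"
  by (simp add: herm_fun_def adj_sum adj_cscale eigproj_adj cong: sum.cong)

lemma cinner_eigproj: "x \<in> eigvals M \<Longrightarrow> cinner v (eigproj M x *v v) = complex_of_real ((norm (eigproj M x *v v))\<^sup>2)"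
  by (metis cinner_adj cinner_self eigproj_adj eigproj_idem matrix_vector_mul_assoc)

lemma quad_form_spectral:
  "quad_form M v = complex_of_real (\<Sum>x\<in>eigvals M. x * (norm (eigproj M x *v v))\<^sup>2)"
proof -
  have "M *v v = (\<Sum>x\<in>eigvals M. complex_of_real x *s (eigproj M x *v v))"
    by (subst spectral_decomp) (simp add: mv.sum_left matrix_vector_cscale)
  then have "quad_form M v = (\<Sum>x\<in>eigvals M. cinner v (complex_of_real x *s (eigproj M x *v v)))"
    by (simp only: quad_form_cinner cinner_sum_right)
  also have "\<dots> = (\<Sum>x\<in>eigvals M. complex_of_real (x * (norm (eigproj M x *v v))\<^sup>2))"
    by (intro sum.cong refl) (simp add: cinner_eigproj)
  finally show ?thesis by simp
qed

lemma norm_spectral: "(norm v)\<^sup>2 = (\<Sum>x\<in>eigvals M. (norm (eigproj M x *v v))\<^sup>2)"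
proof -
  have "complex_of_real ((norm v)\<^sup>2) = cinner v (\<Sum>x\<in>eigvals M. eigproj M x *v v)"
    unfolding mv.sum_left[symmetric] eigproj_sum by (simp add: cinner_self)
  also have "\<dots> = (\<Sum>x\<in>eigvals M. cinner v (eigproj M x *v v))"
    by (rule cinner_sum_right)
  also have "\<dots> = (\<Sum>x\<in>eigvals M. complex_of_real ((norm (eigproj M x *v v))\<^sup>2))"
    by (intro sum.cong refl) (simp add: cinner_eigproj)
  finally have "complex_of_real ((norm v)\<^sup>2) = complex_of_real (\<Sum>x\<in>eigvals M. (norm (eigproj M x *v v))\<^sup>2)"
    by simp
  then show ?thesis unfolding of_real_eq_iff .
qed

text \<open>The quadratic form is additive in \<open>M\<close>, unlike the spectrum; in this shape
  lower spectral bounds pass to mixtures and to nearby matrices.\<close>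

lemma eigvals_ge_iff:
  "(\<forall>x\<in>eigvals M. l \<le> x) \<longleftrightarrow> (\<forall>v. l * (norm v)\<^sup>2 \<le> Re (quad_form M v))"
proof
  assume *: "\<forall>x\<in>eigvals M. l \<le> x"
  show "\<forall>v. l * (norm v)\<^sup>2 \<le> Re (quad_form M v)"
  proof
    fix v
    have "l * (norm v)\<^sup>2 = (\<Sum>x\<in>eigvals M. l * (norm (eigproj M x *v v))\<^sup>2)"
      unfolding norm_spectral[of v] by (rule sum_distrib_left)
    also have "\<dots> \<le> (\<Sum>x\<in>eigvals M. x * (norm (eigproj M x *v v))\<^sup>2)"
      using * by (intro sum_mono mult_right_mono) auto
    finally show "l * (norm v)\<^sup>2 \<le> Re (quad_form M v)" by (simp add: quad_form_spectral)
  qed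
next
  assume *: "\<forall>v. l * (norm v)\<^sup>2 \<le> Re (quad_form M v)"
  show "\<forall>x\<in>eigvals M. l \<le> x"
  proof
    fix x assume "x \<in> eigvals M"
    then obtain v where v: "v \<noteq> 0" "M *v v = complex_of_real x *s v" by (auto simp: eigvals_def)
    have "l * (norm v)\<^sup>2 \<le> x * (norm v)\<^sup>2"
      using *[rule_format, of v] by (simp add: Re_quad_form_eigen[OF v(2)])
    then show "l \<le> x" using v by simp
  qed
qed

lemma pos_semidef_iff: "pos_semidef M \<longleftrightarrow> (\<forall>x\<in>eigvals M. 0 \<le> x)"
  using eigvals_ge_iff[of 0] by (simp add: pos_semidef_def herm)

lemma pos_def_iff_ge: "pos_def M \<longleftrightarrow> (\<exists>l>0. \<forall>v. l * (norm v)\<^sup>2 \<le> Re (quad_form M v))"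
proof
  assume pd: "pos_def M"
  have pos: "x > 0" if x: "x \<in> eigvals M" for x
  proof -
    obtain v where v: "v \<noteq> 0" "M *v v = complex_of_real x *s v" using x by (auto simp: eigvals_def)
    then have "0 < x * (norm v)\<^sup>2"
      using pd Re_quad_form_eigen[OF v(2)] unfolding pos_def_def by metis
    then show ?thesis using v by (simp add: zero_less_mult_iff)
  qed
  have "\<exists>l>0. \<forall>x\<in>eigvals M. l \<le> x"
  proof (cases "eigvals M = {}")
    case False
    then show ?thesis using pos by (intro exI[of _ "Min (eigvals M)"]) auto
  qed (auto intro: exI[of _ 1])
  then show "\<exists>l>0. \<forall>v. l * (norm v)\<^sup>2 \<le> Re (quad_form M v)"
    unfolding eigvals_ge_iff .
next
  assume "\<exists>l>0. \<forall>v. l * (norm v)\<^sup>2 \<le> Re (quad_form M v)"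
  then obtain l where l: "l > 0" "\<And>v. l * (norm v)\<^sup>2 \<le> Re (quad_form M v)" by auto
  show "pos_def M" unfolding pos_def_def
  proof (intro conjI allI impI herm)
    fix v :: "complex^'n" assume "v \<noteq> 0"
    then have "0 < l * (norm v)\<^sup>2" using l by simp
    then show "0 < Re (quad_form M v)" using l(2) by (rule less_le_trans)
  qed
qed

lemma pos_def_iff: "pos_def M \<longleftrightarrow> (\<forall>x\<in>eigvals M. 0 < x)"
proof
  assume "pos_def M"
  then obtain l where "l > 0" "\<forall>x\<in>eigvals M. l \<le> x"
    unfolding pos_def_iff_ge eigvals_ge_iff[symmetric] by blast
  then show "\<forall>x\<in>eigvals M. 0 < x" by force
next
  assume pos: "\<forall>x\<in>eigvals M. 0 < x"
  have "\<exists>l>0. \<forall>x\<in>eigvals M. l \<le> x"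
  proof (cases "eigvals M = {}")
    case False
    then show ?thesis using pos by (intro exI[of _ "Min (eigvals M)"]) auto
  qed (auto intro: exI[of _ 1])
  then show "pos_def M" unfolding pos_def_iff_ge eigvals_ge_iff[symmetric] .
qed

end

text \<open>A spectral projection is a polynomial in \<open>M\<close>, so it stays in every algebra
  containing \<open>M\<close>.\<close>

lemma (in vn_alg) eigproj_in:
  assumes "M \<in> A" "adj M = M" "x \<in> eigvals M"
  shows "eigproj M x \<in> A"
proof -
  obtain S where S: "finite S" "pmat (\<Prod>s\<in>S. lin_factor (complex_of_real s)) M = 0"
    using hermitian_annihilated[OF assms(2)] .
  note E = eigproj_lagrange[OF assms(2) S]
  have "x \<in> S" using E(5) assms by auto
  then show ?thesis using E(6)[of x] pmat_in[OF assms(1)] by simp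
qed

lemma (in vn_alg) herm_fun_in:
  assumes "M \<in> A" "adj M = M"
  shows "herm_fun f M \<in> A"
  unfolding herm_fun_def using eigproj_in[OF assms] by (intro sum_in cscale_in) auto

section \<open>Bilinear forms on subspaces\<close>

text \<open>Traces, homomorphisms and forms are linear only on the algebra. Composed with such a
  projection they become linear on the whole matrix space, where finite dimension gives continuity
  and bounds.\<close>

lemma subspace_projection:
  fixes S :: "'a::euclidean_space set"
  assumes "subspace S"
  obtains p where "linear p" "\<And>x. p x \<in> S" "\<And>x. x \<in> S \<Longrightarrow> p x = x"
proof -
  obtain B where B: "B \<subseteq> S" "independent B" "span B = S"
    using basis_exists[of S] assms by (metis span_eq_iff span_subspace)
  obtain p where p: "linear p" "\<forall>x\<in>B. p x = x" "range p = span ((\<lambda>x. x) ` B)"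
    using linear_independent_extend_subspace[OF B(2), of "\<lambda>x. x"] by auto
  have "p x = x" if "x \<in> S" for x
    using linear_eq_on_span[OF p(1) linear_id, of B x] p(2) B(3) that by simp
  moreover have "p x \<in> S" for x using p(3) B(3) by auto
  ultimately show ?thesis using p(1) that by blast
qed

definition bilinear_on :: "'a::real_vector set \<Rightarrow> ('a \<Rightarrow> 'a \<Rightarrow> real) \<Rightarrow> bool" where
  "bilinear_on S b \<longleftrightarrow>
     (\<forall>x\<in>S. \<forall>y\<in>S. \<forall>z\<in>S. b (x + y) z = b x z + b y z \<and> b z (x + y) = b z x + b z y) \<and>
     (\<forall>r. \<forall>x\<in>S. \<forall>y\<in>S. b (r *\<^sub>R x) y = r * b x y \<and> b x (r *\<^sub>R y) = r * b x y)"

lemma linear_on_extend: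
  fixes S :: "'a::euclidean_space set" and f :: "'a \<Rightarrow> 'b::real_vector"
  assumes S: "subspace S" and "\<And>x y. x \<in> S \<Longrightarrow> y \<in> S \<Longrightarrow> f (x + y) = f x + f y"
    and "\<And>r x. x \<in> S \<Longrightarrow> f (r *\<^sub>R x) = r *\<^sub>R f x"
  obtains g where "linear g" "\<And>x. x \<in> S \<Longrightarrow> g x = f x"
proof -
  obtain p where p: "linear p" "\<And>x. p x \<in> S" "\<And>x. x \<in> S \<Longrightarrow> p x = x"
    using subspace_projection[OF S] by blast
  have "linear (\<lambda>x. f (p x))"
    by (rule linearI) (simp_all add: linear_add[OF p(1)] linear_scale[OF p(1)] assms p(2))
  with p(3) show ?thesis using that[of "\<lambda>x. f (p x)"] by simp
qed

lemma bilinear_on_extend: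
  fixes S :: "'a::euclidean_space set"
  assumes S: "subspace S" and b: "bilinear_on S b"
  obtains c where "bounded_bilinear c" "\<And>x y. x \<in> S \<Longrightarrow> y \<in> S \<Longrightarrow> c x y = b x y"
proof -
  obtain p where p: "linear p" "\<And>x. p x \<in> S" "\<And>x. x \<in> S \<Longrightarrow> p x = x"
    using subspace_projection[OF S] by blast
  have "bilinear (\<lambda>x y. b (p x) (p y))"
    unfolding bilinear_def
    by (auto intro!: linearI simp: linear_add[OF p(1)] linear_scale[OF p(1)]
        b[unfolded bilinear_on_def] p(2))
  then have "bounded_bilinear (\<lambda>x y. b (p x) (p y))" by (simp add: bilinear_conv_bounded_bilinear)
  with p(3) show ?thesis using that[of "\<lambda>x y. b (p x) (p y)"] by simp
qed

lemma bilinear_on_bounded: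
  fixes S :: "'a::euclidean_space set"
  assumes "subspace S" "bilinear_on S b"
  obtains C where "C > 0" "\<And>x y. x \<in> S \<Longrightarrow> y \<in> S \<Longrightarrow> \<bar>b x y\<bar> \<le> C * norm x * norm y"
proof -
  obtain c where c: "bounded_bilinear c" "\<And>x y. x \<in> S \<Longrightarrow> y \<in> S \<Longrightarrow> c x y = b x y"
    using bilinear_on_extend[OF assms] by blast
  obtain K where "K > 0" "\<forall>x y. norm (c x y) \<le> norm x * norm y * K"
    using bounded_bilinear.pos_bounded[OF c(1)] by blast
  then show ?thesis using c(2) that[of K] by (metis mult.assoc mult.commute real_norm_def)
qed

text \<open>The minimum over the unit sphere of \<open>S\<close> is attained and positive;
  homogeneity does the rest.\<close>

lemma pos_def_on_coercive:
  fixes S :: "'a::euclidean_space set"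
  assumes S: "subspace S" and "bilinear_on S b" and pos: "\<And>x. x \<in> S \<Longrightarrow> x \<noteq> 0 \<Longrightarrow> 0 < b x x"
  obtains c where "c > 0" "\<And>x. x \<in> S \<Longrightarrow> c * (norm x)\<^sup>2 \<le> b x x"
proof -
  obtain d where d: "bounded_bilinear d" "\<And>x y. x \<in> S \<Longrightarrow> y \<in> S \<Longrightarrow> d x y = b x y"
    using bilinear_on_extend[OF assms(1,2)] by blast
  have hom: "b (r *\<^sub>R x) (r *\<^sub>R x) = r\<^sup>2 * b x x" if "x \<in> S" for r x
    using assms(2) that S by (simp add: bilinear_on_def subspace_scale power2_eq_square)
  let ?K = "S \<inter> sphere 0 1"
  show ?thesis
  proof (cases "?K = {}")
    \<comment> \<open>Without unit vectors \<open>S\<close> is the zero space and any constant will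
      do.\<close>
    case True
    have "x = 0" if "x \<in> S" for x
    proof (rule ccontr)
      assume "x \<noteq> 0"
      then have "(1 / norm x) *\<^sub>R x \<in> ?K" using that S by (simp add: subspace_scale)
      with True show False by blast
    qed
    then have "1 * (norm x)\<^sup>2 \<le> b x x" if "x \<in> S" for x
      using hom[OF subspace_0[OF S], of 0] that by fastforce
    then show ?thesis by (intro that[of 1]) auto
  next
    case False
    have "compact ?K" using closed_subspace[OF S] by (simp add: closed_Int_compact)
    moreover have "continuous_on ?K (\<lambda>x. d x x)"
      by (intro bounded_bilinear.continuous_on[OF d(1)] continuous_intros)
    ultimately obtain x0 where x0: "x0 \<in> ?K" "\<And>x. x \<in> ?K \<Longrightarrow> d x0 x0 \<le> d x x"
      using continuous_attains_inf[of ?K "\<lambda>x. d x x"] False by blast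
    have "x0 \<noteq> 0" using x0(1) by auto
    then have c: "b x0 x0 > 0" using pos x0 by auto
    have "b x0 x0 * (norm x)\<^sup>2 \<le> b x x" if "x \<in> S" for x
    proof (cases "x = 0")
      case True
      then show ?thesis using hom[OF that, of 0] by simp
    next
      case False
      have *: "(1 / norm x) *\<^sub>R x \<in> S" using that S by (simp add: subspace_scale)
      then have "b x0 x0 \<le> b ((1 / norm x) *\<^sub>R x) ((1 / norm x) *\<^sub>R x)"
        using x0(2)[of "(1 / norm x) *\<^sub>R x"] d(2) x0(1) False by simp
      then show ?thesis using hom[OF that, of "1 / norm x"] False by (simp add: field_simps)
    qed
    then show ?thesis using c that by blast
  qed
qed

text \<open>The form is only semidefinite, so the minimising multiple of \<open>y\<close> may fail
  to exist; then the quadratic in \<open>r\<close> is affine, and it can be nonnegative only if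
  \<open>b x y = 0\<close>.\<close>

lemma cauchy_schwarz_on:
  fixes S :: "'a::real_vector set"
  assumes S: "subspace S" and b: "bilinear_on S b"
    and sym: "\<And>x y. x \<in> S \<Longrightarrow> y \<in> S \<Longrightarrow> b x y = b y x"
    and nn: "\<And>x. x \<in> S \<Longrightarrow> 0 \<le> b x x"
    and xy: "x \<in> S" "y \<in> S"
  shows "(b x y)\<^sup>2 \<le> b x x * b y y"
proof -
  have *: "0 \<le> b x x + 2 * r * b x y + r\<^sup>2 * b y y" for r
  proof -
    have "b (x + r *\<^sub>R y) (x + r *\<^sub>R y) = b x x + 2 * r * b x y + r\<^sup>2 * b y y"
      using b sym[OF xy] xy S
      by (simp add: bilinear_on_def subspace_add subspace_scale power2_eq_square algebra_simps)
    then show ?thesis using nn[of "x + r *\<^sub>R y"] xy S by (simp add: subspace_add subspace_scale)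
  qed
  show ?thesis
  proof (cases "b y y = 0")
    case True
    have "b x y = 0"
    proof (rule ccontr)
      assume "b x y \<noteq> 0"
      \<comment> \<open>This \<open>r\<close> makes the affine function equal to -1.\<close>
      then show False using *[of "- (b x x + 1) / (2 * b x y)"] True by (simp add: field_simps)
    qed
    then show ?thesis using nn xy by simp
  next
    case False
    then have "b y y > 0" using nn[OF xy(2)] by simp
    then show ?thesis using *[of "- b x y / b y y"] by (simp add: field_simps power2_eq_square)
  qed
qed

text \<open>Lax-Milgram in finite dimension, for a form that may be non-symmetric. \<open>J\<close>
  sends \<open>x\<close> to the vector representing \<open>b _ x\<close> in an orthonormal basis;
  positivity makes it injective, and equality of dimensions surjective.\<close>

lemma riesz_on:
  fixes S :: "'a::euclidean_space set"
  assumes S: "subspace S" and b: "bilinear_on S b"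
    and pos: "\<And>x. x \<in> S \<Longrightarrow> x \<noteq> 0 \<Longrightarrow> 0 < b x x"
    and f: "\<And>x y. x \<in> S \<Longrightarrow> y \<in> S \<Longrightarrow> f (x + y) = f x + f y"
      "\<And>r x. x \<in> S \<Longrightarrow> f (r *\<^sub>R x) = r * f x"
  shows "\<exists>x\<in>S. \<forall>a\<in>S. b a x = f a"
proof -
  obtain B where B: "B \<subseteq> S" "pairwise orthogonal B" "\<And>x. x \<in> B \<Longrightarrow> norm x = 1"
      "independent B" "card B = dim S" "span B = S"
    using orthonormal_basis_subspace[OF S] by blast
  have finB: "finite B" using B(4) by (rule independent_imp_finite)
  define J where "J x = (\<Sum>e\<in>B. b e x *\<^sub>R e)" for x
  have BS: "e \<in> S" if "e \<in> B" for e using B(1) that by auto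
  have JS: "J x \<in> S" for x
    unfolding J_def using S BS by (intro subspace_sum) (auto simp: subspace_scale)
  have "J (x + y) = J x + J y" if "x \<in> S" "y \<in> S" for x y
    using b BS that by (simp add: J_def bilinear_on_def sum.distrib scaleR_left_distrib)
  moreover have "J (r *\<^sub>R x) = r *\<^sub>R J x" if "x \<in> S" for r x
    using b BS that by (simp add: J_def bilinear_on_def scaleR_sum_right)
  ultimately obtain g where g: "linear g" "\<And>x. x \<in> S \<Longrightarrow> g x = J x"
    using linear_on_extend[OF S, of J] by blast
  have inner: "(\<Sum>e\<in>B. h e *\<^sub>R e) \<bullet> e' = h e'" if "e' \<in> B" for h e'
  proof -
    have "(\<Sum>e\<in>B. h e *\<^sub>R e) \<bullet> e' = (\<Sum>e\<in>B. if e = e' then h e' else 0)"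
      unfolding inner_sum_left
    proof (intro sum.cong refl)
      fix e assume "e \<in> B"
      then show "(h e *\<^sub>R e) \<bullet> e' = (if e = e' then h e' else 0)"
        using B(2,3) that by (auto simp: pairwise_def orthogonal_def dot_square_norm)
    qed
    then show ?thesis using finB that by simp
  qed
  have on_S: "\<forall>a\<in>S. b a x = k a" if "x \<in> S" "\<And>e. e \<in> B \<Longrightarrow> b e x = k e"
    "\<And>x y. x \<in> S \<Longrightarrow> y \<in> S \<Longrightarrow> k (x + y) = k x + k y"
    "\<And>r x. x \<in> S \<Longrightarrow> k (r *\<^sub>R x) = r * k x" for x k
  proof -
    have "b 0 x = 0" using b that(1) unfolding bilinear_on_def by (metis mult_zero_left scaleR_zero_left)
    moreover have "k 0 = 0" using that(4)[OF that(1), of 0] by simp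
    ultimately have "subspace {a\<in>S. b a x = k a}"
      using S b that unfolding subspace_def bilinear_on_def by auto
    moreover have "B \<subseteq> {a\<in>S. b a x = k a}" using BS that by auto
    ultimately have "span B \<subseteq> {a\<in>S. b a x = k a}" by (rule span_minimal[rotated])
    then show ?thesis using B(6) by auto
  qed
  have "inj_on g S"
  proof (rule linear_injective_on_subspace_0[OF g(1) S, THEN iffD2], intro ballI impI)
    fix x assume x: "x \<in> S" "g x = 0"
    then have "b e x = 0" if "e \<in> B" for e
      using inner[OF that, of "\<lambda>e. b e x"] g(2)[OF x(1)] by (simp add: J_def)
    then have "\<forall>a\<in>S. b a x = 0" by (intro on_S[OF x(1)]) auto
    then show "x = 0" using pos x(1) by force
  qed
  then have "dim (g ` S) = dim S"
    using dim_image_eq[OF g(1), of S] by (simp add: span_eq_iff[THEN iffD2, OF S])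
  moreover have "g ` S \<subseteq> S" using g(2) JS by auto
  ultimately have "g ` S = S"
    using subspace_dim_equal[of "g ` S" S] linear_subspace_image[OF g(1) S] S by simp
  moreover have "(\<Sum>e\<in>B. f e *\<^sub>R e) \<in> S"
    using S BS by (intro subspace_sum) (auto simp: subspace_scale)
  ultimately obtain x where x: "x \<in> S" "g x = (\<Sum>e\<in>B. f e *\<^sub>R e)" by (metis imageE)
  have "b e x = f e" if "e \<in> B" for e
    using inner[OF that, of "\<lambda>e. b e x"] inner[OF that, of f] x g(2)[OF x(1)] by (simp add: J_def)
  then have "\<forall>a\<in>S. b a x = f a" by (intro on_S[OF x(1)]) (auto simp: f)
  with x(1) show ?thesis by blast
qed

section \<open>Traces and star homomorphisms\<close>

locale trace_alg = vn_alg A for A :: "(complex^'n^'n) set" +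
  fixes \<tau> :: "complex^'n^'n \<Rightarrow> complex"
  assumes faithful: "faithful_trace A \<tau>"
begin

lemma tr_add: "a \<in> A \<Longrightarrow> b \<in> A \<Longrightarrow> \<tau> (a + b) = \<tau> a + \<tau> b"
  and tr_cscale: "a \<in> A \<Longrightarrow> \<tau> (c *\<^sub>C a) = c * \<tau> a"
  and tr_comm: "a \<in> A \<Longrightarrow> b \<in> A \<Longrightarrow> \<tau> (a ** b) = \<tau> (b ** a)"
  and tr_nonneg_Reals: "a \<in> A \<Longrightarrow> \<tau> (adj a ** a) \<in> \<real>\<^sub>\<ge>\<^sub>0"
  and tr_faithful: "a \<in> A \<Longrightarrow> \<tau> (adj a ** a) = 0 \<Longrightarrow> a = 0"
  using faithful unfolding faithful_trace_def by blast+

lemma tr_scaleR: "a \<in> A \<Longrightarrow> \<tau> (r *\<^sub>R a) = complex_of_real r * \<tau> a"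
  by (simp add: scaleR_cscale tr_cscale)

lemma tr_zero [simp]: "\<tau> 0 = 0"
  using tr_cscale[OF zero_in, of 0] by simp

lemma tr_minus: "a \<in> A \<Longrightarrow> \<tau> (- a) = - \<tau> a"
  using tr_cscale[of a "-1"] by (simp add: cscale_minus)

lemma tr_diff: "a \<in> A \<Longrightarrow> b \<in> A \<Longrightarrow> \<tau> (a - b) = \<tau> a - \<tau> b"
  using tr_add[of a "- b"] by (simp add: tr_minus)

lemma tr_sum: "(\<And>x. x \<in> S \<Longrightarrow> f x \<in> A) \<Longrightarrow> \<tau> (sum f S) = (\<Sum>x\<in>S. \<tau> (f x))"
  by (induction S rule: infinite_finite_induct) (auto simp: tr_add sum_in)

lemma tr_sq_real: "a \<in> A \<Longrightarrow> \<tau> (adj a ** a) = complex_of_real (Re (\<tau> (adj a ** a)))"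
  and tr_sq_nonneg: "a \<in> A \<Longrightarrow> 0 \<le> Re (\<tau> (adj a ** a))"
  using tr_nonneg_Reals[of a] by (auto elim!: nonneg_Reals_cases)

lemma tr_sq_pos: "a \<in> A \<Longrightarrow> a \<noteq> 0 \<Longrightarrow> 0 < Re (\<tau> (adj a ** a))"
  using tr_sq_nonneg[of a] tr_faithful[of a] tr_sq_real[of a]
  by (metis less_eq_real_def of_real_0)

lemma tr_sq_Im: "a \<in> A \<Longrightarrow> Im (\<tau> (adj a ** a)) = 0"
  by (subst tr_sq_real) auto

text \<open>Polarisation: \<open>\<tau> (adj x ** x)\<close> is real for \<open>x = 1 + a\<close> and for \<open>x = 1 + \<i> a\<close>.\<close>

lemma tr_adj: assumes a: "a \<in> A" shows "\<tau> (adj a) = cnj (\<tau> a)"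
proof -
  have *: "Im (\<tau> b + \<tau> (adj b)) = 0" if b: "b \<in> A" for b
  proof -
    have "\<tau> (adj (mat 1 + b) ** (mat 1 + b)) = \<tau> (mat 1) + (\<tau> b + \<tau> (adj b)) + \<tau> (adj b ** b)"
      using b by (simp add: adj_add matrix_add_ldistrib matrix_add_rdistrib tr_add)
    then have "Im (\<tau> (mat 1) + (\<tau> b + \<tau> (adj b)) + \<tau> (adj b ** b)) = 0"
      using tr_sq_Im[of "mat 1 + b"] b by simp
    then show ?thesis using tr_sq_Im[OF b] tr_sq_Im[OF one_in] by simp
  qed
  have "Im (\<tau> (\<i> *\<^sub>C a) + \<tau> (adj (\<i> *\<^sub>C a))) = Re (\<tau> a) - Re (\<tau> (adj a))"
    using a by (simp add: adj_cscale tr_cscale)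
  moreover have "Im (\<tau> (\<i> *\<^sub>C a) + \<tau> (adj (\<i> *\<^sub>C a))) = 0" using a by (intro *) auto
  ultimately show ?thesis using *[OF a] by (simp add: complex_eq_iff)
qed

lemma tr_adj_mult: "a \<in> A \<Longrightarrow> b \<in> A \<Longrightarrow> cnj (\<tau> (adj a ** b)) = \<tau> (adj b ** a)"
  by (subst tr_adj[symmetric]) (simp_all add: adj_mult)

text \<open>By cyclicity this is the trace of \<open>adj (E ** F) ** (E ** F)\<close>. These numbers
  are the weights in Klein's inequality.\<close>

lemma tr_proj_nonneg:
  assumes "E \<in> A" "F \<in> A" "adj E = E" "E ** E = E" "adj F = F" "F ** F = F"
  shows "0 \<le> Re (\<tau> (E ** F))" "Im (\<tau> (E ** F)) = 0"
proof -
  have "\<tau> (E ** F) = \<tau> (E ** F ** F)" by (simp add: assms flip: matrix_mul_assoc)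
  also have "\<dots> = \<tau> (F ** (E ** F))" by (rule tr_comm) (auto simp: assms)
  also have "F ** (E ** F) = adj (E ** F) ** (E ** F)"
    by (simp add: adj_mult assms) (metis assms(4) matrix_mul_assoc)
  finally show "0 \<le> Re (\<tau> (E ** F))" "Im (\<tau> (E ** F)) = 0"
    using tr_sq_nonneg[of "E ** F"] tr_sq_Im[of "E ** F"] assms by auto
qed

lemma tr_bilinear: "bilinear_on A (\<lambda>a b. Re (\<tau> (adj a ** b)))"
  by (auto simp: bilinear_on_def adj_add matrix_add_ldistrib matrix_add_rdistrib tr_add adj_scaleR
      scaleR_cscale adj_cscale tr_cscale)

lemma tr_tendsto:
  assumes "(f \<longlongrightarrow> x) F" "\<forall>\<^sub>F t in F. f t \<in> A" "x \<in> A"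
  shows "((\<lambda>t. \<tau> (f t)) \<longlongrightarrow> \<tau> x) F"
proof -
  obtain g where g: "linear g" "\<And>a. a \<in> A \<Longrightarrow> g a = \<tau> a"
    by (rule linear_on_extend[OF subspace_alg, of \<tau>])
      (simp_all add: tr_add tr_scaleR scaleR_conv_of_real[where 'a=complex])
  have "((\<lambda>t. g (f t)) \<longlongrightarrow> g x) F"
    by (rule bounded_linear.tendsto[OF _ assms(1)]) (use g(1) in \<open>simp add: linear_conv_bounded_linear\<close>)
  then have "((\<lambda>t. g (f t)) \<longlongrightarrow> \<tau> x) F" using g(2)[OF assms(3)] by simp
  moreover have "\<forall>\<^sub>F t in F. g (f t) = \<tau> (f t)"
    using assms(2) by eventually_elim (rule g(2))
  ultimately show ?thesis by (rule Lim_transform_eventually)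
qed

text \<open>The real parts are solved by \<open>riesz_on\<close>, and testing with
  \<open>\<i> *\<^sub>C a\<close> recovers the imaginary parts. The definite descriptions
  \<open>trace_adjoint\<close> and \<open>generator\<close> are justified through it.\<close>

lemma riesz_alg:
  assumes \<beta>: "\<And>a b x. a \<in> A \<Longrightarrow> b \<in> A \<Longrightarrow> x \<in> A \<Longrightarrow> \<beta> (a + b) x = \<beta> a x + \<beta> b x"
      "\<And>a b x. a \<in> A \<Longrightarrow> b \<in> A \<Longrightarrow> x \<in> A \<Longrightarrow> \<beta> x (a + b) = \<beta> x a + \<beta> x b"
      "\<And>c a x. a \<in> A \<Longrightarrow> x \<in> A \<Longrightarrow> \<beta> (c *\<^sub>C a) x = cnj c * \<beta> a x"
      "\<And>c a x. a \<in> A \<Longrightarrow> x \<in> A \<Longrightarrow> \<beta> x (c *\<^sub>C a) = c * \<beta> x a"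
    and pos: "\<And>a. a \<in> A \<Longrightarrow> a \<noteq> 0 \<Longrightarrow> 0 < Re (\<beta> a a)"
    and F: "\<And>a b. a \<in> A \<Longrightarrow> b \<in> A \<Longrightarrow> F (a + b) = F a + F b"
      "\<And>c a. a \<in> A \<Longrightarrow> F (c *\<^sub>C a) = cnj c * (F a :: complex)"
  shows "\<exists>!x. x \<in> A \<and> (\<forall>a\<in>A. \<beta> a x = F a)"
proof -
  have "bilinear_on A (\<lambda>a x. Re (\<beta> a x))"
    by (auto simp: bilinear_on_def \<beta> scaleR_cscale)
  then have "\<exists>x\<in>A. \<forall>a\<in>A. Re (\<beta> a x) = Re (F a)"
    by (rule riesz_on[OF subspace_alg]) (auto simp: pos F scaleR_cscale)
  then obtain x where x: "x \<in> A" "\<And>a. a \<in> A \<Longrightarrow> Re (\<beta> a x) = Re (F a)" by blast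
  have ex: "\<beta> a x = F a" if "a \<in> A" for a
    using x(2)[OF that] x(2)[of "\<i> *\<^sub>C a"] x(1) that by (simp add: \<beta> F complex_eq_iff)
  have uniq: "y = x" if y: "y \<in> A" "\<forall>a\<in>A. \<beta> a y = F a" for y
  proof (rule ccontr)
    assume "y \<noteq> x"
    have "y = (y - x) + x" by simp
    then have "\<beta> (y - x) y = \<beta> (y - x) (y - x) + \<beta> (y - x) x"
      using \<beta>(2)[of "y - x" x "y - x"] y(1) x(1) by simp
    then have "\<beta> (y - x) (y - x) = 0" using y ex[of "y - x"] x(1) by simp
    then show False using pos[of "y - x"] y x(1) \<open>y \<noteq> x\<close> by simp
  qed
  show ?thesis
  proof (rule ex1I[of _ x])
    show "x \<in> A \<and> (\<forall>a\<in>A. \<beta> a x = F a)" using x(1) ex by blast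
    show "y = x" if "y \<in> A \<and> (\<forall>a\<in>A. \<beta> a y = F a)" for y using uniq[of y] that by blast
  qed
qed

lemma trace_adjoint_exists:
  assumes "\<And>a b. a \<in> A \<Longrightarrow> b \<in> A \<Longrightarrow> \<tau>' (adj (T (a + b)) ** y) = \<tau>' (adj (T a) ** y) + \<tau>' (adj (T b) ** y)"
    and "\<And>c a. a \<in> A \<Longrightarrow> \<tau>' (adj (T (c *\<^sub>C a)) ** y) = cnj c * \<tau>' (adj (T a) ** y)"
  shows "trace_adjoint A \<tau> \<tau>' T y \<in> A"
    and "\<And>a. a \<in> A \<Longrightarrow> \<tau> (adj a ** trace_adjoint A \<tau> \<tau>' T y) = \<tau>' (adj (T a) ** y)"
proof -
  have "\<exists>!x. x \<in> A \<and> (\<forall>a\<in>A. \<tau> (adj a ** x) = \<tau>' (adj (T a) ** y))"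
    by (rule riesz_alg) (use assms in \<open>auto simp: adj_add matrix_add_ldistrib matrix_add_rdistrib
        tr_add adj_cscale tr_cscale tr_sq_pos\<close>)
  from theI'[OF this] show "trace_adjoint A \<tau> \<tau>' T y \<in> A"
    "\<And>a. a \<in> A \<Longrightarrow> \<tau> (adj a ** trace_adjoint A \<tau> \<tau>' T y) = \<tau>' (adj (T a) ** y)"
    unfolding trace_adjoint_def by auto
qed

lemma tr_eqI:
  assumes "x \<in> A" "y \<in> A" "\<And>a. a \<in> A \<Longrightarrow> \<tau> (adj a ** x) = \<tau> (adj a ** y)"
  shows "x = y"
proof -
  have "\<tau> (adj (x - y) ** (x - y)) = 0"
    using assms(3)[of "x - y"] assms(1,2) by (simp add: mm.diff_right tr_diff)
  then show ?thesis using tr_faithful[of "x - y"] assms by simp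
qed

end

locale star_hom = A: vn_alg A + B: vn_alg B
  for A :: "(complex^'n^'n) set" and B :: "(complex^'m^'m) set" +
  fixes h :: "complex^'n^'n \<Rightarrow> complex^'m^'m"
  assumes hom: "unital_star_hom A B h"
begin

lemma h_in [simp, intro]: "a \<in> A \<Longrightarrow> h a \<in> B"
  and h_one [simp]: "h (mat 1) = mat 1"
  and h_add: "a \<in> A \<Longrightarrow> b \<in> A \<Longrightarrow> h (a + b) = h a + h b"
  and h_mult: "a \<in> A \<Longrightarrow> b \<in> A \<Longrightarrow> h (a ** b) = h a ** h b"
  and h_cscale: "a \<in> A \<Longrightarrow> h (c *\<^sub>C a) = c *\<^sub>C h a"
  and h_adj: "a \<in> A \<Longrightarrow> h (adj a) = adj (h a)"
  using hom unfolding unital_star_hom_def by blast+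

lemma h_zero [simp]: "h 0 = 0"
  using h_cscale[OF A.zero_in, of 0] by simp

lemma h_scaleR: "a \<in> A \<Longrightarrow> h (r *\<^sub>R a) = r *\<^sub>R h a"
  by (simp add: scaleR_cscale h_cscale)

lemma h_diff: "a \<in> A \<Longrightarrow> b \<in> A \<Longrightarrow> h (a - b) = h a - h b"
  using h_add[of a "(-1) *\<^sub>C b"] h_cscale[of b "-1"] by (simp add: cscale_minus)

lemma h_sum: "(\<And>x. x \<in> S \<Longrightarrow> f x \<in> A) \<Longrightarrow> h (sum f S) = (\<Sum>x\<in>S. h (f x))"
  by (induction S rule: infinite_finite_induct) (auto simp: h_add A.sum_in)

lemma h_tendsto:
  assumes "(f \<longlongrightarrow> x) F" "\<forall>\<^sub>F t in F. f t \<in> A" "x \<in> A"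
  shows "((\<lambda>t. h (f t)) \<longlongrightarrow> h x) F"
proof -
  obtain g where g: "linear g" "\<And>a. a \<in> A \<Longrightarrow> g a = h a"
    by (rule linear_on_extend[OF A.subspace_alg, of h]) (auto simp: h_add h_scaleR)
  have "((\<lambda>t. g (f t)) \<longlongrightarrow> g x) F"
    by (rule bounded_linear.tendsto[OF _ assms(1)]) (use g(1) in \<open>simp add: linear_conv_bounded_linear\<close>)
  then have "((\<lambda>t. g (f t)) \<longlongrightarrow> h x) F" using g(2)[OF assms(3)] by simp
  moreover have "\<forall>\<^sub>F t in F. g (f t) = h (f t)"
    using assms(2) by eventually_elim (rule g(2))
  ultimately show ?thesis by (rule Lim_transform_eventually)
qed

end

section \<open>The logarithmic mean\<close>

lemma log_mean_commute: "log_mean r s = log_mean s r"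
  by (auto simp: log_mean_def) (metis minus_diff_eq minus_divide_divide)

lemma log_mean_mult_ln: "0 < r \<Longrightarrow> 0 < s \<Longrightarrow> log_mean r s * (ln r - ln s) = r - s"
  by (auto simp: log_mean_def)

text \<open>Both bounds are \<open>ln z \<le> z - 1\<close>, at \<open>r / s\<close> and at
  \<open>s / r\<close>.\<close>

lemma log_mean_bounds_aux:
  assumes "0 < s" "s \<le> r" shows "s \<le> log_mean r s" "log_mean r s \<le> r"
proof -
  have "s \<le> log_mean r s \<and> log_mean r s \<le> r"
  proof (cases "r = s")
    case False
    then have sr: "s < r" using assms by simp
    then have pos: "0 < ln r - ln s" using assms by simp
    have "ln (r / s) \<le> r / s - 1" "ln (s / r) \<le> s / r - 1"
      using assms by (auto intro!: ln_le_minus_one)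
    then have "s * (ln r - ln s) \<le> r - s" "r - s \<le> r * (ln r - ln s)"
      using assms by (simp_all add: ln_div field_simps)
    then show ?thesis using False assms pos by (simp add: log_mean_def field_simps)
  qed (simp add: log_mean_def)
  then show "s \<le> log_mean r s" "log_mean r s \<le> r" by auto
qed

text \<open>If an argument vanishes, the extended mean is 0, and so is \<open>l\<close>.\<close>

lemma log_mean_ge: assumes "l \<le> r" "l \<le> s" "0 \<le> l" shows "l \<le> log_mean r s"
proof (cases "r > 0 \<and> s > 0")
  case True
  then show ?thesis
    using log_mean_bounds_aux(1)[of s r] log_mean_bounds_aux(1)[of r s] assms log_mean_commute[of r s]
    by (cases "s \<le> r") auto
next
  case False
  then show ?thesis using assms by (auto simp: log_mean_def)
qed

lemma log_mean_le: assumes "r \<le> u" "s \<le> u" "0 \<le> r" "0 \<le> s" shows "log_mean r s \<le> u"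
proof (cases "r > 0 \<and> s > 0")
  case True
  then show ?thesis
    using log_mean_bounds_aux(2)[of s r] log_mean_bounds_aux(2)[of r s] assms log_mean_commute[of r s]
    by (cases "s \<le> r") auto
next
  case False
  then show ?thesis using assms by (auto simp: log_mean_def)
qed

lemma theta_ge:
  assumes "l \<le> r" "l \<le> s" "0 \<le> l" shows "exp (- \<bar>freq D j\<bar> / 2) * l \<le> theta D j r s"
  unfolding theta_def using assms by (intro log_mean_ge mult_mono) auto

lemma theta_le:
  assumes "r \<le> u" "s \<le> u" "0 \<le> r" "0 \<le> s" shows "theta D j r s \<le> exp (\<bar>freq D j\<bar> / 2) * u"
  unfolding theta_def using assms by (intro log_mean_le mult_mono) auto

section \<open>Differential structures\<close>

locale diffstr =
  fixes D :: "('n::finite, 'm::finite, 'j) diff_struct"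
  assumes ds: "differential_structure D"
begin

abbreviation "A \<equiv> alg D"
abbreviation "\<tau> \<equiv> tr D"
abbreviation "\<sigma> \<equiv> ref D"

sublocale trace_alg A \<tau>
  by unfold_locales (use ds in \<open>auto simp: differential_structure_def\<close>)

lemma finite_idx [simp, intro]: "finite (idx D)"
  using ds by (simp add: differential_structure_def)

lemma sigma_dens: "\<sigma> \<in> dens D" and sigma_invertible: "invertible \<sigma>"
  using ds by (simp_all add: differential_structure_def)

lemma dens_herm: "\<rho> \<in> dens D \<Longrightarrow> adj \<rho> = \<rho>"
  and dens_in: "\<rho> \<in> dens D \<Longrightarrow> \<rho> \<in> A"
  and dens_tr: "\<rho> \<in> dens D \<Longrightarrow> \<tau> \<rho> = 1"
  by (auto simp: dens_def pos_semidef_def)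

lemma dens_pos_herm: "\<rho> \<in> dens_pos D \<Longrightarrow> adj \<rho> = \<rho>"
  and dens_pos_in: "\<rho> \<in> dens_pos D \<Longrightarrow> \<rho> \<in> A"
  and dens_pos_tr: "\<rho> \<in> dens_pos D \<Longrightarrow> \<tau> \<rho> = 1"
  by (auto simp: dens_pos_def pos_def_def)

lemma dens_eigvals: "\<rho> \<in> dens D \<Longrightarrow> x \<in> eigvals \<rho> \<Longrightarrow> 0 \<le> x"
  using pos_semidef_iff[of \<rho>] dens_herm[of \<rho>] by (auto simp: dens_def)

lemma dens_pos_eigvals: "\<rho> \<in> dens_pos D \<Longrightarrow> x \<in> eigvals \<rho> \<Longrightarrow> 0 < x"
  using pos_def_iff[of \<rho>] dens_pos_herm[of \<rho>] by (auto simp: dens_pos_def)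

lemma dens_pos_dens: "\<rho> \<in> dens_pos D \<Longrightarrow> \<rho> \<in> dens D"
  using dens_pos_eigvals[of \<rho>] pos_semidef_iff[of \<rho>] dens_pos_herm[of \<rho>]
  by (auto simp: dens_pos_def dens_def less_imp_le)

lemma sigma_dens_pos: "\<sigma> \<in> dens_pos D"
proof -
  note h = dens_herm[OF sigma_dens]
  have "x \<noteq> 0" if x: "x \<in> eigvals \<sigma>" for x
  proof
    assume "x = 0"
    with x obtain v where v: "v \<noteq> 0" "\<sigma> *v v = 0" by (auto simp: eigvals_def)
    obtain B where "B ** \<sigma> = mat 1" using sigma_invertible by (auto simp: invertible_def)
    then have "v = B *v (\<sigma> *v v)" by (simp add: matrix_vector_mul_assoc)
    then show False using v by simp
  qed
  then have "pos_def \<sigma>"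
    using dens_eigvals[OF sigma_dens] pos_def_iff[OF h] by (metis order_less_le)
  then show ?thesis using sigma_dens by (simp add: dens_pos_def dens_def)
qed

lemmas sigma_in = dens_in[OF sigma_dens]
  and sigma_herm = dens_herm[OF sigma_dens]
  and sigma_eigvals = dens_pos_eigvals[OF sigma_dens_pos]

lemma tr_one_nz: "\<tau> (mat 1) \<noteq> 0"
proof
  assume *: "\<tau> (mat 1) = 0"
  then have "mat 1 = (0 :: complex^'n^'n)" using tr_faithful[OF one_in] by simp
  then have "\<sigma> = 0" by (metis matrix_mul_lid mm.zero_left)
  then show False using dens_tr[OF sigma_dens] by simp
qed

end

section \<open>A single index of a differential structure\<close>

locale diff_index = diffstr D for D :: "('n::finite, 'm::finite, 'j) diff_struct" +
  fixes j
  assumes j: "j \<in> idx D"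
begin

abbreviation "\<B> \<equiv> balg D j"
abbreviation "\<tau>\<^sub>B \<equiv> btr D j"
abbreviation "\<l> \<equiv> lhom D j"
abbreviation "\<r> \<equiv> rhom D j"
abbreviation "V \<equiv> dvec D j"
abbreviation "\<omega> \<equiv> freq D j"
abbreviation "pd \<equiv> pderiv_j D j"

sublocale B: trace_alg \<B> \<tau>\<^sub>B
  by unfold_locales (use ds j in \<open>auto simp: differential_structure_def\<close>)
sublocale L: star_hom A \<B> \<l>
  by unfold_locales (use ds j in \<open>auto simp: differential_structure_def\<close>)
sublocale R: star_hom A \<B> \<r>
  by unfold_locales (use ds j in \<open>auto simp: differential_structure_def\<close>)

lemma V_in [simp, intro]: "V \<in> \<B>" and V_nz: "V \<noteq> 0"
  using ds j by (auto simp: differential_structure_def)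

lemma pd_in [simp, intro]: "a \<in> A \<Longrightarrow> pd a \<in> \<B>"
  by (simp add: pderiv_j_def)

lemma pd_add: "a \<in> A \<Longrightarrow> b \<in> A \<Longrightarrow> pd (a + b) = pd a + pd b"
  by (simp add: pderiv_j_def L.h_add R.h_add matrix_add_ldistrib matrix_add_rdistrib)

lemma pd_cscale: "a \<in> A \<Longrightarrow> pd (c *\<^sub>C a) = c *\<^sub>C pd a"
  by (simp add: pderiv_j_def L.h_cscale R.h_cscale cscale_diff_right)

lemma pd_one [simp]: "pd (mat 1) = 0"
  by (simp add: pderiv_j_def)

lemma invertible_hom:
  assumes "M \<in> A" "adj M = M" "\<And>x. x \<in> eigvals M \<Longrightarrow> x \<noteq> 0"
  shows "\<r> M ** \<r> (herm_fun inverse M) = mat 1" "\<r> (herm_fun inverse M) ** \<r> M = mat 1"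
    "matrix_inv (\<r> M) = \<r> (herm_fun inverse M)" "invertible (\<r> M)"
proof -
  have "M ** herm_fun inverse M = herm_fun (\<lambda>_. 1) M"
    using herm_fun_mult[OF assms(2), of "\<lambda>x. x" inverse] assms(3)
    by (simp add: herm_fun_id[OF assms(2)]) (simp add: herm_fun_def cong: sum.cong)
  then have "M ** herm_fun inverse M = mat 1" by (simp add: herm_fun_const[OF assms(2)])
  moreover have "herm_fun inverse M ** M = mat 1"
    using arg_cong[OF calculation, of adj] by (simp add: adj_mult herm_fun_adj assms)
  ultimately show *: "\<r> M ** \<r> (herm_fun inverse M) = mat 1" "\<r> (herm_fun inverse M) ** \<r> M = mat 1"
    using R.h_mult[of M "herm_fun inverse M"] R.h_mult[of "herm_fun inverse M" M] herm_fun_in assms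
    by auto
  then show "invertible (\<r> M)" by (auto simp: invertible_def)
  then have "matrix_inv (\<r> M) ** \<r> M = mat 1"
    unfolding matrix_inv_def invertible_def by (rule someI2_ex) simp
  then show "matrix_inv (\<r> M) = \<r> (herm_fun inverse M)"
    by (metis *(1) matrix_mul_assoc matrix_mul_lid matrix_mul_rid)
qed

lemma sigma_V: "\<l> \<sigma> ** V = complex_of_real (exp (- \<omega>)) *\<^sub>C (V ** \<r> \<sigma>)"
proof -
  note inv = invertible_hom[OF sigma_in sigma_herm less_imp_neq[OF sigma_eigvals, symmetric]]
  have "\<l> \<sigma> ** V ** matrix_inv (\<r> \<sigma>) = complex_of_real (exp (- \<omega>)) *\<^sub>C V"
    using ds j by (auto simp: differential_structure_def)
  then have "\<l> \<sigma> ** V ** matrix_inv (\<r> \<sigma>) ** \<r> \<sigma> = complex_of_real (exp (- \<omega>)) *\<^sub>C V ** \<r> \<sigma>"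
    by simp
  then show ?thesis using inv by (simp flip: matrix_mul_assoc)
qed

text \<open>A Schur multiplier with symbol \<open>g\<close>: the block between the eigenvalues x and
  y is multiplied by \<open>g x y\<close>. Composition multiplies symbols; left multiplication by
  \<open>\<l> (herm_fun f \<rho>)\<close>, right multiplication by
  \<open>\<r> (herm_fun f \<rho>)\<close> and the contraction have the symbols f x, f y and
  \<theta>. Identities between non-commuting factors thus reduce to scalar ones.\<close>

definition dsum :: "(real \<Rightarrow> real \<Rightarrow> real) \<Rightarrow> complex^'n^'n \<Rightarrow> complex^'m^'m \<Rightarrow> complex^'m^'m" where
  "dsum g \<rho> b = (\<Sum>x\<in>eigvals \<rho>. \<Sum>y\<in>eigvals \<rho>.
     complex_of_real (g x y) *\<^sub>C (\<l> (eigproj \<rho> x) ** b ** \<r> (eigproj \<rho> y)))"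

lemma rho_contract_dsum: "rho_contract D j \<rho> b = dsum (theta D j) \<rho> b"
  by (simp add: rho_contract_def dsum_def)

lemma dsum_add: "dsum g \<rho> (b + c) = dsum g \<rho> b + dsum g \<rho> c"
  by (simp add: dsum_def matrix_add_ldistrib matrix_add_rdistrib cscale_add_right sum.distrib)

lemma dsum_cscale: "dsum g \<rho> (c *\<^sub>C b) = c *\<^sub>C dsum g \<rho> b"
  by (simp add: dsum_def cscale_sum mult.commute)

lemma dsum_zero [simp]: "dsum g \<rho> 0 = 0"
  by (simp add: dsum_def)

lemma dsum_cong:
  assumes "\<And>x y. x \<in> eigvals \<rho> \<Longrightarrow> y \<in> eigvals \<rho> \<Longrightarrow> f x y = g x y"
  shows "dsum f \<rho> b = dsum g \<rho> b"
  using assms by (simp add: dsum_def cong: sum.cong)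

lemma dsum_add_fun: "dsum (\<lambda>x y. f x y + g x y) \<rho> b = dsum f \<rho> b + dsum g \<rho> b"
  by (simp add: dsum_def cscale_add_left sum.distrib)

lemma dsum_scale_fun: "dsum (\<lambda>x y. c * f x y) \<rho> b = complex_of_real c *\<^sub>C dsum f \<rho> b"
  by (simp add: dsum_def cscale_sum)

context
  fixes \<rho> :: "complex^'n^'n"
  assumes \<rho>: "\<rho> \<in> A" "adj \<rho> = \<rho>"
begin

lemma eig_in: "x \<in> eigvals \<rho> \<Longrightarrow> eigproj \<rho> x \<in> A"
  using eigproj_in[OF \<rho>] .

lemma l_proj: "x \<in> eigvals \<rho> \<Longrightarrow> y \<in> eigvals \<rho> \<Longrightarrow>
    \<l> (eigproj \<rho> x) ** \<l> (eigproj \<rho> y) = (if x = y then \<l> (eigproj \<rho> x) else 0)"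
  using L.h_mult[OF eig_in eig_in, of x y] by (auto simp: eigproj_orth[OF \<rho>(2)])

lemma r_proj: "x \<in> eigvals \<rho> \<Longrightarrow> y \<in> eigvals \<rho> \<Longrightarrow>
    \<r> (eigproj \<rho> x) ** \<r> (eigproj \<rho> y) = (if x = y then \<r> (eigproj \<rho> x) else 0)"
  using R.h_mult[OF eig_in eig_in, of x y] by (auto simp: eigproj_orth[OF \<rho>(2)])

lemma dsum_in: "b \<in> \<B> \<Longrightarrow> dsum g \<rho> b \<in> \<B>"
  unfolding dsum_def using eig_in by (intro B.sum_in B.cscale_in B.mult_in) auto

lemma sandwich_dsum:
  assumes "x \<in> eigvals \<rho>" "y \<in> eigvals \<rho>"
  shows "\<l> (eigproj \<rho> x) ** dsum g \<rho> b ** \<r> (eigproj \<rho> y)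
    = complex_of_real (g x y) *\<^sub>C (\<l> (eigproj \<rho> x) ** b ** \<r> (eigproj \<rho> y))"
proof -
  have "\<l> (eigproj \<rho> x) ** dsum g \<rho> b ** \<r> (eigproj \<rho> y) = (\<Sum>x'\<in>eigvals \<rho>. \<Sum>y'\<in>eigvals \<rho>.
     complex_of_real (g x' y') *\<^sub>C (\<l> (eigproj \<rho> x) ** \<l> (eigproj \<rho> x') ** b **
       (\<r> (eigproj \<rho> y') ** \<r> (eigproj \<rho> y))))"
    by (simp add: dsum_def mm.sum_left mm.sum_right matrix_mul_assoc)
  also have "\<dots> = (\<Sum>x'\<in>eigvals \<rho>. \<Sum>y'\<in>eigvals \<rho>. if x' = x then (if y' = y then
     complex_of_real (g x y) *\<^sub>C (\<l> (eigproj \<rho> x) ** b ** \<r> (eigproj \<rho> y)) else 0) else 0)"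
    using assms by (intro sum.cong refl) (auto simp: l_proj r_proj)
  also have "\<dots> = (\<Sum>x'\<in>eigvals \<rho>. if x' = x then
     complex_of_real (g x y) *\<^sub>C (\<l> (eigproj \<rho> x) ** b ** \<r> (eigproj \<rho> y)) else 0)"
    using assms finite_eigvals[OF \<rho>(2)] by (intro sum.cong refl) auto
  finally show ?thesis using assms finite_eigvals[OF \<rho>(2)] by simp
qed

lemma dsum_dsum: "dsum f \<rho> (dsum g \<rho> b) = dsum (\<lambda>x y. f x y * g x y) \<rho> b"
proof -
  have "dsum f \<rho> c = (\<Sum>x\<in>eigvals \<rho>. \<Sum>y\<in>eigvals \<rho>.
     complex_of_real (f x y) *\<^sub>C (\<l> (eigproj \<rho> x) ** c ** \<r> (eigproj \<rho> y)))" for c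
    by (rule dsum_def)
  from this[of "dsum g \<rho> b"] show ?thesis
    by (simp add: sandwich_dsum dsum_def[of "\<lambda>x y. f x y * g x y"] cong: sum.cong)
qed

lemma sum_l_proj: "(\<Sum>x\<in>eigvals \<rho>. \<l> (eigproj \<rho> x)) = mat 1"
  using L.h_sum[of "eigvals \<rho>" "eigproj \<rho>"] eig_in by (simp add: eigproj_sum[OF \<rho>(2)])

lemma sum_r_proj: "(\<Sum>x\<in>eigvals \<rho>. \<r> (eigproj \<rho> x)) = mat 1"
  using R.h_sum[of "eigvals \<rho>" "eigproj \<rho>"] eig_in by (simp add: eigproj_sum[OF \<rho>(2)])

lemma dsum_left: "dsum (\<lambda>x y. f x) \<rho> b = \<l> (herm_fun f \<rho>) ** b"
proof -
  have "dsum (\<lambda>x y. f x) \<rho> b = (\<Sum>x\<in>eigvals \<rho>. complex_of_real (f x) *\<^sub>C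
      (\<l> (eigproj \<rho> x) ** b ** (\<Sum>y\<in>eigvals \<rho>. \<r> (eigproj \<rho> y))))"
    by (simp add: dsum_def mm.sum_right cscale_sum)
  also have "\<dots> = (\<Sum>x\<in>eigvals \<rho>. \<l> (complex_of_real (f x) *\<^sub>C eigproj \<rho> x) ** b)"
    by (intro sum.cong refl) (simp add: sum_r_proj L.h_cscale eig_in)
  also have "\<dots> = \<l> (herm_fun f \<rho>) ** b"
    unfolding herm_fun_def using eig_in by (subst L.h_sum) (auto simp: mm.sum_left)
  finally show ?thesis .
qed

lemma dsum_right: "dsum (\<lambda>x y. f y) \<rho> b = b ** \<r> (herm_fun f \<rho>)"
proof -
  have "dsum (\<lambda>x y. f y) \<rho> b = (\<Sum>y\<in>eigvals \<rho>. \<Sum>x\<in>eigvals \<rho>. complex_of_real (f y) *\<^sub>C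
      (\<l> (eigproj \<rho> x) ** b ** \<r> (eigproj \<rho> y)))"
    unfolding dsum_def by (rule sum.swap)
  also have "\<dots> = (\<Sum>y\<in>eigvals \<rho>. complex_of_real (f y) *\<^sub>C
      ((\<Sum>x\<in>eigvals \<rho>. \<l> (eigproj \<rho> x)) ** b ** \<r> (eigproj \<rho> y)))"
    by (simp add: mm.sum_left cscale_sum)
  also have "\<dots> = (\<Sum>y\<in>eigvals \<rho>. b ** \<r> (complex_of_real (f y) *\<^sub>C eigproj \<rho> y))"
    by (intro sum.cong refl) (simp add: sum_l_proj R.h_cscale eig_in)
  also have "\<dots> = b ** \<r> (herm_fun f \<rho>)"
    unfolding herm_fun_def using eig_in by (subst R.h_sum) (auto simp: mm.sum_right)
  finally show ?thesis .
qed

lemma dsum_const: "dsum (\<lambda>x y. c) \<rho> b = complex_of_real c *\<^sub>C b"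
  using dsum_left[of "\<lambda>_. c" b] by (simp add: herm_fun_const[OF \<rho>(2)] L.h_cscale)

text \<open>Compression by a left and a right spectral projection is an orthogonal projection of
  \<open>\<B>\<close>; hence the form of a multiplier is diagonal in the blocks.\<close>

lemma tr_sandwich:
  assumes "x \<in> eigvals \<rho>" "y \<in> eigvals \<rho>" "b \<in> \<B>" "c \<in> \<B>"
  defines "P \<equiv> \<lambda>b. \<l> (eigproj \<rho> x) ** b ** \<r> (eigproj \<rho> y)"
  shows "\<tau>\<^sub>B (adj c ** P b) = \<tau>\<^sub>B (adj (P c) ** P b)"
proof -
  let ?E = "\<l> (eigproj \<rho> x)" and ?F = "\<r> (eigproj \<rho> y)"
  have in_B: "?E \<in> \<B>" "?F \<in> \<B>" using eig_in assms by auto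
  have herm: "adj ?E = ?E" "adj ?F = ?F"
    using L.h_adj[OF eig_in] R.h_adj[OF eig_in] assms by (simp_all add: eigproj_adj[OF \<rho>(2)])
  have idem: "?E ** ?E = ?E" "?F ** ?F = ?F" using l_proj r_proj assms by simp_all
  have "\<tau>\<^sub>B (adj (P c) ** P b) = \<tau>\<^sub>B (?F ** (adj c ** (?E ** (?E ** (b ** ?F)))))"
    by (simp add: P_def adj_mult herm flip: matrix_mul_assoc)
  also have "\<dots> = \<tau>\<^sub>B (?F ** (adj c ** (?E ** (b ** ?F))))"
    by (metis idem(1) matrix_mul_assoc)
  also have "\<dots> = \<tau>\<^sub>B ((adj c ** (?E ** (b ** ?F))) ** ?F)"
    using in_B assms by (intro B.tr_comm) auto
  also have "\<dots> = \<tau>\<^sub>B (adj c ** P b)"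
    by (simp add: P_def idem flip: matrix_mul_assoc)
  finally show ?thesis by simp
qed

lemma tr_dsum:
  assumes "b \<in> \<B>" "c \<in> \<B>"
  shows "\<tau>\<^sub>B (adj c ** dsum g \<rho> b) = (\<Sum>x\<in>eigvals \<rho>. \<Sum>y\<in>eigvals \<rho>. complex_of_real (g x y) *
    \<tau>\<^sub>B (adj (\<l> (eigproj \<rho> x) ** c ** \<r> (eigproj \<rho> y)) ** (\<l> (eigproj \<rho> x) ** b ** \<r> (eigproj \<rho> y))))"
proof -
  have in_B: "adj c ** (\<l> (eigproj \<rho> x) ** b ** \<r> (eigproj \<rho> y)) \<in> \<B>"
    if "x \<in> eigvals \<rho>" "y \<in> eigvals \<rho>" for x y
    using eig_in assms that by (intro B.mult_in) auto
  have "\<tau>\<^sub>B (adj c ** dsum g \<rho> b) = (\<Sum>x\<in>eigvals \<rho>. \<tau>\<^sub>B (\<Sum>y\<in>eigvals \<rho>. complex_of_real (g x y) *\<^sub>C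
      (adj c ** (\<l> (eigproj \<rho> x) ** b ** \<r> (eigproj \<rho> y)))))"
    unfolding dsum_def mm.sum_right mult_cscale_right
    using in_B assms by (intro B.tr_sum B.sum_in B.cscale_in) auto
  also have "\<dots> = (\<Sum>x\<in>eigvals \<rho>. \<Sum>y\<in>eigvals \<rho>. complex_of_real (g x y) *
      \<tau>\<^sub>B (adj c ** (\<l> (eigproj \<rho> x) ** b ** \<r> (eigproj \<rho> y))))"
  proof (intro sum.cong refl)
    fix x assume x: "x \<in> eigvals \<rho>"
    have "\<tau>\<^sub>B (\<Sum>y\<in>eigvals \<rho>. complex_of_real (g x y) *\<^sub>C
        (adj c ** (\<l> (eigproj \<rho> x) ** b ** \<r> (eigproj \<rho> y))))
      = (\<Sum>y\<in>eigvals \<rho>. \<tau>\<^sub>B (complex_of_real (g x y) *\<^sub>C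
        (adj c ** (\<l> (eigproj \<rho> x) ** b ** \<r> (eigproj \<rho> y)))))"
      using in_B[OF x] assms by (intro B.tr_sum B.cscale_in) auto
    also have "\<dots> = (\<Sum>y\<in>eigvals \<rho>. complex_of_real (g x y) *
      \<tau>\<^sub>B (adj c ** (\<l> (eigproj \<rho> x) ** b ** \<r> (eigproj \<rho> y))))"
      using in_B[OF x] assms by (intro sum.cong refl B.tr_cscale) auto
    finally show "\<tau>\<^sub>B (\<Sum>y\<in>eigvals \<rho>. complex_of_real (g x y) *\<^sub>C
        (adj c ** (\<l> (eigproj \<rho> x) ** b ** \<r> (eigproj \<rho> y)))) = \<dots>" .
  qed
  also have "\<dots> = (\<Sum>x\<in>eigvals \<rho>. \<Sum>y\<in>eigvals \<rho>. complex_of_real (g x y) *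
    \<tau>\<^sub>B (adj (\<l> (eigproj \<rho> x) ** c ** \<r> (eigproj \<rho> y)) ** (\<l> (eigproj \<rho> x) ** b ** \<r> (eigproj \<rho> y))))"
    using assms by (intro sum.cong refl arg_cong2[of _ _ _ _ "(*)"] tr_sandwich) auto
  finally show ?thesis .
qed

lemma sandwich_in: "x \<in> eigvals \<rho> \<Longrightarrow> y \<in> eigvals \<rho> \<Longrightarrow> b \<in> \<B> \<Longrightarrow>
    \<l> (eigproj \<rho> x) ** b ** \<r> (eigproj \<rho> y) \<in> \<B>"
  using eig_in by (intro B.mult_in) auto

lemma tr_dsum_cnj:
  assumes "b \<in> \<B>" "c \<in> \<B>"
  shows "cnj (\<tau>\<^sub>B (adj c ** dsum g \<rho> b)) = \<tau>\<^sub>B (adj b ** dsum g \<rho> c)"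
  unfolding tr_dsum[OF assms] tr_dsum[OF assms(2,1)]
  by (simp add: B.tr_adj_mult sandwich_in assms cong: sum.cong)

lemma Re_tr_dsum:
  assumes "b \<in> \<B>"
  shows "Re (\<tau>\<^sub>B (adj b ** dsum g \<rho> b)) = (\<Sum>x\<in>eigvals \<rho>. \<Sum>y\<in>eigvals \<rho>. g x y *
    Re (\<tau>\<^sub>B (adj (\<l> (eigproj \<rho> x) ** b ** \<r> (eigproj \<rho> y)) ** (\<l> (eigproj \<rho> x) ** b ** \<r> (eigproj \<rho> y)))))"
  by (simp add: tr_dsum[OF assms assms])

lemma Re_tr_dsum_mono:
  assumes "b \<in> \<B>" "\<And>x y. x \<in> eigvals \<rho> \<Longrightarrow> y \<in> eigvals \<rho> \<Longrightarrow> f x y \<le> g x y"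
  shows "Re (\<tau>\<^sub>B (adj b ** dsum f \<rho> b)) \<le> Re (\<tau>\<^sub>B (adj b ** dsum g \<rho> b))"
  unfolding Re_tr_dsum[OF assms(1)]
  using assms by (intro sum_mono mult_right_mono B.tr_sq_nonneg sandwich_in) auto

lemma Re_tr_dsum_const:
  assumes "b \<in> \<B>"
  shows "Re (\<tau>\<^sub>B (adj b ** dsum (\<lambda>_ _. c) \<rho> b)) = c * Re (\<tau>\<^sub>B (adj b ** b))"
  using assms by (simp add: dsum_const B.tr_cscale)

end

text \<open>Only products with \<open>x = e\<^sup>-\<^sup>\<omega> y\<close> survive between spectral projections of \<open>\<sigma>\<close>.\<close>

lemma sigma_fun_V:
  assumes "\<And>y. y \<in> eigvals \<sigma> \<Longrightarrow> f (exp (- \<omega>) * y) = g y"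
  shows "\<l> (herm_fun f \<sigma>) ** V = V ** \<r> (herm_fun g \<sigma>)"
proof -
  note s = sigma_in sigma_herm
  \<comment> \<open>\<sigma> can be absorbed by the left projection, giving the factor x, or moved
    across \<open>V\<close> into the right one, giving exp(-\<omega>) y.\<close>
  have zero: "\<l> (eigproj \<sigma> x) ** V ** \<r> (eigproj \<sigma> y) = 0"
    if xy: "x \<in> eigvals \<sigma>" "y \<in> eigvals \<sigma>" and ne: "x \<noteq> exp (- \<omega>) * y" for x y
  proof -
    let ?P = "\<l> (eigproj \<sigma> x) ** V ** \<r> (eigproj \<sigma> y)"
    have "complex_of_real x *\<^sub>C ?P = \<l> (eigproj \<sigma> x ** \<sigma>) ** V ** \<r> (eigproj \<sigma> y)"
      by (simp add: eigproj_eigen'[OF s(2) xy(1)] L.h_cscale eig_in[OF s] xy)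
    also have "\<dots> = \<l> (eigproj \<sigma> x) ** (\<l> \<sigma> ** V) ** \<r> (eigproj \<sigma> y)"
      by (simp add: L.h_mult eig_in[OF s] xy s matrix_mul_assoc)
    also have "\<dots> = complex_of_real (exp (- \<omega>)) *\<^sub>C (\<l> (eigproj \<sigma> x) ** V ** \<r> (\<sigma> ** eigproj \<sigma> y))"
      by (simp add: sigma_V R.h_mult eig_in[OF s] xy s matrix_mul_assoc)
    also have "\<dots> = complex_of_real (exp (- \<omega>) * y) *\<^sub>C ?P"
      by (simp add: eigproj_eigen[OF s(2) xy(2)] R.h_cscale eig_in[OF s] xy)
    finally have "complex_of_real (x - exp (- \<omega>) * y) *\<^sub>C ?P = 0"
      by (simp add: cscale_diff_left)
    moreover have "complex_of_real (x - exp (- \<omega>) * y) \<noteq> 0"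
      using ne unfolding of_real_eq_0_iff by simp
    ultimately show ?thesis unfolding cscale_eq_0_iff by blast
  qed
  have "\<l> (herm_fun f \<sigma>) ** V = dsum (\<lambda>x y. f x) \<sigma> V"
    by (simp add: dsum_left[OF s])
  also have "\<dots> = dsum (\<lambda>x y. g y) \<sigma> V"
    unfolding dsum_def using zero assms by (intro sum.cong refl) fastforce
  also have "\<dots> = V ** \<r> (herm_fun g \<sigma>)"
    by (simp add: dsum_right[OF s])
  finally show ?thesis .
qed

text \<open>The functional in the symmetry axiom of the structure, by which passing from j to its
  partner exchanges the two arguments.\<close>

definition gform :: "complex^'n^'n \<Rightarrow> complex^'n^'n \<Rightarrow> complex" where
  "gform a b = \<tau>\<^sub>B (adj V ** \<l> a ** V ** \<r> b)"

text \<open>Expanding both derivations turns the pairing into values of \<open>gform\<close>, the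
  quantity that the symmetry axiom controls.\<close>

lemma tr_pd_pd:
  assumes in_A: "a \<in> A" "b \<in> A" "P \<in> A" "Q \<in> A"
  shows "\<tau>\<^sub>B (adj (pd a) ** (\<l> P ** pd b ** \<r> Q)) =
    gform P (b ** Q ** adj a) - gform (P ** b) (Q ** adj a) - gform (adj a ** P) (b ** Q)
    + gform (adj a ** P ** b) Q"
proof -
  have rot: "\<tau>\<^sub>B (\<r> (adj a) ** X) = \<tau>\<^sub>B (X ** \<r> (adj a))" if "X \<in> \<B>" for X
    using that in_A by (intro B.tr_comm) auto
  have "adj (pd a) = \<r> (adj a) ** adj V - adj V ** \<l> (adj a)"
    by (simp add: pderiv_j_def adj_diff adj_mult L.h_adj R.h_adj in_A)
  then have "\<tau>\<^sub>B (adj (pd a) ** (\<l> P ** pd b ** \<r> Q)) =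
      \<tau>\<^sub>B (\<r> (adj a) ** (adj V ** (\<l> P ** (V ** (\<r> b ** \<r> Q)))))
      - \<tau>\<^sub>B (\<r> (adj a) ** (adj V ** (\<l> P ** (\<l> b ** (V ** \<r> Q)))))
      - \<tau>\<^sub>B (adj V ** (\<l> (adj a) ** (\<l> P ** (V ** (\<r> b ** \<r> Q)))))
      + \<tau>\<^sub>B (adj V ** (\<l> (adj a) ** (\<l> P ** (\<l> b ** (V ** \<r> Q)))))"
    unfolding pderiv_j_def[of D j b]
    by (simp add: mm.diff_left mm.diff_right B.tr_diff in_A flip: matrix_mul_assoc)
  then show ?thesis
    by (simp add: rot in_A gform_def L.h_mult R.h_mult flip: matrix_mul_assoc)
qed

text \<open>Carries \<sigma> from one argument to the other at the price of exp(-\<omega>), which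
  makes \<omega> readable from \<open>gform\<close>.\<close>

lemma gform_sigma_left:
  assumes "a \<in> A" "b \<in> A"
  shows "gform (\<sigma> ** a) b = complex_of_real (exp (- \<omega>)) * gform a (b ** \<sigma>)"
proof -
  have VL: "adj V ** \<l> \<sigma> = complex_of_real (exp (- \<omega>)) *\<^sub>C (\<r> \<sigma> ** adj V)"
    using arg_cong[OF sigma_V, of adj]
    by (simp add: adj_mult adj_cscale sigma_in sigma_herm flip: L.h_adj R.h_adj)
  have "gform (\<sigma> ** a) b = \<tau>\<^sub>B ((adj V ** \<l> \<sigma>) ** (\<l> a ** V ** \<r> b))"
    by (simp add: gform_def L.h_mult assms sigma_in matrix_mul_assoc)
  also have "\<dots> = complex_of_real (exp (- \<omega>)) * \<tau>\<^sub>B (\<r> \<sigma> ** (adj V ** \<l> a ** V ** \<r> b))"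
    by (simp add: VL B.tr_cscale assms sigma_in matrix_mul_assoc)
  also have "\<tau>\<^sub>B (\<r> \<sigma> ** (adj V ** \<l> a ** V ** \<r> b)) = \<tau>\<^sub>B ((adj V ** \<l> a ** V ** \<r> b) ** \<r> \<sigma>)"
    using assms sigma_in by (intro B.tr_comm) auto
  finally show ?thesis by (simp add: gform_def R.h_mult assms sigma_in matrix_mul_assoc)
qed

text \<open>With \<sigma> split into two square roots this is the squared norm of V times the image
  of the root, while \<open>V\<close> is non-zero and \<open>\<r> \<sigma>\<close>
  invertible.\<close>

lemma gform_one_sigma: "gform (mat 1) \<sigma> \<noteq> 0"
proof
  let ?s = "herm_fun sqrt \<sigma>"
  have s: "?s \<in> A" "adj ?s = ?s" "?s ** ?s = \<sigma>"
  proof -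
    have "?s ** ?s = herm_fun (\<lambda>x. x) \<sigma>"
      unfolding herm_fun_mult[OF sigma_herm] unfolding herm_fun_def
      using sigma_eigvals by (intro sum.cong refl) (simp add: less_imp_le flip: of_real_mult)
    then show "?s ** ?s = \<sigma>" by (simp add: herm_fun_id sigma_herm)
  qed (simp_all add: herm_fun_in herm_fun_adj sigma_in sigma_herm)
  note inv = invertible_hom[OF sigma_in sigma_herm less_imp_neq[OF sigma_eigvals, symmetric]]
  have "gform (mat 1) \<sigma> = \<tau>\<^sub>B ((adj V ** V ** \<r> ?s) ** \<r> ?s)"
    using R.h_mult[OF s(1,1)] by (simp add: gform_def s flip: matrix_mul_assoc)
  also have "\<dots> = \<tau>\<^sub>B (\<r> ?s ** (adj V ** V ** \<r> ?s))"
    using s by (intro B.tr_comm) auto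
  also have "\<dots> = \<tau>\<^sub>B (adj (V ** \<r> ?s) ** (V ** \<r> ?s))"
    using R.h_adj[OF s(1)] by (simp add: adj_mult s matrix_mul_assoc)
  finally have eq: "gform (mat 1) \<sigma> = \<tau>\<^sub>B (adj (V ** \<r> ?s) ** (V ** \<r> ?s))" .
  assume "gform (mat 1) \<sigma> = 0"
  then have "V ** \<r> ?s = 0" using B.tr_faithful[of "V ** \<r> ?s"] s eq by auto
  then have "V ** \<r> \<sigma> = 0" using R.h_mult[OF s(1,1)] by (simp add: s matrix_mul_assoc)
  then have "V ** \<r> \<sigma> ** \<r> (herm_fun inverse \<sigma>) = 0" by simp
  then show False using inv(1) V_nz by (simp flip: matrix_mul_assoc)
qed

end

section \<open>Adjoint derivations and the involution of the indices\<close>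

context diff_index
begin

lemma dag_in: "y \<in> \<B> \<Longrightarrow> trace_adjoint A \<tau> \<tau>\<^sub>B pd y \<in> A"
  and dag_form: "y \<in> \<B> \<Longrightarrow> a \<in> A \<Longrightarrow> \<tau> (adj a ** trace_adjoint A \<tau> \<tau>\<^sub>B pd y) = \<tau>\<^sub>B (adj (pd a) ** y)"
proof -
  assume y: "y \<in> \<B>"
  have *: "\<tau>\<^sub>B (adj (pd (a + b)) ** y) = \<tau>\<^sub>B (adj (pd a) ** y) + \<tau>\<^sub>B (adj (pd b) ** y)"
    if "a \<in> A" "b \<in> A" for a b
    using that y by (simp add: pd_add adj_add matrix_add_rdistrib B.tr_add)
  have **: "\<tau>\<^sub>B (adj (pd (c *\<^sub>C a)) ** y) = cnj c * \<tau>\<^sub>B (adj (pd a) ** y)" if "a \<in> A" for c a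
    using that y by (simp add: pd_cscale adj_cscale B.tr_cscale)
  show "trace_adjoint A \<tau> \<tau>\<^sub>B pd y \<in> A"
    by (rule trace_adjoint_exists(1)[of \<tau>\<^sub>B pd y, OF * **])
  show "\<tau> (adj a ** trace_adjoint A \<tau> \<tau>\<^sub>B pd y) = \<tau>\<^sub>B (adj (pd a) ** y)" if "a \<in> A"
    by (rule trace_adjoint_exists(2)[of \<tau>\<^sub>B pd y, OF * ** that])
qed

lemma tr_pd_dsum:
  assumes \<rho>: "\<rho> \<in> A" "adj \<rho> = \<rho>" and "a \<in> A" "b \<in> A"
  shows "\<tau>\<^sub>B (adj (pd a) ** dsum g \<rho> (pd b)) =
    (\<Sum>x\<in>eigvals \<rho>. \<Sum>y\<in>eigvals \<rho>. complex_of_real (g x y) *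
      (gform (eigproj \<rho> x) (b ** eigproj \<rho> y ** adj a) - gform (eigproj \<rho> x ** b) (eigproj \<rho> y ** adj a)
       - gform (adj a ** eigproj \<rho> x) (b ** eigproj \<rho> y) + gform (adj a ** eigproj \<rho> x ** b) (eigproj \<rho> y)))"
  using assms
  by (simp add: tr_dsum[OF \<rho>] tr_sandwich[OF \<rho>, symmetric] tr_pd_pd eig_in[OF \<rho>] cong: sum.cong)

text \<open>The symmetry needs \<open>freq D k = - \<omega>\<close>, so that the arguments of
  \<theta> are exchanged along with those of \<open>gform\<close>. This follows from the axioms:
  moving \<sigma> through both arguments of \<open>gform (mat 1) \<sigma>\<close>, first for k and
  then for j, multiplies a non-zero number by \<open>exp (- freq D k - \<omega>)\<close>, which must
  therefore be 1.\<close>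

lemma star_index:
  obtains k where "k \<in> idx D" "balg D k = \<B>" "dvec D k = adj V"
    "\<And>k'. k' \<in> idx D \<Longrightarrow> balg D k' = \<B> \<Longrightarrow> dvec D k' = adj V \<Longrightarrow> k' = k"
    "\<And>\<rho> a b. \<rho> \<in> A \<Longrightarrow> adj \<rho> = \<rho> \<Longrightarrow> a \<in> A \<Longrightarrow> b \<in> A \<Longrightarrow>
      btr D k (adj (pderiv_j D k a) ** rho_contract D k \<rho> (pderiv_j D k b)) =
      \<tau>\<^sub>B (adj (pd (adj b)) ** rho_contract D j \<rho> (pd (adj a)))"
proof -
  note star = bspec[OF ds[unfolded differential_structure_def, THEN conjunct2, THEN conjunct2,
    THEN conjunct2, THEN conjunct1] j, THEN conjunct2, THEN conjunct2, THEN conjunct2,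
    THEN conjunct2, THEN conjunct2, THEN conjunct2, THEN conjunct2]
  obtain k where k1: "k \<in> idx D"
    and kc: "balg D k = \<B> \<and> dvec D k = adj V \<and>
      (\<forall>k'\<in>idx D. balg D k' = \<B> \<and> dvec D k' = adj V \<longrightarrow> k' = k) \<and>
      (\<forall>b\<in>\<B>. btr D k b = \<tau>\<^sub>B b) \<and>
      (\<forall>a\<in>A. \<forall>b\<in>A. \<tau>\<^sub>B (adj V ** \<l> a ** V ** \<r> b) = \<tau>\<^sub>B (adj V ** rhom D k a ** V ** lhom D k b))"
    using star by (rule bexE)
  note kc2 = kc[THEN conjunct2, THEN conjunct2]
  note k = k1 kc[THEN conjunct1] kc[THEN conjunct2, THEN conjunct1]
    kc2[THEN conjunct1, THEN bspec, THEN mp, OF _ conjI]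
    kc2[THEN conjunct2, THEN conjunct1, THEN bspec]
    kc2[THEN conjunct2, THEN conjunct2, THEN bspec, THEN bspec]
  interpret K: diff_index D k by unfold_locales (rule k)
  have in_B: "lhom D k a \<in> \<B>" "rhom D k a \<in> \<B>" if "a \<in> A" for a
    using K.L.h_in[OF that] K.R.h_in[OF that] by (simp_all add: k)
  have gf: "K.gform a b = gform b a" if "a \<in> A" "b \<in> A" for a b
  proof -
    have "K.gform a b = \<tau>\<^sub>B ((V ** lhom D k a) ** (adj V ** rhom D k b))"
      using in_B that unfolding K.gform_def by (simp add: k matrix_mul_assoc)
    also have "\<dots> = \<tau>\<^sub>B ((adj V ** rhom D k b) ** (V ** lhom D k a))"
      using in_B that by (intro B.tr_comm) auto
    also have "\<dots> = gform b a" using that by (simp add: gform_def k(6) matrix_mul_assoc)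
    finally show ?thesis .
  qed
  have "gform (mat 1) \<sigma> = K.gform (\<sigma> ** mat 1) (mat 1)" using gf sigma_in by simp
  also have "\<dots> = complex_of_real (exp (- freq D k)) * gform (\<sigma> ** mat 1) (mat 1)"
    using gf[of "mat 1" \<sigma>] K.gform_sigma_left[of "mat 1" "mat 1"] sigma_in by simp
  also have "\<dots> = complex_of_real (exp (- freq D k - \<omega>)) * gform (mat 1) \<sigma>"
    using gform_sigma_left[of "mat 1" "mat 1"] by (simp flip: exp_add of_real_mult)
  finally have "complex_of_real (exp (- freq D k - \<omega>)) = 1"
    using gform_one_sigma by (metis mult_cancel_right2)
  then have \<omega>k: "freq D k = - \<omega>"
    unfolding of_real_eq_1_iff exp_eq_one_iff by simp
  have th: "theta D k x y = theta D j y x" for x y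
    using log_mean_commute by (simp add: theta_def \<omega>k)
  have "btr D k (adj (pderiv_j D k a) ** rho_contract D k \<rho> (pderiv_j D k b)) =
      \<tau>\<^sub>B (adj (pd (adj b)) ** rho_contract D j \<rho> (pd (adj a)))"
    if \<rho>: "\<rho> \<in> A" "adj \<rho> = \<rho>" and ab: "a \<in> A" "b \<in> A" for \<rho> a b
  proof -
    note e = eig_in[OF \<rho>]
    show ?thesis
      unfolding rho_contract_dsum K.rho_contract_dsum K.tr_pd_dsum[OF \<rho> ab]
        tr_pd_dsum[OF \<rho> adj_in[OF ab(2)] adj_in[OF ab(1)]]
      by (subst sum.swap) (simp add: gf th e ab algebra_simps cong: sum.cong)
  qed
  from that[OF k(1-4) this] show ?thesis .
qed

lemma pd_diff: "a \<in> A \<Longrightarrow> b \<in> A \<Longrightarrow> pd (a - b) = pd a - pd b"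
  by (simp add: pderiv_j_def L.h_diff R.h_diff mm.diff_left mm.diff_right)

end

section \<open>The operator K\<close>

context diffstr
begin

lemma index: "j \<in> idx D \<Longrightarrow> diff_index D j"
  by unfold_locales

text \<open>The form of \<open>Kop D \<rho>\<close> for the trace inner product. Estimates are made
  on it because it contains no adjoint of a derivation.\<close>

definition kform :: "complex^'n^'n \<Rightarrow> complex^'n^'n \<Rightarrow> complex^'n^'n \<Rightarrow> complex" where
  "kform \<rho> a b = (\<Sum>j\<in>idx D. btr D j (adj (pderiv_j D j a) ** rho_contract D j \<rho> (pderiv_j D j b)))"

lemma contract_in:
  assumes "j \<in> idx D" "\<rho> \<in> A" "adj \<rho> = \<rho>" "a \<in> A"
  shows "rho_contract D j \<rho> (pderiv_j D j a) \<in> balg D j"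
proof -
  interpret diff_index D j by (rule index) fact
  show ?thesis using assms by (simp add: rho_contract_dsum dsum_in)
qed

lemma Kop_in: "\<rho> \<in> A \<Longrightarrow> adj \<rho> = \<rho> \<Longrightarrow> b \<in> A \<Longrightarrow> Kop D \<rho> b \<in> A"
  unfolding Kop_def by (intro sum_in diff_index.dag_in index contract_in)

lemma Kop_form:
  assumes "\<rho> \<in> A" "adj \<rho> = \<rho>" "a \<in> A" "b \<in> A"
  shows "\<tau> (adj a ** Kop D \<rho> b) = kform \<rho> a b"
proof -
  have "\<tau> (adj a ** Kop D \<rho> b) = (\<Sum>j\<in>idx D. \<tau> (adj a ** trace_adjoint A \<tau> (btr D j) (pderiv_j D j)
      (rho_contract D j \<rho> (pderiv_j D j b))))"
    unfolding Kop_def mm.sum_right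
    using assms by (intro tr_sum mult_in adj_in diff_index.dag_in index contract_in)
  also have "\<dots> = kform \<rho> a b"
    unfolding kform_def using assms
    by (intro sum.cong refl diff_index.dag_form index contract_in)
  finally show ?thesis .
qed

context
  fixes \<rho> assumes \<rho>: "\<rho> \<in> A" "adj \<rho> = \<rho>"
begin

lemma kform_cnj: assumes "a \<in> A" "b \<in> A" shows "cnj (kform \<rho> a b) = kform \<rho> b a"
proof -
  have "cnj (btr D j (adj (pderiv_j D j a) ** rho_contract D j \<rho> (pderiv_j D j b)))
      = btr D j (adj (pderiv_j D j b) ** rho_contract D j \<rho> (pderiv_j D j a))" if "j \<in> idx D" for j
  proof -
    interpret diff_index D j by (rule index) fact
    show ?thesis using assms \<rho> by (simp add: rho_contract_dsum tr_dsum_cnj)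
  qed
  then show ?thesis by (simp add: kform_def)
qed

lemma kform_add_right:
  assumes "a \<in> A" "b \<in> A" "c \<in> A" shows "kform \<rho> a (b + c) = kform \<rho> a b + kform \<rho> a c"
proof -
  have "btr D j (adj (pderiv_j D j a) ** rho_contract D j \<rho> (pderiv_j D j (b + c)))
      = btr D j (adj (pderiv_j D j a) ** rho_contract D j \<rho> (pderiv_j D j b))
      + btr D j (adj (pderiv_j D j a) ** rho_contract D j \<rho> (pderiv_j D j c))" if "j \<in> idx D" for j
  proof -
    interpret diff_index D j by (rule index) fact
    show ?thesis using assms \<rho>
      by (simp add: rho_contract_dsum pd_add dsum_add matrix_add_ldistrib B.tr_add dsum_in)
  qed
  then show ?thesis by (simp add: kform_def sum.distrib)
qed

lemma kform_cscale_right: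
  assumes "a \<in> A" "b \<in> A" shows "kform \<rho> a (c *\<^sub>C b) = c * kform \<rho> a b"
proof -
  have "btr D j (adj (pderiv_j D j a) ** rho_contract D j \<rho> (pderiv_j D j (c *\<^sub>C b)))
      = c * btr D j (adj (pderiv_j D j a) ** rho_contract D j \<rho> (pderiv_j D j b))" if "j \<in> idx D" for j
  proof -
    interpret diff_index D j by (rule index) fact
    show ?thesis using assms \<rho>
      by (simp add: rho_contract_dsum pd_cscale dsum_cscale B.tr_cscale dsum_in)
  qed
  then show ?thesis by (simp add: kform_def sum_distrib_left)
qed

lemma kform_add_left:
  assumes "a \<in> A" "b \<in> A" "c \<in> A" shows "kform \<rho> (b + c) a = kform \<rho> b a + kform \<rho> c a"
  using arg_cong[OF kform_add_right[OF assms], of cnj] assms by (simp add: kform_cnj)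

lemma kform_cscale_left:
  assumes "a \<in> A" "b \<in> A" shows "kform \<rho> (c *\<^sub>C b) a = cnj c * kform \<rho> b a"
  using arg_cong[OF kform_cscale_right[OF assms, of c], of cnj] assms by (simp add: kform_cnj)

text \<open>The involution \<open>j \<mapsto> j\<^sup>*\<close> exchanges the summands of \<open>kform \<rho> a b\<close> and \<open>kform \<rho> b\<^sup>* a\<^sup>*\<close>.\<close>

lemma kform_adj:
  assumes "a \<in> A" "b \<in> A" shows "kform \<rho> a b = kform \<rho> (adj b) (adj a)"
proof -
  define Q where "Q j k \<longleftrightarrow> k \<in> idx D \<and> balg D k = balg D j \<and> dvec D k = adj (dvec D j) \<and>
    (\<forall>k'\<in>idx D. balg D k' = balg D j \<longrightarrow> dvec D k' = adj (dvec D j) \<longrightarrow> k' = k) \<and>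
    btr D k (adj (pderiv_j D k a) ** rho_contract D k \<rho> (pderiv_j D k b)) =
    btr D j (adj (pderiv_j D j (adj b)) ** rho_contract D j \<rho> (pderiv_j D j (adj a)))" for j k
  have "\<exists>k. Q j k" if "j \<in> idx D" for j
  proof -
    interpret diff_index D j by (rule index) fact
    show ?thesis using star_index[of "\<exists>k. Q j k"] \<rho> assms unfolding Q_def by blast
  qed
  then obtain st where st: "\<And>j. j \<in> idx D \<Longrightarrow> Q j (st j)" by metis
  have inv: "st (st j) = j" if "j \<in> idx D" for j
  proof -
    have "st j \<in> idx D" using st[OF that] by (simp add: Q_def)
    from st[OF this] have uniq: "\<And>k'. k' \<in> idx D \<Longrightarrow> balg D k' = balg D (st j) \<Longrightarrow>
        dvec D k' = adj (dvec D (st j)) \<Longrightarrow> k' = st (st j)"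
      unfolding Q_def by blast
    have "balg D j = balg D (st j)" "dvec D j = adj (dvec D (st j))"
      using st[OF that] by (simp_all add: Q_def)
    then show ?thesis using uniq[OF that] by simp
  qed
  have mem: "st j \<in> idx D" if "j \<in> idx D" for j using st[OF that] by (simp add: Q_def)
  have eq: "btr D (st j) (adj (pderiv_j D (st j) a) ** rho_contract D (st j) \<rho> (pderiv_j D (st j) b)) =
    btr D j (adj (pderiv_j D j (adj b)) ** rho_contract D j \<rho> (pderiv_j D j (adj a)))"
    if "j \<in> idx D" for j using st[OF that] by (simp add: Q_def)
  show ?thesis
    unfolding kform_def
    by (rule sum.reindex_bij_witness[of _ st st])
      (use inv mem in \<open>auto simp: eq[symmetric]\<close>)
qed

lemma Kop_cscale: "a \<in> A \<Longrightarrow> Kop D \<rho> (c *\<^sub>C a) = c *\<^sub>C Kop D \<rho> a"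
  by (rule tr_eqI) (simp_all add: Kop_in \<rho> tr_cscale Kop_form kform_cscale_right)

lemma Kop_scaleR: "a \<in> A \<Longrightarrow> Kop D \<rho> (r *\<^sub>R a) = r *\<^sub>R Kop D \<rho> a"
  by (simp add: scaleR_cscale Kop_cscale)

text \<open>Thanks to the involution of the indices, the operator commutes with taking adjoints and
  so acts on self-adjoint elements.\<close>

lemma Kop_adj:
  assumes "b \<in> A" shows "Kop D \<rho> (adj b) = adj (Kop D \<rho> b)"
proof (rule tr_eqI)
  fix a assume a: "a \<in> A"
  have "\<tau> (adj a ** Kop D \<rho> (adj b)) = kform \<rho> b (adj a)"
    using a assms by (simp add: Kop_form \<rho> kform_adj[of a "adj b"])
  also have "\<dots> = cnj (kform \<rho> (adj a) b)" using a assms by (simp add: kform_cnj)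
  also have "\<dots> = cnj (\<tau> (a ** Kop D \<rho> b))" using a assms by (simp add: \<rho> flip: Kop_form)
  also have "\<dots> = \<tau> (adj (Kop D \<rho> b) ** adj a)"
    using a assms tr_adj[of "a ** Kop D \<rho> b"] by (simp add: adj_mult Kop_in \<rho>)
  also have "\<dots> = \<tau> (adj a ** adj (Kop D \<rho> b))"
    using a assms by (intro tr_comm) (auto simp: Kop_in \<rho>)
  finally show "\<tau> (adj a ** Kop D \<rho> (adj b)) = \<tau> (adj a ** adj (Kop D \<rho> b))" .
qed (use assms in \<open>simp_all add: Kop_in \<rho>\<close>)

lemma Kop_tangent: assumes "a \<in> tangent D" shows "Kop D \<rho> a \<in> tangent D"
proof -
  have a: "a \<in> A" "adj a = a" using assms by (auto simp: tangent_def)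
  have "kform \<rho> (mat 1) a = 0"
    unfolding kform_def
  proof (rule sum.neutral, rule ballI)
    fix j assume "j \<in> idx D"
    then interpret diff_index D j by (rule index)
    show "btr D j (adj (pderiv_j D j (mat 1)) ** rho_contract D j \<rho> (pderiv_j D j a)) = 0" by simp
  qed
  then have "\<tau> (Kop D \<rho> a) = 0" using Kop_form[OF \<rho> one_in a(1)] by simp
  then show ?thesis using a Kop_adj[OF a(1)] by (simp add: tangent_def Kop_in \<rho>)
qed

lemma kform_bilinear: "bilinear_on A (\<lambda>a b. Re (kform \<rho> a b))"
  by (auto simp: bilinear_on_def kform_add_left kform_add_right scaleR_cscale kform_cscale_left
      kform_cscale_right)

lemma kform_sym: "a \<in> A \<Longrightarrow> b \<in> A \<Longrightarrow> Re (kform \<rho> a b) = Re (kform \<rho> b a)"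
  using arg_cong[OF kform_cnj[of a b], of Re] by simp

end

text \<open>With \<open>w = -1/2\<close> and \<open>w = 1/2\<close> this form bounds \<open>kform \<rho>\<close> from below and above.\<close>

definition dirichlet :: "real \<Rightarrow> complex^'n^'n \<Rightarrow> complex^'n^'n \<Rightarrow> real" where
  "dirichlet w a b = (\<Sum>j\<in>idx D. exp (w * \<bar>freq D j\<bar>) * Re (btr D j (adj (pderiv_j D j a) ** pderiv_j D j b)))"

lemma dirichlet_bilinear: "bilinear_on A (dirichlet w)"
proof -
  have "Re (btr D j (adj (pderiv_j D j (x + y)) ** pderiv_j D j z)) =
      Re (btr D j (adj (pderiv_j D j x) ** pderiv_j D j z)) + Re (btr D j (adj (pderiv_j D j y) ** pderiv_j D j z))
    \<and> Re (btr D j (adj (pderiv_j D j z) ** pderiv_j D j (x + y))) =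
      Re (btr D j (adj (pderiv_j D j z) ** pderiv_j D j x)) + Re (btr D j (adj (pderiv_j D j z) ** pderiv_j D j y))"
    if "j \<in> idx D" "x \<in> A" "y \<in> A" "z \<in> A" for j x y z
  proof -
    interpret diff_index D j by (rule index) fact
    show ?thesis using that by (simp add: pd_add adj_add matrix_add_ldistrib matrix_add_rdistrib B.tr_add)
  qed
  moreover have "Re (btr D j (adj (pderiv_j D j (r *\<^sub>R x)) ** pderiv_j D j y)) =
      r * Re (btr D j (adj (pderiv_j D j x) ** pderiv_j D j y))
    \<and> Re (btr D j (adj (pderiv_j D j x) ** pderiv_j D j (r *\<^sub>R y))) =
      r * Re (btr D j (adj (pderiv_j D j x) ** pderiv_j D j y))"
    if "j \<in> idx D" "x \<in> A" "y \<in> A" for j r x y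
  proof -
    interpret diff_index D j by (rule index) fact
    show ?thesis using that by (simp add: scaleR_cscale pd_cscale adj_cscale B.tr_cscale)
  qed
  ultimately show ?thesis
    by (auto simp: bilinear_on_def dirichlet_def sum.distrib sum_distrib_left algebra_simps
        intro!: sum.cong)
qed

text \<open>\<theta> is a mean of its weighted arguments, hence lies between
  exp(-\<bar>\<omega>\<bar>/2) l and exp(\<bar>\<omega>\<bar>/2) u. The bounding forms are
  independent of \<rho>.\<close>

lemma kform_bounds:
  assumes \<rho>: "\<rho> \<in> A" "adj \<rho> = \<rho>" and a: "a \<in> A" and "0 \<le> l"
    and lu: "\<And>x. x \<in> eigvals \<rho> \<Longrightarrow> l \<le> x" "\<And>x. x \<in> eigvals \<rho> \<Longrightarrow> x \<le> u"
  shows "l * dirichlet (- 1 / 2) a a \<le> Re (kform \<rho> a a)"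
    and "Re (kform \<rho> a a) \<le> u * dirichlet (1 / 2) a a"
proof -
  have *: "l * (exp (- 1 / 2 * \<bar>freq D j\<bar>) * Re (btr D j (adj (pderiv_j D j a) ** pderiv_j D j a)))
      \<le> Re (btr D j (adj (pderiv_j D j a) ** rho_contract D j \<rho> (pderiv_j D j a)))"
    "Re (btr D j (adj (pderiv_j D j a) ** rho_contract D j \<rho> (pderiv_j D j a)))
      \<le> u * (exp (1 / 2 * \<bar>freq D j\<bar>) * Re (btr D j (adj (pderiv_j D j a) ** pderiv_j D j a)))"
    if "j \<in> idx D" for j
  proof -
    interpret diff_index D j by (rule index) fact
    note pa = pd_in[OF a]
    have "Re (\<tau>\<^sub>B (adj (pd a) ** dsum (\<lambda>_ _. exp (- \<bar>\<omega>\<bar> / 2) * l) \<rho> (pd a)))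
      \<le> Re (\<tau>\<^sub>B (adj (pd a) ** dsum (theta D j) \<rho> (pd a)))"
      using lu assms(4) by (intro Re_tr_dsum_mono[OF \<rho> pa] theta_ge) auto
    then show "l * (exp (- 1 / 2 * \<bar>freq D j\<bar>) * Re (btr D j (adj (pderiv_j D j a) ** pderiv_j D j a)))
      \<le> Re (btr D j (adj (pderiv_j D j a) ** rho_contract D j \<rho> (pderiv_j D j a)))"
      by (simp add: Re_tr_dsum_const[OF \<rho> pa] rho_contract_dsum mult_ac)
    have "Re (\<tau>\<^sub>B (adj (pd a) ** dsum (theta D j) \<rho> (pd a)))
      \<le> Re (\<tau>\<^sub>B (adj (pd a) ** dsum (\<lambda>_ _. exp (\<bar>\<omega>\<bar> / 2) * u) \<rho> (pd a)))"
      using lu assms(4) by (intro Re_tr_dsum_mono[OF \<rho> pa] theta_le) (auto intro: order.trans)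
    then show "Re (btr D j (adj (pderiv_j D j a) ** rho_contract D j \<rho> (pderiv_j D j a)))
      \<le> u * (exp (1 / 2 * \<bar>freq D j\<bar>) * Re (btr D j (adj (pderiv_j D j a) ** pderiv_j D j a)))"
      by (simp add: Re_tr_dsum_const[OF \<rho> pa] rho_contract_dsum mult_ac)
  qed
  show "l * dirichlet (- 1 / 2) a a \<le> Re (kform \<rho> a a)"
    unfolding dirichlet_def kform_def sum_distrib_left Re_sum by (rule sum_mono) (rule *(1))
  show "Re (kform \<rho> a a) \<le> u * dirichlet (1 / 2) a a"
    unfolding dirichlet_def kform_def sum_distrib_left Re_sum by (rule sum_mono) (rule *(2))
qed

text \<open>One constant for all densities: an eigenvalue times the trace of its projection is at
  most the trace of \<rho>, which is 1, while traces of non-zero projections are bounded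
  below.\<close>

lemma dens_eigvals_le:
  obtains U where "U > 0" "\<And>\<rho> x. \<rho> \<in> dens D \<Longrightarrow> x \<in> eigvals \<rho> \<Longrightarrow> x \<le> U"
proof -
  obtain c where c: "c > 0" "\<And>a. a \<in> A \<Longrightarrow> c * (norm a)\<^sup>2 \<le> Re (\<tau> (adj a ** a))"
    using pos_def_on_coercive[OF subspace_alg tr_bilinear tr_sq_pos] by blast
  obtain K where K: "K > 0" "\<And>(a :: complex^'n^'n) (b :: complex^'n^'n). norm (a ** b) \<le> norm a * norm b * K"
    using mm.pos_bounded by blast
  have "x \<le> K\<^sup>2 / c" if \<rho>: "\<rho> \<in> dens D" and x: "x \<in> eigvals \<rho>" for \<rho> x
  proof -
    note r = dens_in[OF \<rho>] dens_herm[OF \<rho>]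
    let ?E = "eigproj \<rho>"
    note e = eigproj_in[OF r] eigproj_idem[OF r(2)] eigproj_adj[OF r(2)]
    have nn: "0 \<le> Re (\<tau> (?E y))" if "y \<in> eigvals \<rho>" for y
      using tr_sq_nonneg[of "?E y"] e that by simp
    \<comment> \<open>A non-zero idempotent has norm at least 1 / K, because it equals its
      square.\<close>
    have "norm (?E x) \<le> norm (?E x) * norm (?E x) * K" using K(2)[of "?E x" "?E x"] e x by simp
    then have "1 \<le> norm (?E x) * K" using eigproj_nz[OF r(2) x] by simp
    then have "1 / K\<^sup>2 \<le> (norm (?E x))\<^sup>2"
      using K(1) power_mono[of 1 "norm (?E x) * K" 2] by (simp add: field_simps)
    then have "c * (1 / K\<^sup>2) \<le> c * (norm (?E x))\<^sup>2" using c(1) by (intro mult_left_mono) auto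
    also have "\<dots> \<le> Re (\<tau> (?E x))" using c(2)[of "?E x"] e x by simp
    finally have tE: "c / K\<^sup>2 \<le> Re (\<tau> (?E x))" by simp
    have "1 = Re (\<tau> (\<Sum>y\<in>eigvals \<rho>. complex_of_real y *\<^sub>C ?E y))"
      using dens_tr[OF \<rho>] spectral_decomp[OF r(2)] by simp
    also have "\<dots> = (\<Sum>y\<in>eigvals \<rho>. y * Re (\<tau> (?E y)))"
      using e by (subst tr_sum) (auto simp: tr_cscale)
    finally have "x * Re (\<tau> (?E x)) \<le> 1"
      using member_le_sum[OF x, of "\<lambda>y. y * Re (\<tau> (?E y))"] dens_eigvals[OF \<rho>] nn
        finite_eigvals[OF r(2)] by simp
    moreover have "x * (c / K\<^sup>2) \<le> x * Re (\<tau> (?E x))"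
      using tE dens_eigvals[OF \<rho> x] by (rule mult_left_mono)
    ultimately have "x * (c / K\<^sup>2) \<le> 1" by simp
    then show ?thesis using c K by (simp add: field_simps)
  qed
  then show ?thesis using c K that[of "K\<^sup>2 / c"] by simp
qed

lemma kform_nonneg: "\<rho> \<in> dens D \<Longrightarrow> a \<in> A \<Longrightarrow> 0 \<le> Re (kform \<rho> a a)"
  using kform_bounds(1)[of \<rho> a 0] dens_eigvals[of \<rho>] dens_eigvals_le dens_in[of \<rho>] dens_herm[of \<rho>]
  by (metis mult_zero_left order_refl)

lemma tangent_subspace: "subspace (tangent D)"
  by (auto simp: subspace_def tangent_def tr_add adj_add adj_scaleR tr_scaleR)

lemma tangent_in: "a \<in> tangent D \<Longrightarrow> a \<in> A" and tangent_herm: "a \<in> tangent D \<Longrightarrow> adj a = a"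
  by (auto simp: tangent_def)

lemma bilinear_on_tangent: "bilinear_on A b \<Longrightarrow> bilinear_on (tangent D) b"
  unfolding bilinear_on_def using tangent_in by blast

lemma kform_le:
  obtains C where "C > 0" "\<And>\<rho> a. \<rho> \<in> dens D \<Longrightarrow> a \<in> A \<Longrightarrow> Re (kform \<rho> a a) \<le> C * (norm a)\<^sup>2"
proof -
  obtain U where U: "U > 0" "\<And>\<rho> x. \<rho> \<in> dens D \<Longrightarrow> x \<in> eigvals \<rho> \<Longrightarrow> x \<le> U"
    using dens_eigvals_le by blast
  obtain C where C: "C > 0" "\<And>x y. x \<in> A \<Longrightarrow> y \<in> A \<Longrightarrow> \<bar>dirichlet (1 / 2) x y\<bar> \<le> C * norm x * norm y"
    using bilinear_on_bounded[OF subspace_alg dirichlet_bilinear] by blast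
  have "Re (kform \<rho> a a) \<le> U * C * (norm a)\<^sup>2" if \<rho>: "\<rho> \<in> dens D" and a: "a \<in> A" for \<rho> a
  proof -
    have "Re (kform \<rho> a a) \<le> U * dirichlet (1 / 2) a a"
      using kform_bounds(2)[OF dens_in[OF \<rho>] dens_herm[OF \<rho>] a, of 0 U] dens_eigvals[OF \<rho>] U(2)[OF \<rho>] by simp
    also have "\<dots> \<le> U * (C * norm a * norm a)"
      using C(2)[OF a a] U(1) by (intro mult_left_mono) auto
    finally show ?thesis by (simp add: power2_eq_square mult_ac)
  qed
  then show ?thesis using U C that[of "U * C"] by simp
qed

subsection \<open>The generator\<close>

abbreviation "s\<^sub>2 \<equiv> herm_fun sqrt \<sigma>"

lemma s2_in [simp]: "s\<^sub>2 \<in> A" and s2_adj: "adj s\<^sub>2 = s\<^sub>2"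
  by (simp_all add: herm_fun_in herm_fun_adj sigma_in sigma_herm)

lemma s2_inverse:
  obtains t where "t \<in> A" "adj t = t" "t ** s\<^sub>2 = mat 1" "s\<^sub>2 ** t = mat 1"
proof -
  let ?t = "herm_fun (\<lambda>x. inverse (sqrt x)) \<sigma>"
  have eq: "herm_fun f \<sigma> = mat 1" if "\<And>x. x \<in> eigvals \<sigma> \<Longrightarrow> f x = 1" for f
    using that herm_fun_const[OF sigma_herm, of 1] by (simp add: herm_fun_def)
  have "?t ** s\<^sub>2 = mat 1" "s\<^sub>2 ** ?t = mat 1"
    unfolding herm_fun_mult[OF sigma_herm] by (auto intro!: eq simp: field_simps dest!: sigma_eigvals)
  then show ?thesis
    by (intro that[of ?t]) (simp_all add: herm_fun_in herm_fun_adj sigma_in sigma_herm)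
qed

text \<open>With t the fourth root of \<sigma>, cyclicity turns the trace into that of the square of
  t a t, and t a t vanishes only with a, as the square of t is invertible.\<close>

lemma s2_sandwich_pos:
  assumes "a \<in> A" "a \<noteq> 0" shows "0 < Re (\<tau> (adj a ** s\<^sub>2 ** a ** s\<^sub>2))"
proof -
  let ?t = "herm_fun (\<lambda>x. sqrt (sqrt x)) \<sigma>"
  have t: "?t \<in> A" "adj ?t = ?t"
    by (simp_all add: herm_fun_in herm_fun_adj sigma_in sigma_herm)
  have tt: "?t ** ?t = s\<^sub>2"
    unfolding herm_fun_mult[OF sigma_herm] unfolding herm_fun_def
    using sigma_eigvals by (intro sum.cong refl) (simp add: less_imp_le flip: of_real_mult)
  have "\<tau> (adj a ** s\<^sub>2 ** a ** s\<^sub>2) = \<tau> ((adj a ** ?t ** ?t ** a ** ?t) ** ?t)"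
    by (simp add: tt[symmetric] matrix_mul_assoc)
  also have "\<dots> = \<tau> (?t ** (adj a ** ?t ** ?t ** a ** ?t))"
    using t assms by (intro tr_comm) auto
  also have "\<dots> = \<tau> (adj (?t ** a ** ?t) ** (?t ** a ** ?t))"
    by (simp add: adj_mult t matrix_mul_assoc)
  finally have eq: "\<tau> (adj a ** s\<^sub>2 ** a ** s\<^sub>2) = \<tau> (adj (?t ** a ** ?t) ** (?t ** a ** ?t))" .
  have "?t ** a ** ?t \<noteq> 0"
  proof
    assume "?t ** a ** ?t = 0"
    then have "?t ** (?t ** a ** ?t) ** ?t = 0" by simp
    then have *: "s\<^sub>2 ** a ** s\<^sub>2 = 0" unfolding tt[symmetric] by (simp only: matrix_mul_assoc)
    obtain u where u: "u ** s\<^sub>2 = mat 1" "s\<^sub>2 ** u = mat 1" using s2_inverse by blast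
    have "a = (u ** s\<^sub>2) ** a ** (s\<^sub>2 ** u)" by (simp add: u)
    also have "\<dots> = u ** (s\<^sub>2 ** a ** s\<^sub>2) ** u" by (simp only: matrix_mul_assoc)
    finally show False using * assms by simp
  qed
  then show ?thesis unfolding eq using t assms by (intro tr_sq_pos) auto
qed

definition energy :: "complex^'n^'n \<Rightarrow> complex^'n^'n \<Rightarrow> complex" where
  "energy a b = (\<Sum>j\<in>idx D. btr D j (adj (pderiv_j D j a) ** lhom D j s\<^sub>2 ** pderiv_j D j b ** rhom D j s\<^sub>2))"

text \<open>The form in x and a is positive definite by \<open>s2_sandwich_pos\<close>, so the
  equation defining the generator is a case of \<open>riesz_alg\<close>.\<close>

lemma generator_unique:
  assumes "b \<in> A"
  shows "\<exists>!x. x \<in> A \<and> (\<forall>a\<in>A. \<tau> (adj a ** s\<^sub>2 ** x ** s\<^sub>2) = - energy a b)"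
proof (rule riesz_alg[OF _ _ _ _ s2_sandwich_pos])
  fix a c assume ac: "a \<in> A" "c \<in> A"
  have "btr D j (adj (pderiv_j D j (a + c)) ** lhom D j s\<^sub>2 ** pderiv_j D j b ** rhom D j s\<^sub>2) =
      btr D j (adj (pderiv_j D j a) ** lhom D j s\<^sub>2 ** pderiv_j D j b ** rhom D j s\<^sub>2) +
      btr D j (adj (pderiv_j D j c) ** lhom D j s\<^sub>2 ** pderiv_j D j b ** rhom D j s\<^sub>2)" if "j \<in> idx D" for j
  proof -
    interpret diff_index D j by (rule index) fact
    show ?thesis using assms ac by (simp add: pd_add adj_add matrix_add_rdistrib B.tr_add)
  qed
  then show "- energy (a + c) b = - energy a b + - energy c b" by (simp add: energy_def sum.distrib)
next
  fix a c assume a: "a \<in> A"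
  have "btr D j (adj (pderiv_j D j (c *\<^sub>C a)) ** lhom D j s\<^sub>2 ** pderiv_j D j b ** rhom D j s\<^sub>2) =
      cnj c * btr D j (adj (pderiv_j D j a) ** lhom D j s\<^sub>2 ** pderiv_j D j b ** rhom D j s\<^sub>2)" if "j \<in> idx D" for j
  proof -
    interpret diff_index D j by (rule index) fact
    show ?thesis using assms a by (simp add: pd_cscale adj_cscale B.tr_cscale)
  qed
  then show "- energy (c *\<^sub>C a) b = cnj c * - energy a b" by (simp add: energy_def sum_distrib_left)
qed (simp_all add: adj_add matrix_add_ldistrib matrix_add_rdistrib tr_add adj_cscale tr_cscale)

lemma generator_props:
  assumes "b \<in> A"
  shows generator_in: "generator D b \<in> A"
    and generator_form: "\<And>a. a \<in> A \<Longrightarrow> \<tau> (adj a ** s\<^sub>2 ** generator D b ** s\<^sub>2) = - energy a b"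
proof -
  have "generator D b = (THE x. x \<in> A \<and> (\<forall>a\<in>A. \<tau> (adj a ** s\<^sub>2 ** x ** s\<^sub>2) = - energy a b))"
    unfolding generator_def Let_def energy_def
    by (intro arg_cong[of _ _ The] ext conj_cong refl ball_cong) (rule equation_minus_iff)
  then show "generator D b \<in> A" "\<And>a. a \<in> A \<Longrightarrow> \<tau> (adj a ** s\<^sub>2 ** generator D b ** s\<^sub>2) = - energy a b"
    using theI'[OF generator_unique[OF assms]] by auto
qed

text \<open>The link between ergodicity, which speaks of the kernel of the generator, and the
  derivations that make up \<open>Kop\<close>.\<close>

lemma generator_zero:
  assumes "b \<in> A" "\<And>j. j \<in> idx D \<Longrightarrow> pderiv_j D j b = 0"
  shows "generator D b = 0"
proof -
  have e: "energy a b = 0" if "a \<in> A" for a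
    unfolding energy_def
  proof (rule sum.neutral, rule ballI)
    fix j assume "j \<in> idx D"
    then interpret diff_index D j by (rule index)
    show "btr D j (adj (pderiv_j D j a) ** lhom D j s\<^sub>2 ** pderiv_j D j b ** rhom D j s\<^sub>2) = 0"
      using assms(2)[OF j] by simp
  qed
  show ?thesis
  proof (rule ccontr)
    assume "generator D b \<noteq> 0"
    then have "0 < Re (\<tau> (adj (generator D b) ** s\<^sub>2 ** generator D b ** s\<^sub>2))"
      by (intro s2_sandwich_pos generator_in assms)
    then show False using generator_form[OF assms(1) generator_in[OF assms(1)]] e generator_in[OF assms(1)] by simp
  qed
qed

end

section \<open>Quadratic forms and positivity\<close>

lemma quad_form_bound:
  obtains K where "K > 0" "\<And>(M :: complex^'n^'n) v. \<bar>Re (quad_form M v)\<bar> \<le> K * norm M * (norm v)\<^sup>2"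
proof -
  have "bounded_bilinear (cinner :: complex^'n \<Rightarrow> complex^'n \<Rightarrow> complex)"
    unfolding bilinear_conv_bounded_bilinear[symmetric] bilinear_def
    by (auto intro!: linearI simp: cinner_def sum.distrib algebra_simps scaleR_sum_right)
  then obtain K1 where K1: "K1 > 0" "\<And>(u :: complex^'n) v. norm (cinner u v) \<le> norm u * norm v * K1"
    using bounded_bilinear.pos_bounded by blast
  obtain K2 where K2: "K2 > 0" "\<And>(M :: complex^'n^'n) v. norm (M *v v) \<le> norm M * norm v * K2"
    using mv.pos_bounded by blast
  have "\<bar>Re (quad_form M v)\<bar> \<le> K1 * K2 * norm M * (norm v)\<^sup>2" for M :: "complex^'n^'n" and v
  proof -
    have "\<bar>Re (quad_form M v)\<bar> \<le> norm (cinner v (M *v v))"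
      unfolding quad_form_cinner by (rule abs_Re_le_cmod)
    also have "\<dots> \<le> norm v * norm (M *v v) * K1" by (rule K1)
    also have "\<dots> \<le> norm v * (norm M * norm v * K2) * K1"
      using K1 K2 by (intro mult_left_mono mult_right_mono) auto
    finally show ?thesis by (simp add: power2_eq_square mult_ac)
  qed
  then show ?thesis using K1 K2 that[of "K1 * K2"] by simp
qed

lemma quad_form_add: "quad_form (M + N) v = quad_form M v + quad_form N v"
  by (simp add: quad_form_def mv.add_left algebra_simps sum.distrib)

lemma quad_form_scaleR: "quad_form (r *\<^sub>R M) v = complex_of_real r * quad_form M v"
  unfolding quad_form_def scaleR_cscale matrix_vector_cscale by (simp add: sum_distrib_left mult_ac)

section \<open>Klein's inequality and the gradient of the entropy\<close>

context diffstr
begin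

text \<open>With \<open>f\<close> or \<open>g\<close> the constant 1 or the identity, all traces in
  Klein's inequality become double sums with common weights.\<close>

lemma herm_tau_log:
  assumes "\<rho> \<in> A" "adj \<rho> = \<rho>" "\<nu> \<in> A" "adj \<nu> = \<nu>"
  shows "\<tau> (herm_fun f \<nu> ** herm_fun g \<rho>) =
    (\<Sum>x\<in>eigvals \<nu>. \<Sum>y\<in>eigvals \<rho>. complex_of_real (f x * g y) * \<tau> (eigproj \<nu> x ** eigproj \<rho> y))"
proof -
  note e = eigproj_in[OF assms(1,2)] eigproj_in[OF assms(3,4)]
  have "herm_fun f \<nu> ** herm_fun g \<rho> = (\<Sum>x\<in>eigvals \<nu>. \<Sum>y\<in>eigvals \<rho>.
      complex_of_real (f x * g y) *\<^sub>C (eigproj \<nu> x ** eigproj \<rho> y))"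
    unfolding herm_fun_def mm.sum_left by (simp add: mm.sum_right mult.commute)
  also have "\<tau> \<dots> = (\<Sum>x\<in>eigvals \<nu>. \<tau> (\<Sum>y\<in>eigvals \<rho>.
      complex_of_real (f x * g y) *\<^sub>C (eigproj \<nu> x ** eigproj \<rho> y)))"
    using e by (intro tr_sum sum_in cscale_in mult_in) auto
  also have "\<dots> = (\<Sum>x\<in>eigvals \<nu>. \<Sum>y\<in>eigvals \<rho>. \<tau> (
      complex_of_real (f x * g y) *\<^sub>C (eigproj \<nu> x ** eigproj \<rho> y)))"
    using e by (intro sum.cong refl tr_sum cscale_in mult_in) auto
  also have "\<dots> = (\<Sum>x\<in>eigvals \<nu>. \<Sum>y\<in>eigvals \<rho>.
      complex_of_real (f x * g y) * \<tau> (eigproj \<nu> x ** eigproj \<rho> y))"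
    using e by (intro sum.cong refl tr_cscale mult_in) auto
  finally show ?thesis .
qed

text \<open>Convexity of \<open>x log x\<close>, summed over pairs of eigenvalues with weights \<open>\<tau> (E\<^sub>x F\<^sub>y) \<ge> 0\<close>.\<close>

lemma klein:
  assumes \<rho>: "\<rho> \<in> dens_pos D" and \<nu>: "\<nu> \<in> dens D"
  shows "Re (\<tau> (\<nu> ** herm_fun ln \<rho>)) \<le> Re (\<tau> (\<nu> ** herm_fun ln \<nu>))"
proof -
  note r = dens_pos_in[OF \<rho>] dens_pos_herm[OF \<rho>] and n = dens_in[OF \<nu>] dens_herm[OF \<nu>]
  note h = herm_tau_log[OF r n]
  have "\<tau> (\<nu> ** herm_fun ln \<nu>) = \<tau> (herm_fun (\<lambda>x. x * ln x) \<nu> ** herm_fun (\<lambda>_. 1) \<rho>)"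
    using herm_fun_mult[OF n(2), of "\<lambda>x. x" ln]
    by (simp add: herm_fun_id[OF n(2)] herm_fun_const[OF r(2)])
  note 1 = this[unfolded h]
  have "\<tau> (\<nu> ** herm_fun ln \<rho>) = \<tau> (herm_fun (\<lambda>x. x) \<nu> ** herm_fun ln \<rho>)"
    by (simp add: herm_fun_id[OF n(2)])
  note 2 = this[unfolded h]
  have "\<tau> \<nu> = \<tau> (herm_fun (\<lambda>x. x) \<nu> ** herm_fun (\<lambda>_. 1) \<rho>)"
    by (simp add: herm_fun_id[OF n(2)] herm_fun_const[OF r(2)])
  note 3 = this[unfolded h]
  have "\<tau> \<rho> = \<tau> (herm_fun (\<lambda>_. 1) \<nu> ** herm_fun (\<lambda>x. x) \<rho>)"
    by (simp add: herm_fun_id[OF r(2)] herm_fun_const[OF n(2)])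
  note 4 = this[unfolded h]
  have "0 \<le> (\<Sum>x\<in>eigvals \<nu>. \<Sum>y\<in>eigvals \<rho>. (x * ln x - x * ln y - x + y) * Re (\<tau> (eigproj \<nu> x ** eigproj \<rho> y)))"
  proof (intro sum_nonneg mult_nonneg_nonneg)
    fix x y assume x: "x \<in> eigvals \<nu>" and y: "y \<in> eigvals \<rho>"
    show "0 \<le> Re (\<tau> (eigproj \<nu> x ** eigproj \<rho> y))"
      using x y r n by (intro tr_proj_nonneg eigproj_in eigproj_adj eigproj_idem)
    have "0 \<le> x" "0 < y" using dens_eigvals[OF \<nu> x] dens_pos_eigvals[OF \<rho> y] by auto
    show "0 \<le> x * ln x - x * ln y - x + y"
    \<comment> \<open>At x = 0 the convention \<open>ln 0 = 0\<close> leaves the term y.\<close>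
    proof (cases "x = 0")
      case False
      then have "ln (y / x) \<le> y / x - 1" using \<open>0 \<le> x\<close> \<open>0 < y\<close> by (intro ln_le_minus_one) auto
      then have "x * ln (y / x) \<le> x * (y / x - 1)" using \<open>0 \<le> x\<close> by (rule mult_left_mono)
      then show ?thesis using False \<open>0 \<le> x\<close> \<open>0 < y\<close> by (simp add: ln_div algebra_simps)
    qed (use \<open>0 < y\<close> in simp)
  qed
  also have "\<dots> = Re (\<tau> (\<nu> ** herm_fun ln \<nu>)) - Re (\<tau> (\<nu> ** herm_fun ln \<rho>)) - Re (\<tau> \<nu>) + Re (\<tau> \<rho>)"
    unfolding 1 2 3 4 by (simp add: sum_subtractf sum.distrib algebra_simps flip: of_real_mult)
  \<comment> \<open>The terms without logarithms cancel, both traces being 1.\<close>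
  finally show ?thesis using dens_tr[OF \<nu>] dens_pos_tr[OF \<rho>] by simp
qed

lemma ln_in: "\<rho> \<in> dens D \<Longrightarrow> herm_fun ln \<rho> \<in> A"
  by (intro herm_fun_in dens_in dens_herm)

text \<open>The gradient of the entropy up to a multiple of the identity, which pairs to zero with
  trace-free directions and is annihilated by every derivation. It need not be trace-free
  itself.\<close>

definition entropy_grad :: "complex^'n^'n \<Rightarrow> complex^'n^'n" where
  "entropy_grad \<rho> = herm_fun ln \<rho> - herm_fun ln \<sigma>"

lemma entropy_grad_in: "\<rho> \<in> dens D \<Longrightarrow> entropy_grad \<rho> \<in> A"
  and entropy_grad_adj: "\<rho> \<in> dens D \<Longrightarrow> adj (entropy_grad \<rho>) = entropy_grad \<rho>"
  by (simp_all add: entropy_grad_def ln_in sigma_dens adj_diff herm_fun_adj dens_herm)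

text \<open>A convex function lies above its tangent; as the \<sigma> term is linear, the defect is
  exactly the difference in Klein's inequality.\<close>

lemma Ent_diff_le:
  assumes \<rho>: "\<rho> \<in> dens_pos D" and \<nu>: "\<nu> \<in> dens D"
  shows "Ent D \<rho> - Ent D \<nu> \<le> Re (\<tau> (entropy_grad \<rho> ** (\<rho> - \<nu>)))"
proof -
  note m = dens_in[OF \<nu>] dens_pos_in[OF \<rho>] ln_in[OF \<nu>] ln_in[OF dens_pos_dens[OF \<rho>]] ln_in[OF sigma_dens]
  have "\<tau> (entropy_grad \<rho> ** (\<rho> - \<nu>)) = \<tau> ((\<rho> - \<nu>) ** entropy_grad \<rho>)"
    using m by (intro tr_comm) (auto simp: entropy_grad_def)
  then show ?thesis
    using klein[OF assms] m unfolding Ent_def entropy_grad_def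
    by (simp add: mm.diff_left mm.diff_right tr_diff)
qed

lemma Ent_sigma: "Ent D \<sigma> = 0"
  by (simp add: Ent_def)

end

section \<open>The chain rule for the logarithmic mean\<close>

context diff_index
begin

text \<open>The derivation of \<open>entropy_grad\<close> has the symbol ln y - ln x - \<omega>, the
  logarithmic difference of exp(-\<omega>/2) y and exp(\<omega>/2) x; multiplied by their
  logarithmic mean \<theta> it becomes their plain difference. The summand \<omega> is the
  contribution of log \<sigma>, by \<open>sigma_fun_V\<close>.\<close>

lemma contract_entropy_grad:
  assumes \<rho>: "\<rho> \<in> dens_pos D"
  shows "rho_contract D j \<rho> (pd (entropy_grad \<rho>)) =
    complex_of_real (exp (- \<omega> / 2)) *\<^sub>C (V ** \<r> \<rho>) - complex_of_real (exp (\<omega> / 2)) *\<^sub>C (\<l> \<rho> ** V)"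
proof -
  note r = dens_pos_in[OF \<rho>] dens_pos_herm[OF \<rho>]
  note l = ln_in[OF dens_pos_dens[OF \<rho>]] ln_in[OF sigma_dens]
  have "\<l> (herm_fun ln \<sigma>) ** V = V ** \<r> (herm_fun (\<lambda>y. ln y - \<omega>) \<sigma>)"
    by (rule sigma_fun_V) (use sigma_eigvals in \<open>fastforce simp: ln_mult\<close>)
  also have "herm_fun (\<lambda>y. ln y - \<omega>) \<sigma> = herm_fun ln \<sigma> - herm_fun (\<lambda>_. \<omega>) \<sigma>"
    by (simp add: herm_fun_def cscale_diff_left sum_subtractf)
  also have "\<r> \<dots> = \<r> (herm_fun ln \<sigma>) - complex_of_real \<omega> *\<^sub>C mat 1"
    using l by (simp add: herm_fun_const[OF sigma_herm] R.h_diff R.h_cscale)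
  finally have s: "pd (herm_fun ln \<sigma>) = complex_of_real \<omega> *\<^sub>C V"
    by (simp add: pderiv_j_def mm.diff_right)
  have "pd (herm_fun ln \<rho>) = dsum (\<lambda>x y. ln y) \<rho> V + dsum (\<lambda>x y. - ln x) \<rho> V"
    using dsum_left[OF r, of "\<lambda>x. - ln x" V] L.h_cscale[OF l(1), of "-1"]
    by (simp add: dsum_right[OF r] pderiv_j_def herm_fun_def cscale_minus sum_negf mm.minus_left)
  then have "pd (entropy_grad \<rho>) = dsum (\<lambda>x y. ln y + - ln x) \<rho> V - dsum (\<lambda>_ _. \<omega>) \<rho> V"
    by (simp only: entropy_grad_def pd_diff[OF l] s dsum_const[OF r] dsum_add_fun)
  also have "\<dots> = dsum (\<lambda>x y. (ln y - ln x) - \<omega>) \<rho> V"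
    using dsum_add_fun[of "\<lambda>x y. (ln y - ln x) - \<omega>" "\<lambda>_ _. \<omega>" \<rho> V] by simp
  finally have "rho_contract D j \<rho> (pd (entropy_grad \<rho>)) =
      dsum (\<lambda>x y. theta D j x y * ((ln y - ln x) - \<omega>)) \<rho> V"
    by (simp add: rho_contract_dsum dsum_dsum[OF r])
  also have "\<dots> = dsum (\<lambda>x y. exp (- \<omega> / 2) * y + - exp (\<omega> / 2) * x) \<rho> V"
  proof (rule dsum_cong)
    fix x y assume "x \<in> eigvals \<rho>" "y \<in> eigvals \<rho>"
    then have "0 < x" "0 < y" using dens_pos_eigvals[OF \<rho>] by auto
    then show "theta D j x y * ((ln y - ln x) - \<omega>) = exp (- \<omega> / 2) * y + - exp (\<omega> / 2) * x"
      using log_mean_mult_ln[of "exp (\<omega> / 2) * x" "exp (- \<omega> / 2) * y"]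
      by (simp add: theta_def ln_mult algebra_simps)
  qed
  also have "\<dots> = complex_of_real (exp (- \<omega> / 2)) *\<^sub>C dsum (\<lambda>x y. y) \<rho> V
      + complex_of_real (- exp (\<omega> / 2)) *\<^sub>C dsum (\<lambda>x y. x) \<rho> V"
    by (simp only: dsum_add_fun dsum_scale_fun)
  also have "\<dots> = complex_of_real (exp (- \<omega> / 2)) *\<^sub>C (V ** \<r> \<rho>) - complex_of_real (exp (\<omega> / 2)) *\<^sub>C (\<l> \<rho> ** V)"
    using dsum_left[OF r, of "\<lambda>x. x"] dsum_right[OF r, of "\<lambda>x. x"]
    by (simp add: herm_fun_id[OF r(2)] cscale_minus)
  finally show ?thesis .
qed

text \<open>The root of \<sigma> passes through \<open>V\<close> with the factor exp(-\<omega>/2).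
  The right-hand side is the adjoint of that of \<open>contract_entropy_grad\<close>, with \<rho>
  replaced by \<open>s\<^sub>2 ** a ** s\<^sub>2\<close>; this matches the two sides of
  \<open>Kop_entropy_grad\<close>.\<close>

lemma s2_pd:
  assumes a: "a \<in> A" "adj a = a"
  shows "\<r> s\<^sub>2 ** adj (pd a) ** \<l> s\<^sub>2 =
    complex_of_real (exp (- \<omega> / 2)) *\<^sub>C (\<r> (s\<^sub>2 ** a ** s\<^sub>2) ** adj V)
    - complex_of_real (exp (\<omega> / 2)) *\<^sub>C (adj V ** \<l> (s\<^sub>2 ** a ** s\<^sub>2))"
proof -
  have "\<l> s\<^sub>2 ** V = V ** \<r> (herm_fun (\<lambda>y. exp (- \<omega> / 2) * sqrt y) \<sigma>)"
  proof (rule sigma_fun_V)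
    fix y assume "y \<in> eigvals \<sigma>"
    then have "0 < y" by (rule sigma_eigvals)
    have "exp (- \<omega>) = (exp (- \<omega> / 2))\<^sup>2" by (simp add: power2_eq_square flip: exp_add)
    then show "sqrt (exp (- \<omega>) * y) = exp (- \<omega> / 2) * sqrt y"
      by (simp add: real_sqrt_mult)
  qed
  also have "herm_fun (\<lambda>y. exp (- \<omega> / 2) * sqrt y) \<sigma> = complex_of_real (exp (- \<omega> / 2)) *\<^sub>C s\<^sub>2"
    by (simp add: herm_fun_def cscale_sum)
  finally have 1: "\<l> s\<^sub>2 ** V = complex_of_real (exp (- \<omega> / 2)) *\<^sub>C (V ** \<r> s\<^sub>2)"
    by (simp add: R.h_cscale)
  have 2: "adj V ** \<l> s\<^sub>2 = complex_of_real (exp (- \<omega> / 2)) *\<^sub>C (\<r> s\<^sub>2 ** adj V)"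
    using arg_cong[OF 1, of adj] L.h_adj[OF s2_in] R.h_adj[OF s2_in] by (simp add: adj_mult adj_cscale s2_adj)
  have 3: "\<r> s\<^sub>2 ** adj V = complex_of_real (exp (\<omega> / 2)) *\<^sub>C (adj V ** \<l> s\<^sub>2)"
    unfolding 2 by (simp flip: of_real_mult exp_add)
  have "adj (pd a) = \<r> a ** adj V - adj V ** \<l> a"
    using L.h_adj[OF a(1)] R.h_adj[OF a(1)] by (simp add: pderiv_j_def adj_diff adj_mult a)
  then have "\<r> s\<^sub>2 ** adj (pd a) ** \<l> s\<^sub>2 =
      \<r> s\<^sub>2 ** \<r> a ** (adj V ** \<l> s\<^sub>2) - (\<r> s\<^sub>2 ** adj V) ** \<l> a ** \<l> s\<^sub>2"
    by (simp add: mm.diff_left mm.diff_right matrix_mul_assoc)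
  also have "\<r> s\<^sub>2 ** \<r> a ** (adj V ** \<l> s\<^sub>2) =
      complex_of_real (exp (- \<omega> / 2)) *\<^sub>C (\<r> (s\<^sub>2 ** a ** s\<^sub>2) ** adj V)"
    unfolding 2 using a by (simp add: R.h_mult matrix_mul_assoc)
  also have "(\<r> s\<^sub>2 ** adj V) ** \<l> a ** \<l> s\<^sub>2 =
      complex_of_real (exp (\<omega> / 2)) *\<^sub>C (adj V ** \<l> (s\<^sub>2 ** a ** s\<^sub>2))"
    unfolding 3 using a by (simp add: L.h_mult matrix_mul_assoc)
  finally show ?thesis .
qed

end

section \<open>The adjoint generator and the Fisher information in terms of K\<close>

context diffstr
begin

lemma generator_add: "a \<in> A \<Longrightarrow> b \<in> A \<Longrightarrow> generator D (a + b) = generator D a + generator D b"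
  and generator_cscale: "a \<in> A \<Longrightarrow> generator D (c *\<^sub>C a) = c *\<^sub>C generator D a"
proof -
  have uniq: "x = y" if "b \<in> A" "x \<in> A" "y \<in> A" "\<And>a. a \<in> A \<Longrightarrow> \<tau> (adj a ** s\<^sub>2 ** x ** s\<^sub>2) = - energy a b"
    "\<And>a. a \<in> A \<Longrightarrow> \<tau> (adj a ** s\<^sub>2 ** y ** s\<^sub>2) = - energy a b" for b x y
    using generator_unique[OF that(1)] that by blast
  show "generator D (a + b) = generator D a + generator D b" if ab: "a \<in> A" "b \<in> A"
  proof (rule uniq[OF add_in[OF ab]])
    fix c assume c: "c \<in> A"
    have "btr D j (adj (pderiv_j D j c) ** lhom D j s\<^sub>2 ** pderiv_j D j (a + b) ** rhom D j s\<^sub>2) =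
      btr D j (adj (pderiv_j D j c) ** lhom D j s\<^sub>2 ** pderiv_j D j a ** rhom D j s\<^sub>2) +
      btr D j (adj (pderiv_j D j c) ** lhom D j s\<^sub>2 ** pderiv_j D j b ** rhom D j s\<^sub>2)" if "j \<in> idx D" for j
    proof -
      interpret diff_index D j by (rule index) fact
      show ?thesis using ab c by (simp add: pd_add matrix_add_ldistrib matrix_add_rdistrib B.tr_add)
    qed
    then have "energy c (a + b) = energy c a + energy c b" by (simp add: energy_def sum.distrib)
    then show "\<tau> (adj c ** s\<^sub>2 ** (generator D a + generator D b) ** s\<^sub>2) = - energy c (a + b)"
      using ab c generator_form[OF ab(1) c] generator_form[OF ab(2) c]
      by (simp add: matrix_add_ldistrib matrix_add_rdistrib tr_add generator_in)
  qed (use ab in \<open>simp_all add: generator_in generator_form\<close>)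
  show "generator D (d *\<^sub>C a) = d *\<^sub>C generator D a" if a: "a \<in> A" for d
  proof (rule uniq[OF cscale_in[OF a]])
    fix c assume c: "c \<in> A"
    have "btr D j (adj (pderiv_j D j c) ** lhom D j s\<^sub>2 ** pderiv_j D j (d *\<^sub>C a) ** rhom D j s\<^sub>2) =
      d * btr D j (adj (pderiv_j D j c) ** lhom D j s\<^sub>2 ** pderiv_j D j a ** rhom D j s\<^sub>2)" if "j \<in> idx D" for j
    proof -
      interpret diff_index D j by (rule index) fact
      show ?thesis using a c by (simp add: pd_cscale B.tr_cscale)
    qed
    then have "energy c (d *\<^sub>C a) = d * energy c a" by (simp add: energy_def sum_distrib_left)
    then show "\<tau> (adj c ** s\<^sub>2 ** (d *\<^sub>C generator D a) ** s\<^sub>2) = - energy c (d *\<^sub>C a)"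
      using a c generator_form[OF a c] by (simp add: tr_cscale generator_in)
  qed (use a in \<open>simp_all add: generator_in generator_form\<close>)
qed

lemma generator_adj_props:
  assumes "\<rho> \<in> A"
  shows generator_adj_in: "generator_adj D \<rho> \<in> A"
    and generator_adj_form: "\<And>a. a \<in> A \<Longrightarrow> \<tau> (adj a ** generator_adj D \<rho>) = \<tau> (adj (generator D a) ** \<rho>)"
proof -
  have *: "\<tau> (adj (generator D (a + b)) ** \<rho>) = \<tau> (adj (generator D a) ** \<rho>) + \<tau> (adj (generator D b) ** \<rho>)"
    if "a \<in> A" "b \<in> A" for a b
    using that assms by (simp add: generator_add adj_add matrix_add_rdistrib tr_add generator_in)
  have **: "\<tau> (adj (generator D (c *\<^sub>C a)) ** \<rho>) = cnj c * \<tau> (adj (generator D a) ** \<rho>)" if "a \<in> A" for c a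
    using that assms by (simp add: generator_cscale adj_cscale tr_cscale generator_in)
  show "generator_adj D \<rho> \<in> A"
    by (rule trace_adjoint_exists(1)[of \<tau> "generator D" \<rho>, OF * **])
  show "\<tau> (adj a ** generator_adj D \<rho>) = \<tau> (adj (generator D a) ** \<rho>)" if "a \<in> A" for a
    by (rule trace_adjoint_exists(2)[of \<tau> "generator D" \<rho>, OF * ** that])
qed

text \<open>The generator is defined through a form weighted by the root of \<sigma> on both sides.
  Testing with w, for which \<open>s\<^sub>2 ** w ** s\<^sub>2 = \<rho>\<close>, absorbs the
  weights, and each summand becomes a pairing with the contracted gradient.\<close>

lemma Kop_entropy_grad:
  assumes \<rho>: "\<rho> \<in> dens_pos D"
  shows "Kop D \<rho> (entropy_grad \<rho>) = - generator_adj D \<rho>"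
proof (rule tr_eqI)
  note r = dens_pos_in[OF \<rho>] dens_pos_herm[OF \<rho>]
  note g = entropy_grad_in[OF dens_pos_dens[OF \<rho>]]
  show "Kop D \<rho> (entropy_grad \<rho>) \<in> A" by (intro Kop_in r g)
  show "- generator_adj D \<rho> \<in> A" by (intro minus_in generator_adj_in r)
  fix a assume a: "a \<in> A"
  obtain t where t: "t \<in> A" "adj t = t" "t ** s\<^sub>2 = mat 1" "s\<^sub>2 ** t = mat 1"
    using s2_inverse by blast
  define w where "w = t ** \<rho> ** t"
  have w: "w \<in> A" "adj w = w" using t r by (simp_all add: w_def adj_mult matrix_mul_assoc)
  have sws: "s\<^sub>2 ** w ** s\<^sub>2 = \<rho>"
  proof -
    have "s\<^sub>2 ** w ** s\<^sub>2 = (s\<^sub>2 ** t) ** \<rho> ** (t ** s\<^sub>2)" by (simp only: w_def matrix_mul_assoc)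
    then show ?thesis by (simp add: t)
  qed
  have "\<tau> (adj (generator D a) ** \<rho>) = cnj (\<tau> (\<rho> ** generator D a))"
    using tr_adj[of "\<rho> ** generator D a"] a r by (simp add: adj_mult generator_in)
  also have "\<tau> (\<rho> ** generator D a) = \<tau> (s\<^sub>2 ** (w ** s\<^sub>2 ** generator D a))"
    by (simp add: sws[symmetric] matrix_mul_assoc)
  also have "\<dots> = \<tau> (w ** s\<^sub>2 ** generator D a ** s\<^sub>2)"
    using w a generator_in by (intro tr_comm) auto
  also have "\<dots> = - energy w a"
    using generator_form[OF a w(1)] w(2) by simp
  finally have 1: "\<tau> (adj (generator D a) ** \<rho>) = - cnj (energy w a)" by simp
  have "btr D j (adj (pderiv_j D j a) ** rho_contract D j \<rho> (pderiv_j D j (entropy_grad \<rho>))) =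
    cnj (btr D j (adj (pderiv_j D j w) ** lhom D j s\<^sub>2 ** pderiv_j D j a ** rhom D j s\<^sub>2))" if "j \<in> idx D" for j
  proof -
    interpret diff_index D j by (rule index) fact
    let ?X = "complex_of_real (exp (- \<omega> / 2)) *\<^sub>C (V ** \<r> \<rho>) - complex_of_real (exp (\<omega> / 2)) *\<^sub>C (\<l> \<rho> ** V)"
    have X: "?X \<in> \<B>" using r by auto
    have "adj ?X = \<r> s\<^sub>2 ** adj (pd w) ** \<l> s\<^sub>2"
      unfolding s2_pd[OF w] sws using L.h_adj[OF r(1)] R.h_adj[OF r(1)]
      by (simp add: adj_diff adj_mult adj_cscale r)
    then have "\<tau>\<^sub>B (adj ?X ** pd a) = \<tau>\<^sub>B (\<r> s\<^sub>2 ** (adj (pd w) ** \<l> s\<^sub>2 ** pd a))"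
      by (simp add: matrix_mul_assoc)
    also have "\<dots> = \<tau>\<^sub>B (adj (pd w) ** \<l> s\<^sub>2 ** pd a ** \<r> s\<^sub>2)"
      using w a by (intro B.tr_comm) auto
    finally have "cnj (\<tau>\<^sub>B (adj (pd w) ** \<l> s\<^sub>2 ** pd a ** \<r> s\<^sub>2)) = \<tau>\<^sub>B (adj (pd a) ** ?X)"
      using B.tr_adj_mult[OF X pd_in[OF a]] by simp
    then show ?thesis by (simp add: contract_entropy_grad[OF \<rho>])
  qed
  then have "kform \<rho> a (entropy_grad \<rho>) = cnj (energy w a)"
    by (simp add: kform_def energy_def)
  then show "\<tau> (adj a ** Kop D \<rho> (entropy_grad \<rho>)) = \<tau> (adj a ** - generator_adj D \<rho>)"
    using 1 generator_adj_form[OF r(1) a] a generator_adj_in[OF r(1)]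
    by (simp add: Kop_form[OF r a g] mm.minus_right tr_minus)
qed

lemma Fisher_eq:
  assumes \<rho>: "\<rho> \<in> dens_pos D"
  shows "Fisher D \<rho> = ereal (Re (kform \<rho> (entropy_grad \<rho>) (entropy_grad \<rho>)))"
proof -
  note r = dens_pos_in[OF \<rho>] dens_pos_herm[OF \<rho>]
  note g = entropy_grad_in[OF dens_pos_dens[OF \<rho>]] entropy_grad_adj[OF dens_pos_dens[OF \<rho>]]
  have "kform \<rho> (entropy_grad \<rho>) (entropy_grad \<rho>) = - \<tau> (entropy_grad \<rho> ** generator_adj D \<rho>)"
    using Kop_form[OF r g(1) g(1)] g generator_adj_in[OF r(1)]
    by (simp add: Kop_entropy_grad[OF \<rho>] mm.minus_right tr_minus)
  then show ?thesis using \<rho> by (simp add: Fisher_def entropy_grad_def)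
qed

section \<open>Norm estimates and neighbourhoods of positive densities\<close>

lemma kform_cs:
  assumes "\<rho> \<in> dens D" "a \<in> A" "b \<in> A"
  shows "(Re (kform \<rho> a b))\<^sup>2 \<le> Re (kform \<rho> a a) * Re (kform \<rho> b b)"
  by (rule cauchy_schwarz_on[OF subspace_alg kform_bilinear[OF dens_in[OF assms(1)] dens_herm[OF assms(1)]]])
    (use assms in \<open>auto intro: kform_sym[OF dens_in[OF assms(1)] dens_herm[OF assms(1)]] kform_nonneg\<close>)

text \<open>For b = K a, a multiple of the squared norm of b is at most the form at b and a;
  Cauchy-Schwarz and the upper bound of the form at b and b leave a power of the norm to cancel.
  This compares Euclidean with metric speed, uniformly up to the boundary.\<close>

lemma Kop_norm_le:
  obtains C where "C > 0" "\<And>\<rho> a. \<rho> \<in> dens D \<Longrightarrow> a \<in> A \<Longrightarrow> (norm (Kop D \<rho> a))\<^sup>2 \<le> C * Re (kform \<rho> a a)"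
proof -
  obtain C where C: "C > 0" "\<And>\<rho> a. \<rho> \<in> dens D \<Longrightarrow> a \<in> A \<Longrightarrow> Re (kform \<rho> a a) \<le> C * (norm a)\<^sup>2"
    using kform_le by blast
  obtain c where c: "c > 0" "\<And>a. a \<in> A \<Longrightarrow> c * (norm a)\<^sup>2 \<le> Re (\<tau> (adj a ** a))"
    using pos_def_on_coercive[OF subspace_alg tr_bilinear tr_sq_pos] by blast
  have "(norm (Kop D \<rho> a))\<^sup>2 \<le> C / c\<^sup>2 * Re (kform \<rho> a a)" if \<rho>: "\<rho> \<in> dens D" and a: "a \<in> A" for \<rho> a
  proof -
    note r = dens_in[OF \<rho>] dens_herm[OF \<rho>]
    let ?b = "Kop D \<rho> a"
    have b: "?b \<in> A" by (rule Kop_in[OF r a])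
    have "(c * (norm ?b)\<^sup>2)\<^sup>2 \<le> (Re (\<tau> (adj ?b ** ?b)))\<^sup>2"
      using c(2)[OF b] c(1) by (intro power_mono) auto
    also have "\<dots> = (Re (kform \<rho> ?b a))\<^sup>2" by (simp add: Kop_form[OF r b a])
    also have "\<dots> \<le> Re (kform \<rho> ?b ?b) * Re (kform \<rho> a a)" by (rule kform_cs[OF \<rho> b a])
    also have "\<dots> \<le> (C * (norm ?b)\<^sup>2) * Re (kform \<rho> a a)"
      using C(2)[OF \<rho> b] kform_nonneg[OF \<rho> a] by (rule mult_right_mono)
    finally have *: "(norm ?b)\<^sup>2 * (c\<^sup>2 * (norm ?b)\<^sup>2) \<le> (norm ?b)\<^sup>2 * (C * Re (kform \<rho> a a))"
      by (simp add: power2_eq_square mult_ac)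
    show ?thesis
    proof (cases "?b = 0")
      case True
      then show ?thesis using C c kform_nonneg[OF \<rho> a] by simp
    next
      case False
      then have "c\<^sup>2 * (norm ?b)\<^sup>2 \<le> C * Re (kform \<rho> a a)" using * by simp
      then show ?thesis using c by (simp add: field_simps)
    qed
  qed
  then show ?thesis using C c that[of "C / c\<^sup>2"] by simp
qed

lemma dens_pos_iff_ge:
  "\<rho> \<in> dens_pos D \<longleftrightarrow> \<rho> \<in> dens D \<and> (\<exists>l>0. \<forall>v. l * (norm v)\<^sup>2 \<le> Re (quad_form \<rho> v))"
  using pos_def_iff_ge[of \<rho>] dens_pos_dens[of \<rho>] dens_herm[of \<rho>]
  by (auto simp: dens_pos_def dens_def)

lemma eigvals_ge:
  assumes "\<rho> \<in> dens D" "\<And>v. l * (norm v)\<^sup>2 \<le> Re (quad_form \<rho> v)" "x \<in> eigvals \<rho>"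
  shows "l \<le> x"
  using eigvals_ge_iff[OF dens_herm[OF assms(1)], of l] assms by blast

text \<open>A perturbation of norm below l / (2 K) changes the quadratic form by at most half of its
  lower bound l.\<close>

lemma dens_pos_open_ge:
  assumes "\<rho> \<in> dens_pos D"
  obtains l r where "l > 0" "r > 0" "\<And>x. x \<in> eigvals \<rho> \<Longrightarrow> l \<le> x"
    "\<And>\<nu>. \<nu> \<in> dens D \<Longrightarrow> norm (\<nu> - \<rho>) < r \<Longrightarrow> \<nu> \<in> dens_pos D"
    "\<And>\<nu> x. \<nu> \<in> dens D \<Longrightarrow> norm (\<nu> - \<rho>) < r \<Longrightarrow> x \<in> eigvals \<nu> \<Longrightarrow> l \<le> x"
proof -
  obtain K where K: "K > 0" "\<And>(M :: complex^'n^'n) v. \<bar>Re (quad_form M v)\<bar> \<le> K * norm M * (norm v)\<^sup>2"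
    using quad_form_bound by blast
  obtain l where l: "l > 0" "\<And>v. l * (norm v)\<^sup>2 \<le> Re (quad_form \<rho> v)"
    using assms dens_pos_iff_ge by blast
  have *: "\<nu> \<in> dens_pos D" "\<And>x. x \<in> eigvals \<nu> \<Longrightarrow> l / 2 \<le> x"
    if \<nu>: "\<nu> \<in> dens D" "norm (\<nu> - \<rho>) < l / (2 * K)" for \<nu>
  proof -
    have ge: "l / 2 * (norm v)\<^sup>2 \<le> Re (quad_form \<nu> v)" for v
    proof -
      have "K * norm (\<nu> - \<rho>) \<le> l / 2" using \<nu>(2) K(1) by (simp add: field_simps)
      then have "K * norm (\<nu> - \<rho>) * (norm v)\<^sup>2 \<le> l / 2 * (norm v)\<^sup>2" by (rule mult_right_mono) simp
      then have "- (l / 2 * (norm v)\<^sup>2) \<le> Re (quad_form (\<nu> - \<rho>) v)"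
        using K(2)[of "\<nu> - \<rho>" v] by linarith
      moreover have "Re (quad_form \<nu> v) = Re (quad_form \<rho> v) + Re (quad_form (\<nu> - \<rho>) v)"
        using quad_form_add[of \<rho> "\<nu> - \<rho>" v] by simp
      ultimately show ?thesis using l(2)[of v] by linarith
    qed
    then show "\<nu> \<in> dens_pos D"
      unfolding dens_pos_iff_ge using \<nu> l by (intro conjI exI[of _ "l / 2"]) auto
    show "l / 2 \<le> x" if "x \<in> eigvals \<nu>" for x by (rule eigvals_ge[OF \<nu>(1) ge that])
  qed
  show ?thesis
  proof (rule that)
    show "0 < l / 2" "0 < l / (2 * K)" using l K by simp_all
    show "l / 2 \<le> x" if "x \<in> eigvals \<rho>" for x
      using *(2)[OF dens_pos_dens[OF assms], of x] that l K by simp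
  qed (fact *)+
qed

lemma dens_convex:
  assumes "\<rho> \<in> dens D" "\<nu> \<in> dens D" "0 \<le> t" "t \<le> 1"
  shows "(1 - t) *\<^sub>R \<rho> + t *\<^sub>R \<nu> \<in> dens D"
proof -
  have "0 \<le> (1 - t) * Re (quad_form \<rho> v) + t * Re (quad_form \<nu> v)" for v
    using assms by (intro add_nonneg_nonneg mult_nonneg_nonneg) (auto simp: dens_def pos_semidef_def)
  then show ?thesis using assms
    by (simp add: dens_def pos_semidef_def adj_add adj_scaleR quad_form_add quad_form_scaleR tr_add
        tr_scaleR flip: of_real_add)
qed

lemma dens_pos_mix:
  assumes "\<rho> \<in> dens D" "\<nu> \<in> dens_pos D" "0 < t" "t \<le> 1"
  shows "(1 - t) *\<^sub>R \<rho> + t *\<^sub>R \<nu> \<in> dens_pos D"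
proof -
  obtain l where l: "l > 0" "\<And>v. l * (norm v)\<^sup>2 \<le> Re (quad_form \<nu> v)"
    using assms dens_pos_iff_ge by blast
  have "t * l * (norm v)\<^sup>2 \<le> Re (quad_form ((1 - t) *\<^sub>R \<rho> + t *\<^sub>R \<nu>) v)" for v
  proof -
    have "t * (l * (norm v)\<^sup>2) \<le> t * Re (quad_form \<nu> v)" using l assms by (intro mult_left_mono) auto
    moreover have "0 \<le> (1 - t) * Re (quad_form \<rho> v)"
      using assms by (intro mult_nonneg_nonneg) (auto simp: dens_def pos_semidef_def)
    ultimately show ?thesis by (simp add: quad_form_add quad_form_scaleR mult.assoc)
  qed
  then show ?thesis unfolding dens_pos_iff_ge
    using dens_convex[OF assms(1) dens_pos_dens[OF assms(2)]] assms l
    by (intro conjI exI[of _ "t * l"]) auto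
qed

end

section \<open>Ergodic structures\<close>

locale erg_diffstr = diffstr D for D :: "('n::finite, 'm::finite, 'j) diff_struct" +
  assumes erg: "ergodic D"
begin

text \<open>Ergodicity enters here: if every derivation annihilates \<open>a\<close>, so does the
  generator, hence \<open>a\<close> is a multiple of the identity, and its trace decides.\<close>

lemma dirichlet_pos:
  assumes a: "a \<in> A" "\<tau> a = 0" "a \<noteq> 0"
  shows "0 < dirichlet w a a"
proof -
  have nn: "0 \<le> exp (w * \<bar>freq D j\<bar>) * Re (btr D j (adj (pderiv_j D j a) ** pderiv_j D j a))"
    if "j \<in> idx D" for j
  proof -
    interpret diff_index D j by (rule index) fact
    show ?thesis using a by (intro mult_nonneg_nonneg B.tr_sq_nonneg) auto
  qed
  have "dirichlet w a a \<noteq> 0"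
  proof
    assume "dirichlet w a a = 0"
    then have *: "exp (w * \<bar>freq D j\<bar>) * Re (btr D j (adj (pderiv_j D j a) ** pderiv_j D j a)) = 0"
      if "j \<in> idx D" for j
      using nn that unfolding dirichlet_def by (subst (asm) sum_nonneg_eq_0_iff) auto
    have "pderiv_j D j a = 0" if "j \<in> idx D" for j
    proof -
      interpret diff_index D j by (rule index) fact
      show ?thesis using *[OF that] a B.tr_sq_pos[of "pd a"] by fastforce
    qed
    then have "a \<in> {a \<in> A. generator D a = 0}" using a generator_zero by simp
    then obtain c where "a = c *\<^sub>C mat 1" using erg by (auto simp: ergodic_def)
    then show False using a tr_cscale[OF one_in, of c] tr_one_nz by auto
  qed
  moreover have "0 \<le> dirichlet w a a" unfolding dirichlet_def using nn by (rule sum_nonneg)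
  ultimately show ?thesis by simp
qed

text \<open>The same \<open>c\<close> serves all densities; \<rho> enters only through the lower
  bound \<open>l\<close> of its spectrum, which makes the degeneration at the boundary
  explicit.\<close>

lemma kform_ge:
  obtains c where "c > 0" "\<And>\<rho> a l. \<rho> \<in> dens D \<Longrightarrow> a \<in> A \<Longrightarrow> \<tau> a = 0 \<Longrightarrow> 0 \<le> l \<Longrightarrow>
    (\<And>v. l * (norm v)\<^sup>2 \<le> Re (quad_form \<rho> v)) \<Longrightarrow> l * (c * (norm a)\<^sup>2) \<le> Re (kform \<rho> a a)"
proof -
  obtain U where U: "U > 0" "\<And>\<rho> x. \<rho> \<in> dens D \<Longrightarrow> x \<in> eigvals \<rho> \<Longrightarrow> x \<le> U"
    using dens_eigvals_le by blast
  let ?S = "{a \<in> A. \<tau> a = 0}"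
  have S: "subspace ?S" by (auto simp: subspace_def tr_add tr_scaleR)
  moreover have "bilinear_on ?S (dirichlet (- 1 / 2))"
    using dirichlet_bilinear unfolding bilinear_on_def by blast
  ultimately obtain c where c: "c > 0" "\<And>a. a \<in> ?S \<Longrightarrow> c * (norm a)\<^sup>2 \<le> dirichlet (- 1 / 2) a a"
    using pos_def_on_coercive[of ?S "dirichlet (- 1 / 2)"] dirichlet_pos by blast
  have "l * (c * (norm a)\<^sup>2) \<le> Re (kform \<rho> a a)"
    if \<rho>: "\<rho> \<in> dens D" and a: "a \<in> A" "\<tau> a = 0" and l: "0 \<le> l" "\<And>v. l * (norm v)\<^sup>2 \<le> Re (quad_form \<rho> v)" for \<rho> a l
  proof -
    have "l * (c * (norm a)\<^sup>2) \<le> l * dirichlet (- 1 / 2) a a"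
      using c(2)[of a] a l by (intro mult_left_mono) auto
    also have "\<dots> \<le> Re (kform \<rho> a a)"
      using kform_bounds(1)[OF dens_in[OF \<rho>] dens_herm[OF \<rho>] a(1) l(1)] eigvals_ge[OF \<rho> l(2)] U(2)[OF \<rho>] by blast
    finally show ?thesis .
  qed
  then show ?thesis using c that by blast
qed

lemma Re_kform_pos:
  assumes "\<rho> \<in> dens_pos D" "a \<in> tangent D" "a \<noteq> 0"
  shows "0 < Re (kform \<rho> a a)"
proof -
  obtain c where c: "c > 0" "\<And>\<rho> a l. \<rho> \<in> dens D \<Longrightarrow> a \<in> A \<Longrightarrow> \<tau> a = 0 \<Longrightarrow> 0 \<le> l \<Longrightarrow>
    (\<And>v. l * (norm v)\<^sup>2 \<le> Re (quad_form \<rho> v)) \<Longrightarrow> l * (c * (norm a)\<^sup>2) \<le> Re (kform \<rho> a a)"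
    using kform_ge by blast
  obtain l where l: "l > 0" "\<And>v. l * (norm v)\<^sup>2 \<le> Re (quad_form \<rho> v)"
    using assms(1) dens_pos_iff_ge by blast
  have "l * (c * (norm a)\<^sup>2) \<le> Re (kform \<rho> a a)"
    using c(2)[OF dens_pos_dens[OF assms(1)] _ _ _ l(2), of a] l(1) assms(2) by (auto simp: tangent_def)
  moreover have "0 < l * (c * (norm a)\<^sup>2)" using l c assms by simp
  ultimately show ?thesis by linarith
qed

text \<open>The representation theorem solves the equation only against tangent vectors; the defect
  \<open>Kop D \<rho> a - v\<close> is itself tangent, and testing with it shows that it
  vanishes.\<close>

lemma Kop_surj:
  assumes \<rho>: "\<rho> \<in> dens_pos D" and v: "v \<in> tangent D"
  obtains a where "a \<in> tangent D" "Kop D \<rho> a = v"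
proof -
  note r = dens_pos_in[OF \<rho>] dens_pos_herm[OF \<rho>]
  have "\<exists>a\<in>tangent D. \<forall>b\<in>tangent D. Re (kform \<rho> b a) = Re (\<tau> (adj b ** v))"
    by (rule riesz_on[OF tangent_subspace bilinear_on_tangent[OF kform_bilinear[OF r]] Re_kform_pos[OF \<rho>]])
      (use v tangent_in in \<open>auto simp: adj_add matrix_add_rdistrib tr_add adj_scaleR scaleR_cscale
        adj_cscale tr_cscale\<close>)
  then obtain a where a: "a \<in> tangent D" "\<And>b. b \<in> tangent D \<Longrightarrow> Re (kform \<rho> b a) = Re (\<tau> (adj b ** v))"
    by blast
  define w where "w = Kop D \<rho> a - v"
  have w: "w \<in> tangent D"
    unfolding w_def using Kop_tangent[OF r a(1)] v tangent_subspace by (simp add: subspace_diff)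
  have "Re (\<tau> (adj w ** w)) = Re (kform \<rho> w a) - Re (\<tau> (adj w ** v))"
    using Kop_form[OF r tangent_in[OF w] tangent_in[OF a(1)]] w v Kop_in[OF r tangent_in[OF a(1)]]
    by (simp add: w_def[THEN arg_cong[of _ _ "\<lambda>z. adj w ** z"]] mm.diff_right tr_diff tangent_in)
  then have "w = 0" using a(2)[OF w] tr_sq_pos[OF tangent_in[OF w]] by force
  then show ?thesis using that a(1) by (simp add: w_def)
qed

text \<open>With e the energy and v the velocity, e \<le> C |a| |v| and l c |a|^2 \<le> e;
  eliminating |a| gives the bound. The factor 1 / l is what the lift towards \<sigma> in
  \<open>short_curve\<close> compensates.\<close>

lemma kform_le_Kop:
  obtains C where "C > 0" "\<And>\<rho> a l. \<rho> \<in> dens D \<Longrightarrow> a \<in> tangent D \<Longrightarrow> 0 < l \<Longrightarrow>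
    (\<And>v. l * (norm v)\<^sup>2 \<le> Re (quad_form \<rho> v)) \<Longrightarrow> Re (kform \<rho> a a) \<le> C * (norm (Kop D \<rho> a))\<^sup>2 / l"
proof -
  obtain c where c: "c > 0" "\<And>\<rho> a l. \<rho> \<in> dens D \<Longrightarrow> a \<in> A \<Longrightarrow> \<tau> a = 0 \<Longrightarrow> 0 \<le> l \<Longrightarrow>
    (\<And>v. l * (norm v)\<^sup>2 \<le> Re (quad_form \<rho> v)) \<Longrightarrow> l * (c * (norm a)\<^sup>2) \<le> Re (kform \<rho> a a)"
    using kform_ge by blast
  obtain C where C: "C > 0" "\<And>x y. x \<in> A \<Longrightarrow> y \<in> A \<Longrightarrow> \<bar>Re (\<tau> (adj x ** y))\<bar> \<le> C * norm x * norm y"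
    using bilinear_on_bounded[OF subspace_alg tr_bilinear] by blast
  have "Re (kform \<rho> a a) \<le> (C\<^sup>2 / c) * (norm (Kop D \<rho> a))\<^sup>2 / l"
    if \<rho>: "\<rho> \<in> dens D" and a: "a \<in> tangent D" and l: "0 < l" "\<And>v. l * (norm v)\<^sup>2 \<le> Re (quad_form \<rho> v)" for \<rho> a l
  proof -
    note r = dens_in[OF \<rho>] dens_herm[OF \<rho>]
    let ?e = "Re (kform \<rho> a a)"
    have e0: "0 \<le> ?e" using kform_nonneg[OF \<rho> tangent_in[OF a]] .
    have 1: "l * (c * (norm a)\<^sup>2) \<le> ?e" using c(2)[OF \<rho> _ _ _ l(2), of a] l(1) a by (auto simp: tangent_def)
    have "?e = Re (\<tau> (adj a ** Kop D \<rho> a))" using Kop_form[OF r tangent_in[OF a] tangent_in[OF a]] by simp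
    also have "\<dots> \<le> C * norm a * norm (Kop D \<rho> a)"
      using C(2)[OF tangent_in[OF a] Kop_in[OF r tangent_in[OF a]]] by simp
    finally have "?e\<^sup>2 \<le> (C * norm a * norm (Kop D \<rho> a))\<^sup>2" using e0 by (rule power_mono)
    then have "l * c * ?e\<^sup>2 \<le> l * c * (C * norm a * norm (Kop D \<rho> a))\<^sup>2"
      using l c by (intro mult_left_mono) auto
    also have "\<dots> = (l * (c * (norm a)\<^sup>2)) * (C\<^sup>2 * (norm (Kop D \<rho> a))\<^sup>2)" by (simp add: power_mult_distrib mult_ac)
    also have "\<dots> \<le> ?e * (C\<^sup>2 * (norm (Kop D \<rho> a))\<^sup>2)" using 1 by (rule mult_right_mono) simp
    finally have *: "?e * (l * c * ?e) \<le> ?e * (C\<^sup>2 * (norm (Kop D \<rho> a))\<^sup>2)"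
      by (simp add: power2_eq_square mult_ac)
    show ?thesis
    proof (cases "?e = 0")
      case True
      then show ?thesis using l c by simp
    next
      case False
      then have "l * c * ?e \<le> C\<^sup>2 * (norm (Kop D \<rho> a))\<^sup>2" using * e0 by simp
      then show ?thesis using l c by (simp add: field_simps)
    qed
  qed
  then show ?thesis using C c that[of "C\<^sup>2 / c"] by simp
qed

end

section \<open>A power series for the logarithmic mean\<close>

text \<open>By homogeneity the logarithmic mean of x and y is y times this function at x / y; the
  value at 1 fills the removable singularity.\<close>

definition phi :: "complex \<Rightarrow> complex" where
  "phi z = (if z = 1 then 1 else (z - 1) / Ln z)"

text \<open>On the right half-plane \<open>Ln\<close> vanishes only at 1, where the quotient tends
  to the inverse of the derivative of \<open>Ln\<close>.\<close>

lemma phi_holomorphic: "phi holomorphic_on {z. 0 < Re z}"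
proof (rule no_isolated_singularity'[where K="{1}"])
  show "open {z. 0 < Re z}" by (rule open_halfspace_Re_gt)
  have nz: "Ln z \<noteq> 0" if "0 < Re z" "z \<noteq> 1" for z
  proof
    assume "Ln z = 0"
    moreover have "z \<noteq> 0" using that by auto
    ultimately show False using exp_Ln[of z] that by simp
  qed
  have "(\<lambda>z. (z - 1) / Ln z) holomorphic_on ({z. 0 < Re z} - {1})"
    by (intro holomorphic_intros) (use nz in \<open>auto simp: complex_nonpos_Reals_iff\<close>)
  then show "phi holomorphic_on ({z. 0 < Re z} - {1})"
    by (rule holomorphic_transform) (simp add: phi_def)
  have "(Ln has_field_derivative inverse 1) (at 1)"
    by (rule has_field_derivative_Ln) (auto simp: complex_nonpos_Reals_iff)
  then have "((\<lambda>y. (Ln y - Ln 1) / (y - 1)) \<longlongrightarrow> 1) (at 1)"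
    by (simp add: has_field_derivative_iff)
  then have "((\<lambda>y. inverse ((Ln y - Ln 1) / (y - 1))) \<longlongrightarrow> inverse 1) (at 1)"
    by (rule tendsto_inverse) simp
  then have "((\<lambda>y. (y - 1) / Ln y) \<longlongrightarrow> 1) (at 1)"
    by simp
  then have "(phi \<longlongrightarrow> 1) (at 1)"
    by (rule Lim_transform_eventually) (auto simp: phi_def eventually_at_filter)
  then have lim1: "(phi \<longlongrightarrow> phi 1) (at 1)" by (simp add: phi_def)
  then show "(phi \<longlongrightarrow> phi z) (at z within {z. 0 < Re z})" if "z \<in> {1}" for z
    using that tendsto_within_subset[OF lim1, of "{z. 0 < Re z}"] by simp
qed simp

lemma phi_of_real:
  assumes "0 < x" "0 < y" shows "complex_of_real (log_mean x y) = complex_of_real y * phi (complex_of_real (x / y))"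
proof (cases "x = y")
  case False
  have "Ln (complex_of_real (x / y)) = complex_of_real (ln x - ln y)"
    using assms by (subst Ln_of_real) (auto simp: ln_div)
  moreover have "complex_of_real (x / y) \<noteq> 1"
    using False assms by (simp only: of_real_eq_1_iff) simp
  ultimately have "complex_of_real y * phi (complex_of_real (x / y)) =
      complex_of_real (y * ((x / y - 1) / (ln x - ln y)))"
    by (simp add: phi_def)
  also have "y * ((x / y - 1) / (ln x - ln y)) = log_mean x y"
    using False assms by (simp add: log_mean_def field_simps)
  finally show ?thesis by simp
qed (use assms in \<open>simp add: log_mean_def phi_def\<close>)

text \<open>Expanding at a large c instead of 1 gives a disc reaching from 0 to 2 c, so that all
  quotients of eigenvalues occurring near a given density fit into one disc.\<close>

lemma phi_series:
  assumes "0 < c"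
  obtains a where "\<And>w. cmod (w - complex_of_real c) < c \<Longrightarrow> (\<lambda>n. a n * (w - complex_of_real c) ^ n) sums phi w"
    "\<And>q. 0 \<le> q \<Longrightarrow> q < c \<Longrightarrow> summable (\<lambda>n. cmod (a n) * q ^ n)"
proof -
  define a where "a n = (deriv ^^ n) phi (complex_of_real c) / fact n" for n
  have "ball (complex_of_real c) c \<subseteq> {z. 0 < Re z}"
  proof
    fix z assume "z \<in> ball (complex_of_real c) c"
    then have "\<bar>Re (complex_of_real c - z)\<bar> < c"
      using abs_Re_le_cmod[of "complex_of_real c - z"] by (simp add: dist_norm)
    then show "z \<in> {z. 0 < Re z}" by auto
  qed
  then have hol: "phi holomorphic_on ball (complex_of_real c) c"
    using phi_holomorphic holomorphic_on_subset by blast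
  have 1: "(\<lambda>n. a n * (w - complex_of_real c) ^ n) sums phi w" if "cmod (w - complex_of_real c) < c" for w
    using holomorphic_power_series[OF hol, of w] that by (simp add: a_def dist_norm norm_minus_commute)
  have 2: "summable (\<lambda>n. cmod (a n) * q ^ n)" if q: "0 \<le> q" "q < c" for q
  proof -
    \<comment> \<open>Absolute convergence at q follows from convergence at a larger point.\<close>
    define q' where "q' = (q + c) / 2"
    have q': "q < q'" "q' < c" "0 \<le> q'" using q by (auto simp: q'_def)
    have "(\<lambda>n. a n * (complex_of_real (c + q') - complex_of_real c) ^ n) sums phi (complex_of_real (c + q'))"
      by (rule 1) (use q' in simp)
    then have "summable (\<lambda>n. a n * complex_of_real q' ^ n)"
      by (simp add: sums_iff)
    then have "summable (\<lambda>n. norm (a n * complex_of_real q ^ n))"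
      by (rule powser_insidea) (use q q' in simp)
    then show ?thesis using q by (simp add: norm_mult norm_power)
  qed
  show ?thesis using that 1 2 by blast
qed

section \<open>Inverse matrices\<close>

lemma invertible_matrix_inv:
  assumes "invertible (M :: 'a::field^'n^'n)"
  shows "M ** matrix_inv M = mat 1" "matrix_inv M ** M = mat 1"
proof -
  have "M ** matrix_inv M = mat 1 \<and> matrix_inv M ** M = mat 1"
    using assms unfolding matrix_inv_def invertible_def by (rule someI_ex)
  then show "M ** matrix_inv M = mat 1" "matrix_inv M ** M = mat 1" by auto
qed

text \<open>Cramer's rule makes the entries rational in those of \<open>M\<close>; continuity,
  holomorphy and analyticity of inverses all come from here.\<close>

lemma matrix_inv_nth:
  assumes "invertible (M :: 'a::field^'n^'n)"
  shows "matrix_inv M $ i $ j =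
    det (\<chi> a b. if b = i then (mat 1 :: 'a^'n^'n) $ a $ j else M $ a $ b) / det M"
proof -
  define x where "x = (\<chi> a. matrix_inv M $ a $ j)"
  define b where "b = (\<chi> a. (mat 1 :: 'a^'n^'n) $ a $ j)"
  have "M *v x = b"
    unfolding vec_eq_iff b_def x_def invertible_matrix_inv(1)[OF assms, symmetric]
    by (simp add: matrix_vector_mult_def matrix_matrix_mult_def)
  then have "x = (\<chi> k. det (\<chi> i j. if j = k then b $ i else M $ i $ j) / det M)"
    using cramer[of M x b] assms by (simp add: invertible_det_nz)
  then have "x $ i = det (\<chi> a b'. if b' = i then b $ a else M $ a $ b') / det M" by simp
  then show ?thesis unfolding x_def b_def vec_lambda_beta .
qed

lemma tendsto_det:
  fixes f :: "'a \<Rightarrow> complex^'n^'n"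
  assumes "\<And>i j. ((\<lambda>x. f x $ i $ j) \<longlongrightarrow> M $ i $ j) F"
  shows "((\<lambda>x. det (f x)) \<longlongrightarrow> det M) F"
  unfolding det_def by (intro tendsto_sum tendsto_mult tendsto_const tendsto_prod assms)

lemma tendsto_matrix_inv:
  fixes f :: "'a \<Rightarrow> complex^'n^'n"
  assumes f: "(f \<longlongrightarrow> M) F" and M: "invertible M"
  shows "((\<lambda>x. matrix_inv (f x)) \<longlongrightarrow> matrix_inv M) F" "\<forall>\<^sub>F x in F. invertible (f x)"
proof -
  have f': "((\<lambda>x. f x $ i $ j) \<longlongrightarrow> M $ i $ j) F" for i j
    by (intro tendsto_vec_nth f)
  have "((\<lambda>x. det (f x)) \<longlongrightarrow> det M) F" by (rule tendsto_det[OF f'])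
  moreover have "det M \<noteq> 0" using M invertible_det_nz by blast
  ultimately have "\<forall>\<^sub>F x in F. det (f x) \<noteq> 0" by (rule tendsto_imp_eventually_ne)
  then show ev: "\<forall>\<^sub>F x in F. invertible (f x)" by (simp add: invertible_det_nz)
  have "((\<lambda>x. matrix_inv (f x) $ i $ j) \<longlongrightarrow> matrix_inv M $ i $ j) F" for i j
  proof -
    have "((\<lambda>x. (if b = i then (mat 1 :: complex^'n^'n) $ a $ j else f x $ a $ b)) \<longlongrightarrow>
        (if b = i then (mat 1 :: complex^'n^'n) $ a $ j else M $ a $ b)) F" for a b
      using f' by simp
    then have "((\<lambda>x. det (\<chi> a b. if b = i then (mat 1 :: complex^'n^'n) $ a $ j else f x $ a $ b) / det (f x))
      \<longlongrightarrow> matrix_inv M $ i $ j) F"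
      unfolding matrix_inv_nth[OF M]
      by (intro tendsto_divide tendsto_det f' \<open>det M \<noteq> 0\<close>) simp
    then show ?thesis
      by (rule Lim_transform_eventually) (use ev in eventually_elim, simp add: matrix_inv_nth)
  qed
  then show "((\<lambda>x. matrix_inv (f x)) \<longlongrightarrow> matrix_inv M) F"
    by (intro vec_tendstoI)
qed

lemma holomorphic_on_det:
  assumes "\<And>i j. (\<lambda>z. f z $ i $ j) holomorphic_on S"
  shows "(\<lambda>z. det (f z)) holomorphic_on S"
  unfolding det_def by (intro holomorphic_intros assms)

lemma holomorphic_on_matrix_inv:
  fixes f :: "complex \<Rightarrow> complex^'n^'n"
  assumes f: "\<And>i j. (\<lambda>z. f z $ i $ j) holomorphic_on S" and inv: "\<And>z. z \<in> S \<Longrightarrow> invertible (f z)"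
  shows "(\<lambda>z. matrix_inv (f z) $ i $ j) holomorphic_on S"
proof -
  have "(\<lambda>z. (if b = i then (mat 1 :: complex^'n^'n) $ a $ j else f z $ a $ b)) holomorphic_on S" for a b
    using f by (cases "b = i") simp_all
  then have "(\<lambda>z. det (\<chi> a b. if b = i then (mat 1 :: complex^'n^'n) $ a $ j else f z $ a $ b) / det (f z)) holomorphic_on S"
    by (intro holomorphic_on_divide holomorphic_on_det f) (use inv in \<open>auto simp: invertible_det_nz\<close>)
  then show ?thesis
    by (rule holomorphic_transform) (simp add: matrix_inv_nth inv)
qed

lemma holomorphic_on_matrix_mult:
  assumes "\<And>i j. (\<lambda>z. f z $ i $ j) holomorphic_on S" "\<And>i j. (\<lambda>z. g z $ i $ j) holomorphic_on S"
  shows "(\<lambda>z. (f z ** g z :: complex^'k^'n) $ i $ j) holomorphic_on S"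
  unfolding matrix_matrix_mult_def by (simp, intro holomorphic_intros assms)

section \<open>The contraction as a power series\<close>

context diff_index
begin

text \<open>With \<open>\<Delta> X = e\<^sup>\<omega> \<ell>(M) X r(M)\<^sup>-\<^sup>1\<close>, the contraction is \<open>e\<^sup>-\<^sup>\<omega>\<^sup>/\<^sup>2 phi(\<Delta>) X r(M)\<close>; the power series
  of \<open>phi\<close> at \<open>c\<close> makes sense also for matrices \<open>M\<close> that are not self-adjoint.\<close>

definition shift :: "real \<Rightarrow> complex^'n^'n \<Rightarrow> complex^'m^'m \<Rightarrow> complex^'m^'m" where
  "shift c M X = complex_of_real (exp \<omega>) *\<^sub>C (\<l> M ** X ** matrix_inv (\<r> M)) - complex_of_real c *\<^sub>C X"

definition term_k :: "(nat \<Rightarrow> complex) \<Rightarrow> real \<Rightarrow> complex^'m^'m \<Rightarrow> nat \<Rightarrow> complex^'n^'n \<Rightarrow> complex^'m^'m" where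
  "term_k a c X k M = a k *\<^sub>C (((shift c M ^^ k) X) ** (complex_of_real (exp (- \<omega> / 2)) *\<^sub>C \<r> M))"

text \<open>The symbol is the quotient of the two arguments of \<theta>, shifted by
  \<open>c\<close>.\<close>

lemma shift_dsum:
  assumes "\<rho> \<in> dens_pos D"
  shows "shift c \<rho> X = dsum (\<lambda>x y. exp \<omega> * x / y - c) \<rho> X"
proof -
  note r = dens_pos_in[OF assms] dens_pos_herm[OF assms]
  note inv = invertible_hom[OF r less_imp_neq[OF dens_pos_eigvals[OF assms], symmetric]]
  have "\<l> \<rho> ** X ** matrix_inv (\<r> \<rho>) = dsum (\<lambda>x y. x) \<rho> (dsum (\<lambda>x y. inverse y) \<rho> X)"
    using dsum_left[OF r, of "\<lambda>x. x"] dsum_right[OF r, of inverse]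
    by (simp add: inv herm_fun_id[OF r(2)] matrix_mul_assoc)
  also have "\<dots> = dsum (\<lambda>x y. x * inverse y) \<rho> X" by (rule dsum_dsum[OF r])
  finally have "shift c \<rho> X = dsum (\<lambda>x y. exp \<omega> * (x * inverse y) + - c) \<rho> X"
    unfolding shift_def dsum_add_fun dsum_scale_fun dsum_const[OF r] by (simp add: cscale_minus)
  then show ?thesis by (simp add: divide_inverse mult.assoc)
qed

lemma shift_pow_dsum:
  assumes "\<rho> \<in> dens_pos D"
  shows "(shift c \<rho> ^^ k) X = dsum (\<lambda>x y. (exp \<omega> * x / y - c) ^ k) \<rho> X"
proof (induction k)
  case 0
  then show ?case using dsum_const[OF dens_pos_in[OF assms] dens_pos_herm[OF assms], of 1] by simp
next
  case (Suc k)
  then show ?case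
    using dsum_dsum[OF dens_pos_in[OF assms] dens_pos_herm[OF assms]] by (simp add: shift_dsum[OF assms])
qed

lemma sum_term_k_dens:
  assumes "\<rho> \<in> dens_pos D"
  shows "(\<Sum>k<N. term_k a c X k \<rho>) = (\<Sum>x\<in>eigvals \<rho>. \<Sum>y\<in>eigvals \<rho>.
    (complex_of_real (exp (- \<omega> / 2) * y) * (\<Sum>k<N. a k * complex_of_real (exp \<omega> * x / y - c) ^ k)) *\<^sub>C
      (\<l> (eigproj \<rho> x) ** X ** \<r> (eigproj \<rho> y)))"
proof -
  note r = dens_pos_in[OF assms] dens_pos_herm[OF assms]
  have "term_k a c X k \<rho> = (\<Sum>x\<in>eigvals \<rho>. \<Sum>y\<in>eigvals \<rho>.
    (complex_of_real (exp (- \<omega> / 2) * y) * (a k * complex_of_real (exp \<omega> * x / y - c) ^ k)) *\<^sub>C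
      (\<l> (eigproj \<rho> x) ** X ** \<r> (eigproj \<rho> y)))" for k
  proof -
    have "(shift c \<rho> ^^ k) X ** \<r> \<rho> = dsum (\<lambda>x y. y) \<rho> (dsum (\<lambda>x y. (exp \<omega> * x / y - c) ^ k) \<rho> X)"
      using dsum_right[OF r, of "\<lambda>x. x"] by (simp add: shift_pow_dsum[OF assms] herm_fun_id[OF r(2)])
    also have "\<dots> = dsum (\<lambda>x y. y * (exp \<omega> * x / y - c) ^ k) \<rho> X" by (rule dsum_dsum[OF r])
    finally have "term_k a c X k \<rho> = (a k * complex_of_real (exp (- \<omega> / 2))) *\<^sub>C
        dsum (\<lambda>x y. y * (exp \<omega> * x / y - c) ^ k) \<rho> X"
      by (simp add: term_k_def)
    then show ?thesis by (simp add: dsum_def cscale_sum mult_ac)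
  qed
  then have "(\<Sum>k<N. term_k a c X k \<rho>) = (\<Sum>k<N. \<Sum>x\<in>eigvals \<rho>. \<Sum>y\<in>eigvals \<rho>.
    (complex_of_real (exp (- \<omega> / 2) * y) * (a k * complex_of_real (exp \<omega> * x / y - c) ^ k)) *\<^sub>C
      (\<l> (eigproj \<rho> x) ** X ** \<r> (eigproj \<rho> y)))" by simp
  also have "\<dots> = (\<Sum>x\<in>eigvals \<rho>. \<Sum>y\<in>eigvals \<rho>. \<Sum>k<N.
    (complex_of_real (exp (- \<omega> / 2) * y) * (a k * complex_of_real (exp \<omega> * x / y - c) ^ k)) *\<^sub>C
      (\<l> (eigproj \<rho> x) ** X ** \<r> (eigproj \<rho> y)))"
    by (subst sum.swap) (intro sum.cong refl sum.swap)
  finally show ?thesis by (simp add: cscale_sum_left sum_distrib_left)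
qed

text \<open>Quotients between 0 and 2 c lie in the disc of convergence, and the finitely many blocks
  converge one by one.\<close>

lemma sum_term_k_tendsto:
  assumes \<rho>: "\<rho> \<in> dens_pos D"
    and a: "\<And>w. cmod (w - complex_of_real c) < c \<Longrightarrow> (\<lambda>n. a n * (w - complex_of_real c) ^ n) sums phi w"
    and c: "\<And>x y. x \<in> eigvals \<rho> \<Longrightarrow> y \<in> eigvals \<rho> \<Longrightarrow> exp \<omega> * x / y < 2 * c"
  shows "(\<lambda>N. \<Sum>k<N. term_k a c X k \<rho>) \<longlonglongrightarrow> rho_contract D j \<rho> X"
proof -
  have lim: "(\<lambda>N. complex_of_real (exp (- \<omega> / 2) * y) * (\<Sum>k<N. a k * complex_of_real (exp \<omega> * x / y - c) ^ k))
      \<longlonglongrightarrow> complex_of_real (theta D j x y)" if x: "x \<in> eigvals \<rho>" and y: "y \<in> eigvals \<rho>" for x y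
  proof -
    have xy: "0 < x" "0 < y" using dens_pos_eigvals[OF \<rho>] x y by auto
    have "0 < exp \<omega> * x / y" using xy by simp
    then have "\<bar>exp \<omega> * x / y - c\<bar> < c" using c[OF x y] by linarith
    then have "cmod (complex_of_real (exp \<omega> * x / y) - complex_of_real c) < c"
      unfolding of_real_diff[symmetric] norm_of_real .
    from a[OF this] have "(\<lambda>N. \<Sum>k<N. a k * complex_of_real (exp \<omega> * x / y - c) ^ k) \<longlonglongrightarrow> phi (complex_of_real (exp \<omega> * x / y))"
      by (simp add: sums_def)
    then have lim: "(\<lambda>N. complex_of_real (exp (- \<omega> / 2) * y) * (\<Sum>k<N. a k * complex_of_real (exp \<omega> * x / y - c) ^ k))
      \<longlonglongrightarrow> complex_of_real (exp (- \<omega> / 2) * y) * phi (complex_of_real (exp \<omega> * x / y))"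
      by (intro tendsto_mult tendsto_const)
    have eq: "exp \<omega> * x / y = exp (\<omega> / 2) * x / (exp (- \<omega> / 2) * y)"
      using xy by (simp add: field_simps flip: exp_add)
    have "complex_of_real (exp (- \<omega> / 2) * y) * phi (complex_of_real (exp (\<omega> / 2) * x / (exp (- \<omega> / 2) * y)))
        = complex_of_real (theta D j x y)"
      unfolding theta_def using xy by (intro phi_of_real[symmetric]) auto
    then show ?thesis using lim unfolding eq[symmetric] by simp
  qed
  have bl: "bounded_linear (\<lambda>c. c *\<^sub>C (Y :: complex^'m^'m))" for Y
    by (rule bounded_linear_intro[of _ "norm Y"]) (simp_all add: cscale_add_left scaleR_cscale scaleR_conv_of_real[where 'a=complex])
  show ?thesis
    unfolding sum_term_k_dens[OF \<rho>] rho_contract_def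
    by (intro tendsto_sum bounded_linear.tendsto[OF bl] lim)
qed

text \<open>Uniform convergence is needed for all \<open>M\<close> in the algebra near \<rho>, not
  only self-adjoint ones, since curves will be continued to complex parameters. At \<rho> the shift
  is diagonal in the spectral blocks; in a norm adapted to them it is bounded by q0 < c, and nearby
  shifts are still bounded by some q < c. The coefficients of \<open>phi\<close> are summable
  against the powers of q.\<close>

lemma contract_series:
  assumes \<rho>: "\<rho> \<in> dens_pos D"
  obtains \<delta> a c where "\<delta> > 0" "\<And>M. M \<in> A \<Longrightarrow> norm (M - \<rho>) < \<delta> \<Longrightarrow> invertible (\<r> M)"
    "\<And>X. uniform_limit {M \<in> A. norm (M - \<rho>) < \<delta>} (\<lambda>N M. \<Sum>k<N. term_k a c X k M) (\<lambda>M. suminf (\<lambda>k. term_k a c X k M)) sequentially"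
    "\<And>X M. M \<in> dens D \<Longrightarrow> norm (M - \<rho>) < \<delta> \<Longrightarrow> M \<in> dens_pos D \<and> suminf (\<lambda>k. term_k a c X k M) = rho_contract D j M X"
proof -
  note r = dens_pos_in[OF \<rho>] dens_pos_herm[OF \<rho>]
  let ?E = "eigvals \<rho>"
  obtain U where U: "U > 0" "\<And>\<rho> x. \<rho> \<in> dens D \<Longrightarrow> x \<in> eigvals \<rho> \<Longrightarrow> x \<le> U"
    using dens_eigvals_le by blast
  obtain l \<delta>1 where l: "l > 0" "\<And>x. x \<in> ?E \<Longrightarrow> l \<le> x"
    and \<delta>1: "\<delta>1 > 0" "\<And>M x. M \<in> dens D \<Longrightarrow> norm (M - \<rho>) < \<delta>1 \<Longrightarrow> M \<in> dens_pos D"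
      "\<And>M x. M \<in> dens D \<Longrightarrow> norm (M - \<rho>) < \<delta>1 \<Longrightarrow> x \<in> eigvals M \<Longrightarrow> l \<le> x"
    using dens_pos_open_ge[OF \<rho>] by metis
  \<comment> \<open>An upper bound of the quotients exp(\<omega>) x / y for eigenvalues between l
    and U; the lower bound exp(\<omega>) l / U lies at distance q0 below it.\<close>
  define c where "c = exp \<omega> * U / l"
  define q0 where "q0 = c - exp \<omega> * l / U"
  have c: "c > 0" using U l by (simp add: c_def)
  have lU: "l \<le> U"
  proof -
    have "?E \<noteq> {}"
    proof
      assume "?E = {}"
      then have "\<rho> = 0" using spectral_decomp[OF r(2)] by simp
      then show False using dens_pos_tr[OF \<rho>] by simp
    qed
    then obtain x where "x \<in> ?E" by blast
    then show ?thesis using l(2) U(2)[OF dens_pos_dens[OF \<rho>]] by force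
  qed
  have q0: "0 \<le> q0" "q0 < c"
  proof -
    have "exp \<omega> * l / U \<le> exp \<omega> * U / l" using lU U l by (intro frac_le mult_left_mono) auto
    then show "0 \<le> q0" by (simp add: q0_def c_def)
    show "q0 < c" using U l by (simp add: q0_def)
  qed
  have ratio: "exp \<omega> * x / y \<le> c" if "M \<in> dens D" "norm (M - \<rho>) < \<delta>1" "x \<in> eigvals M" "y \<in> eigvals M" for M x y
    unfolding c_def using that U(2)[OF that(1)] \<delta>1(3)[OF that(1,2)] l(1) U(1)
    by (intro frac_le mult_left_mono mult_nonneg_nonneg) auto
  have ratio0: "\<bar>exp \<omega> * x / y - c\<bar> \<le> q0" if "x \<in> ?E" "y \<in> ?E" for x y
  proof -
    have "exp \<omega> * x / y \<le> c" using ratio[OF dens_pos_dens[OF \<rho>], of x y] \<delta>1(1) that by simp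
    moreover have "exp \<omega> * l / U \<le> exp \<omega> * x / y"
      using that l U(2)[OF dens_pos_dens[OF \<rho>]] dens_pos_eigvals[OF \<rho>]
      by (intro frac_le mult_left_mono mult_nonneg_nonneg) (auto simp: less_imp_le)
    ultimately show ?thesis by (simp add: q0_def)
  qed
  obtain a where a: "\<And>w. cmod (w - complex_of_real c) < c \<Longrightarrow> (\<lambda>n. a n * (w - complex_of_real c) ^ n) sums phi w"
    "\<And>q. 0 \<le> q \<Longrightarrow> q < c \<Longrightarrow> summable (\<lambda>n. cmod (a n) * q ^ n)"
    using phi_series[OF c] by blast
  define P where "P x y X = \<l> (eigproj \<rho> x) ** X ** \<r> (eigproj \<rho> y)" for x y and X :: "complex^'m^'m"
  \<comment> \<open>The adapted norm, the sum of the norms of the blocks. It is equivalent to the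
    given norm by \<open>nu_ge\<close> and \<open>nu_le\<close>.\<close>
  define nu where "nu X = (\<Sum>x\<in>?E. \<Sum>y\<in>?E. norm (P x y X))" for X
  obtain Km where Km: "Km > 0" "\<And>(X :: complex^'m^'m) (Y :: complex^'m^'m). norm (X ** Y) \<le> norm X * norm Y * Km"
    using mm.pos_bounded by blast
  have Km3: "norm (X ** Y ** Z) \<le> norm X * norm Y * norm Z * Km\<^sup>2" for X Y Z :: "complex^'m^'m"
  proof -
    have "norm (X ** Y ** Z) \<le> norm (X ** Y) * norm Z * Km" by (rule Km)
    also have "\<dots> \<le> (norm X * norm Y * Km) * norm Z * Km"
      using Km by (intro mult_right_mono) auto
    finally show ?thesis by (simp add: power2_eq_square mult_ac)
  qed
  have nu_ge: "norm X \<le> nu X" for X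
  proof -
    have "X = (\<Sum>x\<in>?E. \<Sum>y\<in>?E. P x y X)"
      using dsum_const[OF r, of 1 X] by (simp add: dsum_def P_def)
    then have "norm X = norm (\<Sum>x\<in>?E. \<Sum>y\<in>?E. P x y X)" by simp
    also have "\<dots> \<le> nu X" unfolding nu_def by (intro sum_norm_le order_refl)
    finally show ?thesis .
  qed
  define C where "C = (\<Sum>x\<in>?E. \<Sum>y\<in>?E. norm (\<l> (eigproj \<rho> x)) * norm (\<r> (eigproj \<rho> y)) * Km\<^sup>2)"
  have C0: "0 \<le> C" unfolding C_def by (intro sum_nonneg) simp
  have nu_le: "nu X \<le> C * norm X" for X
    unfolding nu_def C_def sum_distrib_right P_def
    by (intro sum_mono order.trans[OF Km3]) (simp add: mult_ac)
  have nu_add: "nu (X + Y) \<le> nu X + nu Y" for X Y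
    unfolding nu_def sum.distrib[symmetric] P_def
    by (intro sum_mono) (simp add: matrix_add_ldistrib matrix_add_rdistrib norm_triangle_ineq)
  have nu0: "nu (shift c \<rho> X) \<le> q0 * nu X" for X
    unfolding nu_def sum_distrib_left
  proof (intro sum_mono)
    fix x y assume xy: "x \<in> ?E" "y \<in> ?E"
    show "norm (P x y (shift c \<rho> X)) \<le> q0 * norm (P x y X)"
      unfolding P_def shift_dsum[OF \<rho>] sandwich_dsum[OF r xy] norm_cscale norm_of_real
      using ratio0[OF xy] by (rule mult_right_mono) simp
  qed
  define q where "q = (q0 + c) / 2"
  have q: "q0 < q" "q < c" "0 \<le> q" using q0 by (auto simp: q_def)
  \<comment> \<open>Chosen so that C \<epsilon> fits into the gap between q0 and q; of C only
    nonnegativity is known, hence C + 1.\<close>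
  define \<epsilon> where "\<epsilon> = (q - q0) / (C + 1)"
  have \<epsilon>: "\<epsilon> > 0" using q C0 by (simp add: \<epsilon>_def)
  \<comment> \<open>Neighbourhoods of \<rho> within the algebra, with \<rho> included.\<close>
  define F where "F = inf (nhds \<rho>) (principal A)"
  have F0: "((\<lambda>M. M) \<longlongrightarrow> \<rho>) F"
    unfolding F_def by (intro tendsto_mono[OF inf_le1 filterlim_ident])
  have evA: "\<forall>\<^sub>F M in F. M \<in> A" unfolding F_def by (simp add: eventually_inf_principal)
  note Fl = L.h_tendsto[OF F0 evA r(1)] and Fr = R.h_tendsto[OF F0 evA r(1)]
  note inv = invertible_hom[OF r less_imp_neq[OF dens_pos_eigvals[OF \<rho>], symmetric]]
  note Fi = tendsto_matrix_inv[OF Fr inv(4)]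
  let ?I = "\<lambda>M. matrix_inv (\<r> M)"
  have "((\<lambda>M. exp \<omega> * Km\<^sup>2 * (norm (\<l> M - \<l> \<rho>) * norm (?I M) + norm (\<l> \<rho>) * norm (?I M - ?I \<rho>))) \<longlongrightarrow>
      exp \<omega> * Km\<^sup>2 * (norm (\<l> \<rho> - \<l> \<rho>) * norm (?I \<rho>) + norm (\<l> \<rho>) * norm (?I \<rho> - ?I \<rho>))) F"
    by (intro tendsto_intros Fl Fi(1))
  then have "\<forall>\<^sub>F M in F. exp \<omega> * Km\<^sup>2 * (norm (\<l> M - \<l> \<rho>) * norm (?I M) + norm (\<l> \<rho>) * norm (?I M - ?I \<rho>)) < \<epsilon>"
    by (rule order_tendstoD(2)) (use \<epsilon> in simp)
  then have "\<forall>\<^sub>F M in F. invertible (\<r> M) \<and> norm (\<r> M) < norm (\<r> \<rho>) + 1 \<and>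
      exp \<omega> * Km\<^sup>2 * (norm (\<l> M - \<l> \<rho>) * norm (?I M) + norm (\<l> \<rho>) * norm (?I M - ?I \<rho>)) < \<epsilon>"
    using Fi(2) order_tendstoD(2)[OF tendsto_norm[OF Fr], of "norm (\<r> \<rho>) + 1"]
    by (simp add: eventually_conj_iff)
  then obtain \<delta>2 where \<delta>2: "\<delta>2 > 0" "\<And>M. M \<in> A \<Longrightarrow> norm (M - \<rho>) < \<delta>2 \<Longrightarrow> invertible (\<r> M) \<and> norm (\<r> M) < norm (\<r> \<rho>) + 1 \<and>
      exp \<omega> * Km\<^sup>2 * (norm (\<l> M - \<l> \<rho>) * norm (?I M) + norm (\<l> \<rho>) * norm (?I M - ?I \<rho>)) < \<epsilon>"
    unfolding F_def eventually_inf_principal eventually_nhds_metric dist_norm by blast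
  define \<delta> where "\<delta> = min \<delta>1 \<delta>2"
  have shift_diff: "norm (shift c M X - shift c \<rho> X) \<le> \<epsilon> * norm X" if "M \<in> A" "norm (M - \<rho>) < \<delta>2" for M X
  proof -
    have "shift c M X - shift c \<rho> X = complex_of_real (exp \<omega>) *\<^sub>C
        ((\<l> M - \<l> \<rho>) ** X ** ?I M + \<l> \<rho> ** X ** (?I M - ?I \<rho>))"
      by (simp add: shift_def mm.diff_left mm.diff_right cscale_diff_right cscale_add_right)
    then have "norm (shift c M X - shift c \<rho> X) = exp \<omega> * norm ((\<l> M - \<l> \<rho>) ** X ** ?I M + \<l> \<rho> ** X ** (?I M - ?I \<rho>))"
      by simp
    also have "\<dots> \<le> exp \<omega> * (norm (\<l> M - \<l> \<rho>) * norm X * norm (?I M) * Km\<^sup>2 + norm (\<l> \<rho>) * norm X * norm (?I M - ?I \<rho>) * Km\<^sup>2)"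
      by (intro mult_left_mono order.trans[OF norm_triangle_ineq] add_mono Km3) simp
    also have "\<dots> = (exp \<omega> * Km\<^sup>2 * (norm (\<l> M - \<l> \<rho>) * norm (?I M) + norm (\<l> \<rho>) * norm (?I M - ?I \<rho>))) * norm X"
      by (simp add: algebra_simps)
    also have "\<dots> \<le> \<epsilon> * norm X"
      using \<delta>2(2)[OF that] by (intro mult_right_mono) auto
    finally show ?thesis .
  qed
  have nu_shift: "nu (shift c M X) \<le> q * nu X" if M: "M \<in> A" "norm (M - \<rho>) < \<delta>2" for M X
  proof -
    have "nu (shift c M X) = nu (shift c \<rho> X + (shift c M X - shift c \<rho> X))" by simp
    also have "\<dots> \<le> nu (shift c \<rho> X) + nu (shift c M X - shift c \<rho> X)" by (rule nu_add)
    also have "\<dots> \<le> q0 * nu X + C * (\<epsilon> * norm X)"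
      using C0 shift_diff[OF M] by (intro add_mono nu0 order.trans[OF nu_le] mult_left_mono) auto
    also have "\<dots> \<le> q0 * nu X + (C + 1) * (\<epsilon> * nu X)"
      using C0 \<epsilon> nu_ge[of X] by (intro add_left_mono mult_mono) auto
    also have "\<dots> = q * nu X" using C0 by (simp add: \<epsilon>_def field_simps)
    finally show ?thesis .
  qed
  have nu_pow: "nu ((shift c M ^^ k) X) \<le> q ^ k * nu X" if M: "M \<in> A" "norm (M - \<rho>) < \<delta>2" for M X k
  proof (induction k)
    case (Suc k)
    have "nu ((shift c M ^^ Suc k) X) \<le> q * nu ((shift c M ^^ k) X)" using nu_shift[OF M] by simp
    also have "\<dots> \<le> q * (q ^ k * nu X)" using Suc q by (intro mult_left_mono) auto
    finally show ?case by (simp add: mult_ac)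
  qed simp
  have unif: "uniform_limit {M \<in> A. norm (M - \<rho>) < \<delta>} (\<lambda>N M. \<Sum>k<N. term_k a c X k M) (\<lambda>M. suminf (\<lambda>k. term_k a c X k M)) sequentially" for X
  proof (rule Weierstrass_m_test)
    let ?B = "nu X * (exp (- \<omega> / 2) * (norm (\<r> \<rho>) + 1)) * Km"
    show "summable (\<lambda>k. (cmod (a k) * q ^ k) * ?B)"
      using a(2)[OF q(3,2)] by (rule summable_mult2)
    fix k M assume M: "M \<in> {M \<in> A. norm (M - \<rho>) < \<delta>}"
    then have M': "M \<in> A" "norm (M - \<rho>) < \<delta>2" by (auto simp: \<delta>_def)
    have "norm (term_k a c X k M) \<le> cmod (a k) *
        (norm ((shift c M ^^ k) X) * norm (complex_of_real (exp (- \<omega> / 2)) *\<^sub>C \<r> M) * Km)"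
      unfolding term_k_def norm_cscale by (intro mult_left_mono order.trans[OF Km(2)]) auto
    also have "\<dots> \<le> cmod (a k) * ((q ^ k * nu X) * (exp (- \<omega> / 2) * (norm (\<r> \<rho>) + 1)) * Km)"
      using order.trans[OF nu_ge nu_pow[OF M']] \<delta>2(2)[OF M'] Km order.trans[OF norm_ge_zero nu_ge] q
      by (intro mult_left_mono mult_mono mult_nonneg_nonneg) auto
    finally show "norm (term_k a c X k M) \<le> (cmod (a k) * q ^ k) * ?B" by (simp add: mult_ac)
  qed
  have val: "M \<in> dens_pos D \<and> suminf (\<lambda>k. term_k a c X k M) = rho_contract D j M X"
    if M: "M \<in> dens D" "norm (M - \<rho>) < \<delta>" for X M
  proof -
    have pd: "M \<in> dens_pos D" using \<delta>1(2) M by (simp add: \<delta>_def)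
    have "(\<lambda>N. \<Sum>k<N. term_k a c X k M) \<longlonglongrightarrow> rho_contract D j M X"
    proof (rule sum_term_k_tendsto[OF pd a(1)])
      fix x y assume "x \<in> eigvals M" "y \<in> eigvals M"
      then show "exp \<omega> * x / y < 2 * c"
        using ratio[of M x y] M c by (simp add: \<delta>_def)
    qed
    then have "(\<lambda>k. term_k a c X k M) sums rho_contract D j M X" by (simp add: sums_def)
    then show ?thesis using pd by (simp add: sums_iff)
  qed
  show ?thesis
  proof (rule that)
    show "0 < \<delta>" using \<delta>1 \<delta>2 by (simp add: \<delta>_def)
    show "invertible (\<r> M)" if "M \<in> A" "norm (M - \<rho>) < \<delta>" for M
      using \<delta>2(2) that by (simp add: \<delta>_def)
  qed (use unif val in blast)+
qed

end

section \<open>Continuity of the form\<close>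

context diff_index
begin

lemma term_k_tendsto:
  assumes \<rho>: "\<rho> \<in> dens_pos D" and f: "(f \<longlongrightarrow> \<rho>) F" "\<forall>\<^sub>F t in F. f t \<in> A"
  shows "((\<lambda>t. term_k a c X k (f t)) \<longlongrightarrow> term_k a c X k \<rho>) F"
proof -
  note r = dens_pos_in[OF \<rho>] dens_pos_herm[OF \<rho>]
  note Fl = L.h_tendsto[OF f r(1)] and Fr = R.h_tendsto[OF f r(1)]
  have Fi: "((\<lambda>t. matrix_inv (\<r> (f t))) \<longlongrightarrow> matrix_inv (\<r> \<rho>)) F"
    by (rule tendsto_matrix_inv(1)[OF Fr])
      (rule invertible_hom(4)[OF r less_imp_neq[OF dens_pos_eigvals[OF \<rho>], symmetric]])
  have bl: "bounded_linear (\<lambda>M. c *\<^sub>C M)" for c :: complex and M :: "complex^'m^'m"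
    by (rule bounded_linear_intro[of _ "cmod c"]) (simp_all add: cscale_add_right scaleR_cscale mult.commute)
  note cs = bounded_linear.tendsto[OF bl]
  have "((\<lambda>t. (shift c (f t) ^^ k) X) \<longlongrightarrow> (shift c \<rho> ^^ k) X) F"
  proof (induction k)
    case (Suc k)
    then show ?case unfolding funpow.simps o_def shift_def
      by (intro tendsto_diff cs mm.tendsto Fl Fi)
  qed simp
  then show ?thesis unfolding term_k_def by (intro cs mm.tendsto Fr)
qed

text \<open>Continuity is invisible in the spectral definition, whose projections may jump where
  eigenvalues meet; it passes from the partial sums of the series to their uniform limit.\<close>

lemma contract_tendsto:
  assumes \<rho>: "\<rho> \<in> dens_pos D"
  shows "((\<lambda>M. rho_contract D j M X) \<longlongrightarrow> rho_contract D j \<rho> X) (at \<rho> within dens D)"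
proof -
  obtain \<delta> a c where s: "\<delta> > 0"
    "\<And>X. uniform_limit {M \<in> A. norm (M - \<rho>) < \<delta>} (\<lambda>N M. \<Sum>k<N. term_k a c X k M) (\<lambda>M. suminf (\<lambda>k. term_k a c X k M)) sequentially"
    "\<And>X M. M \<in> dens D \<Longrightarrow> norm (M - \<rho>) < \<delta> \<Longrightarrow> M \<in> dens_pos D \<and> suminf (\<lambda>k. term_k a c X k M) = rho_contract D j M X"
    by (rule contract_series[OF \<rho>]) (rule that, assumption+)
  let ?S = "{M \<in> A. norm (M - \<rho>) < \<delta>}"
  have ev: "\<forall>\<^sub>F M in at \<rho> within dens D. M \<in> dens D \<and> norm (M - \<rho>) < \<delta>"
    using s(1) by (auto simp: eventually_at dist_norm intro!: exI[of _ \<delta>])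
  have evA: "\<forall>\<^sub>F M in at \<rho> within dens D. M \<in> A"
    using ev by eventually_elim (simp add: dens_in)
  have "((\<lambda>M. suminf (\<lambda>k. term_k a c X k M)) \<longlongrightarrow> rho_contract D j \<rho> X) (at \<rho> within dens D)"
  proof (rule swap_uniform_limit'[OF _ _ s(2)])
    show "\<forall>\<^sub>F N in sequentially. ((\<lambda>M. \<Sum>k<N. term_k a c X k M) \<longlongrightarrow> (\<Sum>k<N. term_k a c X k \<rho>)) (at \<rho> within dens D)"
      by (intro always_eventually allI tendsto_sum) (rule term_k_tendsto[OF \<rho> tendsto_ident_at evA])
    have "(\<lambda>N. \<Sum>k<N. term_k a c X k \<rho>) \<longlonglongrightarrow> suminf (\<lambda>k. term_k a c X k \<rho>)"
      by (rule tendsto_uniform_limitI[OF s(2)]) (use s(1) dens_pos_in[OF \<rho>] in simp)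
    then show "(\<lambda>N. \<Sum>k<N. term_k a c X k \<rho>) \<longlonglongrightarrow> rho_contract D j \<rho> X"
      using s(3)[OF dens_pos_dens[OF \<rho>]] s(1) by simp
    show "\<forall>\<^sub>F M in at \<rho> within dens D. M \<in> ?S"
      using ev by eventually_elim (simp add: dens_in)
  qed simp
  moreover have "\<forall>\<^sub>F M in at \<rho> within dens D. suminf (\<lambda>k. term_k a c X k M) = rho_contract D j M X"
    using ev by eventually_elim (simp add: s(3))
  ultimately show ?thesis by (rule Lim_transform_eventually)
qed

end

lemma (in diffstr) kform_tendsto:
  assumes \<rho>: "\<rho> \<in> dens_pos D" and ab: "a \<in> A" "b \<in> A"
  shows "((\<lambda>M. kform M a b) \<longlongrightarrow> kform \<rho> a b) (at \<rho> within dens D)"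
  unfolding kform_def
proof (rule tendsto_sum)
  fix j assume "j \<in> idx D"
  then interpret diff_index D j by (rule index)
  have "\<forall>\<^sub>F M in at \<rho> within dens D. M \<in> dens D" by (auto simp: eventually_at_filter)
  then have "\<forall>\<^sub>F M in at \<rho> within dens D. adj (pd a) ** rho_contract D j M (pd b) \<in> \<B>"
    by eventually_elim (use ab contract_in[OF j dens_in dens_herm] in blast)
  then show "((\<lambda>M. btr D j (adj (pderiv_j D j a) ** rho_contract D j M (pderiv_j D j b))) \<longlongrightarrow>
      btr D j (adj (pderiv_j D j a) ** rho_contract D j \<rho> (pderiv_j D j b))) (at \<rho> within dens D)"
    using ab contract_in[OF j dens_pos_in[OF \<rho>] dens_pos_herm[OF \<rho>]]
    by (intro B.tr_tendsto mm.tendsto tendsto_const contract_tendsto[OF \<rho>]) auto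
qed

section \<open>Real analytic functions on the unit interval\<close>

text \<open>Real analyticity up to the end points, by local holomorphic continuation. Locally
  uniform limits and derivatives of holomorphic functions are holomorphic, so smoothness of all
  orders comes without estimates of derivatives.\<close>

definition analytic01 :: "(real \<Rightarrow> complex) \<Rightarrow> bool" where
  "analytic01 f \<longleftrightarrow> (\<forall>t\<in>{0..1}. \<exists>r>0. \<exists>F. F holomorphic_on ball (complex_of_real t) r \<and>
    (\<forall>s\<in>{0..1}. \<bar>s - t\<bar> < r \<longrightarrow> f s = F (complex_of_real s)))"

lemma analytic01I:
  assumes "\<And>t. t \<in> {0..1} \<Longrightarrow> \<exists>r>0. \<exists>F. F holomorphic_on ball (complex_of_real t) r \<and>
    (\<forall>s\<in>{0..1}. \<bar>s - t\<bar> < r \<longrightarrow> f s = F (complex_of_real s))"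
  shows "analytic01 f"
  using assms by (simp add: analytic01_def)

lemma analytic01_entire:
  assumes "F holomorphic_on UNIV" "\<And>t. t \<in> {0..1} \<Longrightarrow> f t = F (complex_of_real t)"
  shows "analytic01 f"
proof (rule analytic01I)
  fix t :: real
  have "F holomorphic_on ball (complex_of_real t) 1" using assms(1) holomorphic_on_subset by blast
  then show "\<exists>r>0. \<exists>F. F holomorphic_on ball (complex_of_real t) r \<and>
    (\<forall>s\<in>{0..1}. \<bar>s - t\<bar> < r \<longrightarrow> f s = F (complex_of_real s))"
    using assms(2) by (intro exI[of _ 1] exI[of _ F]) auto
qed

lemma analytic01_cong: "analytic01 f \<Longrightarrow> (\<And>t. t \<in> {0..1} \<Longrightarrow> g t = f t) \<Longrightarrow> analytic01 g"
  unfolding analytic01_def by simp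

lemma analytic01_const: "analytic01 (\<lambda>_. c)"
  by (rule analytic01_entire[of "\<lambda>_. c"]) auto

lemma analytic01_binop:
  assumes "analytic01 f" "analytic01 g"
    and op: "\<And>F G S. F holomorphic_on S \<Longrightarrow> G holomorphic_on S \<Longrightarrow> (\<lambda>z. op (F z) (G z)) holomorphic_on S"
  shows "analytic01 (\<lambda>t. op (f t) (g t))"
proof (rule analytic01I)
  fix t :: real assume t: "t \<in> {0..1}"
  obtain r F where F: "r > 0" "F holomorphic_on ball (complex_of_real t) r"
    "\<And>s. s \<in> {0..1} \<Longrightarrow> \<bar>s - t\<bar> < r \<Longrightarrow> f s = F (complex_of_real s)"
    using assms(1) t unfolding analytic01_def by blast
  obtain r' G where G: "r' > 0" "G holomorphic_on ball (complex_of_real t) r'"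
    "\<And>s. s \<in> {0..1} \<Longrightarrow> \<bar>s - t\<bar> < r' \<Longrightarrow> g s = G (complex_of_real s)"
    using assms(2) t unfolding analytic01_def by blast
  have "F holomorphic_on ball (complex_of_real t) (min r r')" "G holomorphic_on ball (complex_of_real t) (min r r')"
    using F(2) G(2) by (auto intro: holomorphic_on_subset)
  from op[OF this] show "\<exists>r>0. \<exists>H. H holomorphic_on ball (complex_of_real t) r \<and>
    (\<forall>s\<in>{0..1}. \<bar>s - t\<bar> < r \<longrightarrow> op (f s) (g s) = H (complex_of_real s))"
    using F G by (intro exI[of _ "min r r'"] conjI exI[of _ "\<lambda>z. op (F z) (G z)"]) auto
qed

lemma analytic01_add: "analytic01 f \<Longrightarrow> analytic01 g \<Longrightarrow> analytic01 (\<lambda>t. f t + g t)"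
  by (rule analytic01_binop[of f g "(+)"]) (auto intro: holomorphic_intros)

lemma analytic01_mult: "analytic01 f \<Longrightarrow> analytic01 g \<Longrightarrow> analytic01 (\<lambda>t. f t * g t)"
  by (rule analytic01_binop[of f g "(*)"]) (auto intro: holomorphic_intros)

lemma analytic01_sum: "(\<And>x. x \<in> S \<Longrightarrow> analytic01 (f x)) \<Longrightarrow> analytic01 (\<lambda>t. \<Sum>x\<in>S. f x t)"
  by (induction S rule: infinite_finite_induct) (auto intro: analytic01_add analytic01_const)

lemma analytic01_prod: "(\<And>x. x \<in> S \<Longrightarrow> analytic01 (f x)) \<Longrightarrow> analytic01 (\<lambda>t. \<Prod>x\<in>S. f x t)"
  by (induction S rule: infinite_finite_induct) (auto intro: analytic01_mult analytic01_const)

lemma analytic01_inverse: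
  assumes "analytic01 f" and nz: "\<And>t. t \<in> {0..1} \<Longrightarrow> f t \<noteq> 0"
  shows "analytic01 (\<lambda>t. inverse (f t))"
proof (rule analytic01I)
  fix t :: real assume t: "t \<in> {0..1}"
  obtain r F where F: "r > 0" "F holomorphic_on ball (complex_of_real t) r"
    "\<And>s. s \<in> {0..1} \<Longrightarrow> \<bar>s - t\<bar> < r \<Longrightarrow> f s = F (complex_of_real s)"
    using assms(1) t unfolding analytic01_def by blast
  have "continuous_on (ball (complex_of_real t) r) F" using F(2) by (rule holomorphic_on_imp_continuous_on)
  then have "isCont F (complex_of_real t)" using F(1) continuous_on_interior[of _ F] by simp
  moreover have "F (complex_of_real t) \<noteq> 0" using F(3)[OF t] F(1) nz[OF t] by simp
  ultimately obtain e where e: "e > 0" "\<And>z. dist (complex_of_real t) z < e \<Longrightarrow> F z \<noteq> 0"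
    using continuous_at_avoid[of "complex_of_real t" F 0] by blast
  have "F holomorphic_on ball (complex_of_real t) (min r e)" using F(2) by (auto intro: holomorphic_on_subset)
  then have "(\<lambda>z. inverse (F z)) holomorphic_on ball (complex_of_real t) (min r e)"
    by (rule holomorphic_on_inverse) (use e(2) in simp)
  then show "\<exists>r>0. \<exists>H. H holomorphic_on ball (complex_of_real t) r \<and>
    (\<forall>s\<in>{0..1}. \<bar>s - t\<bar> < r \<longrightarrow> inverse (f s) = H (complex_of_real s))"
    using F e(1) by (intro exI[of _ "min r e"] conjI exI[of _ "\<lambda>z. inverse (F z)"]) auto
qed

lemma analytic01_det:
  assumes "\<And>i j. analytic01 (\<lambda>t. f t $ i $ j)"
  shows "analytic01 (\<lambda>t. det (f t))"
  unfolding det_def by (intro analytic01_sum analytic01_mult analytic01_const analytic01_prod assms)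

lemma analytic01_matrix_inv:
  fixes f :: "real \<Rightarrow> complex^'k^'k"
  assumes f: "\<And>i j. analytic01 (\<lambda>t. f t $ i $ j)" and inv: "\<And>t. t \<in> {0..1} \<Longrightarrow> invertible (f t)"
  shows "analytic01 (\<lambda>t. matrix_inv (f t) $ i $ j)"
proof (rule analytic01_cong)
  have "analytic01 (\<lambda>t. (if b = i then (mat 1 :: complex^'k^'k) $ a $ j else f t $ a $ b))" for a b
    using f by (cases "b = i") (simp_all add: analytic01_const)
  then show "analytic01 (\<lambda>t. det (\<chi> a b. if b = i then (mat 1 :: complex^'k^'k) $ a $ j else f t $ a $ b) * inverse (det (f t)))"
    by (intro analytic01_mult analytic01_inverse analytic01_det f) (use inv in \<open>auto simp: invertible_det_nz\<close>)
qed (simp add: matrix_inv_nth inv divide_inverse)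

text \<open>The derivative of a local continuation continues the derivative.\<close>

lemma analytic01_deriv:
  assumes "analytic01 f"
  obtains g where "analytic01 g" "\<And>t. t \<in> {0..1} \<Longrightarrow> (f has_vector_derivative g t) (at t within {0..1})"
proof -
  have *: "\<exists>r>0. \<exists>F. F holomorphic_on ball (complex_of_real t) r \<and>
    (\<forall>s\<in>{0..1}. \<bar>s - t\<bar> < r \<longrightarrow> (f has_vector_derivative F (complex_of_real s)) (at s within {0..1}))"
    if t: "t \<in> {0..1}" for t :: real
  proof -
    obtain r F where F: "r > 0" "F holomorphic_on ball (complex_of_real t) r"
      "\<And>s. s \<in> {0..1} \<Longrightarrow> \<bar>s - t\<bar> < r \<Longrightarrow> f s = F (complex_of_real s)"
      using assms t unfolding analytic01_def by blast
    have d: "(f has_vector_derivative deriv F (complex_of_real s)) (at s within {0..1})"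
      if s: "s \<in> {0..1}" "\<bar>s - t\<bar> < r" for s
    proof (rule has_vector_derivative_transform_within)
      have "complex_of_real s \<in> ball (complex_of_real t) r"
        using s(2) unfolding mem_ball dist_norm of_real_diff[symmetric] norm_of_real by (simp add: abs_minus_commute)
      then have "(F has_field_derivative deriv F (complex_of_real s)) (at (complex_of_real s))"
        using F(2) by (intro holomorphic_derivI[of F "ball (complex_of_real t) r"]) auto
      then show "((\<lambda>x. F (complex_of_real x)) has_vector_derivative deriv F (complex_of_real s)) (at s within {0..1})"
        by (rule has_vector_derivative_real_field)
      show "0 < r - \<bar>s - t\<bar>" using s by simp
      show "F (complex_of_real x) = f x" if "x \<in> {0..1}" "dist x s < r - \<bar>s - t\<bar>" for x
        using F(3)[of x] that by (simp add: dist_real_def)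
    qed (fact s)
    have "deriv F holomorphic_on ball (complex_of_real t) r"
      using F(2) by (intro holomorphic_deriv) auto
    then show ?thesis using F(1) d by blast
  qed
  \<comment> \<open>The continuations depend on the base point; uniqueness of derivatives within the
    interval makes them agree with one globally defined function.\<close>
  define g where "g t = vector_derivative f (at t within {0..1})" for t
  have g: "g s = y" if "s \<in> {0..1}" "(f has_vector_derivative y) (at s within {0..1})" for s y
    unfolding g_def using vector_derivative_within_cbox[of 0 1 s f y] that by simp
  have "analytic01 g" unfolding analytic01_def using * g by metis
  moreover have "(f has_vector_derivative g t) (at t within {0..1})" if t: "t \<in> {0..1}" for t
  proof -
    obtain y where "(f has_vector_derivative y) (at t within {0..1})"
      using *[OF t] t by force
    then show ?thesis using g t by simp
  qed
  ultimately show ?thesis using that by blast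
qed

definition munit :: "'n \<Rightarrow> 'k \<Rightarrow> complex^'k^'n" where
  "munit a b = (\<chi> i j. if i = a \<and> j = b then 1 else 0)"

lemma munit_decomp: "(M :: complex^'n^'n) = (\<Sum>a\<in>UNIV. \<Sum>b\<in>UNIV. (M $ a $ b) *\<^sub>C munit a b)"
proof -
  have "(\<Sum>a\<in>UNIV. \<Sum>b\<in>UNIV. (M $ a $ b) *\<^sub>C munit a b) $ i $ j = M $ i $ j" for i j
  proof -
    have "(\<Sum>a\<in>UNIV. \<Sum>b\<in>UNIV. (M $ a $ b) *\<^sub>C munit a b) $ i $ j =
        (\<Sum>a\<in>UNIV. \<Sum>b\<in>UNIV. if a = i then (if b = j then M $ i $ j else 0) else 0)"
      by (simp, intro sum.cong refl) (simp add: munit_def)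
    also have "\<dots> = (\<Sum>a\<in>UNIV. if a = i then M $ i $ j else 0)" by (intro sum.cong refl) simp
    finally show ?thesis by simp
  qed
  then show ?thesis unfolding mat_eq_iff by simp
qed

lemma cscale_bounded_linear: "bounded_linear (\<lambda>c. c *\<^sub>C (M :: complex^'n^'n))"
  by (rule bounded_linear_intro[of _ "norm M"])
    (simp_all add: cscale_add_left scaleR_cscale scaleR_conv_of_real[where 'a=complex])

text \<open>Differentiation stays inside the class, so iterating it supplies the whole sequence of
  derivatives.\<close>

lemma smooth_curve_analytic01:
  fixes f :: "real \<Rightarrow> complex^'n^'n"
  assumes "\<And>i j. analytic01 (\<lambda>t. f t $ i $ j)"
  shows "smooth_curve f"
proof -
  define R where "R f \<longleftrightarrow> (\<forall>i j. analytic01 (\<lambda>t. f t $ i $ j))" for f :: "real \<Rightarrow> complex^'n^'n"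
  have "\<exists>g. R g \<and> (\<forall>t\<in>{0..1}. (f has_vector_derivative g t) (at t within {0..1}))" if "R f" for f
  proof -
    have "\<forall>i j. \<exists>g. analytic01 g \<and> (\<forall>t\<in>{0..1}. ((\<lambda>t. f t $ i $ j) has_vector_derivative g t) (at t within {0..1}))"
      using that analytic01_deriv unfolding R_def by metis
    then obtain G where G: "\<And>i j. analytic01 (G i j)"
      "\<And>i j t. t \<in> {0..1} \<Longrightarrow> ((\<lambda>t. f t $ i $ j) has_vector_derivative G i j t) (at t within {0..1})" by metis
    define g where "g t = (\<chi> i j. G i j t)" for t
    have "(f has_vector_derivative g t) (at t within {0..1})" if "t \<in> {0..1}" for t
    proof -
      have "((\<lambda>t. \<Sum>a\<in>UNIV. \<Sum>b\<in>UNIV. (f t $ a $ b) *\<^sub>C munit a b) has_vector_derivative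
          (\<Sum>a\<in>UNIV. \<Sum>b\<in>UNIV. (g t $ a $ b) *\<^sub>C munit a b)) (at t within {0..1})"
        unfolding g_def using G(2)[OF that]
        by (intro has_vector_derivative_sum bounded_linear.has_vector_derivative[OF cscale_bounded_linear]) simp
      then show ?thesis by (simp flip: munit_decomp)
    qed
    moreover have "R g" using G(1) by (simp add: R_def g_def)
    ultimately show ?thesis by blast
  qed
  then obtain nxt where nxt: "\<And>f. R f \<Longrightarrow> R (nxt f)"
    "\<And>f t. R f \<Longrightarrow> t \<in> {0..1} \<Longrightarrow> (f has_vector_derivative nxt f t) (at t within {0..1})" by metis
  have "R ((nxt ^^ n) f)" for n
    using assms nxt(1) by (induction n) (simp_all add: R_def)
  then show ?thesis
    unfolding smooth_curve_def using nxt(2) by (intro exI[of _ "\<lambda>n. (nxt ^^ n) f"]) simp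
qed

text \<open>A complex functional is recovered from a real-linear extension \<open>g\<close> of its real part as
  \<open>X \<mapsto> g X - \<i> g (\<i> X)\<close>.\<close>

lemma (in vn_alg) functional_coords:
  assumes "\<And>a b. a \<in> A \<Longrightarrow> b \<in> A \<Longrightarrow> F (a + b) = F a + F b"
    and "\<And>c a. a \<in> A \<Longrightarrow> F (c *\<^sub>C a) = c * (F a :: complex)"
  obtains w where "\<And>Y. Y \<in> A \<Longrightarrow> F Y = (\<Sum>a\<in>UNIV. \<Sum>b\<in>UNIV. w a b * Y $ a $ b)"
proof -
  obtain g where g: "linear g" "\<And>a. a \<in> A \<Longrightarrow> g a = Re (F a)"
    by (rule linear_on_extend[OF subspace_alg, of "\<lambda>a. Re (F a)"]) (auto simp: assms scaleR_cscale)
  define H where "H X = complex_of_real (g X) - \<i> * complex_of_real (g (\<i> *\<^sub>C X))" for X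
  have FH: "F Y = H Y" if "Y \<in> A" for Y
    using that by (simp add: H_def g(2) assms complex_eq_iff)
  have H_add: "H (X + Y) = H X + H Y" for X Y
    by (simp add: H_def linear_add[OF g(1)] cscale_add_right algebra_simps)
  have H_scaleR: "H (r *\<^sub>R X) = r * H X" for r X
  proof -
    have "\<i> *\<^sub>C r *\<^sub>R X = r *\<^sub>R (\<i> *\<^sub>C X)" by (simp add: scaleR_cscale mult.commute)
    then show ?thesis by (simp add: H_def linear_scale[OF g(1)] algebra_simps)
  qed
  have H_i: "H (\<i> *\<^sub>C X) = \<i> * H X" for X
  proof -
    have "\<i> *\<^sub>C \<i> *\<^sub>C X = - X" by (simp add: cscale_minus)
    then show ?thesis by (simp add: H_def linear_neg[OF g(1)] algebra_simps)
  qed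
  have H_cscale: "H (c *\<^sub>C X) = c * H X" for c X
  proof -
    have "c *\<^sub>C X = Re c *\<^sub>R X + Im c *\<^sub>R (\<i> *\<^sub>C X)"
      by (simp add: scaleR_cscale flip: cscale_add_left) (metis complex_eq mult.commute)
    then have "H (c *\<^sub>C X) = Re c * H X + Im c * (\<i> * H X)" by (simp add: H_add H_scaleR H_i)
    also have "\<dots> = c * H X" using complex_eq[of c] by (metis distrib_right mult.assoc mult.commute)
    finally show ?thesis .
  qed
  have H_zero: "H 0 = 0" using H_scaleR[of 0 0] by simp
  have H_sum: "H (sum f S) = (\<Sum>x\<in>S. H (f x))" for f and S :: "'b set"
    by (induction S rule: infinite_finite_induct) (simp_all add: H_add H_zero)
  have "F Y = (\<Sum>a\<in>UNIV. \<Sum>b\<in>UNIV. H (munit a b) * Y $ a $ b)" if "Y \<in> A" for Y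
  proof -
    have "H Y = H (\<Sum>a\<in>UNIV. \<Sum>b\<in>UNIV. (Y $ a $ b) *\<^sub>C munit a b)"
      by (rule arg_cong[OF munit_decomp])
    also have "\<dots> = (\<Sum>a\<in>UNIV. \<Sum>b\<in>UNIV. Y $ a $ b * H (munit a b))"
      unfolding H_sum H_cscale ..
    also have "\<dots> = (\<Sum>a\<in>UNIV. \<Sum>b\<in>UNIV. H (munit a b) * Y $ a $ b)"
      by (intro sum.cong refl mult.commute)
    finally show ?thesis using FH[OF that] by (rule trans[rotated])
  qed
  then show ?thesis by (rule that)
qed

section \<open>Analytic curves of densities\<close>

context diff_index
begin

text \<open>For complex z the path leaves the self-adjoint matrices but not the algebra, on which
  \<open>h\<close> is complex linear.\<close>

lemma hom_path_holomorphic: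
  assumes h: "star_hom A \<B> h" and in_A: "x \<in> A" "b1 \<in> A" "b2 \<in> A"
    and FG: "F holomorphic_on S" "G holomorphic_on S"
  shows "(\<lambda>z. h (x + F z *\<^sub>C b1 + G z *\<^sub>C b2) $ i $ k) holomorphic_on S"
proof -
  interpret h: star_hom A \<B> h by fact
  have "h (x + F z *\<^sub>C b1 + G z *\<^sub>C b2) = h x + F z *\<^sub>C h b1 + G z *\<^sub>C h b2" for z
    using in_A by (simp add: h.h_add h.h_cscale)
  then show ?thesis by simp (intro holomorphic_intros FG)
qed

lemma term_k_holomorphic:
  assumes in_A: "x \<in> A" "b1 \<in> A" "b2 \<in> A" and FG: "F holomorphic_on S" "G holomorphic_on S"
    and inv: "\<And>z. z \<in> S \<Longrightarrow> invertible (\<r> (x + F z *\<^sub>C b1 + G z *\<^sub>C b2))"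
  shows "(\<lambda>z. term_k a c X k (x + F z *\<^sub>C b1 + G z *\<^sub>C b2) $ i $ i') holomorphic_on S"
proof -
  note L = hom_path_holomorphic[OF L.star_hom_axioms in_A FG]
    and R = hom_path_holomorphic[OF R.star_hom_axioms in_A FG]
  note I = holomorphic_on_matrix_inv[OF R inv]
  have "(\<lambda>z. (shift c (x + F z *\<^sub>C b1 + G z *\<^sub>C b2) ^^ k) X $ i $ i') holomorphic_on S" for i i'
  proof (induction k arbitrary: i i')
    case (Suc k)
    note LX = holomorphic_on_matrix_mult[OF holomorphic_on_matrix_mult[OF L Suc] I]
    have "(shift c M ^^ Suc k) X = complex_of_real (exp \<omega>) *\<^sub>C
        (\<l> M ** (shift c M ^^ k) X ** matrix_inv (\<r> M)) - complex_of_real c *\<^sub>C (shift c M ^^ k) X" for M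
      by (simp add: shift_def[of c M "(shift c M ^^ k) X"])
    then show ?case by (simp del: funpow.simps, intro holomorphic_intros LX Suc)
  qed simp
  moreover have "(\<lambda>z. (complex_of_real (exp (- \<omega> / 2)) *\<^sub>C \<r> (x + F z *\<^sub>C b1 + G z *\<^sub>C b2)) $ i $ i') holomorphic_on S" for i i'
    by (simp, intro holomorphic_intros R)
  ultimately have "(\<lambda>z. ((shift c (x + F z *\<^sub>C b1 + G z *\<^sub>C b2) ^^ k) X **
      (complex_of_real (exp (- \<omega> / 2)) *\<^sub>C \<r> (x + F z *\<^sub>C b1 + G z *\<^sub>C b2))) $ i $ i') holomorphic_on S"
    by (rule holomorphic_on_matrix_mult)
  then show ?thesis unfolding term_k_def cscale_nth by (intro holomorphic_intros)
qed

text \<open>The spectral formula is meaningful only for self-adjoint matrices; the sum of the series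
  continues it to complex parameters, as a locally uniform limit of holomorphic functions.\<close>

lemma analytic01_contract:
  assumes in_A: "x \<in> A" "b1 \<in> A" "b2 \<in> A" and FG: "F holomorphic_on UNIV" "G holomorphic_on UNIV"
    and \<rho>: "\<And>t. t \<in> {0..1} \<Longrightarrow> \<rho> t = x + F (complex_of_real t) *\<^sub>C b1 + G (complex_of_real t) *\<^sub>C b2"
      "\<And>t. t \<in> {0..1} \<Longrightarrow> \<rho> t \<in> dens_pos D"
    and cX: "c \<in> \<B>" "X \<in> \<B>"
  shows "analytic01 (\<lambda>t. \<tau>\<^sub>B (adj c ** rho_contract D j (\<rho> t) X))"
proof (rule analytic01I)
  fix t :: real assume t: "t \<in> {0..1}"
  define p where "p z = x + F z *\<^sub>C b1 + G z *\<^sub>C b2" for z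
  obtain \<delta> a d where s: "\<delta> > 0" "\<And>M. M \<in> A \<Longrightarrow> norm (M - \<rho> t) < \<delta> \<Longrightarrow> invertible (\<r> M)"
    "\<And>X. uniform_limit {M \<in> A. norm (M - \<rho> t) < \<delta>} (\<lambda>N M. \<Sum>k<N. term_k a d X k M) (\<lambda>M. suminf (\<lambda>k. term_k a d X k M)) sequentially"
    "\<And>X M. M \<in> dens D \<Longrightarrow> norm (M - \<rho> t) < \<delta> \<Longrightarrow> M \<in> dens_pos D \<and> suminf (\<lambda>k. term_k a d X k M) = rho_contract D j M X"
    by (rule contract_series[OF \<rho>(2)[OF t]]) (rule that, assumption+)
  have pA: "p z \<in> A" for z using in_A by (auto simp: p_def)
  have "continuous_on UNIV p"
    unfolding p_def using FG
    by (intro continuous_intros bounded_linear.continuous_on[OF cscale_bounded_linear] holomorphic_on_imp_continuous_on)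
  then have "isCont p (complex_of_real t)" by (simp add: continuous_on_eq_continuous_at)
  then obtain r where r: "r > 0" "\<And>z. dist z (complex_of_real t) < r \<Longrightarrow> dist (p z) (p (complex_of_real t)) < \<delta>"
    using s(1) unfolding continuous_at_eps_delta by blast
  define S where "S = ball (complex_of_real t) r"
  have pS: "p z \<in> {M \<in> A. norm (M - \<rho> t) < \<delta>}" if "z \<in> S" for z
    using r(2)[of z] pA that \<rho>(1)[OF t] by (simp add: S_def dist_norm norm_minus_commute p_def)
  define Q where "Q z = suminf (\<lambda>k. term_k a d X k (p z))" for z
  have hol: "(\<lambda>z. Q z $ i $ i') holomorphic_on S" for i i'
  proof (rule holomorphic_uniform_sequence)
    show "open S" by (simp add: S_def)
    show "(\<lambda>z. (\<Sum>k<N. term_k a d X k (p z)) $ i $ i') holomorphic_on S" for N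
    proof -
      have "(\<lambda>z. term_k a d X k (p z) $ i $ i') holomorphic_on S" for k
        unfolding p_def
        by (rule term_k_holomorphic[OF in_A])
          (use FG s(2) pS in \<open>auto simp: p_def intro: holomorphic_on_subset\<close>)
      then show ?thesis by (simp, intro holomorphic_intros)
    qed
    fix z assume "z \<in> S"
    then obtain e where e: "e > 0" "cball z e \<subseteq> S"
      using \<open>open S\<close> open_contains_cball by blast
    have "uniform_limit (cball z e) (\<lambda>N z. (\<Sum>k<N. term_k a d X k (p z)) $ i $ i') (\<lambda>z. Q z $ i $ i') sequentially"
      unfolding uniform_limit_iff
    proof (intro allI impI)
      fix \<epsilon> :: real assume "\<epsilon> > 0"
      with s(3)[of X] have "\<forall>\<^sub>F N in sequentially. \<forall>M\<in>{M \<in> A. norm (M - \<rho> t) < \<delta>}.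
          dist (\<Sum>k<N. term_k a d X k M) (suminf (\<lambda>k. term_k a d X k M)) < \<epsilon>"
        unfolding uniform_limit_iff by blast
      then show "\<forall>\<^sub>F N in sequentially. \<forall>z\<in>cball z e.
          dist ((\<Sum>k<N. term_k a d X k (p z)) $ i $ i') (Q z $ i $ i') < \<epsilon>"
      proof eventually_elim
        case (elim N)
        show ?case
        proof
          fix y assume "y \<in> cball z e"
          then have "dist (\<Sum>k<N. term_k a d X k (p y)) (Q y) < \<epsilon>"
            unfolding Q_def using elim pS e(2) by blast
          then show "dist ((\<Sum>k<N. term_k a d X k (p y)) $ i $ i') (Q y $ i $ i') < \<epsilon>"
            using dist_vec_nth_le[of "(\<Sum>k<N. term_k a d X k (p y)) $ i" i' "Q y $ i"]
              dist_vec_nth_le[of "\<Sum>k<N. term_k a d X k (p y)" i "Q y"] by linarith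
        qed
      qed
    qed
    then show "\<exists>e>0. cball z e \<subseteq> S \<and> uniform_limit (cball z e)
        (\<lambda>N z. (\<Sum>k<N. term_k a d X k (p z)) $ i $ i') (\<lambda>z. Q z $ i $ i') sequentially"
      using e by (intro exI[of _ e] conjI)
  qed
  \<comment> \<open>The trace is linear on \<open>\<B>\<close> only. In coordinates it is a fixed
    combination of matrix entries, to which their holomorphy passes.\<close>
  obtain w where w: "\<And>Y. Y \<in> \<B> \<Longrightarrow> \<tau>\<^sub>B (adj c ** Y) = (\<Sum>a\<in>UNIV. \<Sum>b\<in>UNIV. w a b * Y $ a $ b)"
    by (rule B.functional_coords[of "\<lambda>Y. \<tau>\<^sub>B (adj c ** Y)"])
      (use cX in \<open>auto simp: matrix_add_ldistrib B.tr_add B.tr_cscale\<close>)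
  define H where "H z = (\<Sum>a\<in>UNIV. \<Sum>b\<in>UNIV. w a b * Q z $ a $ b)" for z
  have "H holomorphic_on S" unfolding H_def by (intro holomorphic_intros hol)
  moreover have "\<tau>\<^sub>B (adj c ** rho_contract D j (\<rho> u) X) = H (complex_of_real u)"
    if u: "u \<in> {0..1}" "\<bar>u - t\<bar> < r" for u
  proof -
    have "dist (complex_of_real u) (complex_of_real t) < r" using u(2) by (simp add: dist_real_def)
    then have "complex_of_real u \<in> S" by (simp add: S_def dist_commute)
    from pS[OF this] have "norm (\<rho> u - \<rho> t) < \<delta>" using \<rho>(1)[OF u(1)] by (simp add: p_def)
    then have "Q (complex_of_real u) = rho_contract D j (\<rho> u) X"
      using s(4)[OF dens_pos_dens[OF \<rho>(2)[OF u(1)]]] \<rho>(1)[OF u(1)] by (simp add: Q_def p_def)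
    moreover have "rho_contract D j (\<rho> u) X \<in> \<B>"
      using dsum_in[OF dens_pos_in[OF \<rho>(2)[OF u(1)]] dens_pos_herm[OF \<rho>(2)[OF u(1)]]] cX
      by (simp add: rho_contract_dsum)
    ultimately show ?thesis by (simp add: w H_def)
  qed
  ultimately show "\<exists>r>0. \<exists>F. F holomorphic_on ball (complex_of_real t) r \<and>
    (\<forall>s\<in>{0..1}. \<bar>s - t\<bar> < r \<longrightarrow> \<tau>\<^sub>B (adj c ** rho_contract D j (\<rho> s) X) = F (complex_of_real s))"
    using r(1) unfolding S_def by (intro exI[of _ r] exI[of _ H]) blast
qed

end

lemma (in diffstr) analytic01_kform:
  assumes "x \<in> A" "b1 \<in> A" "b2 \<in> A" "F holomorphic_on UNIV" "G holomorphic_on UNIV"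
    "\<And>t. t \<in> {0..1} \<Longrightarrow> \<rho> t = x + F (complex_of_real t) *\<^sub>C b1 + G (complex_of_real t) *\<^sub>C b2"
    "\<And>t. t \<in> {0..1} \<Longrightarrow> \<rho> t \<in> dens_pos D" "a \<in> A" "b \<in> A"
  shows "analytic01 (\<lambda>t. kform (\<rho> t) a b)"
  unfolding kform_def
proof (rule analytic01_sum)
  fix j assume "j \<in> idx D"
  then interpret diff_index D j by (rule index)
  show "analytic01 (\<lambda>t. btr D j (adj (pderiv_j D j a) ** rho_contract D j (\<rho> t) (pderiv_j D j b)))"
    by (rule analytic01_contract[of x b1 b2 F G]) (use assms in auto)
qed

subsection \<open>Solving for the velocity potential\<close>

text \<open>A basis over the reals, indexed by a finite type so that the system for the potential
  becomes a square matrix. It is real because self-adjointness is not a complex linear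
  condition.\<close>

definition rbasis :: "('n \<times> 'n) \<times> bool \<Rightarrow> complex^'n^'n" where
  "rbasis p = (if snd p then 1 else \<i>) *\<^sub>C munit (fst (fst p)) (snd (fst p))"

definition rcoord :: "complex^'n^'n \<Rightarrow> ('n \<times> 'n) \<times> bool \<Rightarrow> real" where
  "rcoord X p = (if snd p then Re else Im) (X $ fst (fst p) $ snd (fst p))"

lemma sum_rbasis:
  "(\<Sum>p\<in>UNIV. c p *\<^sub>R rbasis p) = (\<Sum>a\<in>UNIV. \<Sum>b\<in>UNIV. Complex (c ((a, b), True)) (c ((a, b), False)) *\<^sub>C munit a (b :: 'n::finite))"
proof -
  have "(\<Sum>p\<in>UNIV. c p *\<^sub>R rbasis p) = (\<Sum>q\<in>UNIV. \<Sum>s\<in>UNIV. c (q, s) *\<^sub>R rbasis (q, s))"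
    by (simp add: sum.cartesian_product flip: UNIV_Times_UNIV)
  also have "\<dots> = (\<Sum>q\<in>UNIV. Complex (c (q, True)) (c (q, False)) *\<^sub>C munit (fst q) (snd q))"
    by (intro sum.cong refl)
      (simp add: UNIV_bool rbasis_def scaleR_cscale Complex_eq cscale_add_left mult.commute add.commute)
  also have "\<dots> = (\<Sum>a\<in>UNIV. \<Sum>b\<in>UNIV. Complex (c ((a, b), True)) (c ((a, b), False)) *\<^sub>C munit a b)"
    by (simp add: sum.cartesian_product case_prod_beta flip: UNIV_Times_UNIV)
  finally show ?thesis .
qed

lemma rcoord_decomp: "(\<Sum>p\<in>UNIV. rcoord X p *\<^sub>R rbasis p) = X"
  by (subst munit_decomp[of X]) (simp add: sum_rbasis rcoord_def)

lemma rcoord_sum: "rcoord (\<Sum>p\<in>UNIV. c p *\<^sub>R rbasis p) p = c p"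
proof -
  define Y where "Y = (\<chi> a b. Complex (c ((a, b), True)) (c ((a, b), False)))"
  have "(\<Sum>p\<in>UNIV. c p *\<^sub>R rbasis p) = Y"
    unfolding sum_rbasis by (subst munit_decomp[of Y]) (simp add: Y_def)
  then show ?thesis by (cases p) (auto simp: rcoord_def Y_def)
qed

context erg_diffstr
begin

text \<open>Taking real parts would destroy holomorphy; on tangent vectors the form is real already,
  by its two symmetries \<open>kform_adj\<close> and \<open>kform_cnj\<close>.\<close>

lemma kform_tangent_real:
  assumes "\<rho> \<in> dens_pos D" "a \<in> tangent D" "b \<in> tangent D"
  shows "kform \<rho> a b = complex_of_real (Re (kform \<rho> a b))"
proof -
  note r = dens_pos_in[OF assms(1)] dens_pos_herm[OF assms(1)]
  note ab = tangent_in[OF assms(2)] tangent_in[OF assms(3)] tangent_herm[OF assms(2)] tangent_herm[OF assms(3)]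
  have "kform \<rho> a b = cnj (kform \<rho> a b)"
    using kform_adj[OF r ab(1,2)] kform_cnj[OF r ab(1,2)] ab by simp
  then show ?thesis by (simp add: complex_eq_iff)
qed

text \<open>The matrix \<open>G\<close> below extends \<open>kform (\<rho> t)\<close> from the tangent space to all matrices, by the
  Euclidean inner product on a complement; Cramer's rule then shows that the solution is analytic.\<close>

lemma velocity_potential:
  assumes in_A: "x \<in> A" and b: "b1 \<in> tangent D" "b2 \<in> tangent D"
    and FG: "F holomorphic_on UNIV" "G holomorphic_on UNIV"
    and \<rho>: "\<And>t. t \<in> {0..1} \<Longrightarrow> \<rho> t = x + F (complex_of_real t) *\<^sub>C b1 + G (complex_of_real t) *\<^sub>C b2"
      "\<And>t. t \<in> {0..1} \<Longrightarrow> \<rho> t \<in> dens_pos D"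
    and fg: "analytic01 (\<lambda>t. complex_of_real (f t))" "analytic01 (\<lambda>t. complex_of_real (g t))"
  obtains a where "smooth_curve a" "\<And>t. t \<in> {0..1} \<Longrightarrow> a t \<in> tangent D"
    "\<And>t. t \<in> {0..1} \<Longrightarrow> Kop D (\<rho> t) (a t) = f t *\<^sub>R b1 + g t *\<^sub>R b2"
proof -
  define v where "v t = f t *\<^sub>R b1 + g t *\<^sub>R b2" for t
  have v: "v t \<in> tangent D" for t
    unfolding v_def using b tangent_subspace by (simp add: subspace_add subspace_scale)
  \<comment> \<open>The solution is chosen pointwise, without regularity in t; its analyticity is
    read off afterwards from \<open>sol\<close>.\<close>
  have "\<exists>a. a \<in> tangent D \<and> Kop D (\<rho> t) a = v t" if "t \<in> {0..1}" for t
    using Kop_surj[OF \<rho>(2)[OF that] v[of t]] by blast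
  then obtain a where a: "\<And>t. t \<in> {0..1} \<Longrightarrow> a t \<in> tangent D" "\<And>t. t \<in> {0..1} \<Longrightarrow> Kop D (\<rho> t) (a t) = v t"
    by metis
  obtain P where P: "linear P" "\<And>x. P x \<in> tangent D" "\<And>x. x \<in> tangent D \<Longrightarrow> P x = x"
    using subspace_projection[OF tangent_subspace] by blast
  define \<beta> where "\<beta> t X Y = Re (kform (\<rho> t) (P X) (P Y)) + (X - P X) \<bullet> (Y - P Y)" for t X Y
  have bil: "bilinear (\<beta> t)" if "t \<in> {0..1}" for t
  proof -
    have "bilinear_on (tangent D) (\<lambda>a b. Re (kform (\<rho> t) a b))"
      using that by (intro bilinear_on_tangent kform_bilinear dens_pos_in dens_pos_herm \<rho>)
    then show ?thesis
      unfolding bilinear_def \<beta>_def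
      by (auto intro!: linearI simp: linear_add[OF P(1)] linear_scale[OF P(1)] bilinear_on_def P(2) algebra_simps inner_add inner_diff)
  qed
  have pos: "X = 0" if t: "t \<in> {0..1}" and 0: "\<beta> t X X = 0" for t X
  proof -
    have "0 \<le> Re (kform (\<rho> t) (P X) (P X))"
      by (rule kform_nonneg[OF dens_pos_dens[OF \<rho>(2)[OF t]] tangent_in[OF P(2)]])
    moreover have "0 \<le> (X - P X) \<bullet> (X - P X)" by simp
    ultimately have *: "Re (kform (\<rho> t) (P X) (P X)) = 0" "(X - P X) \<bullet> (X - P X) = 0"
      using 0 unfolding \<beta>_def by linarith+
    have "P X = 0" using *(1) Re_kform_pos[OF \<rho>(2)[OF t] P(2), of X] by fastforce
    then show ?thesis using *(2) by simp
  qed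
  define G where "G t = (\<chi> p q. complex_of_real (\<beta> t (rbasis p) (rbasis q)))" for t
  define w where "w t = (\<chi> p. complex_of_real (Re (\<tau> (P (rbasis p) ** v t))))" for t
  have row: "(\<Sum>q\<in>UNIV. \<beta> t X (rbasis q) * c q) = \<beta> t X (\<Sum>q\<in>UNIV. c q *\<^sub>R rbasis q)" if "t \<in> {0..1}" for t X c
  proof -
    have "linear (\<beta> t X)" using bil[OF that] by (simp add: bilinear_def)
    then show ?thesis by (simp add: linear_sum linear_scale mult.commute)
  qed
  have inv: "invertible (G t)" if t: "t \<in> {0..1}" for t
  proof -
    have zero: "c = (\<lambda>_. 0)" if c: "\<And>p. (\<Sum>q\<in>UNIV. \<beta> t (rbasis p) (rbasis q) * c q) = 0" for c
    proof -
      define X where "X = (\<Sum>q\<in>UNIV. c q *\<^sub>R rbasis q)"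
      have lin: "linear (\<lambda>Y. \<beta> t Y X)" using bil[OF t] by (simp add: bilinear_def)
      have 0: "\<beta> t (rbasis p) X = 0" for p using c[of p] row[OF t] by (simp add: X_def)
      have "\<beta> t X X = \<beta> t (\<Sum>q\<in>UNIV. c q *\<^sub>R rbasis q) X" by (simp add: X_def)
      also have "\<dots> = 0" by (simp add: linear_sum[OF lin] linear_scale[OF lin] 0)
      finally have "X = 0" by (rule pos[OF t])
      then have "c p = 0" for p using rcoord_sum[of c p] by (cases "snd p") (simp_all add: X_def rcoord_def)
      then show ?thesis by auto
    qed
    \<comment> \<open>\<open>G t\<close> has real entries, so the real and imaginary parts of a
      kernel vector lie in the kernel separately.\<close>
    have "y = 0" if y: "G t *v y = 0" for y
    proof -
      have row0: "(\<Sum>q\<in>UNIV. complex_of_real (\<beta> t (rbasis p) (rbasis q)) * y $ q) = 0" for p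
        using arg_cong[OF y, of "\<lambda>u. u $ p"] by (simp add: G_def matrix_vector_mult_def)
      have "(\<Sum>q\<in>UNIV. \<beta> t (rbasis p) (rbasis q) * Re (y $ q)) = 0" for p
        using arg_cong[OF row0[of p], of Re] by simp
      moreover have "(\<Sum>q\<in>UNIV. \<beta> t (rbasis p) (rbasis q) * Im (y $ q)) = 0" for p
        using arg_cong[OF row0[of p], of Im] by simp
      ultimately have "(\<lambda>q. Re (y $ q)) = (\<lambda>_. 0)" "(\<lambda>q. Im (y $ q)) = (\<lambda>_. 0)"
        by (intro zero; simp)+
      then show ?thesis by (simp add: vec_eq_iff complex_eq_iff fun_eq_iff)
    qed
    then have "\<exists>B. B ** G t = mat 1"
      unfolding matrix_left_invertible_ker by blast
    then show ?thesis by (simp add: invertible_left_inverse)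
  qed
  have sol: "matrix_inv (G t) *v w t = (\<chi> q. complex_of_real (rcoord (a t) q))" if t: "t \<in> {0..1}" for t
  proof -
    note r = dens_pos_in[OF \<rho>(2)[OF t]] dens_pos_herm[OF \<rho>(2)[OF t]]
    have "G t *v (\<chi> q. complex_of_real (rcoord (a t) q)) = w t"
    proof -
      have "(G t *v (\<chi> q. complex_of_real (rcoord (a t) q))) $ p = w t $ p" for p
      proof -
        have "(G t *v (\<chi> q. complex_of_real (rcoord (a t) q))) $ p =
            complex_of_real (\<Sum>q\<in>UNIV. \<beta> t (rbasis p) (rbasis q) * rcoord (a t) q)"
          by (simp add: G_def matrix_vector_mult_def)
        also have "\<dots> = complex_of_real (\<beta> t (rbasis p) (a t))"
          by (simp add: row[OF t] rcoord_decomp)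
        \<comment> \<open>\<open>a t\<close> is tangent, so its component in the complement vanishes
          and only the form of \<open>Kop\<close> is left.\<close>
        also have "\<beta> t (rbasis p) (a t) = Re (\<tau> (P (rbasis p) ** v t))"
          using Kop_form[OF r tangent_in[OF P(2)] tangent_in[OF a(1)[OF t]], of "rbasis p"]
          by (simp add: \<beta>_def P(3)[OF a(1)[OF t]] a(2)[OF t] tangent_herm[OF P(2)])
        finally show ?thesis by (simp add: w_def)
      qed
      then show ?thesis by (simp add: vec_eq_iff)
    qed
    then have "matrix_inv (G t) *v w t = (matrix_inv (G t) ** G t) *v (\<chi> q. complex_of_real (rcoord (a t) q))"
      by (simp flip: matrix_vector_mul_assoc)
    then show ?thesis by (simp add: invertible_matrix_inv(2)[OF inv[OF t]])
  qed
  have anG: "analytic01 (\<lambda>t. G t $ p $ q)" for p q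
  proof (rule analytic01_cong)
    show "analytic01 (\<lambda>t. kform (\<rho> t) (P (rbasis p)) (P (rbasis q)) +
        complex_of_real ((rbasis p - P (rbasis p)) \<bullet> (rbasis q - P (rbasis q))))"
      by (intro analytic01_add analytic01_const analytic01_kform[OF in_A _ _ FG \<rho>] tangent_in P b)
    show "G t $ p $ q = kform (\<rho> t) (P (rbasis p)) (P (rbasis q)) +
        complex_of_real ((rbasis p - P (rbasis p)) \<bullet> (rbasis q - P (rbasis q)))" if "t \<in> {0..1}" for t
      using kform_tangent_real[OF \<rho>(2)[OF that] P(2) P(2), of "rbasis p" "rbasis q"]
      by (simp add: G_def \<beta>_def)
  qed
  have anw: "analytic01 (\<lambda>t. w t $ p)" for p
  proof (rule analytic01_cong)
    show "analytic01 (\<lambda>t. complex_of_real (f t) * complex_of_real (Re (\<tau> (P (rbasis p) ** b1))) +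
        complex_of_real (g t) * complex_of_real (Re (\<tau> (P (rbasis p) ** b2))))"
      by (intro analytic01_add analytic01_mult analytic01_const fg)
    show "w t $ p = complex_of_real (f t) * complex_of_real (Re (\<tau> (P (rbasis p) ** b1))) +
        complex_of_real (g t) * complex_of_real (Re (\<tau> (P (rbasis p) ** b2)))" for t
      using tangent_in[OF P(2)] tangent_in[OF b(1)] tangent_in[OF b(2)]
      by (simp add: w_def v_def scaleR_cscale matrix_add_ldistrib tr_add tr_cscale)
  qed
  have an: "analytic01 (\<lambda>t. complex_of_real (rcoord (a t) p))" for p
  proof (rule analytic01_cong)
    show "analytic01 (\<lambda>t. \<Sum>q\<in>UNIV. matrix_inv (G t) $ p $ q * w t $ q)"
      by (intro analytic01_sum analytic01_mult analytic01_matrix_inv anG inv anw)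
    show "complex_of_real (rcoord (a t) p) = (\<Sum>q\<in>UNIV. matrix_inv (G t) $ p $ q * w t $ q)" if "t \<in> {0..1}" for t
      using arg_cong[OF sol[OF that], of "\<lambda>u. u $ p"] by (simp add: matrix_vector_mult_def)
  qed
  have "smooth_curve a"
  proof (rule smooth_curve_analytic01)
    fix i k
    show "analytic01 (\<lambda>t. a t $ i $ k)"
    proof (rule analytic01_cong)
      show "analytic01 (\<lambda>t. complex_of_real (rcoord (a t) ((i, k), True)) + \<i> * complex_of_real (rcoord (a t) ((i, k), False)))"
        by (intro analytic01_add analytic01_mult analytic01_const an)
    qed (simp add: rcoord_def complex_eq_iff)
  qed
  then show ?thesis using a that by (simp add: v_def)
qed

end

section \<open>The action of a curve\<close>

text \<open>Stands in for the Cauchy-Schwarz inequality under the integral: pointwise n \<le> (n^2 /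
  r + r) / 2, and r is optimised after integration.\<close>

lemma le_sqrt_of_amgm:
  assumes "0 \<le> B" "\<And>r. 0 < r \<Longrightarrow> X \<le> (B / r + r) / 2"
  shows "X \<le> sqrt B"
proof (cases "B = 0")
  case True
  show ?thesis
  proof (rule ccontr)
    assume "\<not> X \<le> sqrt B"
    then show False using assms(2)[of X] True by simp
  qed
next
  case False
  then have "0 < sqrt B" using assms by simp
  moreover have "B / sqrt B = sqrt B" using assms(1) by (rule real_div_sqrt)
  ultimately show ?thesis using assms(2)[of "sqrt B"] by simp
qed

context diffstr
begin

definition action :: "(real \<Rightarrow> complex^'n^'n) \<Rightarrow> (real \<Rightarrow> complex^'n^'n) \<Rightarrow> real" where
  "action \<rho> a = integral {0..1} (\<lambda>t. Re (\<tau> (a t ** Kop D (\<rho> t) (a t))))"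

text \<open>The trace of the square of \<rho> is at most U times the trace of \<rho>, and the trace
  inner product controls the Euclidean norm.\<close>

lemma dens_bounded:
  obtains R where "R > 0" "\<And>\<rho>. \<rho> \<in> dens D \<Longrightarrow> norm \<rho> \<le> R"
proof -
  obtain c where c: "c > 0" "\<And>a. a \<in> A \<Longrightarrow> c * (norm a)\<^sup>2 \<le> Re (\<tau> (adj a ** a))"
    using pos_def_on_coercive[OF subspace_alg tr_bilinear tr_sq_pos] by blast
  obtain U where U: "U > 0" "\<And>\<rho> x. \<rho> \<in> dens D \<Longrightarrow> x \<in> eigvals \<rho> \<Longrightarrow> x \<le> U"
    using dens_eigvals_le by blast
  have "norm \<rho> \<le> sqrt (U / c)" if \<rho>: "\<rho> \<in> dens D" for \<rho>
  proof -
    note r = dens_in[OF \<rho>] dens_herm[OF \<rho>]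
    let ?E = "eigproj \<rho>"
    note e = eigproj_in[OF r] eigproj_idem[OF r(2)] eigproj_adj[OF r(2)]
    have nn: "0 \<le> Re (\<tau> (?E y))" if "y \<in> eigvals \<rho>" for y
      using tr_sq_nonneg[of "?E y"] e that by simp
    have tr_fun: "Re (\<tau> (herm_fun f \<rho>)) = (\<Sum>y\<in>eigvals \<rho>. f y * Re (\<tau> (?E y)))" for f
      unfolding herm_fun_def using e by (subst tr_sum) (auto simp: tr_cscale)
    have "\<rho> ** \<rho> = herm_fun (\<lambda>x. x * x) \<rho>"
      using herm_fun_mult[OF r(2), of "\<lambda>x. x" "\<lambda>x. x"] by (simp add: herm_fun_id[OF r(2)])
    then have "Re (\<tau> (adj \<rho> ** \<rho>)) = (\<Sum>y\<in>eigvals \<rho>. y * y * Re (\<tau> (?E y)))"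
      by (simp add: r tr_fun)
    also have "\<dots> \<le> (\<Sum>y\<in>eigvals \<rho>. U * (y * Re (\<tau> (?E y))))"
      unfolding mult.assoc using U(2)[OF \<rho>] dens_eigvals[OF \<rho>] nn
      by (intro sum_mono mult_right_mono mult_nonneg_nonneg) auto
    also have "\<dots> = U * Re (\<tau> (herm_fun (\<lambda>x. x) \<rho>))" by (simp add: tr_fun sum_distrib_left)
    also have "\<dots> = U" by (simp add: herm_fun_id[OF r(2)] dens_tr[OF \<rho>])
    finally have "c * (norm \<rho>)\<^sup>2 \<le> U" using c(2)[OF r(1)] by simp
    then have "(norm \<rho>)\<^sup>2 \<le> U / c" using c by (simp add: field_simps)
    then show ?thesis by (rule real_le_rsqrt)
  qed
  then show ?thesis using U c that[of "sqrt (U / c)"] by simp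
qed

lemma dens_diff_tangent: "\<rho> \<in> dens D \<Longrightarrow> \<nu> \<in> dens D \<Longrightarrow> \<rho> - \<nu> \<in> tangent D"
  by (simp add: tangent_def dens_in adj_diff dens_herm tr_diff dens_tr)

lemma continuous_on_tr:
  assumes "continuous_on S f" "\<And>t. t \<in> S \<Longrightarrow> f t \<in> A"
  shows "continuous_on S (\<lambda>t. \<tau> (f t))"
  unfolding continuous_on_def
proof
  fix t assume t: "t \<in> S"
  have "\<forall>\<^sub>F s in at t within S. f s \<in> A"
    using assms(2) by (auto simp: eventually_at_filter)
  with assms t show "((\<lambda>t. \<tau> (f t)) \<longlongrightarrow> \<tau> (f t)) (at t within S)"
    by (intro tr_tendsto) (auto simp: continuous_on_def)
qed

lemma smooth_curve_continuous: "smooth_curve f \<Longrightarrow> continuous_on {0..1} f"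
  unfolding smooth_curve_def
  by (metis continuous_on_eq_continuous_within funpow_0 has_vector_derivative_continuous)

context
  fixes x y \<rho> a
  assumes adm: "admissible_curve D x y \<rho> a"
begin

lemma adm_ends: "\<rho> 0 = x" "\<rho> 1 = y"
  and adm_dens: "t \<in> {0..1} \<Longrightarrow> \<rho> t \<in> dens_pos D"
  and adm_tangent: "t \<in> {0..1} \<Longrightarrow> a t \<in> tangent D"
  and adm_deriv: "t \<in> {0..1} \<Longrightarrow> (\<rho> has_vector_derivative Kop D (\<rho> t) (a t)) (at t within {0..1})"
  using adm by (auto simp: admissible_curve_def)

lemma adm_form:
  assumes "t \<in> {0..1}"
  shows "Re (\<tau> (a t ** Kop D (\<rho> t) (a t))) = Re (kform (\<rho> t) (a t) (a t))"
  using Kop_form[OF dens_pos_in dens_pos_herm, OF adm_dens adm_dens tangent_in tangent_in,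
      OF assms assms adm_tangent adm_tangent, OF assms assms] tangent_herm[OF adm_tangent[OF assms]]
  by simp

lemma adm_nonneg: "t \<in> {0..1} \<Longrightarrow> 0 \<le> Re (\<tau> (a t ** Kop D (\<rho> t) (a t)))"
  by (simp add: adm_form kform_nonneg dens_pos_dens adm_dens tangent_in adm_tangent)

text \<open>Along an admissible curve this is the derivative of \<rho>, which is continuous because
  \<rho> is smooth.\<close>

lemma adm_Kop_continuous: "continuous_on {0..1} (\<lambda>t. Kop D (\<rho> t) (a t))"
proof -
  obtain d where d: "d 0 = \<rho>" "\<And>n t. t \<in> {0..1} \<Longrightarrow> (d n has_vector_derivative d (Suc n) t) (at t within {0..1})"
    using adm unfolding admissible_curve_def smooth_curve_def by blast
  have "d 1 t = Kop D (\<rho> t) (a t)" if "t \<in> {0..1}" for t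
    using d(2)[OF that, of 0] adm_deriv[OF that] that
    by (intro vector_derivative_unique_within[of t "{0..1}" \<rho>])
      (auto simp: d(1) at_within_cbox_finite[of 0 1, simplified] trivial_limit_within islimpt_Icc)
  moreover have "continuous_on {0..1} (d 1)"
    unfolding continuous_on_eq_continuous_within
    using d(2)[of _ 1] has_vector_derivative_continuous by blast
  ultimately show ?thesis by (rule continuous_on_eq[rotated])
qed

lemma adm_continuous: "continuous_on {0..1} a" "continuous_on {0..1} \<rho>"
  using adm smooth_curve_continuous by (auto simp: admissible_curve_def)

lemma adm_integrand_continuous: "continuous_on {0..1} (\<lambda>t. Re (\<tau> (a t ** Kop D (\<rho> t) (a t))))"
  by (intro continuous_intros continuous_on_tr mm.continuous_on adm_continuous adm_Kop_continuous mult_in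
      tangent_in adm_tangent Kop_in dens_pos_in dens_pos_herm adm_dens)

lemma adm_integrable: "(\<lambda>t. Re (\<tau> (a t ** Kop D (\<rho> t) (a t)))) integrable_on {0..1}"
  using adm_integrand_continuous by (rule integrable_continuous_real)

lemma action_nonneg: "0 \<le> action \<rho> a"
  unfolding action_def by (rule integral_nonneg[OF adm_integrable]) (rule adm_nonneg)

text \<open>Applied with \<open>g\<close> the identity, to compare norm and distance, and with
  \<open>g\<close> the pairing with the entropy gradient, for the slope bound.\<close>

lemma adm_bound:
  fixes g :: "complex^'n^'n \<Rightarrow> 'b::euclidean_space"
  assumes g: "bounded_linear g" and "0 \<le> B" and s: "s \<in> {0..1}"
    and bd: "\<And>t. t \<in> {0..s} \<Longrightarrow> (norm (g (Kop D (\<rho> t) (a t))))\<^sup>2 \<le> B * Re (kform (\<rho> t) (a t) (a t))"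
  shows "norm (g (\<rho> s) - g x) \<le> sqrt (B * action \<rho> a)"
proof (rule le_sqrt_of_amgm)
  show "0 \<le> B * action \<rho> a" using assms(2) action_nonneg by simp
  fix r :: real assume r: "0 < r"
  let ?e = "\<lambda>t. Re (\<tau> (a t ** Kop D (\<rho> t) (a t)))"
  have sub: "{0..s} \<subseteq> {0..1}" using s by auto
  have "((\<lambda>t. g (Kop D (\<rho> t) (a t))) has_integral (g (\<rho> s) - g (\<rho> 0))) {0..s}"
  proof (rule fundamental_theorem_of_calculus)
    fix t assume "t \<in> {0..s}"
    then have "(\<rho> has_vector_derivative Kop D (\<rho> t) (a t)) (at t within {0..s})"
      using adm_deriv[of t] sub has_vector_derivative_within_subset by blast
    then show "((\<lambda>t. g (\<rho> t)) has_vector_derivative g (Kop D (\<rho> t) (a t))) (at t within {0..s})"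
      by (rule bounded_linear.has_vector_derivative[OF g])
  qed (use s in simp)
  then have int: "(\<lambda>t. g (Kop D (\<rho> t) (a t))) integrable_on {0..s}"
    "integral {0..s} (\<lambda>t. g (Kop D (\<rho> t) (a t))) = g (\<rho> s) - g x"
    using adm_ends(1) by (auto simp: integrable_on_def)
  have ie: "?e integrable_on {0..s}" using adm_integrable sub by (rule integrable_on_subinterval)
  have i1: "(\<lambda>t. (B / r) / 2 * ?e t) integrable_on {0..s}"
    using integrable_on_cmult_left[OF ie, of "(B / r) / 2"] by simp
  have ib: "(\<lambda>t. (B / r) / 2 * ?e t + r / 2) integrable_on {0..s}"
    by (intro integrable_add i1 integrable_const_ivl)
  have "norm (g (\<rho> s) - g x) \<le> integral {0..s} (\<lambda>t. (B / r) / 2 * ?e t + r / 2)"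
    unfolding int(2)[symmetric]
  proof (rule integral_norm_bound_integral[OF int(1) ib])
    fix t assume t: "t \<in> {0..s}"
    let ?n = "norm (g (Kop D (\<rho> t) (a t)))"
    have "?n\<^sup>2 \<le> B * ?e t" using bd[OF t] adm_form[of t] t sub by auto
    moreover have "0 \<le> (?n - r)\<^sup>2" by simp
    ultimately have "2 * r * ?n \<le> B * ?e t + r\<^sup>2" by (simp add: power2_diff algebra_simps)
    then show "?n \<le> (B / r) / 2 * ?e t + r / 2" using r by (simp add: field_simps power2_eq_square)
  qed
  also have "\<dots> = (B / r) / 2 * integral {0..s} ?e + r / 2 * s"
    using s by (subst integral_add[OF i1 integrable_const_ivl]) simp
  also have "\<dots> \<le> (B / r) / 2 * action \<rho> a + r / 2 * 1"
  proof (intro add_mono mult_left_mono)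
    show "integral {0..s} ?e \<le> action \<rho> a"
      unfolding action_def using sub ie adm_integrable
      by (rule integral_subset_le) (use adm_nonneg in blast)
  qed (use s r assms(2) in auto)
  finally show "norm (g (\<rho> s) - g x) \<le> (B * action \<rho> a / r + r) / 2"
    by (simp add: field_simps)
qed

end

lemma riem_dist_le:
  assumes "admissible_curve D x y \<rho> a" shows "riem_dist D x y \<le> sqrt (action \<rho> a)"
proof -
  let ?S = "{(\<rho>, a). admissible_curve D x y \<rho> a}"
  have "(INF (\<rho>, a) \<in> ?S. action \<rho> a) \<le> (case (\<rho>, a) of (\<rho>, a) \<Rightarrow> action \<rho> a)"
    by (rule cINF_lower) (use assms action_nonneg in \<open>auto intro!: bdd_belowI2[of _ 0]\<close>)
  then show ?thesis by (simp add: riem_dist_def action_def)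
qed

text \<open>The given curve makes the set of competitors non-empty, so that its infimum is
  approached.\<close>

lemma riem_dist_approx:
  assumes "admissible_curve D x y \<rho> a" "e > 0"
  obtains \<rho>' a' where "admissible_curve D x y \<rho>' a'" "action \<rho>' a' < (riem_dist D x y)\<^sup>2 + e"
    "0 \<le> riem_dist D x y"
proof -
  let ?S = "{(\<rho>, a). admissible_curve D x y \<rho> a}"
  let ?I = "INF (\<rho>, a) \<in> ?S. action \<rho> a"
  have ne: "?S \<noteq> {}" using assms by auto
  have "0 \<le> ?I" by (rule cINF_greatest[OF ne]) (auto intro: action_nonneg)
  then have sq: "(riem_dist D x y)\<^sup>2 = ?I" "0 \<le> riem_dist D x y" by (simp_all add: riem_dist_def action_def)
  have "Inf ((\<lambda>(\<rho>, a). action \<rho> a) ` ?S) < ?I + e" using assms(2) by simp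
  then obtain z where "z \<in> (\<lambda>(\<rho>, a). action \<rho> a) ` ?S" "z < ?I + e"
    using cInf_lessD[of "(\<lambda>(\<rho>, a). action \<rho> a) ` ?S"] ne by blast
  then show ?thesis using that sq by auto
qed

end

context erg_diffstr
begin

text \<open>Integrates the comparison of speeds in \<open>Kop_norm_le\<close>. The second bound
  keeps an entire curve of small action near its starting point.\<close>

lemma riem_dist_ge:
  obtains c where "c > 0" "\<And>x y \<rho> a. admissible_curve D x y \<rho> a \<Longrightarrow> norm (x - y) \<le> c * riem_dist D x y"
    "\<And>x y \<rho> a s. admissible_curve D x y \<rho> a \<Longrightarrow> s \<in> {0..1} \<Longrightarrow> norm (\<rho> s - x) \<le> c * sqrt (action \<rho> a)"
proof -
  obtain C where C: "C > 0" "\<And>\<rho> a. \<rho> \<in> dens D \<Longrightarrow> a \<in> A \<Longrightarrow> (norm (Kop D \<rho> a))\<^sup>2 \<le> C * Re (kform \<rho> a a)"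
    using Kop_norm_le by blast
  have 1: "norm (\<rho> s - x) \<le> sqrt C * sqrt (action \<rho> a)"
    if adm: "admissible_curve D x y \<rho> a" and s: "s \<in> {0..1}" for x y \<rho> a s
  proof -
    have "norm (\<rho> s - x) \<le> sqrt (C * action \<rho> a)"
    proof (rule adm_bound[OF adm bounded_linear_ident _ s])
      fix t assume "t \<in> {0..s}"
      then have "t \<in> {0..1}" using s by auto
      then show "(norm (Kop D (\<rho> t) (a t)))\<^sup>2 \<le> C * Re (kform (\<rho> t) (a t) (a t))"
        by (intro C(2) dens_pos_dens tangent_in adm_dens[OF adm] adm_tangent[OF adm])
    qed (use C in simp)
    then show ?thesis by (simp add: real_sqrt_mult)
  qed
  have 2: "norm (x - y) \<le> sqrt C * riem_dist D x y" if adm: "admissible_curve D x y \<rho> a" for x y \<rho> a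
  proof (rule field_le_epsilon)
    fix e :: real assume e: "e > 0"
    \<comment> \<open>The excess e^2 / C contributes exactly e once its root is multiplied by that
      of C.\<close>
    obtain \<rho>' a' where a': "admissible_curve D x y \<rho>' a'" "action \<rho>' a' < (riem_dist D x y)\<^sup>2 + e\<^sup>2 / C"
      "0 \<le> riem_dist D x y"
      using riem_dist_approx[OF adm, of "e\<^sup>2 / C"] e C by auto
    have "norm (x - y) \<le> sqrt C * sqrt (action \<rho>' a')"
      using 1[OF a'(1), of 1] adm_ends[OF a'(1)] by (simp add: norm_minus_commute)
    also have "\<dots> \<le> sqrt C * sqrt ((riem_dist D x y)\<^sup>2 + e\<^sup>2 / C)"
      using a'(2) C by (intro mult_left_mono real_sqrt_le_mono) auto
    also have "\<dots> \<le> sqrt C * (sqrt ((riem_dist D x y)\<^sup>2) + sqrt (e\<^sup>2 / C))"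
      using e C by (intro mult_left_mono sqrt_add_le_add_sqrt) auto
    also have "\<dots> = sqrt C * riem_dist D x y + e"
      using e C a'(3) by (simp add: real_sqrt_divide field_simps)
    finally show "norm (x - y) \<le> sqrt C * riem_dist D x y + e" .
  qed
  show ?thesis using that[of "sqrt C"] C 1 2 by simp
qed

text \<open>The segment from \<open>x\<close> to \<open>y\<close>, traversed with velocity vanishing at both ends and lifted towards
  \<open>\<sigma>\<close> by \<open>\<eta> = 16 \<delta> t\<^sup>2 (1 - t)\<^sup>2\<close>: the velocity is of order \<open>\<delta> t (1 - t)\<close> and the smallest eigenvalue
  at least of order \<open>\<eta>\<close>, so the energy is of order \<open>\<delta>\<close>.\<close>

lemma short_curve:
  obtains C where "C > 0" "\<And>x y \<delta>. x \<in> dens_pos D \<Longrightarrow> y \<in> dens_pos D \<Longrightarrow> 0 < \<delta> \<Longrightarrow> \<delta> \<le> 1 \<Longrightarrow>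
    \<exists>\<rho> a. admissible_curve D x y \<rho> a \<and> (norm (y - x) \<le> \<delta> \<longrightarrow> action \<rho> a \<le> C * \<delta>)"
proof -
  obtain C0 where C0: "C0 > 0" "\<And>\<rho> a l. \<rho> \<in> dens D \<Longrightarrow> a \<in> tangent D \<Longrightarrow> 0 < l \<Longrightarrow>
    (\<And>v. l * (norm v)\<^sup>2 \<le> Re (quad_form \<rho> v)) \<Longrightarrow> Re (kform \<rho> a a) \<le> C0 * (norm (Kop D \<rho> a))\<^sup>2 / l"
    using kform_le_Kop by blast
  obtain R where R: "R > 0" "\<And>\<rho>. \<rho> \<in> dens D \<Longrightarrow> norm \<rho> \<le> R" using dens_bounded by blast
  define M where "M = 4 * R"
  obtain l0 where l0: "l0 > 0" "\<And>v. l0 * (norm v)\<^sup>2 \<le> Re (quad_form \<sigma> v)"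
    using sigma_dens_pos dens_pos_iff_ge by blast
  define C where "C = C0 * (6 + 32 * M)\<^sup>2 / (16 * l0)"
  have main: "\<exists>\<rho> a. admissible_curve D x y \<rho> a \<and> (norm (y - x) \<le> \<delta> \<longrightarrow> action \<rho> a \<le> C * \<delta>)"
    if x: "x \<in> dens_pos D" and y: "y \<in> dens_pos D" and \<delta>: "0 < \<delta>" "\<delta> \<le> 1" for x y \<delta>
  proof -
    \<comment> \<open>\<phi> is the cubic step with derivative 6 t (1 - t), so the curve stops at
      both ends; the factor 16 makes \<delta> the maximum of \<eta>. Everything is polynomial in t,
      hence analytic.\<close>
    define \<phi> \<phi>' \<eta> \<eta>' f g f' where
      "\<phi> t = 3 * t\<^sup>2 - 2 * t ^ 3" and "\<phi>' t = 6 * (t * (1 - t))"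
      and "\<eta> t = 16 * \<delta> * (t * (1 - t))\<^sup>2" and "\<eta>' t = 32 * \<delta> * (t * (1 - t)) * (1 - 2 * t)"
      and "f t = (1 - \<eta> t) * \<phi> t" and "g t = \<eta> t"
      and "f' t = (1 - \<eta> t) * \<phi>' t - \<eta>' t * \<phi> t" for t :: real
    define F G :: "complex \<Rightarrow> complex" where "F z = (1 - 16 * complex_of_real \<delta> * (z * (1 - z))\<^sup>2) * (3 * z\<^sup>2 - 2 * z ^ 3)"
      and "G z = 16 * complex_of_real \<delta> * (z * (1 - z))\<^sup>2" for z
    note defs = \<phi>_def \<phi>'_def \<eta>_def \<eta>'_def f_def g_def f'_def
    have fF: "complex_of_real (f t) = F (complex_of_real t)" "complex_of_real (g t) = G (complex_of_real t)" for t
      by (simp_all add: defs F_def G_def)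
    have FG: "F holomorphic_on UNIV" "G holomorphic_on UNIV"
      unfolding F_def G_def by (intro holomorphic_intros)+
    define b1 b2 where "b1 = y - x" and "b2 = \<sigma> - x"
    have b: "b1 \<in> tangent D" "b2 \<in> tangent D"
      using dens_diff_tangent dens_pos_dens[OF x] dens_pos_dens[OF y] sigma_dens by (auto simp: b1_def b2_def)
    define \<rho> where "\<rho> t = x + f t *\<^sub>R b1 + g t *\<^sub>R b2" for t
    have \<rho>_mix: "\<rho> t = (1 - \<eta> t) *\<^sub>R ((1 - \<phi> t) *\<^sub>R x + \<phi> t *\<^sub>R y) + \<eta> t *\<^sub>R \<sigma>" for t
      by (simp add: \<rho>_def f_def g_def b1_def b2_def algebra_simps)
    have \<phi>01: "0 \<le> \<phi> t" "\<phi> t \<le> 1" if "t \<in> {0..1}" for t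
    proof -
      have "\<phi> t = t\<^sup>2 * (3 - 2 * t)" "1 - \<phi> t = (1 - t)\<^sup>2 * (1 + 2 * t)"
        by (simp_all add: \<phi>_def algebra_simps power2_eq_square power3_eq_cube)
      moreover have "0 \<le> t\<^sup>2 * (3 - 2 * t)" "0 \<le> (1 - t)\<^sup>2 * (1 + 2 * t)" using that by auto
      ultimately show "0 \<le> \<phi> t" "\<phi> t \<le> 1" by linarith+
    qed
    have s: "0 \<le> t * (1 - t)" "t * (1 - t) \<le> 1 / 4" if "t \<in> {0..1}" for t :: real
    proof -
      have "0 \<le> (t - 1 / 2)\<^sup>2" by simp
      then show "t * (1 - t) \<le> 1 / 4" by (simp add: power2_eq_square algebra_simps)
    qed (use that in simp)
    have \<eta>01: "0 \<le> \<eta> t" "\<eta> t \<le> 1" if "t \<in> {0..1}" for t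
    proof -
      have "(t * (1 - t))\<^sup>2 \<le> (1 / 4)\<^sup>2" using s[OF that] by (intro power_mono) auto
      then have "\<delta> * (16 * (t * (1 - t))\<^sup>2) \<le> 1 * 1" using \<delta> by (intro mult_mono) (auto simp: power2_eq_square)
      then show "\<eta> t \<le> 1" by (simp add: \<eta>_def mult_ac)
    qed (use \<delta> in \<open>simp add: \<eta>_def\<close>)
    have mix: "(1 - \<phi> t) *\<^sub>R x + \<phi> t *\<^sub>R y \<in> dens D" if "t \<in> {0..1}" for t
      using dens_convex[OF dens_pos_dens[OF x] dens_pos_dens[OF y] \<phi>01[OF that]] .
    have ends: "\<rho> 0 = x" "\<rho> 1 = y" by (simp_all add: \<rho>_def defs b1_def)
    have dp: "\<rho> t \<in> dens_pos D" if t: "t \<in> {0..1}" for t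
    proof (cases "t = 0 \<or> t = 1")
      case True
      then show ?thesis using ends x y by auto
    next
      case False
      then have "0 < \<eta> t" using \<delta> t by (simp add: \<eta>_def)
      then show ?thesis unfolding \<rho>_mix using dens_pos_mix[OF mix[OF t] sigma_dens_pos] \<eta>01(2)[OF t] by blast
    qed
    have \<rho>z: "\<rho> t = x + F (complex_of_real t) *\<^sub>C b1 + G (complex_of_real t) *\<^sub>C b2" for t
      by (simp add: \<rho>_def scaleR_cscale fF)
    have fg: "analytic01 (\<lambda>t. complex_of_real (f' t))" "analytic01 (\<lambda>t. complex_of_real (\<eta>' t))"
      by (rule analytic01_entire[of "\<lambda>z. (1 - 16 * complex_of_real \<delta> * (z * (1 - z))\<^sup>2) * (6 * (z * (1 - z)))
            - 32 * complex_of_real \<delta> * (z * (1 - z)) * (1 - 2 * z) * (3 * z\<^sup>2 - 2 * z ^ 3)"],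
          (intro holomorphic_intros)[1], simp add: defs)
        (rule analytic01_entire[of "\<lambda>z. 32 * complex_of_real \<delta> * (z * (1 - z)) * (1 - 2 * z)"],
          (intro holomorphic_intros)[1], simp add: defs)
    obtain a where a: "smooth_curve a" "\<And>t. t \<in> {0..1} \<Longrightarrow> a t \<in> tangent D"
      "\<And>t. t \<in> {0..1} \<Longrightarrow> Kop D (\<rho> t) (a t) = f' t *\<^sub>R b1 + \<eta>' t *\<^sub>R b2"
      using velocity_potential[OF dens_pos_in[OF x] b FG \<rho>z dp fg] by blast
    have "smooth_curve \<rho>"
    proof (rule smooth_curve_analytic01, rule analytic01_entire)
      fix i k
      show "(\<lambda>z. (x + F z *\<^sub>C b1 + G z *\<^sub>C b2) $ i $ k) holomorphic_on UNIV"
        by (simp, intro holomorphic_intros FG)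
    qed (simp add: \<rho>z)
    have d\<phi>: "(\<phi> has_real_derivative \<phi>' t) (at t within S)" for t S
      unfolding \<phi>_def \<phi>'_def by (auto intro!: derivative_eq_intros simp: algebra_simps power2_eq_square)
    have d\<eta>: "(\<eta> has_real_derivative \<eta>' t) (at t within S)" for t S
      unfolding \<eta>_def \<eta>'_def by (auto intro!: derivative_eq_intros simp: algebra_simps power2_eq_square)
    have df: "(f has_real_derivative f' t) (at t within S)" for t S
      unfolding f_def f'_def by (auto intro!: derivative_eq_intros d\<phi> d\<eta>)
    have "(\<rho> has_vector_derivative f' t *\<^sub>R b1 + \<eta>' t *\<^sub>R b2) (at t within {0..1})" for t
      unfolding \<rho>_def g_def using df[of t "{0..1}"] d\<eta>[of t "{0..1}"]
      by (auto intro!: derivative_eq_intros has_vector_derivative_scaleR simp: has_real_derivative_iff_has_vector_derivative)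
    with a \<open>smooth_curve \<rho>\<close> ends dp have adm: "admissible_curve D x y \<rho> a"
      by (simp add: admissible_curve_def)
    have "action \<rho> a \<le> C * \<delta>" if d: "norm (y - x) \<le> \<delta>"
    proof -
      have e: "Re (\<tau> (a t ** Kop D (\<rho> t) (a t))) \<le> C * \<delta>" if t: "t \<in> {0..1}" for t
      proof (cases "t = 0 \<or> t = 1")
        case True
        \<comment> \<open>At the ends the lift vanishes, but so does the velocity.\<close>
        then have "Kop D (\<rho> t) (a t) = 0" using a(3)[OF t] by (auto simp: defs)
        then show ?thesis using C0 \<delta> l0 by (simp add: C_def)
      next
        case False
        define s where "s = t * (1 - t)"
        have s0: "0 < s" using False t by (simp add: s_def)
        have \<eta>s: "\<eta> t = 16 * \<delta> * s\<^sup>2" by (simp add: \<eta>_def s_def)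
        have low: "\<eta> t * l0 * (norm v)\<^sup>2 \<le> Re (quad_form (\<rho> t) v)" for v
        proof -
          have "0 \<le> (1 - \<eta> t) * Re (quad_form ((1 - \<phi> t) *\<^sub>R x + \<phi> t *\<^sub>R y) v)"
            using mix[OF t] \<eta>01[OF t] by (intro mult_nonneg_nonneg) (auto simp: dens_def pos_semidef_def)
          moreover have "\<eta> t * (l0 * (norm v)\<^sup>2) \<le> \<eta> t * Re (quad_form \<sigma> v)"
            using l0(2) \<eta>01[OF t] by (intro mult_left_mono) auto
          ultimately show ?thesis unfolding \<rho>_mix by (simp add: quad_form_add quad_form_scaleR)
        qed
        have "norm (f' t *\<^sub>R b1 + \<eta>' t *\<^sub>R b2) \<le> s * (\<delta> * (6 + 32 * M))"
        proof -
          \<comment> \<open>Regrouped like this, the first summand carries y - x, of norm at most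
            \<delta>, and the second carries \<eta>', which has a factor \<delta> of its
            own.\<close>
          have eq: "f' t *\<^sub>R b1 + \<eta>' t *\<^sub>R b2 = ((1 - \<eta> t) * \<phi>' t) *\<^sub>R (y - x) + \<eta>' t *\<^sub>R (\<sigma> - ((1 - \<phi> t) *\<^sub>R x + \<phi> t *\<^sub>R y))"
            by (simp add: f'_def b1_def b2_def algebra_simps)
          have 1: "\<bar>(1 - \<eta> t) * \<phi>' t\<bar> * norm (y - x) \<le> 6 * s * \<delta>"
          proof (intro mult_mono d)
            have "\<bar>(1 - \<eta> t) * \<phi>' t\<bar> \<le> 1 * (6 * s)"
              unfolding abs_mult using \<eta>01[OF t] s0 by (intro mult_mono) (auto simp: \<phi>'_def s_def)
            then show "\<bar>(1 - \<eta> t) * \<phi>' t\<bar> \<le> 6 * s" by simp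
          qed (use s0 in auto)
          have 2: "\<bar>\<eta>' t\<bar> * norm (\<sigma> - ((1 - \<phi> t) *\<^sub>R x + \<phi> t *\<^sub>R y)) \<le> (32 * \<delta> * s) * M"
          proof (intro mult_mono)
            have "\<bar>\<eta>' t\<bar> = 32 * \<delta> * s * \<bar>1 - 2 * t\<bar>"
              using \<delta> s0 by (simp add: \<eta>'_def abs_mult flip: s_def)
            also have "\<dots> \<le> 32 * \<delta> * s * 1" using \<delta> s0 t by (intro mult_left_mono) auto
            finally show "\<bar>\<eta>' t\<bar> \<le> 32 * \<delta> * s" by simp
            have "norm (\<sigma> - ((1 - \<phi> t) *\<^sub>R x + \<phi> t *\<^sub>R y)) \<le> R + R"
              using R(2)[OF sigma_dens] R(2)[OF mix[OF t]] by (intro order.trans[OF norm_triangle_ineq4]) auto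
            then show "norm (\<sigma> - ((1 - \<phi> t) *\<^sub>R x + \<phi> t *\<^sub>R y)) \<le> M" using R by (simp add: M_def)
          qed (use \<delta> s0 in auto)
          have "norm (f' t *\<^sub>R b1 + \<eta>' t *\<^sub>R b2) \<le> 6 * s * \<delta> + (32 * \<delta> * s) * M"
            unfolding eq using 1 2 by (intro order.trans[OF norm_triangle_ineq] add_mono) auto
          then show ?thesis by (simp add: algebra_simps)
        qed
        then have "(norm (f' t *\<^sub>R b1 + \<eta>' t *\<^sub>R b2))\<^sup>2 \<le> (s * (\<delta> * (6 + 32 * M)))\<^sup>2" by (intro power_mono) auto
        then have "C0 * (norm (f' t *\<^sub>R b1 + \<eta>' t *\<^sub>R b2))\<^sup>2 / (\<eta> t * l0) \<le> C0 * (s * (\<delta> * (6 + 32 * M)))\<^sup>2 / (\<eta> t * l0)"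
          using C0 l0 \<eta>01[OF t] by (intro divide_right_mono mult_left_mono) auto
        \<comment> \<open>The squared velocity is of order s^2 \<delta>^2 and the eigenvalue bound
          of order s^2 \<delta>, so s cancels and one \<delta> remains.\<close>
        also have "\<dots> = C * \<delta>"
          unfolding \<eta>s C_def using s0 \<delta> l0 by (simp add: field_simps power_mult_distrib power2_eq_square)
        finally have "C0 * (norm (Kop D (\<rho> t) (a t)))\<^sup>2 / (\<eta> t * l0) \<le> C * \<delta>" by (simp add: a(3)[OF t])
        moreover have "0 < \<eta> t * l0" using s0 \<delta> l0 by (simp add: \<eta>s)
        ultimately show ?thesis
          unfolding adm_form[OF adm t] using C0(2)[OF dens_pos_dens[OF dp[OF t]] a(2)[OF t] _ low] by linarith
      qed
      have "action \<rho> a \<le> integral {0..1} (\<lambda>t::real. C * \<delta>)"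
        unfolding action_def by (rule integral_le[OF adm_integrable[OF adm] integrable_const_ivl e])
      then show ?thesis by simp
    qed
    with adm show ?thesis by blast
  qed
  have "C > 0" using C0 l0 R by (simp add: C_def M_def)
  then show ?thesis using main that by blast
qed

end

section \<open>Smooth functions on the real line\<close>

text \<open>Derivatives are two-sided on the whole line, so curves that rest outside their interval
  can be added without treating junctions.\<close>

primrec Ck :: "nat \<Rightarrow> (real \<Rightarrow> 'a::real_normed_vector) \<Rightarrow> bool" where
  "Ck 0 f \<longleftrightarrow> True"
| "Ck (Suc n) f \<longleftrightarrow> (\<exists>f'. (\<forall>t. (f has_vector_derivative f' t) (at t)) \<and> Ck n f')"

lemma Ck_Suc_D: "Ck (Suc n) f \<Longrightarrow> Ck n f"
proof (induction n arbitrary: f)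
  case (Suc n)
  then show ?case by (metis Ck.simps(2))
qed simp

lemma Ck_const: "Ck n (\<lambda>_. c)"
proof (induction n arbitrary: c)
  case (Suc n)
  then show ?case by (auto intro!: exI[of _ "\<lambda>_. 0"] derivative_eq_intros)
qed simp

lemma Ck_add: "Ck n f \<Longrightarrow> Ck n g \<Longrightarrow> Ck n (\<lambda>t. f t + g t)"
proof (induction n arbitrary: f g)
  case (Suc n)
  then obtain f' g' where "\<And>t. (f has_vector_derivative f' t) (at t)" "Ck n f'"
    "\<And>t. (g has_vector_derivative g' t) (at t)" "Ck n g'" by auto
  then show ?case using Suc.IH by (auto intro!: exI[of _ "\<lambda>t. f' t + g' t"] has_vector_derivative_add)
qed simp

lemma Ck_scaleR: "Ck n g \<Longrightarrow> Ck n f \<Longrightarrow> Ck n (\<lambda>t. g t *\<^sub>R f t)"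
proof (induction n arbitrary: f g)
  case (Suc n)
  then obtain f' g' where *: "\<And>t. (f has_vector_derivative f' t) (at t)" "Ck n f'"
    "\<And>t. (g has_vector_derivative g' t) (at t)" "Ck n g'" by auto
  have "Ck n (\<lambda>t. g t *\<^sub>R f' t + g' t *\<^sub>R f t)"
    using Ck_Suc_D[OF Suc.prems(1)] Ck_Suc_D[OF Suc.prems(2)] * by (intro Ck_add Suc.IH)
  moreover have "((\<lambda>t. g t *\<^sub>R f t) has_vector_derivative g t *\<^sub>R f' t + g' t *\<^sub>R f t) (at t)" for t
    using has_vector_derivative_scaleR[of g "g' t" t UNIV f "f' t"] *(1,3)
    by (simp add: has_real_derivative_iff_has_vector_derivative)
  ultimately show ?case by (auto intro!: exI[of _ "\<lambda>t. g t *\<^sub>R f' t + g' t *\<^sub>R f t"])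
qed simp

lemma Ck_affine: "Ck n f \<Longrightarrow> Ck n (\<lambda>t. f (\<alpha> * t + \<beta>))"
proof (induction n arbitrary: f)
  case (Suc n)
  then obtain f' where *: "\<And>t. (f has_vector_derivative f' t) (at t)" "Ck n f'" by auto
  have "((\<lambda>t. f (\<alpha> * t + \<beta>)) has_vector_derivative \<alpha> *\<^sub>R f' (\<alpha> * t + \<beta>)) (at t)" for t
  proof -
    have "((\<lambda>t. \<alpha> * t + \<beta>) has_vector_derivative \<alpha>) (at t)"
      unfolding has_real_derivative_iff_has_vector_derivative[symmetric]
      by (auto intro!: derivative_eq_intros)
    from vector_diff_chain_at[OF this *(1)] show ?thesis by (simp add: o_def)
  qed
  moreover have "Ck n (\<lambda>t. \<alpha> *\<^sub>R f' (\<alpha> * t + \<beta>))"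
    using Suc.IH[OF *(2)] by (intro Ck_scaleR Ck_const)
  ultimately show ?case by (auto intro!: exI[of _ "\<lambda>t. \<alpha> *\<^sub>R f' (\<alpha> * t + \<beta>)"])
qed simp

text \<open>Derivatives obtained for different n agree by uniqueness, so one sequence serves all
  orders.\<close>

lemma Ck_smooth_curve:
  assumes "\<And>n. Ck n f" shows "smooth_curve f"
proof -
  define R where "R f \<longleftrightarrow> (\<forall>n. Ck n f)" for f :: "real \<Rightarrow> 'a"
  define nxt where "nxt f = (\<lambda>t. vector_derivative f (at t))" for f :: "real \<Rightarrow> 'a"
  have nxt: "R (nxt f) \<and> (\<forall>t. (f has_vector_derivative nxt f t) (at t))" if "R f" for f
  proof -
    have "Ck n (nxt f) \<and> (\<forall>t. (f has_vector_derivative nxt f t) (at t))" for n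
    proof -
      have "Ck (Suc n) f" using that by (simp only: R_def)
      then obtain f' where f': "\<And>t. (f has_vector_derivative f' t) (at t)" "Ck n f'" by auto
      then have "nxt f = f'" by (simp add: nxt_def fun_eq_iff vector_derivative_at)
      then show ?thesis using f' by simp
    qed
    then show ?thesis by (simp add: R_def)
  qed
  have "R ((nxt ^^ n) f)" for n
    using assms nxt by (induction n) (simp_all add: R_def)
  then show ?thesis
    unfolding smooth_curve_def using nxt
    by (intro exI[of _ "\<lambda>n. (nxt ^^ n) f"]) (simp add: has_vector_derivative_at_within)
qed

text \<open>The functions \<open>d m\<close> have derivatives only within [0, 1]; as
  \<open>s\<close> never leaves this interval, the chain rule relative to its range
  suffices.\<close>

lemma Ck_compose:
  assumes d: "\<And>m t. t \<in> {0..1} \<Longrightarrow> (d m has_vector_derivative d (Suc m) t) (at t within {0..1})"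
    and s: "\<And>t. (s has_real_derivative s' t) (at t)" "\<And>n. Ck n s'" "\<And>t. s t \<in> {0..1}"
  shows "Ck n (\<lambda>t. d m (s t))" "((\<lambda>t. d m (s t)) has_vector_derivative s' t *\<^sub>R d (Suc m) (s t)) (at t)"
proof -
  have der: "((\<lambda>t. d m (s t)) has_vector_derivative s' t *\<^sub>R d (Suc m) (s t)) (at t)" for m t
  proof -
    have "(d m has_vector_derivative d (Suc m) (s t)) (at (s t) within s ` UNIV)"
      by (rule has_vector_derivative_within_subset[OF d[OF s(3)]]) (use s(3) in auto)
    then show ?thesis
      using vector_diff_chain_within[of s "s' t" t UNIV "d m" "d (Suc m) (s t)"] s(1)[of t]
      by (simp add: o_def has_real_derivative_iff_has_vector_derivative)
  qed
  then show "((\<lambda>t. d m (s t)) has_vector_derivative s' t *\<^sub>R d (Suc m) (s t)) (at t)" .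
  show "Ck n (\<lambda>t. d m (s t))"
  proof (induction n arbitrary: m)
    case (Suc n)
    then have "Ck n (\<lambda>t. s' t *\<^sub>R d (Suc m) (s t))" by (intro Ck_scaleR s(2))
    then show ?case using der by (auto intro!: exI[of _ "\<lambda>t. s' t *\<^sub>R d (Suc m) (s t)"])
  qed simp
qed

subsection \<open>A flat step\<close>

text \<open>The family \<open>p(1/t) exp(-\<delta>/t)\<close> is closed under derivatives, and flat at \<open>0\<close>.\<close>

definition flat :: "real \<Rightarrow> real poly \<Rightarrow> real \<Rightarrow> real" where
  "flat \<delta> p t = (if 0 < t then poly p (1 / t) * exp (- \<delta> / t) else 0)"

text \<open>The free exponent \<open>k\<close> is for the induction: removing a coefficient raises
  it by one.\<close>

lemma poly_exp_tendsto:
  fixes \<delta> :: real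
  assumes "\<delta> > 0"
  shows "((\<lambda>u. u ^ k * poly p u * exp (- \<delta> * u)) \<longlongrightarrow> 0) at_top"
proof (induction p arbitrary: k)
  case (pCons a p)
  have "filterlim (\<lambda>u. \<delta> * u) at_top at_top"
    by (rule filterlim_tendsto_pos_mult_at_top[of "\<lambda>_. \<delta>" \<delta> at_top "\<lambda>x. x"])
      (use assms in \<open>auto simp: filterlim_ident\<close>)
  then have "((\<lambda>u. (\<delta> * u) ^ k / exp (\<delta> * u)) \<longlongrightarrow> 0) at_top"
    by (rule filterlim_compose[OF tendsto_power_div_exp_0])
  then have "((\<lambda>u. a / \<delta> ^ k * ((\<delta> * u) ^ k / exp (\<delta> * u))) \<longlongrightarrow> 0) at_top"
    by (rule tendsto_mult_right_zero)
  then have "((\<lambda>u. a / \<delta> ^ k * ((\<delta> * u) ^ k / exp (\<delta> * u)) + u ^ Suc k * poly p u * exp (- \<delta> * u)) \<longlongrightarrow> 0 + 0) at_top"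
    by (rule tendsto_add[OF _ pCons.IH])
  then show ?case
    using assms by (simp add: field_simps power_mult_distrib exp_minus)
qed simp

text \<open>With u = 1 / t, the derivative of p(u) exp(-\<delta> u) in t is u^2 (\<delta> p(u) -
  p'(u)) exp(-\<delta> u), again of this form; at 0 the decay in u beats every polynomial.\<close>

lemma flat_deriv:
  assumes "\<delta> > 0"
  shows "(flat \<delta> p has_real_derivative flat \<delta> (monom 1 2 * (smult \<delta> p - pderiv p)) t) (at t)"
proof -
  consider "t < 0" | "t = 0" | "0 < t" by linarith
  then show ?thesis
  proof cases
    case 1
    then have "((\<lambda>_. 0) has_real_derivative flat \<delta> (monom 1 2 * (smult \<delta> p - pderiv p)) t) (at t)"
      by (simp add: flat_def)
    then show ?thesis
      by (rule has_field_derivative_transform_within_open[of _ _ _ "{..<0}"]) (use 1 in \<open>auto simp: flat_def\<close>)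
  next
    case 3
    have "((\<lambda>t. poly p (1 / t) * exp (- \<delta> / t)) has_real_derivative
        flat \<delta> (monom 1 2 * (smult \<delta> p - pderiv p)) t) (at t)"
      using 3 by (auto intro!: derivative_eq_intros DERIV_chain2[OF poly_DERIV]
          simp: flat_def poly_monom field_simps power2_eq_square)
    then show ?thesis
      by (rule has_field_derivative_transform_within_open[of _ _ _ "{0<..}"]) (use 3 in \<open>auto simp: flat_def\<close>)
  next
    case 2
    have "((\<lambda>h. flat \<delta> p h / h) \<longlongrightarrow> 0) (at 0)"
    proof (rule filterlim_split_at_real)
      show "((\<lambda>h. flat \<delta> p h / h) \<longlongrightarrow> 0) (at_left 0)"
        by (rule tendsto_eventually) (auto simp: eventually_at_filter flat_def)
      have "((\<lambda>h. inverse h ^ 1 * poly p (inverse h) * exp (- \<delta> * inverse h)) \<longlongrightarrow> 0) (at_right 0)"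
        by (rule filterlim_compose[OF poly_exp_tendsto[OF assms] filterlim_inverse_at_top_right])
      then show "((\<lambda>h. flat \<delta> p h / h) \<longlongrightarrow> 0) (at_right 0)"
        by (rule Lim_transform_eventually) (auto simp: eventually_at_filter flat_def field_simps)
    qed
    then have "(flat \<delta> p has_real_derivative 0) (at 0)"
      by (simp add: DERIV_def) (simp add: flat_def)
    then show ?thesis using 2 by (simp add: flat_def)
  qed
qed

lemma Ck_flat: "\<delta> > 0 \<Longrightarrow> Ck n (flat \<delta> p)"
proof (induction n arbitrary: p)
  case (Suc n)
  then show ?case
    using flat_deriv[OF Suc.prems] by (auto simp: has_real_derivative_iff_has_vector_derivative)
qed simp

text \<open>A step that is flat at both ends must exceed slope 1 somewhere, but by as little as
  wanted. The slope is a bump with values in [0, 1], divided by its integral, which is made at least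
  1 / M.\<close>

lemma flat_step:
  assumes "1 < (M :: real)"
  obtains s s' where "\<And>t. (s has_real_derivative s' t) (at t)" "\<And>n. Ck n s'" "\<And>t. s t \<in> {0..1}"
    "\<And>t. t \<le> 0 \<Longrightarrow> s t = 0" "\<And>t. 1 \<le> t \<Longrightarrow> s t = 1" "\<And>t. 0 \<le> s' t" "\<And>t. s' t \<le> M"
    "\<And>t. t \<le> 0 \<Longrightarrow> s' t = 0" "\<And>t. 1 \<le> t \<Longrightarrow> s' t = 0"
proof -
  \<comment> \<open>With \<delta> = \<kappa>^2 the bump is at least 1 - 2 \<kappa> on an interval of
    length 1 - 2 \<kappa>; \<kappa> makes the product equal to 1 / M.\<close>
  define \<kappa> where "\<kappa> = (1 - 1 / sqrt M) / 2"
  have "1 - 2 * \<kappa> = 1 / sqrt M" by (simp add: \<kappa>_def field_simps)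
  then have \<kappa>: "0 < \<kappa>" "\<kappa> < 1 / 2" "(1 - 2 * \<kappa>)\<^sup>2 = 1 / M"
    using assms by (simp_all add: \<kappa>_def power_divide)
  define \<delta> where "\<delta> = \<kappa>\<^sup>2"
  have \<delta>: "\<delta> > 0" using \<kappa> by (simp add: \<delta>_def)
  define b where "b t = flat \<delta> 1 t * flat \<delta> 1 (1 - t)" for t
  have f01: "0 \<le> flat \<delta> 1 t" "flat \<delta> 1 t \<le> 1" for t using \<delta> by (auto simp: flat_def)
  have b01: "0 \<le> b t" "b t \<le> 1" for t
    unfolding b_def using f01 by (auto intro: mult_le_one)
  have b0: "b t = 0" if "t \<le> 0 \<or> 1 \<le> t" for t using that by (auto simp: b_def flat_def)
  have "Ck n b" for n
    using Ck_scaleR[OF Ck_flat[OF \<delta>, of n 1] Ck_affine[OF Ck_flat[OF \<delta>, of n 1], of "-1" 1]]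
    by (simp add: b_def[abs_def])
  have cont: "continuous_on S b" for S
  proof -
    have "\<exists>b'. \<forall>t. (b has_vector_derivative b' t) (at t)" using \<open>Ck (Suc 0) b\<close> by simp
    then show ?thesis
      by (meson continuous_at_imp_continuous_on has_vector_derivative_continuous)
  qed
  \<comment> \<open>Starting at -1 makes 0 an interior point; below -1 the interval is empty and its
    integral 0, the value wanted there.\<close>
  define I where "I t = integral {-1..t} b" for t
  have Ineg: "I t = 0" if "t \<le> 0" for t
    unfolding I_def using b0 that by (intro integral_eq_0_iff[THEN iffD2] integral_unique has_integral_is_0) auto
  have I: "(I has_real_derivative b t) (at t)" for t
  proof (cases "t < 0")
    case True
    have "((\<lambda>_. 0) has_real_derivative b t) (at t)" using True b0 by simp
    then show ?thesis
      by (rule has_field_derivative_transform_within_open[of _ _ _ "{..<0}"]) (use True Ineg in auto)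
  next
    case False
    have "(I has_real_derivative b t) (at t within {-1..t + 1})"
      unfolding I_def using False by (intro integral_has_real_derivative cont) auto
    then show ?thesis using False by (simp add: at_within_Icc_at)
  qed
  have mono: "I u \<le> I v" if "u \<le> v" for u v
    using that I b01 by (meson DERIV_nonneg_imp_nondecreasing)
  define Z where "Z = I 1"
  have Iup: "I t = Z" if "1 \<le> t" for t
  proof -
    have "I t - I 1 = integral {1..t} b"
      unfolding I_def using that
      by (subst Henstock_Kurzweil_Integration.integral_combine[of "-1" 1 t, symmetric]) (auto intro: integrable_continuous_real cont)
    also have "\<dots> = 0" using b0 by (intro integral_unique has_integral_is_0) auto
    finally show ?thesis by (simp add: Z_def)
  qed
  have "(1 - 2 * \<kappa>)\<^sup>2 \<le> Z"
  proof -
    have low: "1 - 2 * \<kappa> \<le> b t" if t: "t \<in> {\<kappa>..1 - \<kappa>}" for t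
    proof -
      have "0 < t" "t < 1" using t \<kappa> by auto
      have "\<delta> / t \<le> \<kappa>" "\<delta> / (1 - t) \<le> \<kappa>"
        using mult_left_mono[of \<kappa> t \<kappa>] mult_left_mono[of \<kappa> "1 - t" \<kappa>] t \<kappa> \<open>0 < t\<close> \<open>t < 1\<close>
        by (simp_all add: \<delta>_def pos_divide_le_eq power2_eq_square)
      then have "1 - 2 * \<kappa> \<le> 1 + (- \<delta> / t + - \<delta> / (1 - t))" by simp
      also have "\<dots> \<le> exp (- \<delta> / t + - \<delta> / (1 - t))" by (rule exp_ge_add_one_self)
      also have "\<dots> = b t" using \<open>0 < t\<close> \<open>t < 1\<close> unfolding b_def flat_def exp_add by simp
      finally show ?thesis .
    qed
    have "(1 - 2 * \<kappa>)\<^sup>2 = integral {\<kappa>..1 - \<kappa>} (\<lambda>_. 1 - 2 * \<kappa>)" using \<kappa> by (simp add: power2_eq_square)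
    also have "\<dots> \<le> integral {\<kappa>..1 - \<kappa>} b"
      using low by (intro integral_le integrable_const_ivl integrable_continuous_real cont)
    also have "\<dots> \<le> Z"
      unfolding Z_def I_def using \<kappa> b01
      by (intro integral_subset_le integrable_continuous_real cont) auto
    finally show ?thesis .
  qed
  then have Z: "1 / M \<le> Z" "0 < Z" using \<kappa> assms by (auto intro: less_le_trans[of 0 "1 / M"])
  show ?thesis
  proof (rule that[of "\<lambda>t. I t / Z" "\<lambda>t. b t / Z"])
    show "((\<lambda>t. I t / Z) has_real_derivative b t / Z) (at t)" for t by (rule DERIV_cdivide[OF I])
    show "Ck n (\<lambda>t. b t / Z)" for n
      using Ck_scaleR[OF Ck_const[of n "1 / Z"] \<open>\<And>n. Ck n b\<close>[of n]] by simp
    show "I t / Z \<in> {0..1}" for t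
    proof -
      have "0 \<le> I t" using mono[of "min t 0" t] Ineg[of "min t 0"] by simp
      moreover have "I t \<le> Z" using mono[of t "max t 1"] Iup[of "max t 1"] by simp
      ultimately show ?thesis using Z by simp
    qed
    show "b t / Z \<le> M" for t
    proof -
      have "b t / Z \<le> 1 / Z" using b01 Z by (intro divide_right_mono) auto
      also have "\<dots> \<le> M" using Z assms by (simp add: field_simps)
      finally show ?thesis .
    qed
  qed (use Ineg Iup b01 b0 Z in auto)
qed

section \<open>The triangle inequality\<close>

text \<open>One factor u' is used up by the substitution, the other is bounded by its maximum
  \<open>K\<close>.\<close>

lemma reparam_integral_le:
  fixes e u u' :: "real \<Rightarrow> real"
  assumes e: "continuous_on {0..1} e" "\<And>r. r \<in> {0..1} \<Longrightarrow> 0 \<le> e r"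
    and u: "\<And>t. t \<in> {p..q} \<Longrightarrow> (u has_real_derivative u' t) (at t)" "\<And>t. t \<in> {p..q} \<Longrightarrow> u t \<in> {0..1}" "u p = 0" "u q = 1"
    and u': "\<And>t. t \<in> {p..q} \<Longrightarrow> 0 \<le> u' t" "\<And>t. t \<in> {p..q} \<Longrightarrow> u' t \<le> K"
    and "p \<le> q" and int: "(\<lambda>t. (u' t)\<^sup>2 * e (u t)) integrable_on {p..q}"
  shows "integral {p..q} (\<lambda>t. (u' t)\<^sup>2 * e (u t)) \<le> K * integral {0..1} e"
proof -
  define E where "E r = integral {0..r} e" for r
  have "((\<lambda>t. u' t * e (u t)) has_integral (E (u q) - E (u p))) {p..q}"
  proof (rule fundamental_theorem_of_calculus[OF \<open>p \<le> q\<close>])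
    fix t assume t: "t \<in> {p..q}"
    have "(E has_vector_derivative e (u t)) (at (u t) within {0..1})"
      using integral_has_real_derivative[OF e(1) u(2)[OF t]]
      by (simp add: E_def[abs_def] has_real_derivative_iff_has_vector_derivative)
    then have "(E has_vector_derivative e (u t)) (at (u t) within u ` {p..q})"
      by (rule has_vector_derivative_within_subset) (use u(2) in auto)
    moreover have "(u has_vector_derivative u' t) (at t within {p..q})"
      using u(1)[OF t] by (simp add: has_real_derivative_iff_has_vector_derivative has_vector_derivative_at_within)
    ultimately show "((\<lambda>t. E (u t)) has_vector_derivative u' t * e (u t)) (at t within {p..q})"
      using vector_diff_chain_within[of u "u' t" t "{p..q}" E "e (u t)"] by (simp add: o_def)
  qed
  then have h: "((\<lambda>t. u' t * e (u t)) has_integral (integral {0..1} e)) {p..q}"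
    by (simp add: E_def u)
  have "integral {p..q} (\<lambda>t. (u' t)\<^sup>2 * e (u t)) \<le> integral {p..q} (\<lambda>t. K * (u' t * e (u t)))"
  proof (rule integral_le[OF int])
    show "(\<lambda>t. K * (u' t * e (u t))) integrable_on {p..q}"
      using has_integral_mult_right[OF h] by blast
    fix t assume t: "t \<in> {p..q}"
    have "u' t * (u' t * e (u t)) \<le> K * (u' t * e (u t))"
      using u'[OF t] e(2)[OF u(2)[OF t]] by (intro mult_right_mono) auto
    then show "(u' t)\<^sup>2 * e (u t) \<le> K * (u' t * e (u t))" by (simp add: power2_eq_square mult.assoc)
  qed
  also have "\<dots> = K * integral {0..1} e" using integral_unique[OF has_integral_mult_right[OF h]] by simp
  finally show ?thesis .
qed

context diffstr
begin

text \<open>Both pieces are slowed down to a stop of infinite order at the junction, so that the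
  concatenation is a sum of smooth functions on the line.\<close>

lemma concat_curves:
  assumes adm1: "admissible_curve D x y \<rho>1 a1" and adm2: "admissible_curve D y z \<rho>2 a2"
    and \<mu>: "0 < \<mu>" "\<mu> < 1" and M: "1 < M"
  obtains \<rho> a where "admissible_curve D x z \<rho> a"
    "action \<rho> a \<le> M * (action \<rho>1 a1 / \<mu> + action \<rho>2 a2 / (1 - \<mu>))"
proof -
  obtain s s' where s: "\<And>t. (s has_real_derivative s' t) (at t)" "\<And>n. Ck n s'" "\<And>t. s t \<in> {0..1}"
    "\<And>t. t \<le> 0 \<Longrightarrow> s t = 0" "\<And>t. 1 \<le> t \<Longrightarrow> s t = 1" "\<And>t. 0 \<le> s' t" "\<And>t. s' t \<le> M"
    "\<And>t. t \<le> 0 \<Longrightarrow> s' t = 0" "\<And>t. 1 \<le> t \<Longrightarrow> s' t = 0"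
    using flat_step[OF M] by blast
  \<comment> \<open>The first piece moves during [0, \<mu>], the second during [\<mu>, 1]; these are
    the rates that stretch the unit interval accordingly.\<close>
  define p1 p2 where "p1 = 1 / \<mu>" and "p2 = 1 / (1 - \<mu>)"
  have p: "0 < p1" "0 < p2" using \<mu> by (simp_all add: p1_def p2_def)
  define q2 where "q2 = - \<mu> * p2"
  define u1 u2 where "u1 t = s (p1 * t + 0)" and "u2 t = s (p2 * t + q2)" for t
  define u1' u2' where "u1' t = p1 * s' (p1 * t + 0)" and "u2' t = p2 * s' (p2 * t + q2)" for t
  have arg1: "1 \<le> p1 * t + 0" if "\<mu> \<le> t" for t using that \<mu> by (simp add: p1_def field_simps)
  have arg2: "p2 * t + q2 \<le> 0" if "t \<le> \<mu>" for t
    using mult_left_mono[OF that, of p2] p by (simp add: q2_def mult.commute)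
  have arg2': "p2 * 1 + q2 = 1" using \<mu> by (simp add: q2_def p2_def field_simps)
  have du: "(u1 has_real_derivative u1' t) (at t)" "(u2 has_real_derivative u2' t) (at t)" for t
  proof -
    have *: "((\<lambda>t. s (p * t + q)) has_real_derivative p * s' (p * t + q)) (at t)" for p q :: real
    proof -
      have "((\<lambda>t. p * t + q) has_real_derivative p) (at t)"
        by (auto intro!: derivative_eq_intros)
      from DERIV_chain2[OF s(1) this] show ?thesis by (simp add: mult.commute[of p "s' _"])
    qed
    show "(u1 has_real_derivative u1' t) (at t)" "(u2 has_real_derivative u2' t) (at t)"
      unfolding u1_def[abs_def] u1'_def u2_def[abs_def] u2'_def by (rule *)+
  qed
  have cu: "Ck n u1'" "Ck n u2'" for n
    unfolding u1'_def u2'_def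
    using Ck_scaleR[OF Ck_const[of n p1] Ck_affine[OF s(2)[of n], of p1 0]]
      Ck_scaleR[OF Ck_const[of n p2] Ck_affine[OF s(2)[of n], of p2 q2]] by simp_all
  have u01: "u1 t \<in> {0..1}" "u2 t \<in> {0..1}" for t unfolding u1_def u2_def by (rule s(3))+
  have left: "u2 t = 0" "u2' t = 0" if "t \<le> \<mu>" for t
    using s(4,8)[OF arg2[OF that]] by (simp_all add: u2_def u2'_def)
  have right: "u1 t = 1" "u1' t = 0" if "\<mu> \<le> t" for t
    using s(5,9)[OF arg1[OF that]] by (simp_all add: u1_def u1'_def)
  have ends: "u1 0 = 0" "u2 1 = 1" using s(4)[of 0] s(5)[of 1] arg2' by (simp_all add: u1_def u2_def)
  \<comment> \<open>Each piece rests at y while the other moves, so subtracting y once leaves the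
    concatenation.\<close>
  define \<rho> where "\<rho> t = \<rho>1 (u1 t) + \<rho>2 (u2 t) + - y" for t
  define a where "a t = u1' t *\<^sub>R a1 (u1 t) + u2' t *\<^sub>R a2 (u2 t)" for t
  note K1 = adm_ends[OF adm1] and K2 = adm_ends[OF adm2]
  have smooth: "Ck n (\<lambda>t. c (u t))" if c: "smooth_curve c" and u: "\<And>t. (u has_real_derivative u' t) (at t)"
      "\<And>n. Ck n u'" "\<And>t. u t \<in> {0..1}" for n and c :: "real \<Rightarrow> complex^'n^'n" and u u'
  proof -
    obtain d where d: "d 0 = c" "\<And>n t. t \<in> {0..1} \<Longrightarrow> (d n has_vector_derivative d (Suc n) t) (at t within {0..1})"
      using c unfolding smooth_curve_def by blast
    show ?thesis using Ck_compose(1)[of d u u' n 0, OF d(2) u] by (simp add: d(1))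
  qed
  have sm: "smooth_curve \<rho>1" "smooth_curve a1" "smooth_curve \<rho>2" "smooth_curve a2"
    using adm1 adm2 by (auto simp: admissible_curve_def)
  have s\<rho>: "smooth_curve \<rho>"
    unfolding \<rho>_def
    by (intro Ck_smooth_curve Ck_add Ck_const smooth[OF sm(1) du(1) cu(1) u01(1)] smooth[OF sm(3) du(2) cu(2) u01(2)])
  have sa: "smooth_curve a"
    unfolding a_def
    by (intro Ck_smooth_curve Ck_add Ck_scaleR cu smooth[OF sm(2) du(1) cu(1) u01(1)] smooth[OF sm(4) du(2) cu(2) u01(2)])
  have chain: "((\<lambda>t. c (u t)) has_vector_derivative u' t *\<^sub>R c') (at t)"
    if "(u has_real_derivative u' t) (at t)" "\<And>t. u t \<in> {0..1}" "(c has_vector_derivative c') (at (u t) within {0..1})"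
    for c :: "real \<Rightarrow> complex^'n^'n" and u u' t c'
  proof -
    have "(c has_vector_derivative c') (at (u t) within u ` UNIV)"
      by (rule has_vector_derivative_within_subset[OF that(3)]) (use that(2) in auto)
    then show ?thesis
      using vector_diff_chain_within[of u "u' t" t UNIV c c'] that(1)
      by (simp add: o_def has_real_derivative_iff_has_vector_derivative)
  qed
  have der: "(\<rho> has_vector_derivative u1' t *\<^sub>R Kop D (\<rho>1 (u1 t)) (a1 (u1 t)) + u2' t *\<^sub>R Kop D (\<rho>2 (u2 t)) (a2 (u2 t))) (at t)" for t
  proof -
    have "(\<rho> has_vector_derivative u1' t *\<^sub>R Kop D (\<rho>1 (u1 t)) (a1 (u1 t)) + u2' t *\<^sub>R Kop D (\<rho>2 (u2 t)) (a2 (u2 t)) + 0) (at t)"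
      unfolding \<rho>_def[abs_def]
      by (intro has_vector_derivative_add has_vector_derivative_const
          chain[OF du(1) u01(1) adm_deriv[OF adm1 u01(1)]] chain[OF du(2) u01(2) adm_deriv[OF adm2 u01(2)]])
    then show ?thesis by simp
  qed
  have piece1: "\<rho> t = \<rho>1 (u1 t)" "a t = u1' t *\<^sub>R a1 (u1 t)" if "t \<le> \<mu>" for t
    using left[OF that] K2 by (simp_all add: \<rho>_def a_def)
  have piece2: "\<rho> t = \<rho>2 (u2 t)" "a t = u2' t *\<^sub>R a2 (u2 t)" if "\<mu> \<le> t" for t
    using right[OF that] K1 by (simp_all add: \<rho>_def a_def)
  note h1 = adm_dens[OF adm1 u01(1)] adm_tangent[OF adm1 u01(1)]
    and h2 = adm_dens[OF adm2 u01(2)] adm_tangent[OF adm2 u01(2)]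
  have k1: "Kop D (\<rho> t) (a t) = u1' t *\<^sub>R Kop D (\<rho>1 (u1 t)) (a1 (u1 t))" if "t \<le> \<mu>" for t
    using Kop_scaleR[OF dens_pos_in[OF h1(1)] dens_pos_herm[OF h1(1)] tangent_in[OF h1(2)]]
    by (simp add: piece1[OF that])
  have k2: "Kop D (\<rho> t) (a t) = u2' t *\<^sub>R Kop D (\<rho>2 (u2 t)) (a2 (u2 t))" if "\<mu> \<le> t" for t
    using Kop_scaleR[OF dens_pos_in[OF h2(1)] dens_pos_herm[OF h2(1)] tangent_in[OF h2(2)]]
    by (simp add: piece2[OF that])
  have adm: "admissible_curve D x z \<rho> a"
    unfolding admissible_curve_def
  proof (intro conjI ballI s\<rho> sa)
    show "\<rho> 0 = x" using piece1(1)[of 0] \<mu> ends K1 by simp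
    show "\<rho> 1 = z" using piece2(1)[of 1] \<mu> ends K2 by simp
    fix t :: real
    show "\<rho> t \<in> dens_pos D" using piece1(1)[of t] piece2(1)[of t] h1 h2 by (cases "t \<le> \<mu>") auto
    show "a t \<in> tangent D" unfolding a_def
      using h1 h2 tangent_subspace by (intro subspace_add subspace_scale)
    have "Kop D (\<rho> t) (a t) = u1' t *\<^sub>R Kop D (\<rho>1 (u1 t)) (a1 (u1 t)) + u2' t *\<^sub>R Kop D (\<rho>2 (u2 t)) (a2 (u2 t))"
      using k1[of t] k2[of t] left[of t] right[of t] by (cases "t \<le> \<mu>") auto
    then show "(\<rho> has_vector_derivative Kop D (\<rho> t) (a t)) (at t within {0..1})"
      using der[of t] by (simp add: has_vector_derivative_at_within)
  qed
  let ?e = "\<lambda>t. Re (\<tau> (a t ** Kop D (\<rho> t) (a t)))"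
  let ?e1 = "\<lambda>t. Re (\<tau> (a1 t ** Kop D (\<rho>1 t) (a1 t)))"
  let ?e2 = "\<lambda>t. Re (\<tau> (a2 t ** Kop D (\<rho>2 t) (a2 t)))"
  have e1: "?e t = (u1' t)\<^sup>2 * ?e1 (u1 t)" if "t \<le> \<mu>" for t
    unfolding k1[OF that] unfolding piece1(2)[OF that] scaleR_cscale
    using Kop_in[OF dens_pos_in[OF h1(1)] dens_pos_herm[OF h1(1)] tangent_in[OF h1(2)]] tangent_in[OF h1(2)]
    by (simp add: tr_cscale power2_eq_square mult.assoc)
  have e2: "?e t = (u2' t)\<^sup>2 * ?e2 (u2 t)" if "\<mu> \<le> t" for t
    unfolding k2[OF that] unfolding piece2(2)[OF that] scaleR_cscale
    using Kop_in[OF dens_pos_in[OF h2(1)] dens_pos_herm[OF h2(1)] tangent_in[OF h2(2)]] tangent_in[OF h2(2)]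
    by (simp add: tr_cscale power2_eq_square mult.assoc)
  have int: "?e integrable_on {0..\<mu>}" "?e integrable_on {\<mu>..1}"
    using integrable_on_subinterval[OF adm_integrable[OF adm]] \<mu> by auto
  have "action \<rho> a = integral {0..\<mu>} ?e + integral {\<mu>..1} ?e"
    unfolding action_def using \<mu> adm_integrable[OF adm]
    by (intro Henstock_Kurzweil_Integration.integral_combine[symmetric]) auto
  also have "integral {0..\<mu>} ?e = integral {0..\<mu>} (\<lambda>t. (u1' t)\<^sup>2 * ?e1 (u1 t))"
    by (intro integral_cong e1) simp
  also have "\<dots> \<le> (p1 * M) * integral {0..1} ?e1"
  proof (rule reparam_integral_le[OF adm_integrand_continuous[OF adm1] adm_nonneg[OF adm1] du(1) u01(1) ends(1) right(1)])
    show "(\<lambda>t. (u1' t)\<^sup>2 * ?e1 (u1 t)) integrable_on {0..\<mu>}"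
      using int(1) by (rule integrable_eq) (simp add: e1)
  qed (use p s \<mu> in \<open>auto simp: u1'_def intro!: mult_left_mono\<close>)
  also have "integral {\<mu>..1} ?e = integral {\<mu>..1} (\<lambda>t. (u2' t)\<^sup>2 * ?e2 (u2 t))"
    by (intro integral_cong e2) simp
  also have "\<dots> \<le> (p2 * M) * integral {0..1} ?e2"
  proof (rule reparam_integral_le[OF adm_integrand_continuous[OF adm2] adm_nonneg[OF adm2] du(2) u01(2) left(1) ends(2)])
    show "(\<lambda>t. (u2' t)\<^sup>2 * ?e2 (u2 t)) integrable_on {\<mu>..1}"
      using int(2) by (rule integrable_eq) (simp add: e2)
  qed (use p s \<mu> in \<open>auto simp: u2'_def intro!: mult_left_mono\<close>)
  finally have "action \<rho> a \<le> M * (action \<rho>1 a1 / \<mu> + action \<rho>2 a2 / (1 - \<mu>))"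
    by (simp add: action_def p1_def p2_def algebra_simps)
  with adm show ?thesis by (rule that)
qed

text \<open>Time is divided in proportion to the lengths: \<mu> = \<alpha> / (\<alpha> + \<beta>)
  turns \<alpha>^2 / \<mu> + \<beta>^2 / (1 - \<mu>) into (\<alpha> + \<beta>)^2.\<close>

lemma riem_dist_triangle:
  assumes adm1: "admissible_curve D x y \<rho>1 a1" and adm2: "admissible_curve D y z \<rho>2 a2"
  shows "riem_dist D x z \<le> riem_dist D x y + riem_dist D y z"
proof -
  let ?W1 = "riem_dist D x y" and ?W2 = "riem_dist D y z"
  have nn: "0 \<le> ?W1" "0 \<le> ?W2"
    using riem_dist_approx[OF adm1 zero_less_one] riem_dist_approx[OF adm2 zero_less_one] by metis+
  have *: "riem_dist D x z \<le> sqrt (1 + e) * (?W1 + e + (?W2 + e))" if e: "0 < e" for e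
  proof -
    obtain \<rho>1' a1' where c1: "admissible_curve D x y \<rho>1' a1'" "action \<rho>1' a1' < ?W1\<^sup>2 + e\<^sup>2"
      using riem_dist_approx[OF adm1, of "e\<^sup>2"] e by (metis zero_less_power)
    obtain \<rho>2' a2' where c2: "admissible_curve D y z \<rho>2' a2'" "action \<rho>2' a2' < ?W2\<^sup>2 + e\<^sup>2"
      using riem_dist_approx[OF adm2, of "e\<^sup>2"] e by (metis zero_less_power)
    \<comment> \<open>The added e absorbs the excess e^2 of the action and keeps both lengths
      positive, as the divisions require.\<close>
    define \<alpha> \<beta> where "\<alpha> = ?W1 + e" and "\<beta> = ?W2 + e"
    have ab: "0 < \<alpha>" "0 < \<beta>" using nn e by (simp_all add: \<alpha>_def \<beta>_def)
    have le: "action \<rho>1' a1' \<le> \<alpha>\<^sup>2" "action \<rho>2' a2' \<le> \<beta>\<^sup>2"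
      using c1(2) c2(2) nn e by (simp_all add: \<alpha>_def \<beta>_def power2_sum add.commute add_increasing less_imp_le order.trans)
    define \<mu> where "\<mu> = \<alpha> / (\<alpha> + \<beta>)"
    have \<mu>: "0 < \<mu>" "\<mu> < 1" "1 - \<mu> = \<beta> / (\<alpha> + \<beta>)" using ab by (simp_all add: \<mu>_def field_simps)
    obtain \<rho> a where c: "admissible_curve D x z \<rho> a"
      "action \<rho> a \<le> (1 + e) * (action \<rho>1' a1' / \<mu> + action \<rho>2' a2' / (1 - \<mu>))"
      using concat_curves[OF c1(1) c2(1) \<mu>(1,2), of "1 + e"] e by auto
    have "action \<rho> a \<le> (1 + e) * (\<alpha>\<^sup>2 / \<mu> + \<beta>\<^sup>2 / (1 - \<mu>))"
      using le \<mu> e by (intro order.trans[OF c(2)] mult_left_mono add_mono divide_right_mono) auto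
    also have "\<alpha>\<^sup>2 / \<mu> + \<beta>\<^sup>2 / (1 - \<mu>) = (\<alpha> + \<beta>)\<^sup>2"
      unfolding \<mu>(3) using ab by (simp add: \<mu>_def power2_eq_square field_simps)
    finally have "sqrt (action \<rho> a) \<le> sqrt ((1 + e) * (\<alpha> + \<beta>)\<^sup>2)" by (rule real_sqrt_le_mono)
    also have "\<dots> = sqrt (1 + e) * (\<alpha> + \<beta>)" using ab by (simp add: real_sqrt_mult)
    finally show ?thesis using riem_dist_le[OF c(1)] by (simp add: \<alpha>_def \<beta>_def)
  qed
  have "((\<lambda>e. sqrt (1 + e) * (?W1 + e + (?W2 + e))) \<longlongrightarrow> sqrt (1 + 0) * (?W1 + 0 + (?W2 + 0))) (at_right 0)"
    by (intro tendsto_intros)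
  then have "riem_dist D x z \<le> sqrt (1 + 0) * (?W1 + 0 + (?W2 + 0))"
    by (rule tendsto_lowerbound) (use * in \<open>auto simp: eventually_at_filter\<close>)
  then show ?thesis by simp
qed

end

section \<open>The transport distance on all densities\<close>

context erg_diffstr
begin

text \<open>In \<open>short_curve\<close> only the bound on the action is conditional on the points
  being close; the curve itself exists for any two points, with \<delta> = 1.\<close>

lemma admissible_exists:
  assumes "x \<in> dens_pos D" "y \<in> dens_pos D"
  obtains \<rho> a where "admissible_curve D x y \<rho> a"
  using short_curve assms by (metis order_refl zero_less_one)

lemma riem_dist_nonneg: "x \<in> dens_pos D \<Longrightarrow> y \<in> dens_pos D \<Longrightarrow> 0 \<le> riem_dist D x y"
  by (metis admissible_exists riem_dist_approx zero_less_one)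

lemma riem_dist_small:
  assumes "0 < \<epsilon>"
  obtains d where "0 < d" "\<And>x y. x \<in> dens_pos D \<Longrightarrow> y \<in> dens_pos D \<Longrightarrow> norm (y - x) \<le> d \<Longrightarrow> riem_dist D x y \<le> \<epsilon>"
proof -
  obtain C where C: "C > 0" "\<And>x y \<delta>. x \<in> dens_pos D \<Longrightarrow> y \<in> dens_pos D \<Longrightarrow> 0 < \<delta> \<Longrightarrow> \<delta> \<le> 1 \<Longrightarrow>
    \<exists>\<rho> a. admissible_curve D x y \<rho> a \<and> (norm (y - x) \<le> \<delta> \<longrightarrow> action \<rho> a \<le> C * \<delta>)"
    using short_curve by blast
  define d where "d = min 1 (\<epsilon>\<^sup>2 / C)"
  have d: "0 < d" "d \<le> 1" "C * d \<le> \<epsilon>\<^sup>2"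
    using C(1) assms by (simp_all add: d_def min_def field_simps)
  have "riem_dist D x y \<le> \<epsilon>" if xy: "x \<in> dens_pos D" "y \<in> dens_pos D" "norm (y - x) \<le> d" for x y
  proof -
    obtain \<rho> a where a: "admissible_curve D x y \<rho> a" "action \<rho> a \<le> C * d"
      using C(2)[OF xy(1,2) d(1,2)] xy(3) by blast
    have "riem_dist D x y \<le> sqrt (action \<rho> a)" by (rule riem_dist_le[OF a(1)])
    also have "\<dots> \<le> sqrt (\<epsilon>\<^sup>2)" using a(2) d(3) by (intro real_sqrt_le_mono) auto
    finally show ?thesis using assms by simp
  qed
  then show ?thesis using d(1) that by blast
qed

lemma riem_dist_self: "x \<in> dens_pos D \<Longrightarrow> riem_dist D x x = 0"
proof (rule antisym)
  assume x: "x \<in> dens_pos D"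
  show "riem_dist D x x \<le> 0"
  proof (rule field_le_epsilon)
    fix e :: real assume "0 < e"
    then obtain d where "0 < d" "\<And>x y. x \<in> dens_pos D \<Longrightarrow> y \<in> dens_pos D \<Longrightarrow> norm (y - x) \<le> d \<Longrightarrow> riem_dist D x y \<le> e"
      using riem_dist_small by blast
    from this(2)[OF x x] this(1) show "riem_dist D x x \<le> 0 + e" by simp
  qed
qed (rule riem_dist_nonneg)

lemma triangle:
  assumes "x \<in> dens_pos D" "y \<in> dens_pos D" "z \<in> dens_pos D"
  shows "riem_dist D x z \<le> riem_dist D x y + riem_dist D y z"
  using assms by (metis admissible_exists riem_dist_triangle)

text \<open>Moving the end points changes the distance by at most two small distances, at a rate
  that does not deteriorate near the boundary. Uniformity gives limits at singular densities, so
  that \<open>Lim\<close> in \<open>wdist\<close> is a genuine value.\<close>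

lemma riem_dist_uniformly_continuous:
  "uniformly_continuous_on (dens_pos D \<times> dens_pos D) (\<lambda>(x, y). riem_dist D x y)"
  unfolding uniformly_continuous_on_def
proof (intro allI impI)
  fix e :: real assume "0 < e"
  then obtain d where d: "0 < d" "\<And>x y. x \<in> dens_pos D \<Longrightarrow> y \<in> dens_pos D \<Longrightarrow> norm (y - x) \<le> d \<Longrightarrow> riem_dist D x y \<le> e / 3"
    using riem_dist_small[of "e / 3"] by auto
  have le: "riem_dist D x' y' \<le> riem_dist D x y + 2 * (e / 3)"
    if "x \<in> dens_pos D" "y \<in> dens_pos D" "x' \<in> dens_pos D" "y' \<in> dens_pos D" "dist x' x \<le> d" "dist y' y \<le> d" for x y x' y'
    using triangle[OF that(3,1,4)] triangle[OF that(1,2,4)] d(2)[OF that(3,1)] d(2)[OF that(2,4)] that(5,6)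
    by (simp add: dist_norm norm_minus_commute)
  have "dist (riem_dist D x' y') (riem_dist D x y) < e"
    if xy: "x \<in> dens_pos D" "y \<in> dens_pos D" "x' \<in> dens_pos D" "y' \<in> dens_pos D" "dist (x', y') (x, y) < d" for x y x' y'
  proof -
    have "dist x' x \<le> d" "dist y' y \<le> d"
      using xy(5) dist_fst_le[of "(x', y')" "(x, y)"] dist_snd_le[of "(x', y')" "(x, y)"] by auto
    then show ?thesis
      using le[OF xy(1-4)] le[OF xy(3,4,1,2)] \<open>0 < e\<close> by (simp add: dist_real_def dist_commute abs_less_iff)
  qed
  then show "\<exists>d>0. \<forall>p\<in>dens_pos D \<times> dens_pos D. \<forall>p'\<in>dens_pos D \<times> dens_pos D. dist p' p < d \<longrightarrow>
      dist (case p' of (x, y) \<Rightarrow> riem_dist D x y) (case p of (x, y) \<Rightarrow> riem_dist D x y) < e"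
    using d(1) by (intro exI[of _ d]) auto
qed

lemma dens_closure: "dens D \<subseteq> closure (dens_pos D)"
proof
  fix \<rho> assume \<rho>: "\<rho> \<in> dens D"
  have "((\<lambda>t. (1 - t) *\<^sub>R \<rho> + t *\<^sub>R \<sigma>) \<longlongrightarrow> (1 - 0) *\<^sub>R \<rho> + 0 *\<^sub>R \<sigma>) (at_right 0)"
    by (intro tendsto_intros)
  moreover have "\<forall>\<^sub>F t in at_right 0. (1 - t) *\<^sub>R \<rho> + t *\<^sub>R \<sigma> \<in> closure (dens_pos D)"
    unfolding eventually_at_right_field
    using dens_pos_mix[OF \<rho> sigma_dens_pos] closure_subset by (intro exI[of _ 1]) force
  ultimately have "(1 - 0) *\<^sub>R \<rho> + 0 *\<^sub>R \<sigma> \<in> closure (dens_pos D)"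
    by (rule Lim_in_closed_set[OF closed_closure _ trivial_limit_at_right_real, rotated])
  then show "\<rho> \<in> closure (dens_pos D)" by simp
qed

text \<open>The bound for positive densities passes to the limits that define the distance
  elsewhere. In particular distinct densities have positive distance.\<close>

lemma wdist_ge:
  obtains c where "c > 0" "\<And>\<rho> \<nu>. \<rho> \<in> dens D \<Longrightarrow> \<nu> \<in> dens D \<Longrightarrow> norm (\<rho> - \<nu>) \<le> c * wdist D \<rho> \<nu>"
proof -
  obtain c where c: "c > 0" "\<And>x y \<rho> a. admissible_curve D x y \<rho> a \<Longrightarrow> norm (x - y) \<le> c * riem_dist D x y"
    by (rule riem_dist_ge) (rule that, assumption+)
  have c': "norm (x - y) \<le> c * riem_dist D x y" if "x \<in> dens_pos D" "y \<in> dens_pos D" for x y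
    using admissible_exists[OF that] c(2) by metis
  have "norm (\<rho> - \<nu>) \<le> c * wdist D \<rho> \<nu>" if "\<rho> \<in> dens D" "\<nu> \<in> dens D" for \<rho> \<nu>
  proof (cases "\<rho> \<in> dens_pos D \<and> \<nu> \<in> dens_pos D")
    case True
    then show ?thesis using c' by (simp add: wdist_def)
  next
    case False
    let ?X = "dens_pos D \<times> dens_pos D"
    let ?F = "at (\<rho>, \<nu>) within ?X"
    have cl: "(\<rho>, \<nu>) \<in> closure ?X" using that dens_closure by (auto simp: closure_Times)
    obtain l where l: "((\<lambda>(x, y). riem_dist D x y) \<longlongrightarrow> l) ?F"
      using uniformly_continuous_on_extension_at_closure[OF riem_dist_uniformly_continuous cl] by blast
    \<comment> \<open>The pair lies in the closure of the set but not in it, so it is a limit point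
      and the limit is unique.\<close>
    have nt: "?F \<noteq> bot"
      using cl False by (simp add: trivial_limit_within closure_def)
    have "wdist D \<rho> \<nu> = l"
      using tendsto_Lim[OF nt l] False by (auto simp: wdist_def)
    moreover have "norm (\<rho> - \<nu>) \<le> c * l"
    proof (rule tendsto_le[OF nt])
      show "((\<lambda>p. c * (case p of (x, y) \<Rightarrow> riem_dist D x y)) \<longlongrightarrow> c * l) ?F"
        by (intro tendsto_intros l)
      have "((\<lambda>p. norm (fst p - snd p)) \<longlongrightarrow> norm (fst (\<rho>, \<nu>) - snd (\<rho>, \<nu>))) ?F"
        by (intro tendsto_intros)
      then show "((\<lambda>p. norm (fst p - snd p)) \<longlongrightarrow> norm (\<rho> - \<nu>)) ?F" by simp
      show "\<forall>\<^sub>F p in ?F. norm (fst p - snd p) \<le> c * (case p of (x, y) \<Rightarrow> riem_dist D x y)"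
        unfolding eventually_at_filter using c' by (intro always_eventually) auto
    qed
    ultimately show ?thesis by simp
  qed
  then show ?thesis using c(1) that by blast
qed

section \<open>The HWI inequality\<close>

text \<open>Slope bound for the entropy: by convexity its decrease is at most the pairing of the fixed
  gradient at \<open>\<rho>\<close> with the velocity, which Cauchy--Schwarz bounds along a nearly shortest curve.\<close>

lemma Ent_slope:
  assumes \<rho>: "\<rho> \<in> dens_pos D" and \<epsilon>: "0 < \<epsilon>" "\<epsilon> \<le> 1"
  obtains r where "0 < r" "\<And>\<nu>. \<nu> \<in> dens D \<Longrightarrow> 0 < wdist D \<rho> \<nu> \<Longrightarrow> wdist D \<rho> \<nu> < r \<Longrightarrow>
    Ent D \<rho> - Ent D \<nu> \<le>
      sqrt ((Re (kform \<rho> (entropy_grad \<rho>) (entropy_grad \<rho>)) + \<epsilon>) * (1 + \<epsilon>)) * wdist D \<rho> \<nu>"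
proof -
  let ?g = "entropy_grad \<rho>"
  let ?I = "Re (kform \<rho> ?g ?g)"
  note g = entropy_grad_in[OF dens_pos_dens[OF \<rho>]] entropy_grad_adj[OF dens_pos_dens[OF \<rho>]]
  have I0: "0 \<le> ?I" by (rule kform_nonneg[OF dens_pos_dens[OF \<rho>] g(1)])
  obtain c1 where c1: "c1 > 0" "\<And>\<rho> \<nu>. \<rho> \<in> dens D \<Longrightarrow> \<nu> \<in> dens D \<Longrightarrow> norm (\<rho> - \<nu>) \<le> c1 * wdist D \<rho> \<nu>"
    using wdist_ge by blast
  obtain c2 where c2: "c2 > 0"
    "\<And>x y \<rho> a s. admissible_curve D x y \<rho> a \<Longrightarrow> s \<in> {0..1} \<Longrightarrow> norm (\<rho> s - x) \<le> c2 * sqrt (action \<rho> a)"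
    by (rule riem_dist_ge) (rule that, assumption+)
  obtain r1 where r1: "r1 > 0" "\<And>\<nu>. \<nu> \<in> dens D \<Longrightarrow> norm (\<nu> - \<rho>) < r1 \<Longrightarrow> \<nu> \<in> dens_pos D"
    using dens_pos_open_ge[OF \<rho>] by metis
  have "((\<lambda>M. Re (kform M ?g ?g)) \<longlongrightarrow> ?I) (at \<rho> within dens D)"
    by (intro tendsto_Re kform_tendsto \<rho> g)
  then have "\<forall>\<^sub>F M in at \<rho> within dens D. Re (kform M ?g ?g) < ?I + \<epsilon>"
    by (rule order_tendstoD(2)) (use \<epsilon> in simp)
  then obtain r2 where r2: "r2 > 0" "\<And>M. M \<in> dens D \<Longrightarrow> M \<noteq> \<rho> \<Longrightarrow> dist M \<rho> < r2 \<Longrightarrow> Re (kform M ?g ?g) < ?I + \<epsilon>"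
    unfolding eventually_at by blast
  have near: "Re (kform M ?g ?g) \<le> ?I + \<epsilon>" if "M \<in> dens D" "norm (M - \<rho>) < r2" for M
    using r2(2)[of M] that \<epsilon> by (cases "M = \<rho>") (auto simp: dist_norm)
  \<comment> \<open>The first bound forces \<nu> to be positive definite; the second keeps a nearly
    shortest curve where the form exceeds its value at \<rho> by at most \<epsilon>.\<close>
  define r where "r = min (r1 / c1) (r2 / (2 * c2))"
  have r: "0 < r" using r1 r2 c1 c2 by (simp add: r_def)
  have "Ent D \<rho> - Ent D \<nu> \<le> sqrt ((?I + \<epsilon>) * (1 + \<epsilon>)) * wdist D \<rho> \<nu>"
    if \<nu>: "\<nu> \<in> dens D" and w: "0 < wdist D \<rho> \<nu>" "wdist D \<rho> \<nu> < r" for \<nu>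
  proof -
    let ?w = "wdist D \<rho> \<nu>"
    have "c1 * ?w < r1" using w(2) c1(1) by (simp add: r_def field_simps)
    then have "norm (\<nu> - \<rho>) < r1"
      using c1(2)[OF dens_pos_dens[OF \<rho>] \<nu>] by (simp add: norm_minus_commute)
    then have \<nu>p: "\<nu> \<in> dens_pos D" by (rule r1(2)[OF \<nu>])
    then have wr: "?w = riem_dist D \<rho> \<nu>" using \<rho> by (simp add: wdist_def)
    obtain \<rho>0 a0 where "admissible_curve D \<rho> \<nu> \<rho>0 a0" using admissible_exists[OF \<rho> \<nu>p] .
    moreover have "0 < \<epsilon> * ?w\<^sup>2" using \<epsilon> w by simp
    ultimately obtain \<rho>' a where a: "admissible_curve D \<rho> \<nu> \<rho>' a" "action \<rho>' a < ?w\<^sup>2 + \<epsilon> * ?w\<^sup>2"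
      unfolding wr using riem_dist_approx by metis
    have act: "action \<rho>' a \<le> (1 + \<epsilon>) * ?w\<^sup>2" using a(2) by (simp add: algebra_simps)
    also have "\<dots> \<le> 2\<^sup>2 * ?w\<^sup>2" using \<epsilon> by (intro mult_right_mono) auto
    finally have "sqrt (action \<rho>' a) \<le> 2 * ?w"
      using w by (intro real_le_lsqrt) (auto simp: power_mult_distrib)
    then have "c2 * sqrt (action \<rho>' a) \<le> c2 * (2 * ?w)" using c2(1) by (intro mult_left_mono) auto
    also have "\<dots> < r2" using w(2) c2(1) by (simp add: r_def field_simps)
    finally have close: "norm (\<rho>' t - \<rho>) < r2" if "t \<in> {0..1}" for t
      using c2(2)[OF a(1) that] by linarith
    obtain h where h: "linear h" "\<And>X. X \<in> A \<Longrightarrow> h X = Re (\<tau> (?g ** X))"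
      by (rule linear_on_extend[OF subspace_alg, of "\<lambda>X. Re (\<tau> (?g ** X))"])
        (use g in \<open>auto simp: matrix_add_ldistrib tr_add scaleR_cscale tr_cscale\<close>)
    have "norm (h (\<rho>' 1) - h \<rho>) \<le> sqrt ((?I + \<epsilon>) * action \<rho>' a)"
    proof (rule adm_bound[OF a(1)])
      show "bounded_linear h" using h(1) by (simp add: linear_conv_bounded_linear)
      fix t :: real assume t: "t \<in> {0..1}"
      note p = adm_dens[OF a(1) t]
      note ta = tangent_in[OF adm_tangent[OF a(1) t]]
      have "h (Kop D (\<rho>' t) (a t)) = Re (kform (\<rho>' t) ?g (a t))"
        using Kop_form[OF dens_pos_in[OF p] dens_pos_herm[OF p] g(1) ta] g(2)
        by (simp add: h(2) Kop_in[OF dens_pos_in[OF p] dens_pos_herm[OF p] ta])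
      then have "(norm (h (Kop D (\<rho>' t) (a t))))\<^sup>2 \<le> Re (kform (\<rho>' t) ?g ?g) * Re (kform (\<rho>' t) (a t) (a t))"
        using kform_cs[OF dens_pos_dens[OF p] g(1) ta] by simp
      also have "\<dots> \<le> (?I + \<epsilon>) * Re (kform (\<rho>' t) (a t) (a t))"
        using near[OF dens_pos_dens[OF p] close[OF t]] kform_nonneg[OF dens_pos_dens[OF p] ta]
        by (rule mult_right_mono)
      finally show "(norm (h (Kop D (\<rho>' t) (a t))))\<^sup>2 \<le> (?I + \<epsilon>) * Re (kform (\<rho>' t) (a t) (a t))" .
    qed (use I0 \<epsilon> in auto)
    also have "\<dots> \<le> sqrt ((?I + \<epsilon>) * ((1 + \<epsilon>) * ?w\<^sup>2))"
      using act I0 \<epsilon> by (intro real_sqrt_le_mono mult_left_mono) auto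
    also have "\<dots> = sqrt ((?I + \<epsilon>) * (1 + \<epsilon>)) * ?w"
      using w by (simp add: real_sqrt_mult)
    finally have "h \<rho> - h \<nu> \<le> sqrt ((?I + \<epsilon>) * (1 + \<epsilon>)) * ?w"
      using adm_ends[OF a(1)] by simp
    moreover have "h \<rho> - h \<nu> = Re (\<tau> (?g ** (\<rho> - \<nu>)))"
      using h(2)[of "\<rho> - \<nu>"] dens_pos_in[OF \<rho>] dens_in[OF \<nu>] by (simp add: linear_diff[OF h(1)])
    ultimately show ?thesis using Ent_diff_le[OF \<rho> \<nu>] by simp
  qed
  then show ?thesis using r that by blast
qed

text \<open>Convexity bounds the entropy at \<open>\<gamma> t\<close> from above, the slope estimate
  from below. Together, with entropy 0 at \<sigma>, they give t times the claim up to a factor 1 - t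
  and the \<epsilon> of the slope; after division t and then \<epsilon> tend to 0.\<close>

lemma HWI_pos:
  assumes Ric: "Ric_ge D \<kappa>" and \<rho>: "\<rho> \<in> dens_pos D"
  shows "Ent D \<rho> \<le> wdist D \<rho> \<sigma> * sqrt (Re (kform \<rho> (entropy_grad \<rho>) (entropy_grad \<rho>)))
    - \<kappa> / 2 * (wdist D \<rho> \<sigma>)\<^sup>2"
proof (cases "\<rho> = \<sigma>")
  case True
  then show ?thesis using riem_dist_self[OF sigma_dens_pos] sigma_dens_pos by (simp add: Ent_sigma wdist_def)
next
  case False
  let ?I = "Re (kform \<rho> (entropy_grad \<rho>) (entropy_grad \<rho>))"
  let ?w = "wdist D \<rho> \<sigma>"
  obtain c where c: "c > 0" "\<And>\<rho> \<nu>. \<rho> \<in> dens D \<Longrightarrow> \<nu> \<in> dens D \<Longrightarrow> norm (\<rho> - \<nu>) \<le> c * wdist D \<rho> \<nu>"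
    using wdist_ge by blast
  have "0 < norm (\<rho> - \<sigma>)" using False by simp
  then have "0 < c * ?w" using c(2)[OF dens_pos_dens[OF \<rho>] sigma_dens] by linarith
  then have w: "0 < ?w" using c(1) by (simp add: zero_less_mult_iff)
  obtain \<gamma> where \<gamma>: "const_speed_geodesic D \<gamma>" "\<gamma> 0 = \<rho>" "\<gamma> 1 = \<sigma>"
    "\<And>t. t \<in> {0..1} \<Longrightarrow> Ent D (\<gamma> t) \<le> (1 - t) * Ent D \<rho> + t * Ent D \<sigma> - \<kappa> / 2 * t * (1 - t) * ?w\<^sup>2"
    using Ric dens_pos_dens[OF \<rho>] sigma_dens unfolding Ric_ge_def by metis
  have \<gamma>d: "\<gamma> t \<in> dens D" "wdist D \<rho> (\<gamma> t) = t * ?w" if "t \<in> {0..1}" for t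
  proof -
    show "\<gamma> t \<in> dens D" using \<gamma>(1) that by (simp add: const_speed_geodesic_def)
    have "wdist D (\<gamma> 0) (\<gamma> t) = \<bar>0 - t\<bar> * wdist D (\<gamma> 0) (\<gamma> 1)"
      using \<gamma>(1) that unfolding const_speed_geodesic_def by (metis atLeastAtMost_iff order_refl zero_le_one)
    then show "wdist D \<rho> (\<gamma> t) = t * ?w" using \<gamma>(2,3) that by simp
  qed
  have eps: "Ent D \<rho> \<le> sqrt ((?I + \<epsilon>) * (1 + \<epsilon>)) * ?w - \<kappa> / 2 * ?w\<^sup>2" if \<epsilon>: "0 < \<epsilon>" "\<epsilon> \<le> 1" for \<epsilon>
  proof -
    let ?s = "sqrt ((?I + \<epsilon>) * (1 + \<epsilon>))"
    obtain r where r: "0 < r" "\<And>\<nu>. \<nu> \<in> dens D \<Longrightarrow> 0 < wdist D \<rho> \<nu> \<Longrightarrow> wdist D \<rho> \<nu> < r \<Longrightarrow>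
        Ent D \<rho> - Ent D \<nu> \<le> ?s * wdist D \<rho> \<nu>"
      using Ent_slope[OF \<rho> \<epsilon>] by blast
    have step: "Ent D \<rho> \<le> ?s * ?w - \<kappa> / 2 * (1 - t) * ?w\<^sup>2" if t: "0 < t" "t < min 1 (r / ?w)" for t
    proof -
      have t01: "t \<in> {0..1}" using t by simp
      have "t * ?w < r" using t w by (simp add: field_simps)
      moreover have "0 < t * ?w" using t w by simp
      ultimately have "Ent D \<rho> - Ent D (\<gamma> t) \<le> ?s * (t * ?w)"
        using r(2)[OF \<gamma>d(1)[OF t01]] by (simp add: \<gamma>d(2)[OF t01])
      then have "t * Ent D \<rho> \<le> t * (?s * ?w - \<kappa> / 2 * (1 - t) * ?w\<^sup>2)"
        using \<gamma>(4)[OF t01] by (simp add: Ent_sigma algebra_simps)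
      then show ?thesis using t by simp
    qed
    have "((\<lambda>t. ?s * ?w - \<kappa> / 2 * (1 - t) * ?w\<^sup>2) \<longlongrightarrow> ?s * ?w - \<kappa> / 2 * (1 - 0) * ?w\<^sup>2) (at_right 0)"
      by (intro tendsto_intros)
    moreover have "\<forall>\<^sub>F t in at_right 0. Ent D \<rho> \<le> ?s * ?w - \<kappa> / 2 * (1 - t) * ?w\<^sup>2"
      unfolding eventually_at_right_field using step r(1) w by (intro exI[of _ "min 1 (r / ?w)"]) auto
    ultimately have "Ent D \<rho> \<le> ?s * ?w - \<kappa> / 2 * (1 - 0) * ?w\<^sup>2"
      by (rule tendsto_lowerbound) simp
    then show ?thesis by simp
  qed
  have "((\<lambda>\<epsilon>. sqrt ((?I + \<epsilon>) * (1 + \<epsilon>)) * ?w - \<kappa> / 2 * ?w\<^sup>2) \<longlongrightarrow>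
      sqrt ((?I + 0) * (1 + 0)) * ?w - \<kappa> / 2 * ?w\<^sup>2) (at_right 0)"
    by (intro tendsto_intros)
  moreover have "\<forall>\<^sub>F \<epsilon> in at_right 0. Ent D \<rho> \<le> sqrt ((?I + \<epsilon>) * (1 + \<epsilon>)) * ?w - \<kappa> / 2 * ?w\<^sup>2"
    unfolding eventually_at_right_field using eps by (intro exI[of _ 1]) auto
  ultimately have "Ent D \<rho> \<le> sqrt ((?I + 0) * (1 + 0)) * ?w - \<kappa> / 2 * ?w\<^sup>2"
    by (rule tendsto_lowerbound) simp
  then show ?thesis by (simp add: mult.commute)
qed

end

theorem theorem11p3:
  fixes D :: "('n::finite, 'm::finite, 'j) diff_struct" and \<kappa> :: real and \<rho> :: "complex^'n^'n"
  assumes "differential_structure D"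
    and "ergodic D"
    and "Ric_ge D \<kappa>"
    and "\<rho> \<in> dens D"
  shows "ereal (Ent D \<rho>) \<le>
    ereal (wdist D \<rho> (ref D)) * sqrt_ereal (Fisher D \<rho>)
    - ereal (\<kappa> / 2 * (wdist D \<rho> (ref D))\<^sup>2)"
proof -
  interpret erg_diffstr D by unfold_locales (use assms in auto)
  show ?thesis
  proof (cases "\<rho> \<in> dens_pos D")
    case True
    then show ?thesis
      using HWI_pos[OF assms(3) True] by (simp add: Fisher_eq sqrt_ereal_def)
  next
    case False
    obtain c where c: "c > 0" "\<And>\<rho> \<nu>. \<rho> \<in> dens D \<Longrightarrow> \<nu> \<in> dens D \<Longrightarrow> norm (\<rho> - \<nu>) \<le> c * wdist D \<rho> \<nu>"
      using wdist_ge by blast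
    have "0 < norm (\<rho> - ref D)" using False sigma_dens_pos by auto
    then have "0 < c * wdist D \<rho> (ref D)" using c(2)[OF assms(4) sigma_dens] by linarith
    then have "0 < wdist D \<rho> (ref D)" using c(1) by (simp add: zero_less_mult_iff)
    then show ?thesis using False by (simp add: Fisher_def sqrt_ereal_def)
  qed
qed

end
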